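(* Let $0<p\le q<\infty$, $\omega,\nu\in\mathcal{D}$, $\Psi,\Phi\in\mathcal{L}$, and let $g$ be analytic in $\mathbb{D}$. Then the following statements hold: (i) $T_g:A^p_{\omega,\Psi}\to A^q_{\nu,\Phi}$ is bounded if and only if $$\sup_{a\in\mathbb{D}}\frac{|g'(a)|(1-|a|)\left(\Phi\left(\frac{1}{\omega(S(a))}\right)\nu(S(a))\right)^{\frac1q}}{\left(\Psi\left(\frac{1}{\omega(S(a))}\right)\omega(S(a))\right)^{\frac1p}}<\infty;$$ (ii) $T_g:A^p_{\omega,\Psi}\to A^q_{\nu,\Phi}$ is compact if and only if $$\lim_{|a|\to1^-}\frac{|g'(a)|(1-|a|)\left(\Phi\left(\frac{1}{\omega(S(a))}\right)\nu(S(a))\right)^{\frac1q}}{\left(\Psi\left(\frac{1}{\omega(S(a))}\right)\omega(S(a))\right)^{\frac1p}}=0.$$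
   Context: $\mathbb{D}=\{z\in\mathbb{C}:|z|<1\}$, and $dA=\frac{dx\,dy}{\pi}$ is the normalized area measure on $\mathbb{D}$. Integral operator: for $g$ analytic in $\mathbb{D}$, $T_g(f)(z)=\int_0^z f(\zeta)g'(\zeta)\,d\zeta$, $z\in\mathbb{D}$, for $f$ analytic in $\mathbb{D}$. Class $\mathcal{L}$: a function $\Psi:[0,\infty)\to(0,\infty)$ belongs to $\mathcal{L}$ if (1) it is essentially monotonic, i.e. either essentially increasing (there is a constant $C>0$ with $\Psi(x)\le C\Psi(y)$ for all $0\le x\le y$) or essentially decreasing (there is a constant $C>0$ with $\Psi(y)\le C\Psi(x)$ for all $0\le x\le y$), and (2) $\Psi(x)\asymp\Psi(x^2)$ for $0\le x<\infty$, i.e. there is a constant $C\ge1$ with $C^{-1}\Psi(x)\le\Psi(x^2)\le C\Psi(x)$ for all $x\ge0$. The functions $\Psi,\Phi$ are understood to be Borel measurable so that the integrals below make sense. Weights: a weight is an integrable function $\omega:\mathbb{D}\to[0,\infty)$; it is radial if $\omega(z)=\omega(|z|)$. For a radial weight, $\widehat{\omega}(z)=\int_{|z|}^1\omega(s)\,ds$, and it is assumed that $\widehat{\omega}>0$ on $\mathbb{D}$. A radial weight belongs to $\widehat{\mathcal{D}}$ if there is $C\ge1$ with $\widehat{\omega}(r)\le C\widehat{\omega}\left(\frac{1+r}{2}\right)$ for all $0\le r<1$; it belongs to $\check{\mathcal{D}}$ if there are $K>1$ and $C>1$ with $\widehat{\omega}(r)\ge C\widehat{\omega}\left(1-\frac{1-r}{K}\right)$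 for all $0\le r<1$; and $\mathcal{D}=\widehat{\mathcal{D}}\cap\check{\mathcal{D}}$. For measurable $S\subset\mathbb{D}$, $\omega(S)=\int_S\omega\,dA$. Carleson squares: for $a\in\mathbb{D}\setminus\{0\}$, $S(a)=\{z\in\mathbb{D}:|z|\ge|a|,\ |\arg a-\arg z|<\frac12(1-|a|)\}$ (the difference of arguments being taken modulo $2\pi$), and $S(0)=\mathbb{D}$. Spaces: for $0<p<\infty$, $A^p_{\omega,\Psi}$ is the set of all analytic functions $f$ on $\mathbb{D}$ with $\|f\|_{A^p_{\omega,\Psi}}=\left(\int_{\mathbb{D}}|f|^p\Psi(|f|)\,\omega\,dA\right)^{1/p}<\infty$. This is a quasinorm that need not be absolutely homogeneous. An operator between such spaces is bounded if it maps bounded sets into bounded sets, and compact if it sends a neighborhood of the origin onto a relatively compact subset of the target space (in both cases it is required to map the first space into the second). *)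

theory Defs
  imports "HOL-Complex_Analysis.Complex_Analysis"
begin

abbreviation unit_disc :: "complex set" where
  "unit_disc \<equiv> ball 0 1"

definition disc_area :: "complex measure" where
  "disc_area = density (lebesgue_on unit_disc) (\<lambda>_. ennreal (1 / pi))"


text \<open>Functions on \<open>[0, \<infinity>)\<close> are modelled as functions on the reals; only their
  values on \<open>{0..}\<close> are ever constrained or used.\<close>

definition ess_increasing :: "(real \<Rightarrow> real) \<Rightarrow> bool" where
  "ess_increasing \<Psi> \<longleftrightarrow> (\<exists>C>0. \<forall>x y. 0 \<le> x \<longrightarrow> x \<le> y \<longrightarrow> \<Psi> x \<le> C * \<Psi> y)"

definition ess_decreasing :: "(real \<Rightarrow> real) \<Rightarrow> bool" where
  "ess_decreasing \<Psi> \<longleftrightarrow> (\<exists>C>0. \<forall>x y. 0 \<le> x \<longrightarrow> x \<le> y \<longrightarrow> \<Psi> y \<le> C * \<Psi> x)"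

definition class_L :: "(real \<Rightarrow> real) set" where
  "class_L = {\<Psi>.
     (\<forall>x\<ge>0. \<Psi> x > 0) \<and>
     \<Psi> \<in> borel_measurable (restrict_space borel {0..}) \<and>
     (ess_increasing \<Psi> \<or> ess_decreasing \<Psi>) \<and>
     (\<exists>C\<ge>1. \<forall>x\<ge>0. inverse C * \<Psi> x \<le> \<Psi> (x\<^sup>2) \<and> \<Psi> (x\<^sup>2) \<le> C * \<Psi> x)}"


definition weight :: "(complex \<Rightarrow> real) \<Rightarrow> bool" where
  "weight \<omega> \<longleftrightarrow> (\<forall>z\<in>unit_disc. 0 \<le> \<omega> z) \<and> integrable disc_area \<omega>"

definition radial :: "(complex \<Rightarrow> real) \<Rightarrow> bool" where
  "radial \<omega> \<longleftrightarrow> (\<forall>z\<in>unit_disc. \<omega> z = \<omega> (complex_of_real (cmod z)))"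

definition weight_tail :: "(complex \<Rightarrow> real) \<Rightarrow> complex \<Rightarrow> real" where
  "weight_tail \<omega> z = (LINT s:{cmod z..<1}|lebesgue. \<omega> (complex_of_real s))"

text \<open>Integrability of a radial weight on the disc does not bound its integral along the radius near
  the origin, so the tail at \<open>0\<close> may be infinite in the extended sense. The integral
  above is then \<open>0\<close> by convention, and \<open>\<omega>\<close> is excluded by the positivity requirement
  below. Nothing is lost: in the extended sense such an \<open>\<omega>\<close> fails the upper doubling
  condition at \<open>r = 0\<close>.\<close>

definition radial_weight :: "(complex \<Rightarrow> real) \<Rightarrow> bool" where
  "radial_weight \<omega> \<longleftrightarrow> weight \<omega> \<and> radial \<omega> \<and> (\<forall>z\<in>unit_disc. weight_tail \<omega> z > 0)"

definition class_D_hat :: "(complex \<Rightarrow> real) set" where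
  "class_D_hat = {\<omega>. radial_weight \<omega> \<and>
     (\<exists>C\<ge>1. \<forall>r::real. 0 \<le> r \<longrightarrow> r < 1 \<longrightarrow>
        weight_tail \<omega> (complex_of_real r) \<le> C * weight_tail \<omega> (complex_of_real ((1 + r) / 2)))}"

definition class_D_check :: "(complex \<Rightarrow> real) set" where
  "class_D_check = {\<omega>. radial_weight \<omega> \<and>
     (\<exists>K>1. \<exists>C>1. \<forall>r::real. 0 \<le> r \<longrightarrow> r < 1 \<longrightarrow>
        weight_tail \<omega> (complex_of_real r) \<ge> C * weight_tail \<omega> (complex_of_real (1 - (1 - r) / K)))}"

definition class_D :: "(complex \<Rightarrow> real) set" where
  "class_D = class_D_hat \<inter> class_D_check"

definition weight_mass :: "(complex \<Rightarrow> real) \<Rightarrow> complex set \<Rightarrow> real" where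
  "weight_mass \<omega> S = (LINT z:S|disc_area. \<omega> z)"

definition carleson_square :: "complex \<Rightarrow> complex set" where
  "carleson_square a = (if a = 0 then unit_disc else
     {z \<in> unit_disc. cmod a \<le> cmod z \<and>
        (\<exists>k::int. \<bar>Arg a - Arg z + 2 * pi * of_int k\<bar> < (1 - cmod a) / 2)})"


text \<open>An analytic function on the disc is represented by its extension by \<open>0\<close> to the whole
  plane, so that equality of representatives is equality on the disc.\<close>

definition bergman_space ::
    "real \<Rightarrow> (complex \<Rightarrow> real) \<Rightarrow> (real \<Rightarrow> real) \<Rightarrow> (complex \<Rightarrow> complex) set" where
  "bergman_space p \<omega> \<Psi> = {f. f holomorphic_on unit_disc \<and> (\<forall>z. z \<notin> unit_disc \<longrightarrow> f z = 0) \<and>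
     integrable disc_area (\<lambda>z. cmod (f z) powr p * \<Psi> (cmod (f z)) * \<omega> z)}"

definition bergman_norm ::
    "real \<Rightarrow> (complex \<Rightarrow> real) \<Rightarrow> (real \<Rightarrow> real) \<Rightarrow> (complex \<Rightarrow> complex) \<Rightarrow> real" where
  "bergman_norm p \<omega> \<Psi> f =
     (LINT z|disc_area. cmod (f z) powr p * \<Psi> (cmod (f z)) * \<omega> z) powr (1 / p)"

definition bergman_bounded ::
    "real \<Rightarrow> (complex \<Rightarrow> real) \<Rightarrow> (real \<Rightarrow> real) \<Rightarrow> (complex \<Rightarrow> complex) set \<Rightarrow> bool" where
  "bergman_bounded p \<omega> \<Psi> B \<longleftrightarrow>
     B \<subseteq> bergman_space p \<omega> \<Psi> \<and> bdd_above (bergman_norm p \<omega> \<Psi> ` B)"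

text \<open>The topology induced by the quasinorm: a set is open iff with each of its points \<open>f\<close>
  it contains a translated quasinorm ball \<open>f + {h. \<parallel>h\<parallel> < \<epsilon>}\<close>.\<close>

definition bergman_topology ::
    "real \<Rightarrow> (complex \<Rightarrow> real) \<Rightarrow> (real \<Rightarrow> real) \<Rightarrow> (complex \<Rightarrow> complex) topology" where
  "bergman_topology p \<omega> \<Psi> = topology (\<lambda>V. V \<subseteq> bergman_space p \<omega> \<Psi> \<and>
     (\<forall>f\<in>V. \<exists>\<epsilon>>0. \<forall>h\<in>bergman_space p \<omega> \<Psi>. bergman_norm p \<omega> \<Psi> h < \<epsilon> \<longrightarrow> (\<lambda>z. f z + h z) \<in> V))"

lemma openin_bergman_topology:
  "openin (bergman_topology p \<omega> \<Psi>) V \<longleftrightarrow> V \<subseteq> bergman_space p \<omega> \<Psi> \<and>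
     (\<forall>f\<in>V. \<exists>\<epsilon>>0. \<forall>h\<in>bergman_space p \<omega> \<Psi>. bergman_norm p \<omega> \<Psi> h < \<epsilon> \<longrightarrow> (\<lambda>z. f z + h z) \<in> V)"
proof -
  let ?A = "bergman_space p \<omega> \<Psi>" and ?n = "bergman_norm p \<omega> \<Psi>"
  let ?P = "\<lambda>V. V \<subseteq> ?A \<and> (\<forall>f\<in>V. \<exists>\<epsilon>>0. \<forall>h\<in>?A. ?n h < \<epsilon> \<longrightarrow> (\<lambda>z. f z + h z) \<in> V)"
  have "istopology ?P"
    unfolding istopology_def
  proof (intro conjI allI impI)
    fix S T assume S: "?P S" and T: "?P T"
    show "S \<inter> T \<subseteq> ?A" using S by blast
    show "\<forall>f\<in>S \<inter> T. \<exists>\<epsilon>>0. \<forall>h\<in>?A. ?n h < \<epsilon> \<longrightarrow> (\<lambda>z. f z + h z) \<in> S \<inter> T"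
    proof
      fix f assume "f \<in> S \<inter> T"
      then obtain d e :: real where "d > 0" "e > 0"
        and "\<forall>h\<in>?A. ?n h < d \<longrightarrow> (\<lambda>z. f z + h z) \<in> S"
        and "\<forall>h\<in>?A. ?n h < e \<longrightarrow> (\<lambda>z. f z + h z) \<in> T"
        using S T by blast
      then show "\<exists>\<epsilon>>0. \<forall>h\<in>?A. ?n h < \<epsilon> \<longrightarrow> (\<lambda>z. f z + h z) \<in> S \<inter> T"
        by (intro exI[of _ "min d e"]) auto
    qed
  next
    fix \<K> assume K: "\<forall>K\<in>\<K>. ?P K"
    show "\<Union>\<K> \<subseteq> ?A" using K by blast
    show "\<forall>f\<in>\<Union>\<K>. \<exists>\<epsilon>>0. \<forall>h\<in>?A. ?n h < \<epsilon> \<longrightarrow> (\<lambda>z. f z + h z) \<in> \<Union>\<K>"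
    proof
      fix f assume "f \<in> \<Union>\<K>"
      then obtain K where "K \<in> \<K>" "f \<in> K" by blast
      moreover from this K obtain \<epsilon> :: real where "\<epsilon> > 0"
        and "\<forall>h\<in>?A. ?n h < \<epsilon> \<longrightarrow> (\<lambda>z. f z + h z) \<in> K" by blast
      ultimately show "\<exists>\<epsilon>>0. \<forall>h\<in>?A. ?n h < \<epsilon> \<longrightarrow> (\<lambda>z. f z + h z) \<in> \<Union>\<K>"
        by blast
    qed
  qed
  then show ?thesis
    unfolding bergman_topology_def by (simp add: topology_inverse')
qed

definition bounded_operator ::
    "real \<Rightarrow> (complex \<Rightarrow> real) \<Rightarrow> (real \<Rightarrow> real) \<Rightarrow> real \<Rightarrow> (complex \<Rightarrow> real) \<Rightarrow> (real \<Rightarrow> real) \<Rightarrow>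
     ((complex \<Rightarrow> complex) \<Rightarrow> complex \<Rightarrow> complex) \<Rightarrow> bool" where
  "bounded_operator p \<omega> \<Psi> q \<nu> \<Phi> T \<longleftrightarrow>
     T ` bergman_space p \<omega> \<Psi> \<subseteq> bergman_space q \<nu> \<Phi> \<and>
     (\<forall>B. bergman_bounded p \<omega> \<Psi> B \<longrightarrow> bergman_bounded q \<nu> \<Phi> (T ` B))"

definition compact_operator ::
    "real \<Rightarrow> (complex \<Rightarrow> real) \<Rightarrow> (real \<Rightarrow> real) \<Rightarrow> real \<Rightarrow> (complex \<Rightarrow> real) \<Rightarrow> (real \<Rightarrow> real) \<Rightarrow>
     ((complex \<Rightarrow> complex) \<Rightarrow> complex \<Rightarrow> complex) \<Rightarrow> bool" where
  "compact_operator p \<omega> \<Psi> q \<nu> \<Phi> T \<longleftrightarrow>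
     T ` bergman_space p \<omega> \<Psi> \<subseteq> bergman_space q \<nu> \<Phi> \<and>
     (\<exists>N \<subseteq> bergman_space p \<omega> \<Psi>.
        (\<exists>U. openin (bergman_topology p \<omega> \<Psi>) U \<and> (\<lambda>_. 0) \<in> U \<and> U \<subseteq> N) \<and>
        compactin (bergman_topology q \<nu> \<Phi>) (bergman_topology q \<nu> \<Phi> closure_of (T ` N)))"

definition integral_op ::
    "(complex \<Rightarrow> complex) \<Rightarrow> (complex \<Rightarrow> complex) \<Rightarrow> complex \<Rightarrow> complex" where
  "integral_op g f z = (if z \<in> unit_disc
     then contour_integral (linepath 0 z) (\<lambda>\<zeta>. f \<zeta> * deriv g \<zeta>) else 0)"

definition carleson_ratio ::
    "real \<Rightarrow> (complex \<Rightarrow> real) \<Rightarrow> (real \<Rightarrow> real) \<Rightarrow> real \<Rightarrow> (complex \<Rightarrow> real) \<Rightarrow> (real \<Rightarrow> real) \<Rightarrow>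
     (complex \<Rightarrow> complex) \<Rightarrow> complex \<Rightarrow> real" where
  "carleson_ratio p \<omega> \<Psi> q \<nu> \<Phi> g a =
     (let W = weight_mass \<omega> (carleson_square a); V = weight_mass \<nu> (carleson_square a)
      in cmod (deriv g a) * (1 - cmod a) * (\<Phi> (1 / W) * V) powr (1 / q)
           / (\<Psi> (1 / W) * W) powr (1 / p))"

end

theory Submission
  imports Defs
begin

text \<open>
  Write \<open>F x = |x|^p * \<Psi> |x|\<close>, \<open>E x = |x|^q * \<Phi> |x|\<close>, and let \<open>\<kappa>\<close> be a large constant for which the
  weights see the radii \<open>r_k = 1 - \<kappa>^(-k)\<close> as a geometric scale: passing from one tail
  \<open>{r_k \<le> |z|}\<close> to the next divides its mass by something between \<open>2\<close> and a constant. A Carleson square at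
  distance about \<open>\<kappa>^(-k)\<close> from the circle then has mass about \<open>W_k = \<kappa>^(-k) * \<omega>{r_k \<le> |z|}\<close>, and \<open>V_k\<close>
  for \<open>\<nu>\<close>. As \<open>W_k\<close> lies between two powers of \<open>D = \<kappa>^k\<close> and members of class L do not
  distinguish between quantities that are powers of each other, \<open>\<Psi> (1 / \<omega>(S(a)))\<close> is comparable with
  \<open>\<Psi> D\<close>. So the quotient in the theorem is comparable with \<open>|g'(a)| * \<kappa>^(-k) * X_k / Y_k\<close>, where
  \<open>X_k = (W_k * \<Psi> D) powr (-1/p)\<close> and \<open>Y_k = (V_k * \<Phi> D) powr (-1/q)\<close> solve \<open>F X_k * W_k = 1\<close> and
  \<open>E Y_k * V_k = 1\<close> up to constants. Thus \<open>X_k\<close> is the largest value, up to a constant, that a function from the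
  unit ball of the source space takes at distance \<open>\<kappa>^(-k)\<close> from the circle, and \<open>Y_k\<close> is the same
  for the target space.

  Only one property of \<open>F\<close> matters for the function theory: it is bounded by powers under
  dilation of its argument. Hence, because \<open>|f| powr d\<close> is subharmonic for every \<open>d > 0\<close>, it satisfies
  \<open>F |f(a)| \<le> K * average of F |f|\<close> with a Poisson kernel (\<open>quasi_power_subharmonic\<close>). This yields
  the pointwise growth bound (\<open>growth_estimate\<close>), and a function on the unit circle that dominates \<open>F |f|\<close> on a
  whole ring and whose mean is controlled by the mass of \<open>f\<close> on a nearby ring (\<open>annulus_majorant\<close>).

  Necessity. The functions \<open>X_k * ((1 - |a|) / (1 - cnj a * z))^n\<close> have bounded mass and are comparable with \<open>X_k\<close> at
  \<open>a\<close> (\<open>test_function\<close>). By the growth bound and Cauchy's estimate, a bound for the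
  mass of \<open>h = T_g f\<close> on the ring near \<open>a\<close> bounds \<open>|h'(a)| = |f(a)| |g'(a)|\<close> by a multiple of \<open>\<kappa>^k * Y_k\<close>, and the multiple
  tends to zero with the mass (\<open>derivative_growth\<close>). This gives the bounded case. In the compact case a finite
  net of functions approximates the images of all test functions, and a single function of finite mass has little mass
  on the rings near the circle.

  Sufficiency. Let \<open>|g'| \<le> \<epsilon> * \<kappa>^k * Y_k / X_k\<close> on the ring \<open>r_k \<le> |z| \<le> r_(k+1)\<close>. Integration along a radius bounds \<open>T_g f\<close> on the
  \<open>j\<close>-th ring by the sum over \<open>k \<le> j\<close> of \<open>\<epsilon> * (Y_k / X_k) * max |f|\<close>, the maximum being over the part of the radius in the \<open>k\<close>-th ring.
  Since \<open>E\<close> of such a sum is at most a sum with slowly growing geometric weights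
  (\<open>quasi_power_sum_le\<close>) while the tails of \<open>\<nu>\<close> halve, the mass of \<open>T_g f\<close> is controlled by the sum
  of the masses of \<open>E (\<epsilon> * (Y_k / X_k) * max |f|)\<close> (\<open>area_estimate\<close>). Here the hypothesis \<open>p \<le> q\<close> enters: for
  values \<open>x \<le> R * X_k\<close>, which by the growth bound are all that occur, \<open>E (Y_k / X_k * x) * V_k \<le> K * (F x * W_k + D powr (-1 - \<tau>))\<close>
  (\<open>pointwise_transfer\<close>), whose right side sums to the mass of \<open>f\<close> and a convergent geometric
  series. For compactness one extracts a locally uniformly convergent subsequence by Montel's theorem, applies the estimate to
  the differences with small \<open>\<epsilon>\<close> near the circle and small values of the function away from it, and translates
  sequential compactness into compactness for the topology of the quasinorm (\<open>compactin_closure_of\<close>).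
\<close>

section \<open>Functions of class L\<close>

text \<open>The hypothesis on squares, used \<open>j\<close> times, shows that replacing the argument by its power with
  exponent \<open>2 ^ j\<close> costs only a constant factor.\<close>

lemma slow_increasing_compare:
  fixes \<Psi> :: "real \<Rightarrow> real"
  assumes pos: "\<And>x. 0 \<le> x \<Longrightarrow> \<Psi> x > 0"
    and mono: "\<And>x y. 0 \<le> x \<Longrightarrow> x \<le> y \<Longrightarrow> \<Psi> x \<le> C * \<Psi> y"
    and sq: "\<And>x. 0 \<le> x \<Longrightarrow> \<Psi> (x\<^sup>2) \<le> C * \<Psi> x"
    and C: "C \<ge> 1" and L: "L \<ge> 0"
  shows "\<exists>C'>0. \<forall>x y. 0 \<le> x \<longrightarrow> 0 \<le> y \<longrightarrow> x \<le> A * max 1 y powr L \<longrightarrow> \<Psi> x \<le> C' * \<Psi> y"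
proof -
  define E where "E = max 2 A"
  obtain j where j: "1 + L \<le> 2 ^ j"
    using real_arch_pow[of 2 "1 + L"] by (auto intro: less_imp_le)
  have pw: "\<Psi> (x ^ (2 ^ i)) \<le> C ^ i * \<Psi> x" if "0 \<le> x" for x i
  proof (induction i)
    case (Suc i)
    have "\<Psi> (x ^ (2 ^ Suc i)) = \<Psi> ((x ^ (2 ^ i))\<^sup>2)"
      by (simp add: power_mult[symmetric] mult.commute)
    also have "\<dots> \<le> C * \<Psi> (x ^ (2 ^ i))" using that by (intro sq) auto
    also have "\<dots> \<le> C * (C ^ i * \<Psi> x)" using Suc C by (intro mult_left_mono) auto
    finally show ?case by (simp add: mult_ac)
  qed auto
  define C' where "C' = C * C ^ j * (1 + C * \<Psi> E / \<Psi> 0)"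
  have E2: "E \<ge> 2" by (simp add: E_def)
  have pE: "\<Psi> E > 0" and p0: "\<Psi> 0 > 0" using pos E2 by auto
  have "C' > 0" unfolding C'_def using C pE p0 by (intro mult_pos_pos add_pos_nonneg) auto
  moreover have "\<Psi> x \<le> C' * \<Psi> y" if x: "0 \<le> x" and y: "0 \<le> y" and xy: "x \<le> A * max 1 y powr L" for x y
  proof -
    define E' where "E' = max y E"
    have E': "E' \<ge> 2" "E' > 0" using E2 by (auto simp: E'_def)
    have "x \<le> E' * E' powr L"
    proof -
      have "A * max 1 y powr L \<le> E' * max 1 y powr L" by (intro mult_right_mono) (auto simp: E'_def E_def)
      also have "\<dots> \<le> E' * E' powr L" using E' L E2 by (intro mult_left_mono powr_mono2) (auto simp: E'_def)
      finally show ?thesis using xy by simp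
    qed
    also have "\<dots> = E' powr (1 + L)" using E' by (simp add: powr_add)
    also have "\<dots> \<le> E' powr (2 ^ j)" using j E' by (intro powr_mono) auto
    also have "\<dots> = E' ^ (2 ^ j)" using E' powr_realpow[of E' "2 ^ j"] by simp
    finally have "\<Psi> x \<le> C * \<Psi> (E' ^ (2 ^ j))" using mono x by blast
    also have "\<dots> \<le> C * (C ^ j * \<Psi> E')" using pw[of E' j] E' C by (intro mult_left_mono) auto
    also have "\<dots> \<le> C * (C ^ j * ((1 + C * \<Psi> E / \<Psi> 0) * \<Psi> y))"
    proof -
      have "\<Psi> E' \<le> (1 + C * \<Psi> E / \<Psi> 0) * \<Psi> y"
      proof (cases "E \<le> y")
        case True
        then have "E' = y" by (simp add: E'_def)
        moreover have "0 \<le> C * \<Psi> E / \<Psi> 0 * \<Psi> y" using C pE p0 pos[OF y] by simp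
        ultimately show ?thesis by (simp add: algebra_simps)
      next
        case False
        then have "E' = E" by (simp add: E'_def)
        have "\<Psi> 0 \<le> C * \<Psi> y" using mono[of 0 y] y by simp
        then have "\<Psi> E * \<Psi> 0 \<le> \<Psi> E * (C * \<Psi> y)" using pE by (intro mult_left_mono) auto
        then have "\<Psi> E \<le> C * \<Psi> E / \<Psi> 0 * \<Psi> y" using p0 by (simp add: field_simps)
        then show ?thesis using \<open>E' = E\<close> pos[OF y] by (simp add: algebra_simps)
      qed
      then show ?thesis using C by (intro mult_left_mono) auto
    qed
    finally show ?thesis by (simp add: C'_def mult_ac)
  qed
  ultimately show ?thesis by blast
qed

text \<open>Beyond a threshold the factor \<open>C\<close> lost when the argument is squared is absorbed by \<open>x powr
  (d / 2)\<close>, so that the bound passes from \<open>sqrt x\<close> to \<open>x\<close>.\<close>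

lemma slow_increasing_growth:
  fixes \<Psi> :: "real \<Rightarrow> real"
  assumes pos: "\<And>x. 0 \<le> x \<Longrightarrow> \<Psi> x > 0"
    and mono: "\<And>x y. 0 \<le> x \<Longrightarrow> x \<le> y \<Longrightarrow> \<Psi> x \<le> C * \<Psi> y"
    and sq: "\<And>x. 0 \<le> x \<Longrightarrow> \<Psi> (x\<^sup>2) \<le> C * \<Psi> x"
    and C: "C \<ge> 1" and d: "d > 0"
  shows "\<exists>B>0. \<forall>x\<ge>0. \<Psi> x \<le> B * max 1 x powr d"
proof -
  define Y where "Y = max 2 (C powr (2 / d))"
  have Y2: "Y \<ge> 2" by (simp add: Y_def)
  have YC: "C \<le> x powr (d / 2)" if "x \<ge> Y" for x
  proof -
    have "C = (C powr (2 / d)) powr (d / 2)" using C d by (simp add: powr_powr)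
    also have "\<dots> \<le> x powr (d / 2)" using that d by (intro powr_mono2) (auto simp: Y_def)
    finally show ?thesis .
  qed
  define B where "B = C * \<Psi> Y"
  have B: "B > 0" using C pos[of Y] Y2 by (simp add: B_def)
  have base: "\<Psi> x \<le> B * max 1 x powr d" if "0 \<le> x" "x \<le> Y" for x
  proof -
    have "\<Psi> x \<le> B" using mono that by (simp add: B_def)
    also have "\<dots> \<le> B * max 1 x powr d" using B d ge_one_powr_ge_zero[of "max 1 x" d] by simp
    finally show ?thesis .
  qed
  have ind: "\<Psi> x \<le> B * max 1 x powr d" if "0 \<le> x" "x \<le> Y ^ (2 ^ n)" for x n
    using that
  proof (induction n arbitrary: x)
    case 0 then show ?case using base by simp
  next
    case (Suc n)
    show ?case
    proof (cases "x \<le> Y")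
      case True then show ?thesis using base Suc by simp
    next
      case False
      have "x \<le> (Y ^ (2 ^ n))\<^sup>2" using Suc.prems by (simp add: power_mult[symmetric] mult.commute)
      then have "sqrt x \<le> Y ^ (2 ^ n)" using Y2 by (intro real_le_lsqrt) auto
      then have IH: "\<Psi> (sqrt x) \<le> B * max 1 (sqrt x) powr d" using Suc by simp
      have x1: "x > 1" using False Y2 by simp
      have "\<Psi> x \<le> C * \<Psi> (sqrt x)" using sq[of "sqrt x"] x1 by simp
      also have "\<dots> \<le> x powr (d/2) * (B * sqrt x powr d)"
        using IH YC[of x] False x1 C B pos[of "sqrt x"] by (intro mult_mono) (auto simp: max_def)
      also have "sqrt x powr d = x powr (d/2)" using x1 by (simp add: powr_half_sqrt[symmetric] powr_powr)
      also have "x powr (d/2) * (B * x powr (d/2)) = B * max 1 x powr d"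
        using x1 by (simp add: max_def powr_add[symmetric] mult_ac)
      finally show ?thesis .
    qed
  qed
  have "\<Psi> x \<le> B * max 1 x powr d" if x: "0 \<le> x" for x
  proof -
    obtain n where "x < Y ^ n" using real_arch_pow[of Y x] Y2 by auto
    also have "Y ^ n \<le> Y ^ (2 ^ n)" using Y2 by (intro power_increasing) (auto intro: less_imp_le less_exp)
    finally have "x \<le> Y ^ (2 ^ n)" by simp
    then show ?thesis using ind[of x n] x by simp
  qed
  then show ?thesis using B by blast
qed

text \<open>Either \<open>x\<close> is at most the square of \<open>max 1 y\<close>, and the two values are comparable, or
  \<open>x / y \<ge> sqrt x\<close>, and the growth of \<open>\<Psi>\<close> is slower than any power of this
  quotient.\<close>

lemma slow_increasing_Potter:
  fixes \<Psi> :: "real \<Rightarrow> real"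
  assumes pos: "\<And>x. 0 \<le> x \<Longrightarrow> \<Psi> x > 0"
    and mono: "\<And>x y. 0 \<le> x \<Longrightarrow> x \<le> y \<Longrightarrow> \<Psi> x \<le> C * \<Psi> y"
    and sq: "\<And>x. 0 \<le> x \<Longrightarrow> \<Psi> (x\<^sup>2) \<le> C * \<Psi> x"
    and C: "C \<ge> 1" and d: "d > 0"
  shows "\<exists>B>0. \<forall>x>0. \<forall>y>0. \<Psi> x \<le> B * max (x/y) (y/x) powr d * \<Psi> y"
proof -
  obtain C1 where C1: "C1 > 0" and cmp: "\<And>x y. 0 \<le> x \<Longrightarrow> 0 \<le> y \<Longrightarrow> x \<le> 1 * max 1 y powr 2 \<Longrightarrow> \<Psi> x \<le> C1 * \<Psi> y"
    using slow_increasing_compare[where \<Psi>=\<Psi> and C=C and L=2 and A=1] pos mono sq C by (metis zero_le_numeral)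
  obtain B1 where B1: "B1 > 0" and gr: "\<And>x. 0 \<le> x \<Longrightarrow> \<Psi> x \<le> B1 * max 1 x powr (d/2)"
    using slow_increasing_growth[where \<Psi>=\<Psi> and C=C and d="d/2"] pos mono sq C d by (metis half_gt_zero)
  define B where "B = C1 + B1 * C / \<Psi> 0"
  have p0: "\<Psi> 0 > 0" using pos by simp
  have "\<Psi> x \<le> B * max (x/y) (y/x) powr d * \<Psi> y" if x: "x > 0" and y: "y > 0" for x y
  proof -
    define m where "m = max (x/y) (y/x)"
    have "1 \<le> x / y \<or> 1 \<le> y / x" using x y by (auto simp: field_simps)
    then have m1: "m \<ge> 1" by (auto simp: m_def)
    have md: "m powr d \<ge> 1" using m1 d by (simp add: ge_one_powr_ge_zero)
    have py: "\<Psi> y > 0" using pos y by simp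
    show ?thesis
    proof (cases "x \<le> max 1 y powr 2")
      case True
      then have "\<Psi> x \<le> C1 * \<Psi> y" using cmp x y by simp
      also have "\<dots> \<le> B * m powr d * \<Psi> y"
      proof -
        have "C1 * 1 \<le> B * m powr d" using md C1 B1 C p0 by (intro mult_mono) (auto simp: B_def)
        then show ?thesis using py by simp
      qed
      finally show ?thesis by (simp add: m_def)
    next
      case False
      then have lt: "(max 1 y)\<^sup>2 < x" by simp
      have "1 \<le> (max 1 y)\<^sup>2" by (intro one_le_power) simp
      then have x1: "x > 1" using lt by linarith
      have "max 1 y < sqrt x" using lt by (intro real_less_rsqrt) auto
      then have "y < sqrt x" by simp
      then have "sqrt x * y \<le> sqrt x * sqrt x" using x1 by (intro mult_left_mono) auto
      then have "sqrt x \<le> x / y" using x1 y by (simp add: field_simps)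
      then have sm: "sqrt x \<le> m" by (simp add: m_def)
      have "\<Psi> x \<le> B1 * x powr (d/2)" using gr[of x] x1 by (simp add: max_def)
      also have "x powr (d/2) = sqrt x powr d" using x1 by (simp add: powr_half_sqrt[symmetric] powr_powr)
      also have "B1 * sqrt x powr d \<le> B1 * m powr d" using sm B1 d x1 by (intro mult_left_mono powr_mono2) auto
      also have "\<dots> \<le> B1 * m powr d * (C * \<Psi> y / \<Psi> 0)"
      proof -
        have "1 \<le> C * \<Psi> y / \<Psi> 0" using mono[of 0 y] y p0 by (simp add: field_simps)
        then have "B1 * m powr d * 1 \<le> B1 * m powr d * (C * \<Psi> y / \<Psi> 0)" using B1 by (intro mult_left_mono) auto
        then show ?thesis by simp
      qed
      also have "\<dots> = (B1 * C / \<Psi> 0) * m powr d * \<Psi> y" by simp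
      also have "\<dots> \<le> B * m powr d * \<Psi> y" using C1 py by (intro mult_right_mono) (auto simp: B_def)
      finally show ?thesis by (simp add: m_def)
    qed
  qed
  moreover have "B > 0" using C1 B1 C p0 by (auto simp: B_def intro: add_pos_nonneg)
  ultimately show ?thesis by blast
qed

lemma class_L_pos: "\<Psi> \<in> class_L \<Longrightarrow> 0 \<le> x \<Longrightarrow> 0 < \<Psi> x"
  by (auto simp: class_L_def)

text \<open>The reciprocal of an essentially decreasing member of class L is essentially increasing with the same
  behaviour under squaring, so both cases can be treated by the lemmas on slowly increasing functions.\<close>

lemma class_L_cases:
  assumes "\<Psi> \<in> class_L"
  obtains C where "C \<ge> 1" "\<And>x y. 0 \<le> x \<Longrightarrow> x \<le> y \<Longrightarrow> \<Psi> x \<le> C * \<Psi> y"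
      "\<And>x. 0 \<le> x \<Longrightarrow> \<Psi> (x\<^sup>2) \<le> C * \<Psi> x"
    | C where "C \<ge> 1" "\<And>x y. 0 \<le> x \<Longrightarrow> x \<le> y \<Longrightarrow> 1 / \<Psi> x \<le> C * (1 / \<Psi> y)"
      "\<And>x. 0 \<le> x \<Longrightarrow> 1 / \<Psi> (x\<^sup>2) \<le> C * (1 / \<Psi> x)"
proof -
  have pos: "\<And>x. 0 \<le> x \<Longrightarrow> \<Psi> x > 0" using assms by (simp add: class_L_def)
  obtain C2 where C2: "C2 \<ge> 1" "\<And>x. 0 \<le> x \<Longrightarrow> inverse C2 * \<Psi> x \<le> \<Psi> (x\<^sup>2) \<and> \<Psi> (x\<^sup>2) \<le> C2 * \<Psi> x"
    using assms unfolding class_L_def by auto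
  have up: "a \<le> max C1 C2 * b" if "a \<le> c * b" "c = C1 \<or> c = C2" "b > 0" for a b c C1 :: real
  proof -
    have "c * b \<le> max C1 C2 * b" using that by (intro mult_right_mono) auto
    with that(1) show ?thesis by (rule order_trans)
  qed
  have "ess_increasing \<Psi> \<or> ess_decreasing \<Psi>" using assms by (simp add: class_L_def)
  then show thesis
  proof
    assume "ess_increasing \<Psi>"
    then obtain C1 where C1: "\<And>x y. 0 \<le> x \<Longrightarrow> x \<le> y \<Longrightarrow> \<Psi> x \<le> C1 * \<Psi> y"
      unfolding ess_increasing_def by auto
    show thesis
    proof (rule that(1)[of "max C1 C2"])
      show "\<Psi> x \<le> max C1 C2 * \<Psi> y" if "0 \<le> x" "x \<le> y" for x y
        by (rule up[OF C1]) (use that pos[of y] in auto)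
      show "\<Psi> (x\<^sup>2) \<le> max C1 C2 * \<Psi> x" if "0 \<le> x" for x
        by (rule up[of _ C2]) (use that pos[of x] C2 in auto)
    qed (use C2 in auto)
  next
    assume "ess_decreasing \<Psi>"
    then obtain C1 where C1: "\<And>x y. 0 \<le> x \<Longrightarrow> x \<le> y \<Longrightarrow> \<Psi> y \<le> C1 * \<Psi> x"
      unfolding ess_decreasing_def by auto
    show thesis
    proof (rule that(2)[of "max C1 C2"])
      show "1 / \<Psi> x \<le> max C1 C2 * (1 / \<Psi> y)" if "0 \<le> x" "x \<le> y" for x y
        using up[OF C1[OF that], of C1] that pos[of x] pos[of y] by (simp add: field_simps)
      show "1 / \<Psi> (x\<^sup>2) \<le> max C1 C2 * (1 / \<Psi> x)" if "0 \<le> x" for x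
      proof -
        have "\<Psi> x \<le> C2 * \<Psi> (x\<^sup>2)" using C2(1) C2(2)[OF that] by (simp add: field_simps)
        then have "\<Psi> x \<le> max C1 C2 * \<Psi> (x\<^sup>2)" by (rule up[of _ C2]) (use pos in auto)
        then show ?thesis using that pos[of x] pos[of "x\<^sup>2"] by (simp add: field_simps)
      qed
    qed (use C2 in auto)
  qed
qed

text \<open>Class L does not distinguish between arguments that are bounded by powers of each other. This is how the
  values of \<open>\<Psi>\<close> at \<open>1 / \<omega>(S(a))\<close>, at \<open>1 / (1 - |a|)\<close> and at
  the values of functions are exchanged for one another.\<close>

lemma class_L_compare:
  assumes "\<Psi> \<in> class_L" "L \<ge> 0"
  shows "\<exists>C>0. \<forall>x\<ge>0. \<forall>y\<ge>0. x \<le> A * max 1 y powr L \<longrightarrow> y \<le> A * max 1 x powr L \<longrightarrow> \<Psi> x \<le> C * \<Psi> y"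
  using assms(1)
proof (cases rule: class_L_cases)
  case (1 C)
  show ?thesis
    using slow_increasing_compare[where \<Psi>=\<Psi> and C=C and L=L and A=A, OF class_L_pos[OF assms(1)] 1(2,3,1) assms(2)]
    by blast
next
  case (2 C)
  have "\<exists>C'>0. \<forall>x y. 0 \<le> x \<longrightarrow> 0 \<le> y \<longrightarrow> x \<le> A * max 1 y powr L \<longrightarrow> 1 / \<Psi> x \<le> C' * (1 / \<Psi> y)"
    by (rule slow_increasing_compare[where \<Psi>="\<lambda>x. 1 / \<Psi> x" and C=C])
       (use 2 assms class_L_pos[OF assms(1)] in auto)
  then obtain C' where C': "C' > 0" "\<And>x y. 0 \<le> x \<Longrightarrow> 0 \<le> y \<Longrightarrow> x \<le> A * max 1 y powr L \<Longrightarrow> 1 / \<Psi> x \<le> C' * (1 / \<Psi> y)"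
    by blast
  show ?thesis
  proof (intro exI[of _ C'] conjI allI impI)
    fix x y :: real assume *: "0 \<le> x" "0 \<le> y" "y \<le> A * max 1 x powr L"
    show "\<Psi> x \<le> C' * \<Psi> y"
      using C'(2)[OF *(2,1,3)] class_L_pos[OF assms(1) *(1)] class_L_pos[OF assms(1) *(2)] by (simp add: field_simps)
  qed (use C' in auto)
qed

lemma class_L_Potter:
  assumes "\<Psi> \<in> class_L" "d > 0"
  shows "\<exists>B>0. \<forall>x>0. \<forall>y>0. \<Psi> x \<le> B * max (x/y) (y/x) powr d * \<Psi> y"
  using assms(1)
proof (cases rule: class_L_cases)
  case (1 C)
  show ?thesis
    by (rule slow_increasing_Potter[where \<Psi>=\<Psi> and C=C and d=d, OF class_L_pos[OF assms(1)] 1(2,3,1) assms(2)])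
next
  case (2 C)
  have "\<exists>B>0. \<forall>x>0. \<forall>y>0. 1 / \<Psi> x \<le> B * max (x/y) (y/x) powr d * (1 / \<Psi> y)"
    by (rule slow_increasing_Potter[where \<Psi>="\<lambda>x. 1 / \<Psi> x" and C=C])
       (use 2 assms class_L_pos[OF assms(1)] in auto)
  then obtain B where B: "B > 0" "\<And>x y. 0 < x \<Longrightarrow> 0 < y \<Longrightarrow> 1 / \<Psi> x \<le> B * max (x/y) (y/x) powr d * (1 / \<Psi> y)"
    by blast
  show ?thesis
  proof (intro exI[of _ B] conjI allI impI)
    fix x y :: real assume *: "0 < x" "0 < y"
    show "\<Psi> x \<le> B * max (x/y) (y/x) powr d * \<Psi> y"
      using B(2)[OF *(2,1)] class_L_pos[OF assms(1), of x] class_L_pos[OF assms(1), of y] * 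
      by (simp add: field_simps max.commute)
  qed (use B in auto)
qed

text \<open>The two-sided power control under dilations is the only property of \<open>F x = |x|^p * \<Psi> |x|\<close> on
  which the estimates for a single space rely.\<close>

definition quasi_power :: "(real \<Rightarrow> real) \<Rightarrow> bool" where
  "quasi_power F \<longleftrightarrow> F \<in> borel_measurable borel \<and> F 0 = 0 \<and> (\<forall>x>0. F x > 0) \<and>
     (\<exists>C\<ge>1. \<exists>\<alpha>>0. \<exists>\<beta>>0. \<forall>t\<ge>0. \<forall>x\<ge>0. F (t * x) \<le> C * max (t powr \<alpha>) (t powr \<beta>) * F x)"

definition orlicz :: "real \<Rightarrow> (real \<Rightarrow> real) \<Rightarrow> real \<Rightarrow> real" where
  "orlicz p \<Psi> x = \<bar>x\<bar> powr p * \<Psi> \<bar>x\<bar>"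

text \<open>The Potter bound with exponent \<open>p / 2\<close> lets \<open>\<Psi>\<close> change \<open>t powr p\<close>
  at most to \<open>t powr (p / 2)\<close> or \<open>t powr (3 * p / 2)\<close>.\<close>

lemma quasi_power_orlicz:
  assumes "\<Psi> \<in> class_L" "p > 0"
  shows "quasi_power (orlicz p \<Psi>)"
proof -
  note pos = class_L_pos[OF assms(1)]
  have [measurable]: "\<Psi> \<in> borel_measurable (restrict_space borel {0..})" using assms(1) by (simp add: class_L_def)
  have "(\<lambda>x::real. \<Psi> \<bar>x\<bar>) \<in> borel_measurable borel"
    by (rule measurable_compose[where g=\<Psi> and N="restrict_space borel {0..}"])
       (auto intro!: measurable_restrict_space2)
  then have "orlicz p \<Psi> \<in> borel_measurable borel"
    unfolding orlicz_def[abs_def] by measurable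
  moreover obtain B where B: "B > 0" "\<And>x y. 0 < x \<Longrightarrow> 0 < y \<Longrightarrow> \<Psi> x \<le> B * max (x/y) (y/x) powr (p/2) * \<Psi> y"
    using class_L_Potter[OF assms(1), of "p/2"] assms(2) by auto
  have "orlicz p \<Psi> (t * x) \<le> max 1 B * max (t powr (p/2)) (t powr (3*p/2)) * orlicz p \<Psi> x" if "t \<ge> 0" "x \<ge> 0" for t x
  proof (cases "t = 0 \<or> x = 0")
    case True then show ?thesis using pos[of x] pos[of 0] that by (auto simp: orlicz_def)
  next
    case False
    then have t: "t > 0" and x: "x > 0" using that by auto
    have mx: "max t (1/t) powr (p/2) * t powr p = max (t powr (p/2)) (t powr (3*p/2))"
    proof (cases "t \<ge> 1")
      case True
      have "1 / t \<le> 1" using True by simp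
      then have "1 / t \<le> t" using True by linarith
      then have "max t (1/t) = t" by (rule max_absorb1)
      moreover have "t powr (p/2) \<le> t powr (3*p/2)" using True assms(2) by (intro powr_mono) auto
      ultimately show ?thesis by (simp add: powr_add[symmetric])
    next
      case False
      have "1 \<le> 1/t" using t False by simp
      then have "max t (1/t) = 1/t" using False by simp
      moreover have "t powr (3*p/2) \<le> t powr (p/2)" using False t assms(2) by (intro powr_mono') auto
      moreover have "(1/t) powr (p/2) * t powr p = t powr (p/2)"
        using t by (simp add: powr_divide powr_diff[symmetric])
      ultimately show ?thesis by simp
    qed
    have "\<Psi> (t*x) \<le> B * max t (1/t) powr (p/2) * \<Psi> x" using B(2)[of "t*x" x] t x by simp
    then have "(t * x) powr p * \<Psi> (t * x) \<le> (t*x) powr p * (B * max t (1/t) powr (p/2) * \<Psi> x)"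
      by (rule mult_left_mono) auto
    also have "\<dots> = B * (max t (1/t) powr (p/2) * t powr p) * (x powr p * \<Psi> x)"
      using t x by (simp add: powr_mult)
    also have "\<dots> \<le> max 1 B * (max t (1/t) powr (p/2) * t powr p) * (x powr p * \<Psi> x)"
      using pos[of x] x by (intro mult_right_mono) auto
    finally show ?thesis unfolding mx using t x by (simp add: orlicz_def)
  qed
  moreover have "orlicz p \<Psi> x > 0" if "x > 0" for x using that pos[of x] by (simp add: orlicz_def)
  ultimately show ?thesis
    unfolding quasi_power_def using assms(2)
    by (intro conjI exI[of _ "max 1 B"] exI[of _ "p/2"] exI[of _ "3*p/2"]) (auto simp: orlicz_def)
qed

section \<open>Subharmonicity of quasi-powers of analytic functions\<close>

text \<open>For \<open>|a| < |w|\<close> this is the Poisson kernel of the disc of radius \<open>|w|\<close>, with pole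
  \<open>a\<close> inside and \<open>w\<close> on the boundary, for the normalised arc length.\<close>

definition poisson :: "complex \<Rightarrow> complex \<Rightarrow> real" where
  "poisson a w = ((cmod w)\<^sup>2 - (cmod a)\<^sup>2) / (cmod (w - a))\<^sup>2"

abbreviation ecirc :: "real \<Rightarrow> complex" where
  "ecirc t \<equiv> cis (2 * pi * t)"

lemma cmod_diff_le_cmod_one_minus:
  assumes "cmod a \<le> 1" "cmod b \<le> 1"
  shows "cmod (a - b) \<le> cmod (1 - cnj b * a)"
proof -
  have "(cmod (1 - cnj b * a))\<^sup>2 - (cmod (a - b))\<^sup>2 = (1 - (cmod a)\<^sup>2) * (1 - (cmod b)\<^sup>2)"
    unfolding cmod_power2 by (simp add: power2_eq_square algebra_simps)
  also have "\<dots> \<ge> 0" using assms by (intro mult_nonneg_nonneg) (auto simp: abs_square_le_1)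
  finally have "(cmod (a - b))\<^sup>2 \<le> (cmod (1 - cnj b * a))\<^sup>2" by simp
  then show ?thesis by (rule power2_le_imp_le) simp
qed

lemma cmod_one_minus_cnj_unit:
  assumes "cmod w = 1" shows "cmod (1 - cnj b * w) = cmod (w - b)"
proof -
  have "cnj w * w = 1" using assms by (simp add: complex_norm_square[symmetric] mult.commute)
  then have "1 - cnj b * w = cnj (w - b) * w" by (simp add: algebra_simps)
  then show ?thesis using assms by (metis complex_mod_cnj mult.right_neutral norm_mult)
qed

lemma one_minus_cnj_mult_nonzero:
  assumes a: "cmod a < 1" and z: "cmod z \<le> 1"
  shows "1 - cnj a * z \<noteq> 0"
proof
  assume "1 - cnj a * z = 0"
  then have "cmod a * cmod z = 1" by (metis complex_mod_cnj eq_iff_diff_eq_0 norm_mult norm_one)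
  moreover have "cmod a * cmod z \<le> cmod a * 1" using z by (intro mult_left_mono) auto
  ultimately show False using a by simp
qed

text \<open>Cauchy's formula for \<open>u z * (1 - |a|^2) / (1 - cnj a * z)\<close>: this function has the value \<open>u
  a\<close> at \<open>a\<close>, and on the unit circle its Cauchy kernel is the Poisson kernel times
  \<open>u\<close>.\<close>

lemma poisson_formula:
  assumes hol: "u holomorphic_on ball 0 R" and R: "R > 1" and a: "cmod a < 1"
  shows "((\<lambda>t. of_real (poisson a (ecirc t)) * u (ecirc t)) has_integral u a) {0..1}"
proof -
  define v where "v = (\<lambda>z. u z * of_real (1 - (cmod a)\<^sup>2) / (1 - cnj a * z))"
  have nz: "1 - cnj a * z \<noteq> 0" if "cmod z \<le> 1" for z using one_minus_cnj_mult_nonzero[OF a that] .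
  have "u holomorphic_on cball 0 1" using R by (intro holomorphic_on_subset[OF hol]) auto
  then have hv: "v holomorphic_on cball 0 1"
    unfolding v_def by (intro holomorphic_intros) (use nz in auto)
  have "((\<lambda>w. v w / (w - a)) has_contour_integral (2*pi * \<i> * winding_number (circlepath 0 1) a * v a)) (circlepath 0 1)"
    using a by (intro Cauchy_integral_formula_convex_simple[OF convex_cball hv]) auto
  also have "winding_number (circlepath 0 1) a = 1"
    using a by (intro winding_number_circlepath) auto
  also have "v a = u a"
  proof -
    have "1 - cnj a * a = of_real (1 - (cmod a)\<^sup>2)"
      by (simp only: of_real_diff of_real_1 complex_norm_square mult.commute)
    then show ?thesis using nz[of a] a by (simp add: v_def)
  qed
  finally have "((\<lambda>x. v (circlepath 0 1 x) / (circlepath 0 1 x - a) * vector_derivative (circlepath 0 1) (at x within {0..1}))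
       has_integral 2 * pi * \<i> * 1 * u a) {0..1}"
    unfolding has_contour_integral_def .
  then have I: "((\<lambda>x. 1 / (2 * pi * \<i>) * (v (circlepath 0 1 x) / (circlepath 0 1 x - a) * vector_derivative (circlepath 0 1) (at x within {0..1})))
       has_integral 1 / (2 * pi * \<i>) * (2 * pi * \<i> * 1 * u a)) {0..1}"
    by (rule has_integral_mult_right)
  have ce: "circlepath 0 1 x = ecirc x" for x
    by (simp add: circlepath cis_conv_exp mult_ac)
  have I2: "((\<lambda>x. 1 / (2 * pi * \<i>) * (v (ecirc x) / (ecirc x - a) * (2 * pi * \<i> * ecirc x)))
       has_integral u a) {0..1}"
  proof (rule has_integral_eq_rhs[OF has_integral_eq[OF _ I]])
    fix x :: real assume "x \<in> {0..1}"
    then have "vector_derivative (circlepath 0 1) (at x within {0..1}) = 2 * pi * \<i> * ecirc x"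
      using vector_derivative_circlepath01[of x 0 1] by (simp add: cis_conv_exp mult_ac)
    then show "1 / (2 * pi * \<i>) * (v (circlepath 0 1 x) / (circlepath 0 1 x - a) * vector_derivative (circlepath 0 1) (at x within {0..1}))
      = 1 / (2 * pi * \<i>) * (v (ecirc x) / (ecirc x - a) * (2 * pi * \<i> * ecirc x))" by (simp only: ce)
  qed simp
  have key: "1 / (2 * pi * \<i>) * (v w / (w - a) * (2 * pi * \<i> * w)) = of_real (poisson a w) * u w"
    if w: "cmod w = 1" for w
  proof -
    have cw: "cnj w * w = 1" using w by (simp add: complex_norm_square[symmetric] mult.commute)
    have eq: "1 - cnj a * w = w * cnj (w - a)" using cw by (simp add: algebra_simps)
    have w0: "w \<noteq> 0" and wa: "w \<noteq> a" using w a by auto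
    have N: "(w - a) * cnj (w - a) = of_real ((cmod (w - a))\<^sup>2)" by (simp only: complex_norm_square)
    have "1 / (2 * pi * \<i>) * (v w / (w - a) * (2 * pi * \<i> * w)) = v w * w / (w - a)"
      using wa by (simp add: field_simps)
    also have "\<dots> = u w * of_real (1 - (cmod a)\<^sup>2) / (w * cnj (w - a)) * w / (w - a)" unfolding v_def eq ..
    also have "\<dots> = u w * of_real (1 - (cmod a)\<^sup>2) / ((w - a) * cnj (w - a))"
      using w0 by simp
    also have "\<dots> = of_real (poisson a w) * u w" unfolding N poisson_def w by simp
    finally show ?thesis .
  qed
  show ?thesis
    by (rule has_integral_eq[OF _ I2]) (rule key, simp)
qed

lemma poisson_mass:
  assumes a: "cmod a < 1"
  shows "((\<lambda>t. poisson a (ecirc t)) has_integral 1) {0..1}"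
proof -
  have "((\<lambda>t. of_real (poisson a (ecirc t)) * 1 :: complex) has_integral 1) {0..1}"
    by (rule poisson_formula[where R=2]) (use a in auto)
  from has_integral_Re[OF this] show ?thesis by simp
qed

lemma poisson_nonneg: "cmod a \<le> cmod w \<Longrightarrow> poisson a w \<ge> 0"
  unfolding poisson_def by (intro divide_nonneg_nonneg) (auto intro: power_mono)

lemma continuous_on_poisson:
  assumes "cmod a < 1" shows "continuous_on A (\<lambda>t. poisson a (ecirc t))"
proof -
  have "ecirc t \<noteq> a" for t using assms by (metis norm_cis order_less_irrefl)
  then show ?thesis unfolding poisson_def by (intro continuous_intros) auto
qed

lemma continuous_on_circle_trace:
  assumes "f holomorphic_on ball 0 R" "R > 1" and d: "d > 0"
  shows "continuous_on A (\<lambda>t. cmod (f (ecirc t)) powr d)"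
proof -
  have "continuous_on A (f \<circ> (\<lambda>t. ecirc t))"
    by (rule continuous_on_compose)
       (use assms in \<open>auto intro!: continuous_intros continuous_on_subset[OF holomorphic_on_imp_continuous_on[OF assms(1)]]\<close>)
  then have "continuous_on A (\<lambda>t. cmod (f (ecirc t)))" by (auto simp: o_def intro: continuous_intros)
  then show ?thesis using d by (intro continuous_on_powr') (auto intro: continuous_intros)
qed

text \<open>Where \<open>f\<close> has no zeros, \<open>|f| powr d\<close> is the modulus of the analytic function
  \<open>f powr d\<close>, to which the Poisson formula applies.\<close>

lemma powr_subharmonic_zero_free:
  assumes hol: "f holomorphic_on ball 0 R" and R: "R > 1" and a: "cmod a < 1" and d: "d > 0"
    and nz: "\<And>z. z \<in> ball 0 R \<Longrightarrow> f z \<noteq> 0"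
  shows "cmod (f a) powr d \<le> integral {0..1} (\<lambda>t. poisson a (ecirc t) * cmod (f (ecirc t)) powr d)"
proof -
  have "\<exists>h. h holomorphic_on ball 0 R \<and> (\<forall>z\<in>ball 0 R. f z = exp (h z))"
  proof -
    have "simply_connected (ball (0::complex) R)" by (simp add: convex_imp_simply_connected)
    then show ?thesis using simply_connected_eq_holomorphic_log[of "ball 0 R"] hol nz by simp
  qed
  then obtain h where h: "h holomorphic_on ball 0 R" "\<And>z. z \<in> ball 0 R \<Longrightarrow> f z = exp (h z)" by blast
  define u where "u = (\<lambda>z. exp (of_real d * h z))"
  have hu: "u holomorphic_on ball 0 R" unfolding u_def using h by (intro holomorphic_intros)
  have cu: "cmod (u z) = cmod (f z) powr d" if "z \<in> ball 0 R" for z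
    using h(2)[OF that] by (simp add: u_def norm_exp_eq_Re powr_def)
  have aR: "a \<in> ball 0 R" "ecirc t \<in> ball 0 R" for t using a R by auto
  have I: "((\<lambda>t. of_real (poisson a (ecirc t)) * u (ecirc t)) has_integral u a) {0..1}"
    by (rule poisson_formula[OF hu R a])
  have "cmod (f a) powr d = cmod (u a)" using cu aR by simp
  also have "\<dots> = cmod (integral {0..1} (\<lambda>t. of_real (poisson a (ecirc t)) * u (ecirc t)))"
    using I by (simp add: integral_unique)
  also have "\<dots> \<le> integral {0..1} (\<lambda>t. poisson a (ecirc t) * cmod (f (ecirc t)) powr d)"
  proof (rule integral_norm_bound_integral)
    show "(\<lambda>t. of_real (poisson a (ecirc t)) * u (ecirc t)) integrable_on {0..1}" using I by blast
    show "(\<lambda>t. poisson a (ecirc t) * cmod (f (ecirc t)) powr d) integrable_on {0..1}"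
      by (intro integrable_continuous_interval continuous_intros continuous_on_poisson[OF a]
          continuous_on_circle_trace[OF hol R d])
    show "cmod (of_real (poisson a (ecirc t)) * u (ecirc t)) \<le> poisson a (ecirc t) * cmod (f (ecirc t)) powr d" for t
      using a by (simp add: norm_mult cu[OF aR(2)] poisson_nonneg)
  qed
  finally show ?thesis .
qed

text \<open>Zeros on the circle are avoided by the dilates \<open>z \<mapsto> f (r * z)\<close> with \<open>r\<close>
  tending to \<open>1\<close>.\<close>

lemma powr_subharmonic_zero_free_open:
  assumes hol: "f holomorphic_on ball 0 R" and R: "R > 1" and a: "cmod a < 1" and d: "d > 0"
    and nz: "\<And>z. z \<in> ball 0 1 \<Longrightarrow> f z \<noteq> 0"
  shows "cmod (f a) powr d \<le> integral {0..1} (\<lambda>t. poisson a (ecirc t) * cmod (f (ecirc t)) powr d)"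
proof -
  define r :: "nat \<Rightarrow> real" where "r n = 1 - inverse (real (Suc (Suc n)))" for n
  have r: "0 < r n" "r n < 1" for n by (auto simp: r_def field_simps)
  have "(\<lambda>n. inverse (real (Suc n))) \<longlonglongrightarrow> 0" by (rule LIMSEQ_inverse_real_of_nat)
  then have "(\<lambda>n. inverse (real (Suc (Suc n)))) \<longlonglongrightarrow> 0" by (rule LIMSEQ_Suc)
  then have rl: "r \<longlonglongrightarrow> 1" unfolding r_def[abs_def]
    using tendsto_diff[OF tendsto_const[of 1], of "\<lambda>n. inverse (real (Suc (Suc n)))" 0 sequentially] by simp
  have cont: "isCont f z" if "cmod z \<le> 1" for z
    using that R hol by (auto simp: continuous_on_eq_continuous_at dest!: holomorphic_on_imp_continuous_on)
  have fl: "(\<lambda>n. cmod (f (of_real (r n) * z)) powr d) \<longlonglongrightarrow> cmod (f z) powr d" if "cmod z \<le> 1" for z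
  proof -
    have "(\<lambda>n. of_real (r n) * z) \<longlonglongrightarrow> of_real 1 * z" by (intro tendsto_intros rl)
    then have "(\<lambda>n. f (of_real (r n) * z)) \<longlonglongrightarrow> f z" using cont[OF that] isCont_tendsto_compose by fastforce
    then show ?thesis using d by (intro tendsto_powr' tendsto_intros) auto
  qed
  have le: "cmod (f (of_real (r n) * a)) powr d \<le> integral {0..1} (\<lambda>t. poisson a (ecirc t) * cmod (f (of_real (r n) * ecirc t)) powr d)" for n
  proof (rule powr_subharmonic_zero_free[where f="\<lambda>z. f (of_real (r n) * z)" and R="1 / r n"])
    have sub: "(\<lambda>z. of_real (r n) * z) ` ball 0 (1 / r n) \<subseteq> ball (0::complex) 1"
      using r[of n] by (auto simp: norm_mult field_simps)
    then have "f holomorphic_on (\<lambda>z. of_real (r n) * z) ` ball 0 (1 / r n)"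
      using R by (intro holomorphic_on_subset[OF hol]) auto
    then have "(f \<circ> (\<lambda>z. of_real (r n) * z)) holomorphic_on ball 0 (1 / r n)"
      by (intro holomorphic_on_compose holomorphic_intros)
    then show "(\<lambda>z. f (of_real (r n) * z)) holomorphic_on ball 0 (1 / r n)" by (simp add: o_def)
    show "f (of_real (r n) * z) \<noteq> 0" if "z \<in> ball 0 (1 / r n)" for z
      using sub that by (intro nz) blast
  qed (use r[of n] a d in auto)
  obtain M where M: "\<And>z. cmod z \<le> 1 \<Longrightarrow> cmod (f z) \<le> M"
  proof -
    have "compact (f ` cball 0 1)"
      using R by (intro compact_continuous_image continuous_on_subset[OF holomorphic_on_imp_continuous_on[OF hol]]) auto
    then have "bounded (f ` cball 0 1)" by (rule compact_imp_bounded)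
    then show ?thesis using that unfolding bounded_iff by (metis dist_0_norm image_eqI mem_cball)
  qed
  have "(\<lambda>n. integral {0..1} (\<lambda>t. poisson a (ecirc t) * cmod (f (of_real (r n) * ecirc t)) powr d))
     \<longlonglongrightarrow> integral {0..1} (\<lambda>t. poisson a (ecirc t) * cmod (f (ecirc t)) powr d)"
  proof (rule dominated_convergence(2))
    fix n
    have "continuous_on {0..1} (f \<circ> (\<lambda>t. of_real (r n) * ecirc t))"
    proof (rule continuous_on_compose)
      have "r n < R" using r[of n] R by linarith
      then have "(\<lambda>t. of_real (r n) * ecirc t) ` {0..1} \<subseteq> ball 0 R" using r[of n] by (auto simp: norm_mult)
      then show "continuous_on ((\<lambda>t. of_real (r n) * ecirc t) ` {0..1}) f"
        by (rule continuous_on_subset[OF holomorphic_on_imp_continuous_on[OF hol]])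
    qed (intro continuous_intros)
    then have "continuous_on {0..1} (\<lambda>t. cmod (f (of_real (r n) * ecirc t)))"
      by (auto simp: o_def intro: continuous_intros)
    then show "(\<lambda>t. poisson a (ecirc t) * cmod (f (of_real (r n) * ecirc t)) powr d) integrable_on {0..1}"
      by (intro integrable_continuous_interval continuous_on_mult continuous_on_poisson[OF a] continuous_on_powr') (use d in auto)
    show "(\<lambda>t. poisson a (ecirc t) * M powr d) integrable_on {0..1}"
      by (intro integrable_continuous_interval continuous_intros continuous_on_poisson[OF a])
    show "norm (poisson a (ecirc t) * cmod (f (of_real (r n) * ecirc t)) powr d) \<le> poisson a (ecirc t) * M powr d" for t
    proof -
      have "cmod (f (of_real (r n) * ecirc t)) \<le> M" using r[of n] by (intro M) (simp add: norm_mult)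
      then show ?thesis using a d
        by (auto simp: norm_mult poisson_nonneg intro!: mult_left_mono powr_mono2)
    qed
  next
    show "(\<lambda>n. poisson a (ecirc t) * cmod (f (of_real (r n) * ecirc t)) powr d) \<longlonglongrightarrow> poisson a (ecirc t) * cmod (f (ecirc t)) powr d" for t
      by (intro tendsto_intros fl) simp
  qed
  then show ?thesis using LIMSEQ_le[OF fl[of a]] le a by auto
qed

text \<open>The local factorisation at a zero extends to all of \<open>S\<close>, because the quotient is analytic away
  from the zero.\<close>

lemma holomorphic_factor_zero_global:
  assumes hol: "f holomorphic_on S" and S: "open S" "connected S" and b: "b \<in> S" and nc: "\<not> f constant_on S"
  obtains n h where "h holomorphic_on S" "h b \<noteq> 0" "\<And>z. z \<in> S \<Longrightarrow> f z = (z - b) ^ n * h z"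
proof -
  have "\<exists>w\<in>S. f w \<noteq> 0" using nc b unfolding constant_on_def by metis
  from zorder_exist_zero[OF hol S b this] obtain r n g where r: "r > 0" "cball b r \<subseteq> S" "g holomorphic_on cball b r"
    and fg: "\<And>w. w \<in> cball b r \<Longrightarrow> f w = g w * (w - b) ^ n \<and> g w \<noteq> 0" by metis
  define h where "h = (\<lambda>z. if z \<in> ball b r then g z else f z / (z - b) ^ n)"
  have h2: "h z = f z / (z - b) ^ n" if "z \<noteq> b" "z \<in> S" for z
    using that fg[of z] by (auto simp: h_def)
  have "h holomorphic_on ball b r \<union> (S - {b})"
  proof (rule holomorphic_on_Un)
    have "g holomorphic_on ball b r" by (rule holomorphic_on_subset[OF r(3)]) auto
    then show "h holomorphic_on ball b r" by (rule holomorphic_transform) (auto simp: h_def)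
    have "(\<lambda>z. f z / (z - b) ^ n) holomorphic_on S - {b}"
      using hol by (intro holomorphic_intros) (auto intro: holomorphic_on_subset)
    then show "h holomorphic_on S - {b}" by (rule holomorphic_transform) (auto simp: h2)
  qed (use S in auto)
  moreover have "ball b r \<union> (S - {b}) = S" using r b by auto
  ultimately have "h holomorphic_on S" by simp
  moreover have "h b \<noteq> 0" using fg[of b] r by (auto simp: h_def)
  moreover have "f z = (z - b) ^ n * h z" if "z \<in> S" for z
    using that fg[of b] r h2[of z] by (cases "z = b") (auto simp: h_def)
  ultimately show thesis by (rule that)
qed

text \<open>By induction on the number of zeros in the disc: dividing by a Blaschke factor removes a zero, leaves the
  modulus on the circle unchanged and does not decrease it inside.\<close>

lemma powr_subharmonic_unit:
  assumes R: "R > 1" and a: "cmod a < 1" and d: "d > 0" and hol: "f holomorphic_on ball 0 R"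
  shows "cmod (f a) powr d \<le> integral {0..1} (\<lambda>t. poisson a (ecirc t) * cmod (f (ecirc t)) powr d)"
proof (cases "f constant_on ball 0 R")
  case True
  then obtain c where c: "\<And>z. z \<in> ball 0 R \<Longrightarrow> f z = c" by (auto simp: constant_on_def)
  show ?thesis using c R a by (simp add: integral_unique[OF poisson_mass[OF a]])
next
  case False
  have fin: "finite {z \<in> ball 0 1. g z = 0}" if "g holomorphic_on ball 0 R" "\<not> g constant_on ball 0 R" for g
    using R by (intro finite_subset[OF _ holomorphic_compact_finite_zeros[OF that(1) _ _ compact_cball[of 0 1] _ that(2)]]) auto
  show ?thesis using hol False
  proof (induction "card {z \<in> ball 0 1. f z = 0}" arbitrary: f rule: less_induct)
    case less
    show ?case
    proof (cases "{z \<in> ball 0 1. f z = 0} = {}")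
      case True
      then show ?thesis using R a d less.prems(1) by (intro powr_subharmonic_zero_free_open) auto
    next
      case False
      then obtain b where b: "cmod b < 1" "f b = 0" by auto
      obtain n h where h: "h holomorphic_on ball 0 R" "h b \<noteq> 0" "\<And>z. z \<in> ball 0 R \<Longrightarrow> f z = (z - b) ^ n * h z"
      proof (rule holomorphic_factor_zero_global[of f "ball 0 R" b])
        show "b \<in> ball 0 R" using b R by simp
      qed (use less.prems that in auto)
      \<comment> \<open>\<open>f\<close> divided by the \<open>n\<close>-th power of the Blaschke factor \<open>(z - b) / (1 - cnj b * z)\<close>\<close>
      define f1 where "f1 z = h z * (1 - cnj b * z) ^ n" for z
      have h1: "f1 holomorphic_on ball 0 R" unfolding f1_def using h by (intro holomorphic_intros)
      have nz: "1 - cnj b * z \<noteq> 0" if "cmod z < 1" for z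
        using one_minus_cnj_mult_nonzero[of b z] that b by simp
      have zer: "{z \<in> ball 0 1. f1 z = 0} = {z \<in> ball 0 1. f z = 0} - {b}"
        using h(2,3) R nz by (auto simp: f1_def)
      have b': "b \<in> {z \<in> ball 0 1. f z = 0}" using b by simp
      have cle: "cmod (f a) \<le> cmod (f1 a)"
        using h(3)[of a] a R b cmod_diff_le_cmod_one_minus[of a b]
        by (simp add: f1_def norm_mult norm_power mult.commute mult_left_mono power_mono)
      have ceq: "cmod (f1 (ecirc t)) = cmod (f (ecirc t))" for t
        using h(3)[of "ecirc t"] R cmod_one_minus_cnj_unit[of "ecirc t" b] by (simp add: f1_def norm_mult norm_power)
      have "cmod (f1 a) powr d \<le> integral {0..1} (\<lambda>t. poisson a (ecirc t) * cmod (f1 (ecirc t)) powr d)"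
      proof (cases "f1 constant_on ball 0 R")
        case True
        then obtain c where c: "\<And>z. z \<in> ball 0 R \<Longrightarrow> f1 z = c" by (auto simp: constant_on_def)
        show ?thesis using c R a by (simp add: integral_unique[OF poisson_mass[OF a]])
      next
        case F: False
        show ?thesis
        proof (rule less.hyps[OF _ h1 F])
          show "card {z \<in> ball 0 1. f1 z = 0} < card {z \<in> ball 0 1. f z = 0}"
            unfolding zer using fin[OF less.prems] b' by (meson card_Diff1_less)
        qed
      qed
      moreover have "cmod (f a) powr d \<le> cmod (f1 a) powr d" using cle d by (intro powr_mono2) auto
      ultimately show ?thesis unfolding ceq by simp
    qed
  qed
qed

text \<open>The mean over the circle through \<open>z\<close> is taken with nonnegative extended values, so that it is
  defined for every measurable function.\<close>

definition circ_avg :: "(complex \<Rightarrow> ennreal) \<Rightarrow> complex \<Rightarrow> ennreal" where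
  "circ_avg H z = (\<integral>\<^sup>+ t. H (z * ecirc t) * indicator {0..1} t \<partial>lborel)"

lemma measurable_cis [measurable]: "cis \<in> borel_measurable borel"
  by (intro borel_measurable_continuous_onI continuous_intros)

lemma circ_avg_mono: "(\<And>w. cmod w = cmod z \<Longrightarrow> H w \<le> G w) \<Longrightarrow> circ_avg H z \<le> circ_avg G z"
  unfolding circ_avg_def by (intro nn_integral_mono mult_right_mono) (auto simp: norm_mult)

lemma circ_avg_cong: "(\<And>w. cmod w = cmod z \<Longrightarrow> H w = G w) \<Longrightarrow> circ_avg H z = circ_avg G z"
  by (intro antisym circ_avg_mono) auto

lemma circ_avg_cmult:
  assumes [measurable]: "H \<in> borel_measurable borel"
  shows "circ_avg (\<lambda>w. c * H w) z = c * circ_avg H z"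
  unfolding circ_avg_def mult.assoc by (rule nn_integral_cmult) measurable

lemma circ_avg_add:
  assumes [measurable]: "H \<in> borel_measurable borel" "G \<in> borel_measurable borel"
  shows "circ_avg (\<lambda>w. H w + G w) z = circ_avg H z + circ_avg G z"
  unfolding circ_avg_def distrib_right by (rule nn_integral_add) measurable

lemma circ_avg_const: "circ_avg (\<lambda>w. c) z = c"
  unfolding circ_avg_def by (subst nn_integral_cmult) auto

lemma measurable_poisson [measurable]: "poisson a \<in> borel_measurable borel"
  unfolding poisson_def[abs_def] by measurable

lemma poisson_scale:
  assumes "z \<noteq> 0" and that: "cmod w = 1" shows "poisson a (z * w) = poisson (a / z) w"
proof -
  have "z * w - a = z * (w - a / z)" using assms by (simp add: field_simps)
  then have "(cmod (z * w - a))\<^sup>2 = (cmod z)\<^sup>2 * (cmod (w - a / z))\<^sup>2" by (simp add: norm_mult power_mult_distrib)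
  then have "poisson a (z * w) = ((cmod z)\<^sup>2 * (1 - (cmod a / cmod z)\<^sup>2)) / ((cmod z)\<^sup>2 * (cmod (w - a / z))\<^sup>2)"
    using assms by (simp add: poisson_def norm_mult power_divide right_diff_distrib)
  also have "\<dots> = poisson (a / z) w" using assms by (simp add: poisson_def norm_divide)
  finally show ?thesis .
qed

lemma has_integral_circ_avg:
  assumes "((\<lambda>t. h (z * ecirc t)) has_integral I) {0..1}" "\<And>w. cmod w = cmod z \<Longrightarrow> 0 \<le> h w"
  shows "circ_avg (\<lambda>w. ennreal (h w)) z = ennreal I"
  unfolding circ_avg_def
  by (rule nn_integral_has_integral_lebesgue'[OF _ assms(1)]) (auto simp: assms(2) norm_mult)

lemma circ_avg_poisson:
  assumes "cmod a < cmod z" shows "circ_avg (\<lambda>w. ennreal (poisson a w)) z = 1"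
proof -
  have z: "z \<noteq> 0" using assms by auto
  have "((\<lambda>t. poisson (a / z) (ecirc t)) has_integral 1) {0..1}"
    using assms z by (intro poisson_mass) (simp add: norm_divide)
  then have "((\<lambda>t. poisson a (z * ecirc t)) has_integral 1) {0..1}" using z by (simp add: poisson_scale)
  from has_integral_circ_avg[OF this] show ?thesis using assms by (simp add: poisson_nonneg)
qed

lemma powr_subharmonic:
  assumes hol: "f holomorphic_on ball 0 1" and az: "cmod a < cmod z" and z1: "cmod z < 1" and d: "d > 0"
  shows "ennreal (cmod (f a) powr d) \<le> circ_avg (\<lambda>w. ennreal (poisson a w * cmod (f w) powr d)) z"
proof -
  have z: "z \<noteq> 0" using az by auto
  define g where "g w = f (z * w)" for w
  have R: "1 / cmod z > 1" using z1 z by simp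
  have "f holomorphic_on (\<lambda>w. z * w) ` ball 0 (1 / cmod z)"
    using z by (intro holomorphic_on_subset[OF hol]) (auto simp: norm_mult field_simps)
  then have "(f \<circ> (\<lambda>w. z * w)) holomorphic_on ball 0 (1 / cmod z)"
    by (intro holomorphic_on_compose holomorphic_intros)
  then have hg: "g holomorphic_on ball 0 (1 / cmod z)" by (simp add: o_def g_def[abs_def])
  have a': "cmod (a / z) < 1" using az z by (simp add: norm_divide)
  define J where "J = integral {0..1} (\<lambda>t. poisson (a/z) (ecirc t) * cmod (g (ecirc t)) powr d)"
  have "cmod (g (a/z)) powr d \<le> J" unfolding J_def by (rule powr_subharmonic_unit[OF R a' d hg])
  moreover have "((\<lambda>t. poisson (a/z) (ecirc t) * cmod (g (ecirc t)) powr d) has_integral J) {0..1}"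
    unfolding J_def
    by (intro integrable_integral integrable_continuous_interval continuous_intros continuous_on_poisson a'
          continuous_on_circle_trace[OF hg R d])
  then have "((\<lambda>t. poisson a (z * ecirc t) * cmod (f (z * ecirc t)) powr d) has_integral J) {0..1}"
    using z by (simp add: poisson_scale g_def)
  then have "circ_avg (\<lambda>w. ennreal (poisson a w * cmod (f w) powr d)) z = ennreal J"
    by (rule has_integral_circ_avg) (use az in \<open>auto simp: poisson_nonneg\<close>)
  ultimately show ?thesis using z by (simp add: g_def ennreal_leI)
qed

lemma measurable_indicator_holomorphic:
  assumes "f holomorphic_on ball 0 1"
  shows "(\<lambda>z. if z \<in> ball 0 1 then f z else 0) \<in> borel_measurable borel"
  by (rule borel_measurable_continuous_on_if)
     (use assms in \<open>auto intro: holomorphic_on_imp_continuous_on\<close>)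

text \<open>The dilation bounds of a quasi-power with one exponent for contractions and one for expansions, which is the
  form in which they are applied.\<close>

definition power_bounds :: "(real \<Rightarrow> real) \<Rightarrow> real \<Rightarrow> real \<Rightarrow> real \<Rightarrow> bool" where
  "power_bounds F C \<alpha> \<beta> \<longleftrightarrow> C \<ge> 1 \<and> 0 < \<alpha> \<and> \<alpha> \<le> \<beta> \<and>
     (\<forall>t x. 0 \<le> t \<longrightarrow> t \<le> 1 \<longrightarrow> 0 \<le> x \<longrightarrow> F (t * x) \<le> C * t powr \<alpha> * F x) \<and>
     (\<forall>t x. 1 \<le> t \<longrightarrow> 0 \<le> x \<longrightarrow> F (t * x) \<le> C * t powr \<beta> * F x)"

lemma power_boundsD:
  assumes "power_bounds F C \<alpha> \<beta>"
  shows "C \<ge> 1" "0 < \<alpha>" "\<alpha> \<le> \<beta>"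
    "0 \<le> t \<Longrightarrow> t \<le> 1 \<Longrightarrow> 0 \<le> x \<Longrightarrow> F (t * x) \<le> C * t powr \<alpha> * F x"
    "1 \<le> t \<Longrightarrow> 0 \<le> x \<Longrightarrow> F (t * x) \<le> C * t powr \<beta> * F x"
  using assms unfolding power_bounds_def by auto

lemma quasi_power_bounds:
  assumes "quasi_power F"
  obtains C \<alpha> \<beta> where "power_bounds F C \<alpha> \<beta>"
proof -
  obtain C a b where *: "C \<ge> 1" "a > 0" "b > 0"
      "\<And>t x. 0 \<le> t \<Longrightarrow> 0 \<le> x \<Longrightarrow> F (t * x) \<le> C * max (t powr a) (t powr b) * F x"
    using assms unfolding quasi_power_def by auto
  have m1: "max (t powr a) (t powr b) = t powr (min a b)" if "0 \<le> t" "t \<le> 1" for t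
  proof (cases "a \<le> b")
    case True
    then have "t powr b \<le> t powr a" using that * by (intro powr_mono') auto
    then show ?thesis using True by simp
  next
    case False
    then have "t powr a \<le> t powr b" using that * by (intro powr_mono') auto
    then show ?thesis using False by simp
  qed
  have m2: "max (t powr a) (t powr b) = t powr (max a b)" if "1 \<le> t" for t
  proof (cases "a \<le> b")
    case True
    then have "t powr a \<le> t powr b" using that by (intro powr_mono) auto
    then show ?thesis using True by simp
  next
    case False
    then have "t powr b \<le> t powr a" using that by (intro powr_mono) auto
    then show ?thesis using False by simp
  qed
  have "power_bounds F C (min a b) (max a b)"
    unfolding power_bounds_def
  proof (intro conjI allI impI)
    show "F (t * x) \<le> C * t powr (min a b) * F x" if "0 \<le> t" "t \<le> 1" "0 \<le> x" for t x
      using *(4)[of t x] m1[of t] that by simp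
    show "F (t * x) \<le> C * t powr (max a b) * F x" if "1 \<le> t" "0 \<le> x" for t x
      using *(4)[of t x] m2[of t] that by simp
  qed (use * in auto)
  then show thesis by (rule that)
qed

lemma quasi_power_nonneg: "quasi_power F \<Longrightarrow> 0 \<le> x \<Longrightarrow> 0 \<le> F x"
  unfolding quasi_power_def by (cases "x = 0") (auto intro: less_imp_le)

lemma quasi_power_pos: "quasi_power F \<Longrightarrow> 0 < x \<Longrightarrow> 0 < F x"
  unfolding quasi_power_def by auto

lemma quasi_power_zero: "quasi_power F \<Longrightarrow> F 0 = 0"
  unfolding quasi_power_def by auto

lemma quasi_power_measurable: "quasi_power F \<Longrightarrow> F \<in> borel_measurable borel"
  unfolding quasi_power_def by auto

text \<open>There need not be a power of \<open>|f|\<close> that is comparable with \<open>F |f|\<close>. But \<open>y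
  powr \<alpha> \<le> x powr \<alpha> + C * x powr \<alpha> / F x * F y\<close> for all \<open>y\<close>, and
  if \<open>x\<close> is the multiple of \<open>|f a|\<close> with \<open>2 * x powr \<alpha> = |f a| powr
  \<alpha>\<close>, then the first term accounts for only half of the mean of \<open>|f| powr
  \<alpha>\<close>.\<close>

lemma quasi_power_subharmonic:
  assumes F: "quasi_power F"
  shows "\<exists>K>0. \<forall>f a z. f holomorphic_on ball 0 1 \<longrightarrow> cmod a < cmod z \<longrightarrow> cmod z < 1 \<longrightarrow>
           ennreal (F (cmod (f a))) \<le> ennreal K * circ_avg (\<lambda>w. ennreal (poisson a w) * ennreal (F (cmod (f w)))) z"
proof -
  obtain C \<alpha> \<beta> where pb: "power_bounds F C \<alpha> \<beta>" using quasi_power_bounds[OF F] .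
  note C = power_boundsD(1-3)[OF pb] and lo = power_boundsD(4)[OF pb] and hi = power_boundsD(5)[OF pb]
  have [measurable]: "F \<in> borel_measurable borel" using quasi_power_measurable[OF F] .
  define \<theta> where "\<theta> = 2 powr (1 / \<alpha>)"
  have \<theta>: "\<theta> \<ge> 1" "\<theta> powr \<alpha> = 2" using C by (auto simp: \<theta>_def powr_powr ge_one_powr_ge_zero)
  define K where "K = C * \<theta> powr \<beta> * C"
  have K: "K > 0" using C \<theta> by (simp add: K_def)
  have "ennreal (F (cmod (f a))) \<le> ennreal K * circ_avg (\<lambda>w. ennreal (poisson a w) * ennreal (F (cmod (f w)))) z"
    if hol: "f holomorphic_on ball 0 1" and az: "cmod a < cmod z" and z1: "cmod z < 1" for f a z
  proof (cases "f a = 0")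
    case True then show ?thesis using quasi_power_zero[OF F] by simp
  next
    case False
    define g where "g w = (if w \<in> ball 0 1 then f w else 0)" for w
    have [measurable]: "g \<in> borel_measurable borel" unfolding g_def[abs_def] by (rule measurable_indicator_holomorphic[OF hol])
    have gf: "g w = f w" if "cmod w \<le> cmod z" for w using that z1 by (simp add: g_def)
    define x where "x = cmod (f a) / \<theta>"
    have x: "x > 0" using False \<theta> by (simp add: x_def)
    have Fx: "F x > 0" using quasi_power_pos[OF F x] .
    have fa: "cmod (f a) = \<theta> * x" using \<theta> by (simp add: x_def)
    have pt: "y powr \<alpha> \<le> x powr \<alpha> + C * x powr \<alpha> / F x * F y" if y: "y \<ge> 0" for y
    proof (cases "y \<le> x")
      case True
      then have "y powr \<alpha> \<le> x powr \<alpha>" using y C by (intro powr_mono2) auto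
      moreover have "0 \<le> C * x powr \<alpha> / F x * F y" using C Fx quasi_power_nonneg[OF F y] by simp
      ultimately show ?thesis by linarith
    next
      case False
      then have y0: "y > 0" using x by linarith
      have "F (x / y * y) \<le> C * (x / y) powr \<alpha> * F y" using False x y0 by (intro lo) auto
      then have "F x \<le> C * x powr \<alpha> / y powr \<alpha> * F y" using y0 x by (simp add: powr_divide)
      then have "y powr \<alpha> \<le> C * x powr \<alpha> / F x * F y" using y0 Fx by (simp add: field_simps)
      moreover have "0 \<le> x powr \<alpha>" by simp
      ultimately show ?thesis by linarith
    qed
    define J where "J = circ_avg (\<lambda>w. ennreal (poisson a w) * ennreal (F (cmod (f w)))) z"
    have J': "J = circ_avg (\<lambda>w. ennreal (poisson a w) * ennreal (F (cmod (g w)))) z"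
      unfolding J_def by (rule circ_avg_cong) (simp add: gf)
    define b where "b = C * x powr \<alpha> / F x"
    have b: "b > 0" using C x Fx by (simp add: b_def)
    have "ennreal (2 * x powr \<alpha>) = ennreal (cmod (f a) powr \<alpha>)" using \<theta> x by (simp add: fa powr_mult)
    also have "\<dots> \<le> circ_avg (\<lambda>w. ennreal (poisson a w * cmod (f w) powr \<alpha>)) z"
      by (rule powr_subharmonic[OF hol az z1]) (use C in simp)
    also have "\<dots> \<le> circ_avg (\<lambda>w. ennreal (x powr \<alpha>) * ennreal (poisson a w) + ennreal b * (ennreal (poisson a w) * ennreal (F (cmod (g w))))) z"
    proof (rule circ_avg_mono)
      fix w assume w: "cmod w = cmod z"
      have "poisson a w * cmod (f w) powr \<alpha> \<le> poisson a w * (x powr \<alpha> + b * F (cmod (f w)))"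
        using az w pt[of "cmod (f w)"] by (intro mult_left_mono poisson_nonneg) (auto simp: b_def)
      also have "\<dots> = x powr \<alpha> * poisson a w + b * (poisson a w * F (cmod (g w)))" using w gf by (simp add: algebra_simps)
      finally show "ennreal (poisson a w * cmod (f w) powr \<alpha>) \<le> ennreal (x powr \<alpha>) * ennreal (poisson a w) + ennreal b * (ennreal (poisson a w) * ennreal (F (cmod (g w))))"
        using az w b poisson_nonneg[of a w] quasi_power_nonneg[OF F, of "cmod (g w)"]
        by (simp add: ennreal_mult'[symmetric] ennreal_plus[symmetric] ennreal_leI del: ennreal_plus)
    qed
    also have "\<dots> = ennreal (x powr \<alpha>) + ennreal b * J"
      using az by (simp add: circ_avg_add circ_avg_cmult circ_avg_poisson J')
    finally have main: "ennreal (2 * x powr \<alpha>) \<le> ennreal (x powr \<alpha>) + ennreal b * J" .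
    show ?thesis
    proof (cases J)
      case (real j)
      then have "2 * x powr \<alpha> \<le> x powr \<alpha> + b * j" using main b
        by (simp add: ennreal_mult'[symmetric] ennreal_plus[symmetric] del: ennreal_plus)
      then have "x powr \<alpha> \<le> C * x powr \<alpha> / F x * j" by (simp add: b_def)
      then have "x powr \<alpha> * F x \<le> x powr \<alpha> * (C * j)" using Fx by (simp add: field_simps)
      then have Fxj: "F x \<le> C * j" using x by simp
      have "F (cmod (f a)) \<le> C * \<theta> powr \<beta> * F x" unfolding fa using \<theta> x by (intro hi) auto
      also have "\<dots> \<le> C * \<theta> powr \<beta> * (C * j)" using Fxj C by (intro mult_left_mono) auto
      finally have "F (cmod (f a)) \<le> K * j" by (simp add: K_def)
      then show ?thesis using real K by (simp add: J_def[symmetric] ennreal_mult'[symmetric] ennreal_leI)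
    next
      case top
      then show ?thesis using K by (simp add: J_def[symmetric] ennreal_mult_top)
    qed
  qed
  then show ?thesis using K by blast
qed

section \<open>Radial weights as rotation invariant measures\<close>

lemma lborel_translate: "(\<integral>\<^sup>+ x. h (c + x) \<partial>lborel) = (\<integral>\<^sup>+ x. h x \<partial>(lborel :: complex measure))"
  if [measurable]: "h \<in> borel_measurable borel" for c :: complex
proof -
  have "(\<integral>\<^sup>+ x. h x \<partial>lborel) = (\<integral>\<^sup>+ x. h x \<partial>(distr lborel borel ((+) c)))" by (simp add: lborel_distr_plus)
  also have "\<dots> = (\<integral>\<^sup>+ x. h (c + x) \<partial>lborel)" by (rule nn_integral_distr) auto
  finally show ?thesis ..
qed

lemma emeasure_lborel_disc: "r \<ge> 0 \<Longrightarrow> emeasure lborel (ball (a::complex) r) = ennreal (pi * r\<^sup>2)"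
  by (simp add: emeasure_ball unit_ball_vol_2)

lemma emeasure_lborel_cdisc: "r \<ge> 0 \<Longrightarrow> emeasure lborel (cball (a::complex) r) = ennreal (pi * r\<^sup>2)"
  by (simp add: emeasure_cball unit_ball_vol_2)

text \<open>The argument for the uniqueness of Haar measure: both measures are translation invariant, and by Fubini's
  theorem they are proportional; as the unit disc is invariant under rotations, the factor is
  \<open>1\<close>.\<close>

lemma lborel_rotate:
  assumes c: "cmod c = 1"
  shows "distr lborel borel (\<lambda>z. c * z) = (lborel :: complex measure)"
proof (rule measure_eqI)
  fix E :: "complex set" assume "E \<in> sets (distr lborel borel (\<lambda>z. c * z))"
  then have [measurable]: "E \<in> sets borel" by simp
  define B where "B = ball (0::complex) 1"
  have [measurable]: "B \<in> sets borel" by (simp add: B_def)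
  have c0: "c \<noteq> 0" using c by auto
  have B: "emeasure lborel B = ennreal pi" unfolding B_def by (subst emeasure_lborel_disc) auto
  have E: "emeasure (distr lborel borel (\<lambda>z. c * z)) E = (\<integral>\<^sup>+x. indicator E (c * x) \<partial>lborel)"
  proof -
    have "emeasure (distr lborel borel (\<lambda>z. c * z)) E = (\<integral>\<^sup>+x. indicator E x \<partial>(distr lborel borel (\<lambda>z. c * z)))" by simp
    also have "\<dots> = (\<integral>\<^sup>+x. indicator E (c * x) \<partial>lborel)" by (rule nn_integral_distr) auto
    finally show ?thesis .
  qed
  have "emeasure (distr lborel borel (\<lambda>z. c * z)) E * emeasure lborel B
      = (\<integral>\<^sup>+y. (\<integral>\<^sup>+x. indicator E (c * x) \<partial>lborel) * indicator B y \<partial>lborel)"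
    unfolding E by (subst nn_integral_cmult) auto
  also have "\<dots> = (\<integral>\<^sup>+y. (\<integral>\<^sup>+x. indicator E (c * x + y) * indicator B y \<partial>lborel) \<partial>lborel)"
  proof (rule nn_integral_cong)
    fix y :: complex
    have "(\<integral>\<^sup>+x. indicator E (c * x + y) * indicator B y \<partial>lborel) = (\<integral>\<^sup>+x. indicator E (c * x + y) \<partial>lborel) * (indicator B y :: ennreal)"
      by (rule nn_integral_multc) measurable
    also have "(\<integral>\<^sup>+x. indicator E (c * x + y) \<partial>lborel) = (\<integral>\<^sup>+x. indicator E (c * (y / c + x)) \<partial>lborel)"
      using c0 by (intro nn_integral_cong) (simp add: distrib_left add.commute)
    also have "\<dots> = (\<integral>\<^sup>+x. indicator E (c * x) \<partial>lborel)"
      by (rule lborel_translate[where h="\<lambda>x. indicator E (c * x)"]) measurable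
    finally show "(\<integral>\<^sup>+x. indicator E (c * x) \<partial>lborel) * indicator B y = (\<integral>\<^sup>+x. indicator E (c * x + y) * indicator B y \<partial>lborel)" ..
  qed
  also have "\<dots> = (\<integral>\<^sup>+x. (\<integral>\<^sup>+y. indicator E (c * x + y) * indicator B y \<partial>lborel) \<partial>lborel)"
    by (rule lborel_pair.Fubini') measurable
  also have "\<dots> = (\<integral>\<^sup>+x. (\<integral>\<^sup>+y. indicator E y * indicator B (y - c * x) \<partial>lborel) \<partial>lborel)"
  proof (rule nn_integral_cong)
    fix x :: complex
    show "(\<integral>\<^sup>+y. indicator E (c * x + y) * indicator B y \<partial>lborel) = (\<integral>\<^sup>+y. indicator E y * indicator B (y - c * x) \<partial>lborel)"
      using lborel_translate[where h="\<lambda>y. indicator E y * indicator B (y - c * x) :: ennreal" and c="c * x"] by simp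
  qed
  also have "\<dots> = (\<integral>\<^sup>+y. (\<integral>\<^sup>+x. indicator E y * indicator B (y - c * x) \<partial>lborel) \<partial>lborel)"
    by (rule lborel_pair.Fubini') measurable
  also have "\<dots> = (\<integral>\<^sup>+y. indicator E y * emeasure lborel B \<partial>lborel)"
  proof (rule nn_integral_cong)
    fix y :: complex
    have "(\<integral>\<^sup>+x. indicator E y * indicator B (y - c * x) \<partial>lborel) = (indicator E y :: ennreal) * (\<integral>\<^sup>+x. indicator B (y - c * x) \<partial>lborel)"
      by (rule nn_integral_cmult) measurable
    also have "(\<integral>\<^sup>+x. indicator B (y - c * x) \<partial>lborel) = (\<integral>\<^sup>+x. indicator (ball (y / c) 1) x \<partial>lborel)"
    proof (rule nn_integral_cong)
      fix x :: complex
      have "y - c * x = c * (y / c - x)" using c0 by (simp add: field_simps)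
      then have "cmod (y - c * x) = cmod (y / c - x)" using c by (simp add: norm_mult)
      then show "indicator B (y - c * x) = (indicator (ball (y / c) 1) x :: ennreal)"
        by (simp add: B_def indicator_def dist_norm norm_minus_commute[of "c * x"])
    qed
    also have "\<dots> = emeasure lborel B" unfolding B by (simp add: emeasure_lborel_disc)
    finally show "(\<integral>\<^sup>+x. indicator E y * indicator B (y - c * x) \<partial>lborel) = indicator E y * emeasure lborel B" .
  qed
  also have "\<dots> = emeasure lborel E * emeasure lborel B" by (subst nn_integral_multc) auto
  finally have "emeasure (distr lborel borel (\<lambda>z. c * z)) E * ennreal pi = emeasure lborel E * ennreal pi" unfolding B .
  then show "emeasure (distr lborel borel (\<lambda>z. c * z)) E = emeasure lborel E"
    by (metis ennreal_mult_divide_eq ennreal_eq_0_iff ennreal_neq_top leD pi_gt_zero)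
qed simp

text \<open>Both sides integrate \<open>u\<close> against the image of the area on the disc under the modulus, whose
  distribution function is \<open>\<pi> r^2\<close>.\<close>

lemma nn_integral_radial:
  fixes u :: "real \<Rightarrow> ennreal"
  assumes [measurable]: "u \<in> borel_measurable borel"
  shows "(\<integral>\<^sup>+z. u (cmod z) * indicator (ball 0 1) z \<partial>lborel) = (\<integral>\<^sup>+s. u s * (ennreal (2 * pi * s) * indicator {0..<1} s) \<partial>lborel)"
proof -
  define M where "M = distr (density lborel (indicator (ball (0::complex) 1))) borel cmod"
  define N where "N = density lborel (\<lambda>s::real. ennreal (2 * pi * s) * indicator {0..<1} s)"
  have eM: "emeasure M {x<..} = ennreal (pi * (1 - (max 0 (min 1 x))\<^sup>2))" for x
  proof -
    define y where "y = max 0 (min 1 x)"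
    have y: "0 \<le> y" "y \<le> 1" by (auto simp: y_def)
    have [measurable]: "cmod -` {x<..} \<in> sets borel" using measurable_sets[of cmod borel borel "{x<..}"] by simp
    have "emeasure M {x<..} = emeasure (density lborel (indicator (ball (0::complex) 1))) (cmod -` {x<..})"
      unfolding M_def by (subst emeasure_distr) auto
    also have "\<dots> = emeasure lborel (ball 0 1 \<inter> cmod -` {x<..})"
      by (subst emeasure_density) (auto intro!: borel_measurable_indicator simp: indicator_inter_arith[symmetric])
    also have "\<dots> = ennreal (pi * (1 - y\<^sup>2))"
    proof -
      consider "x < 0" | "0 \<le> x" "x < 1" | "1 \<le> x" by linarith
      then show ?thesis
      proof cases
        case 1
        then have "ball 0 1 \<inter> cmod -` {x<..} = ball 0 1" by (auto intro: less_le_trans[OF _ norm_ge_zero])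
        then show ?thesis using 1 by (simp add: y_def emeasure_lborel_disc)
      next
        case 2
        then have "ball 0 1 \<inter> cmod -` {x<..} = ball 0 1 - cball 0 x" by auto
        moreover have "emeasure lborel (ball 0 1 - cball (0::complex) x) = emeasure lborel (ball (0::complex) 1) - emeasure lborel (cball (0::complex) x)"
          using 2 by (intro emeasure_Diff) (auto simp: emeasure_lborel_cdisc)
        ultimately show ?thesis using 2
          by (simp add: y_def emeasure_lborel_disc emeasure_lborel_cdisc ennreal_minus right_diff_distrib)
      next
        case 3
        then have "ball 0 1 \<inter> cmod -` {x<..} = {}" by auto
        then show ?thesis using 3 by (simp add: y_def)
      qed
    qed
    finally show ?thesis by (simp add: y_def)
  qed
  have eN: "emeasure N {x<..} = ennreal (pi * (1 - (max 0 (min 1 x))\<^sup>2))" for x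
  proof -
    define y where "y = max 0 (min 1 x)"
    have y: "0 \<le> y" "y \<le> 1" by (auto simp: y_def)
    have "emeasure N {x<..} = (\<integral>\<^sup>+s. ennreal (2 * pi * s) * indicator {0..<1} s * indicator {x<..} s \<partial>lborel)"
      unfolding N_def by (subst emeasure_density) auto
    also have "\<dots> = (\<integral>\<^sup>+s. ennreal (2 * pi * s) * indicator {y..1} s \<partial>lborel)"
    proof (rule nn_integral_cong_AE)
      show "AE s in lborel. ennreal (2 * pi * s) * indicator {0..<1} s * indicator {x<..} s = ennreal (2 * pi * s) * indicator {y..1} s"
        using AE_lborel_singleton[of y] AE_lborel_singleton[of 1]
      proof eventually_elim
        case (elim s)
        then show ?case by (auto simp: y_def indicator_def split: if_splits)
      qed
    qed
    also have "\<dots> = ennreal (pi * 1\<^sup>2 - pi * y\<^sup>2)"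
      using y by (intro nn_integral_FTC_Icc)
        (auto intro!: derivative_eq_intros simp: has_real_derivative_iff_has_vector_derivative[symmetric])
    finally show ?thesis by (simp add: y_def right_diff_distrib)
  qed
  have "M = N"
    by (rule measure_eqI_lessThan) (auto simp: M_def[symmetric] eM eN, simp_all add: M_def N_def)
  have "(\<integral>\<^sup>+z. u (cmod z) * indicator (ball 0 1) z \<partial>lborel) = (\<integral>\<^sup>+s. u s \<partial>M)"
  proof -
    have [measurable]: "(indicator (ball (0::complex) 1) :: complex \<Rightarrow> ennreal) \<in> borel_measurable borel"
      by (intro borel_measurable_indicator) simp
    have "(\<integral>\<^sup>+s. u s \<partial>M) = (\<integral>\<^sup>+z. u (cmod z) \<partial>density lborel (indicator (ball (0::complex) 1)))"
      unfolding M_def by (rule nn_integral_distr) measurable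
    also have "\<dots> = (\<integral>\<^sup>+z. indicator (ball 0 1) z * u (cmod z) \<partial>lborel)"
      by (rule nn_integral_density) measurable
    finally show ?thesis by (simp add: mult.commute)
  qed
  also have "\<dots> = (\<integral>\<^sup>+s. u s * (ennreal (2 * pi * s) * indicator {0..<1} s) \<partial>lborel)"
    unfolding \<open>M = N\<close> N_def by (subst nn_integral_density) (auto simp: mult.commute)
  finally show ?thesis .
qed

text \<open>The weighted area as a Borel measure on the plane. Weights are only Lebesgue measurable, and passing to the
  Borel sets makes measurability routine from here on.\<close>

definition weight_measure :: "(complex \<Rightarrow> real) \<Rightarrow> complex measure" where
  "weight_measure \<omega> = distr (density disc_area (\<lambda>z. ennreal (\<omega> z))) borel (\<lambda>z. z)"

lemma sets_weight_measure [simp, measurable_cong]: "sets (weight_measure \<omega>) = sets borel"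
  and space_weight_measure [simp]: "space (weight_measure \<omega>) = UNIV"
  by (simp_all add: weight_measure_def)

lemma measurable_disc_area:
  assumes "h \<in> measurable borel N" shows "h \<in> measurable disc_area N"
proof -
  have "h \<in> measurable lebesgue N" using assms by (simp add: measurable_completion)
  then have "h \<in> measurable (lebesgue_on unit_disc) N" by (rule measurable_restrict_space1)
  then show ?thesis by (simp add: disc_area_def cong: measurable_cong_sets)
qed

lemma nn_integral_weight_measure:
  assumes w: "weight \<omega>" and H: "H \<in> borel_measurable borel"
  shows "(\<integral>\<^sup>+z. H z \<partial>weight_measure \<omega>) = (\<integral>\<^sup>+z. ennreal (\<omega> z) * H z \<partial>disc_area)"
proof -
  have [measurable]: "\<omega> \<in> borel_measurable disc_area" using w by (auto simp: weight_def)
  have [measurable]: "(\<lambda>z::complex. z) \<in> borel_measurable disc_area" by (rule measurable_disc_area) simp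
  have [measurable]: "H \<in> borel_measurable disc_area" using H by (rule measurable_disc_area)
  have "(\<integral>\<^sup>+z. H z \<partial>weight_measure \<omega>) = (\<integral>\<^sup>+z. H z \<partial>density disc_area (\<lambda>z. ennreal (\<omega> z)))"
    unfolding weight_measure_def using H by (subst nn_integral_distr) (auto cong: measurable_cong_sets)
  also have "\<dots> = (\<integral>\<^sup>+z. ennreal (\<omega> z) * H z \<partial>disc_area)"
    by (rule nn_integral_density) measurable
  finally show ?thesis .
qed

text \<open>A Borel density exists because a Lebesgue measurable function agrees almost everywhere with a Borel one.\<close>

lemma weight_measure_density:
  assumes w: "weight \<omega>"
  shows "\<exists>G\<in>borel_measurable borel. weight_measure \<omega> = density lborel G \<and>
    (AE z in lborel. G z = ennreal (1/pi) * ennreal (\<omega> z) * indicator unit_disc z)"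
proof -
  have mw: "\<omega> \<in> borel_measurable (lebesgue_on unit_disc)"
    using w by (auto simp: weight_def disc_area_def cong: measurable_cong_sets)
  define G0 where "G0 z = ennreal (1/pi) * ennreal (\<omega> z) * indicator unit_disc z" for z
  have "(\<lambda>z. if z \<in> unit_disc then \<omega> z else 0) \<in> borel_measurable lebesgue"
    by (rule borel_measurable_if_I[OF mw]) auto
  then have "(\<lambda>z. ennreal (1/pi) * ennreal (if z \<in> unit_disc then \<omega> z else 0)) \<in> borel_measurable lebesgue"
    by measurable
  then have mG0: "G0 \<in> borel_measurable lebesgue"
    by (rule measurable_cong[THEN iffD1, rotated]) (simp add: G0_def indicator_def)
  then obtain G where G[measurable]: "G \<in> borel_measurable lborel" and ae: "AE z in lborel. G0 z = G z"
    using completion_ex_borel_measurable by blast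
  have ae': "AE z in lebesgue. G0 z = G z" using ae by (rule AE_completion)
  have "weight_measure \<omega> = density lborel G"
  proof (rule measure_eqI)
    fix A assume "A \<in> sets (weight_measure \<omega>)"
    then have [measurable]: "A \<in> sets borel" by simp
    have mA': "(indicator A :: complex \<Rightarrow> ennreal) \<in> borel_measurable (lebesgue_on unit_disc)"
      by (intro measurable_restrict_space1 measurable_completion) simp
    have "emeasure (weight_measure \<omega>) A = (\<integral>\<^sup>+z. indicator A z \<partial>weight_measure \<omega>)" by simp
    also have "\<dots> = (\<integral>\<^sup>+z. ennreal (\<omega> z) * indicator A z \<partial>disc_area)"
      by (rule nn_integral_weight_measure[OF w]) simp
    also have "\<dots> = (\<integral>\<^sup>+z. ennreal (1/pi) * (ennreal (\<omega> z) * indicator A z) \<partial>lebesgue_on unit_disc)"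
      unfolding disc_area_def using mw mA' by (subst nn_integral_density) auto
    also have "\<dots> = (\<integral>\<^sup>+z. ennreal (1/pi) * (ennreal (\<omega> z) * indicator A z) * indicator unit_disc z \<partial>lebesgue)"
      by (subst nn_integral_restrict_space) auto
    also have "\<dots> = (\<integral>\<^sup>+z. G z * indicator A z \<partial>lebesgue)"
    proof (rule nn_integral_cong_AE)
      show "AE z in lebesgue. ennreal (1/pi) * (ennreal (\<omega> z) * indicator A z) * indicator unit_disc z = G z * indicator A z"
        using ae'
      proof eventually_elim
        case (elim z)
        then show ?case unfolding elim[symmetric] G0_def by (simp only: mult_ac)
      qed
    qed
    also have "\<dots> = (\<integral>\<^sup>+z. G z * indicator A z \<partial>lborel)" by (rule nn_integral_completion)
    also have "\<dots> = emeasure (density lborel G) A" by (subst emeasure_density) auto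
    finally show "emeasure (weight_measure \<omega>) A = emeasure (density lborel G) A" .
  qed simp
  moreover have "AE z in lborel. G z = ennreal (1/pi) * ennreal (\<omega> z) * indicator unit_disc z"
    using ae by (auto simp: G0_def elim: eventually_mono)
  ultimately show ?thesis using G by auto
qed

definition rotation_invariant :: "complex measure \<Rightarrow> bool" where
  "rotation_invariant M \<longleftrightarrow> sets M = sets borel \<and> finite_measure M \<and> (\<forall>c. cmod c = 1 \<longrightarrow> distr M borel (\<lambda>z. c * z) = M)"

lemma finite_weight_measure:
  assumes w: "weight \<omega>" shows "finite_measure (weight_measure \<omega>)"
proof
  have nn: "AE z in disc_area. 0 \<le> \<omega> z"
    using w by (intro AE_I2) (auto simp: weight_def disc_area_def space_restrict_space)
  have "emeasure (weight_measure \<omega>) (space (weight_measure \<omega>)) = (\<integral>\<^sup>+z. 1 \<partial>weight_measure \<omega>)" by simp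
  also have "\<dots> = (\<integral>\<^sup>+z. ennreal (\<omega> z) \<partial>disc_area)" by (subst nn_integral_weight_measure[OF w]) auto
  also have "\<dots> < \<infinity>" using w nn by (subst nn_integral_eq_integral) (auto simp: weight_def)
  finally show "emeasure (weight_measure \<omega>) (space (weight_measure \<omega>)) \<noteq> \<infinity>" by simp
qed

text \<open>A Borel density of the weight need not be radial pointwise; it is radial almost everywhere, and that suffices
  because rotations preserve the area.\<close>

lemma rotation_invariant_weight_measure:
  assumes w: "weight \<omega>" and r: "radial \<omega>"
  shows "rotation_invariant (weight_measure \<omega>)"
proof -
  obtain G where [measurable]: "G \<in> borel_measurable borel" and eq: "weight_measure \<omega> = density lborel G"
    and ae: "AE z in lborel. G z = ennreal (1/pi) * ennreal (\<omega> z) * indicator unit_disc z"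
    using weight_measure_density[OF w] by blast
  have "distr (density lborel G) borel (\<lambda>z. c * z) = density lborel G" if c: "cmod c = 1" for c
  proof (rule measure_eqI)
    have ae1: "AE z in distr lborel borel (\<lambda>z. c * z). G z = ennreal (1/pi) * ennreal (\<omega> z) * indicator unit_disc z"
      using ae unfolding lborel_rotate[OF c] .
    have "(\<lambda>z. c * z) \<in> measurable lborel borel" by simp
    from AE_distrD[OF this ae1]
    have ae2: "AE z in lborel. G (c * z) = ennreal (1/pi) * ennreal (\<omega> (c * z)) * indicator unit_disc (c * z)" .
    have rad: "\<omega> (c * z) = \<omega> z" if "cmod z < 1" for z
    proof -
      have r': "\<omega> w = \<omega> (complex_of_real (cmod w))" if "cmod w < 1" for w
        using r that unfolding radial_def by (metis dist_0_norm mem_ball)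
      have "cmod (c * z) = cmod z" using c by (simp add: norm_mult)
      then show ?thesis using r'[of "c * z"] r'[of z] that by metis
    qed
    have ae3: "AE z in lborel. G (c * z) = G z"
      using ae ae2
    proof eventually_elim
      case (elim z)
      then show ?case using c rad[of z] by (auto simp: indicator_def norm_mult)
    qed
    fix A assume "A \<in> sets (distr (density lborel G) borel (\<lambda>z. c * z))"
    then have [measurable]: "A \<in> sets borel" by simp
    have "emeasure (distr (density lborel G) borel (\<lambda>z. c * z)) A = (\<integral>\<^sup>+z. indicator A z \<partial>distr (density lborel G) borel (\<lambda>z. c * z))" by simp
    also have "\<dots> = (\<integral>\<^sup>+z. indicator A (c * z) \<partial>density lborel G)" by (rule nn_integral_distr) auto
    also have "\<dots> = (\<integral>\<^sup>+z. G z * indicator A (c * z) \<partial>lborel)" by (rule nn_integral_density) auto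
    also have "\<dots> = (\<integral>\<^sup>+z. G (c * z) * indicator A (c * z) \<partial>lborel)"
      using ae3 by (intro nn_integral_cong_AE) (auto elim!: eventually_mono)
    also have "\<dots> = (\<integral>\<^sup>+z. G z * indicator A z \<partial>distr lborel borel (\<lambda>z. c * z))"
      by (subst nn_integral_distr) auto
    also have "\<dots> = emeasure (density lborel G) A"
      unfolding lborel_rotate[OF c] by (subst emeasure_density) auto
    finally show "emeasure (distr (density lborel G) borel (\<lambda>z. c * z)) A = emeasure (density lborel G) A" .
  qed simp
  then show ?thesis using finite_weight_measure[OF w] unfolding rotation_invariant_def eq by simp
qed

lemma measurable_circ_avg [measurable]:
  assumes [measurable]: "H \<in> borel_measurable borel"
  shows "circ_avg H \<in> borel_measurable borel"
  unfolding circ_avg_def[abs_def] by measurable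

text \<open>Averaging the rotated integrals over all rotations does not change them; Fubini's theorem then moves the
  average inside. Radial measures are used only through this fact and the masses of their tails.\<close>

lemma nn_integral_circ_avg:
  assumes M: "rotation_invariant M" and H[measurable]: "H \<in> borel_measurable borel"
  shows "(\<integral>\<^sup>+z. H z \<partial>M) = (\<integral>\<^sup>+z. circ_avg H z \<partial>M)"
proof -
  have sM[measurable_cong]: "sets M = sets borel" using M by (simp add: rotation_invariant_def)
  interpret finite_measure M using M by (simp add: rotation_invariant_def)
  interpret P: pair_sigma_finite M lborel ..
  have rot: "(\<integral>\<^sup>+z. H (z * ecirc t) \<partial>M) = (\<integral>\<^sup>+z. H z \<partial>M)" for t
  proof -
    have "(\<integral>\<^sup>+z. H z \<partial>M) = (\<integral>\<^sup>+z. H z \<partial>distr M borel (\<lambda>z. ecirc t * z))"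
      using M by (simp add: rotation_invariant_def)
    also have "\<dots> = (\<integral>\<^sup>+z. H (ecirc t * z) \<partial>M)" by (rule nn_integral_distr) auto
    finally show ?thesis by (simp add: mult.commute)
  qed
  have "(\<integral>\<^sup>+z. circ_avg H z \<partial>M) = (\<integral>\<^sup>+t. (\<integral>\<^sup>+z. H (z * ecirc t) * indicator {0..1} t \<partial>M) \<partial>lborel)"
    unfolding circ_avg_def by (rule P.Fubini'[symmetric]) measurable
  also have "\<dots> = (\<integral>\<^sup>+t. (\<integral>\<^sup>+z. H z \<partial>M) * indicator {0..1::real} t \<partial>lborel)"
  proof (rule nn_integral_cong)
    fix t :: real
    have "(\<integral>\<^sup>+z. H (z * ecirc t) * indicator {0..1} t \<partial>M) = (\<integral>\<^sup>+z. H (z * ecirc t) \<partial>M) * indicator {0..1} t"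
      by (rule nn_integral_multc) measurable
    then show "(\<integral>\<^sup>+z. H (z * ecirc t) * indicator {0..1} t \<partial>M) = (\<integral>\<^sup>+z. H z \<partial>M) * indicator {0..1} t"
      by (simp add: rot)
  qed
  also have "\<dots> = (\<integral>\<^sup>+z. H z \<partial>M)" by (subst nn_integral_cmult) auto
  finally show ?thesis ..
qed

section \<open>Tails of a radial weight and masses of Carleson squares\<close>

lemma shrink_radius:
  fixes r c :: real
  assumes "0 \<le> r" "r < 1" "1 \<le> c"
  shows "0 \<le> 1 - (1 - r) / c" "1 - (1 - r) / c < 1"
proof -
  have "(1 - r) / c \<le> (1 - r) / 1" using assms by (intro divide_left_mono) auto
  then show "0 \<le> 1 - (1 - r) / c" using assms by simp
  have "0 < (1 - r) / c" using assms by simp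
  then show "1 - (1 - r) / c < 1" by simp
qed

definition tail_mass :: "complex measure \<Rightarrow> real \<Rightarrow> real" where
  "tail_mass M r = measure M {z. r \<le> cmod z}"

text \<open>In polar coordinates the tail mass is the integral of \<open>2 * s * \<omega> s\<close> over \<open>[r,
  1)\<close>. The lower bound degenerates at the origin, where the doubling condition will take its place.\<close>

lemma tail_mass_bounds:
  assumes w: "radial_weight \<omega>" and r: "0 \<le> r" "r < 1"
  shows "2 * r * weight_tail \<omega> (complex_of_real r) \<le> tail_mass (weight_measure \<omega>) r"
    and "tail_mass (weight_measure \<omega>) r \<le> 2 * weight_tail \<omega> (complex_of_real r)"
    and "weight_tail \<omega> (complex_of_real r) \<le> weight_tail \<omega> 0"
proof -
  define t where "t = weight_tail \<omega> (complex_of_real r)"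
  define g where "g s = indicator {0..<1} s * \<omega> (complex_of_real s)" for s :: real
  have wt: "weight \<omega>" and rad: "radial \<omega>" and t0: "weight_tail \<omega> 0 > 0"
    using w by (auto simp: radial_weight_def)
  have g_nonneg: "0 \<le> g s" for s using wt by (auto simp: g_def weight_def indicator_def)
  \<comment> \<open>otherwise the tail at the origin would be \<open>0\<close> by the convention for divergent integrals\<close>
  have ig: "integrable lebesgue g"
  proof (rule ccontr)
    assume "\<not> integrable lebesgue g"
    then have "(LINT s|lebesgue. g s) = 0" by (rule not_integrable_integral_eq)
    then show False using t0 by (simp add: weight_tail_def set_lebesgue_integral_def g_def)
  qed
  obtain g' where g'[measurable]: "g' \<in> borel_measurable lborel" and ae: "AE s in lborel. g s = g' s"
    using completion_ex_borel_measurable_real[OF borel_measurable_integrable[OF ig]] by blast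
  have t: "ennreal t = (\<integral>\<^sup>+s. ennreal (g' s) * indicator {r..<1} s \<partial>lborel)"
  proof -
    have eq: "indicator {r..<1} s *\<^sub>R \<omega> (complex_of_real s) = indicator {r..<1} s *\<^sub>R g s" for s
      using r by (auto simp: g_def indicator_def)
    have i: "integrable lebesgue (\<lambda>s. indicator {r..<1} s *\<^sub>R g s)"
      by (intro integrable_mult_indicator ig) auto
    have "ennreal t = ennreal (LINT s|lebesgue. indicator {r..<1} s *\<^sub>R g s)"
      using r by (simp add: t_def weight_tail_def set_lebesgue_integral_def eq del: real_scaleR_def)
    also have "\<dots> = (\<integral>\<^sup>+s. ennreal (indicator {r..<1} s *\<^sub>R g s) \<partial>lebesgue)"
      by (rule nn_integral_eq_integral[symmetric, OF i]) (auto simp: g_nonneg)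
    also have "\<dots> = (\<integral>\<^sup>+s. ennreal (g' s) * indicator {r..<1} s \<partial>lebesgue)"
      using AE_completion[OF ae] by (intro nn_integral_cong_AE) (auto simp: indicator_def elim!: eventually_mono)
    also have "\<dots> = (\<integral>\<^sup>+s. ennreal (g' s) * indicator {r..<1} s \<partial>lborel)" by (rule nn_integral_completion)
    finally show ?thesis .
  qed
  have t_nonneg: "0 \<le> t" unfolding t_def weight_tail_def set_lebesgue_integral_def
    using wt r by (intro integral_nonneg_AE AE_I2) (auto simp: indicator_def weight_def)
  obtain G where [measurable]: "G \<in> borel_measurable borel" and eq: "weight_measure \<omega> = density lborel G"
    and aeG: "AE z in lborel. G z = ennreal (1/pi) * ennreal (\<omega> z) * indicator unit_disc z"
    using weight_measure_density[OF wt] by blast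
  obtain N where N: "N \<in> null_sets lborel" "{s \<in> space lborel. \<not> g s = g' s} \<subseteq> N"
    using ae by (auto simp: eventually_ae_filter)
  have [measurable]: "N \<in> sets borel" using N by auto
  have aeN: "AE z in lborel. \<not> (cmod z \<in> N \<and> z \<in> unit_disc)"
  proof -
    have [measurable]: "(indicator (ball (0::complex) 1) :: complex \<Rightarrow> ennreal) \<in> borel_measurable borel"
      by (intro borel_measurable_indicator) simp
    have "(\<integral>\<^sup>+z. indicator N (cmod z) * indicator (ball 0 1) z \<partial>(lborel :: complex measure)) = (\<integral>\<^sup>+s. indicator N s * (ennreal (2 * pi * s) * indicator {0..<1} s) \<partial>lborel)"
      by (rule nn_integral_radial) measurable
    also have "\<dots> = (\<integral>\<^sup>+(s::real). 0 \<partial>lborel)"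
      using AE_not_in[OF N(1)] by (intro nn_integral_cong_AE) (auto simp: indicator_def elim!: eventually_mono)
    finally have "(\<integral>\<^sup>+z. indicator N (cmod z) * indicator (ball 0 1) z \<partial>(lborel :: complex measure)) = 0" by simp
    then have "AE z in (lborel :: complex measure). indicator N (cmod z) * indicator (ball 0 1) z = (0 :: ennreal)"
      by (subst (asm) nn_integral_0_iff_AE) simp_all
    then show ?thesis by (auto simp: indicator_def elim!: eventually_mono split: if_splits)
  qed
  have aeGr: "AE z in lborel. G z = ennreal (1/pi) * ennreal (g' (cmod z)) * indicator unit_disc z"
    using aeG aeN
  proof eventually_elim
    case (elim z)
    show ?case
    proof (cases "z \<in> unit_disc")
      case True
      then have "\<omega> z = \<omega> (complex_of_real (cmod z))" using rad unfolding radial_def by blast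
      also have "\<dots> = g (cmod z)" using True by (simp add: g_def)
      also have "\<dots> = g' (cmod z)" using N(2) elim True by auto
      finally show ?thesis using elim by simp
    qed (use elim in simp)
  qed
  interpret finite_measure "weight_measure \<omega>" by (rule finite_weight_measure[OF wt])
  have "ennreal (tail_mass (weight_measure \<omega>) r) = emeasure (density lborel G) {z. r \<le> cmod z}"
    unfolding tail_mass_def eq[symmetric] by (rule emeasure_eq_measure[symmetric])
  also have "\<dots> = (\<integral>\<^sup>+z. G z * indicator {z. r \<le> cmod z} z \<partial>lborel)" by (subst emeasure_density) auto
  also have "\<dots> = (\<integral>\<^sup>+z. (ennreal (1/pi) * ennreal (g' (cmod z)) * indicator {r..} (cmod z)) * indicator (ball 0 1) z \<partial>lborel)"
    using aeGr by (intro nn_integral_cong_AE) (auto simp: indicator_def elim!: eventually_mono)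
  also have "\<dots> = (\<integral>\<^sup>+s. (ennreal (1/pi) * ennreal (g' s) * indicator {r..} s) * (ennreal (2 * pi * s) * indicator {0..<1} s) \<partial>lborel)"
    by (rule nn_integral_radial) measurable
  also have "\<dots> = (\<integral>\<^sup>+s. ennreal (2 * s) * (ennreal (g' s) * indicator {r..<1} s) \<partial>lborel)"
  proof (rule nn_integral_cong)
    fix s :: real
    have "ennreal (1/pi) * ennreal (2 * pi * s) = ennreal (2 * s)"
      by (subst ennreal_mult'[symmetric]) auto
    then show "(ennreal (1/pi) * ennreal (g' s) * indicator {r..} s) * (ennreal (2 * pi * s) * indicator {0..<1} s)
       = ennreal (2 * s) * (ennreal (g' s) * indicator {r..<1} s)"
      using r by (auto simp: indicator_def mult_ac)
  qed
  finally have T: "ennreal (tail_mass (weight_measure \<omega>) r) = (\<integral>\<^sup>+s. ennreal (2 * s) * (ennreal (g' s) * indicator {r..<1} s) \<partial>lborel)" .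
  have "ennreal (tail_mass (weight_measure \<omega>) r) \<le> (\<integral>\<^sup>+s. ennreal 2 * (ennreal (g' s) * indicator {r..<1} s) \<partial>lborel)"
    unfolding T
  proof (intro nn_integral_mono)
    fix s :: real
    have "ennreal (2 * s) \<le> ennreal 2" if "s < 1" using that by (intro ennreal_leI) simp
    then show "ennreal (2 * s) * (ennreal (g' s) * indicator {r..<1} s) \<le> ennreal 2 * (ennreal (g' s) * indicator {r..<1} s)"
      by (cases "s < 1") (auto intro: mult_right_mono)
  qed
  also have "\<dots> = ennreal 2 * ennreal t" unfolding t by (rule nn_integral_cmult) measurable
  also have "\<dots> = ennreal (2 * t)" by (rule ennreal_mult[symmetric]) (use t_nonneg in auto)
  finally show "tail_mass (weight_measure \<omega>) r \<le> 2 * weight_tail \<omega> (complex_of_real r)" using t_nonneg by (simp add: t_def)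
  have "ennreal (2 * r * t) = ennreal (2 * r) * ennreal t" using r t_nonneg by (simp add: ennreal_mult)
  also have "\<dots> = (\<integral>\<^sup>+s. ennreal (2 * r) * (ennreal (g' s) * indicator {r..<1} s) \<partial>lborel)"
    unfolding t by (rule nn_integral_cmult[symmetric]) measurable
  also have "\<dots> \<le> ennreal (tail_mass (weight_measure \<omega>) r)"
    unfolding T by (intro nn_integral_mono) (auto simp: indicator_def intro!: mult_right_mono ennreal_leI)
  finally show "2 * r * weight_tail \<omega> (complex_of_real r) \<le> tail_mass (weight_measure \<omega>) r"
    by (simp add: t_def tail_mass_def)
  have "(LINT s|lebesgue. indicator {r..<1} s *\<^sub>R g s) \<le> (LINT s|lebesgue. g s)"
    by (intro integral_mono integrable_mult_indicator ig) (auto simp: indicator_def g_nonneg)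
  moreover have "(LINT s|lebesgue. indicator {r..<1} s *\<^sub>R g s) = weight_tail \<omega> (complex_of_real r)"
    unfolding weight_tail_def set_lebesgue_integral_def
    by (rule Bochner_Integration.integral_cong) (use r in \<open>auto simp: g_def indicator_def\<close>)
  moreover have "(LINT s|lebesgue. g s) = weight_tail \<omega> 0"
    unfolding weight_tail_def set_lebesgue_integral_def by (simp add: g_def)
  ultimately show "weight_tail \<omega> (complex_of_real r) \<le> weight_tail \<omega> 0" by simp
qed

lemma tail_mass_antimono:
  assumes "finite_measure M" "sets M = sets borel" "r \<le> s"
  shows "tail_mass M s \<le> tail_mass M r"
proof -
  interpret finite_measure M by fact
  show ?thesis unfolding tail_mass_def using assms by (intro finite_measure_mono) auto
qed

text \<open>Moving \<open>\<kappa>\<close> times closer to the circle divides the mass of the tail by at least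
  \<open>2\<close> and at most \<open>1 / c\<close>.\<close>

definition scale_measure :: "real \<Rightarrow> real \<Rightarrow> complex measure \<Rightarrow> bool" where
  "scale_measure \<kappa> c M \<longleftrightarrow> rotation_invariant M \<and> emeasure M {z. 1 \<le> cmod z} = 0 \<and> 2 \<le> \<kappa> \<and> 0 < c \<and> 
     (\<forall>r. 0 \<le> r \<longrightarrow> r < 1 \<longrightarrow> 0 < tail_mass M r \<and> c * tail_mass M r \<le> tail_mass M (1 - (1 - r) / \<kappa>) \<and>
        tail_mass M (1 - (1 - r) / \<kappa>) \<le> tail_mass M r / 2)"

lemma weight_measure_outside:
  assumes "weight \<omega>" shows "emeasure (weight_measure \<omega>) {z. 1 \<le> cmod z} = 0"
proof -
  have "emeasure (weight_measure \<omega>) {z. 1 \<le> cmod z} = (\<integral>\<^sup>+z. indicator {z. 1 \<le> cmod z} z \<partial>weight_measure \<omega>)"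
    by (subst nn_integral_indicator) auto
  also have "\<dots> = (\<integral>\<^sup>+z. ennreal (\<omega> z) * indicator {z. 1 \<le> cmod z} z \<partial>disc_area)"
    by (rule nn_integral_weight_measure[OF assms]) simp
  also have "\<dots> = (\<integral>\<^sup>+z. 0 \<partial>disc_area)"
    by (rule nn_integral_cong) (auto simp: disc_area_def space_restrict_space indicator_def)
  finally show ?thesis by simp
qed

text \<open>Iterating the lower condition makes the quotient of consecutive tails at least any given constant, and
  iterating the upper condition keeps it bounded. All large \<open>\<kappa>\<close> are allowed, so that two
  weights can share a scale.\<close>

lemma class_D_scale_measure:
  assumes "\<omega> \<in> class_D"
  shows "\<exists>\<kappa>0. \<forall>\<kappa>\<ge>\<kappa>0. \<exists>c. scale_measure \<kappa> c (weight_measure \<omega>)"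
proof -
  define M where "M = weight_measure \<omega>"
  define T where "T = tail_mass M"
  define t where "t r = weight_tail \<omega> (complex_of_real r)" for r
  have rw: "radial_weight \<omega>" using assms by (auto simp: class_D_def class_D_hat_def)
  then have wt: "weight \<omega>" and rad: "radial \<omega>" by (auto simp: radial_weight_def)
  have tpos: "0 < t r" if "0 \<le> r" "r < 1" for r using rw that by (auto simp: radial_weight_def t_def)
  obtain C where C: "C \<ge> 1" "\<And>r. 0 \<le> r \<Longrightarrow> r < 1 \<Longrightarrow> t r \<le> C * t ((1 + r) / 2)"
    using assms unfolding class_D_def class_D_hat_def t_def by auto
  obtain K C1 where K: "K > 1" "C1 > 1" "\<And>r. 0 \<le> r \<Longrightarrow> r < 1 \<Longrightarrow> t r \<ge> C1 * t (1 - (1 - r) / K)"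
    using assms unfolding class_D_def class_D_check_def t_def by auto
  have finM: "finite_measure M" and sM: "sets M = sets borel" unfolding M_def by (auto intro: finite_weight_measure wt)
  have anti: "T s \<le> T r" if "r \<le> s" for r s using tail_mass_antimono[OF finM sM that] by (simp add: T_def)
  have up: "T r \<le> 2 * t r" if "0 \<le> r" "r < 1" for r
    using tail_mass_bounds(2)[OF rw that] by (simp add: T_def M_def t_def)
  have lo: "t r \<le> C * T r" if r: "0 \<le> r" "r < 1" for r
  proof (cases "r \<ge> 1/2")
    case True
    have "1 * t r \<le> 2 * r * t r" using True tpos[OF r] by (intro mult_right_mono) auto
    also have "\<dots> \<le> T r" using tail_mass_bounds(1)[OF rw r] by (simp add: T_def M_def t_def)
    also have "1 * T r \<le> C * T r" using C(1) by (intro mult_right_mono) (auto simp: T_def tail_mass_def)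
    finally show ?thesis by simp
  next
    case False
    have "t r \<le> t 0" using tail_mass_bounds(3)[OF rw r] by (simp add: t_def)
    also have "\<dots> \<le> C * t (1/2)" using C(2)[of 0] by simp
    also have "\<dots> \<le> C * T (1/2)" using C tail_mass_bounds(1)[OF rw, of "1/2"] by (intro mult_left_mono) (auto simp: T_def M_def t_def)
    also have "\<dots> \<le> C * T r" using anti[of r "1/2"] C False by (intro mult_left_mono) auto
    finally show ?thesis .
  qed
  have Tpos: "0 < T r" if "0 \<le> r" "r < 1" for r
    using lo[OF that] tpos[OF that] C(1) by (smt (verit) mult_le_0_iff zero_less_mult_pos)
  define A where "A = 2 * C * C"
  have A: "A \<ge> 1" using C(1) mult_mono[of 1 C 1 C] by (simp add: A_def)
  have dbl: "T r \<le> A * T (1 - (1 - r) / 2)" if r: "0 \<le> r" "r < 1" for r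
  proof -
    have e: "(1 + r) / 2 = 1 - (1 - r) / 2" by (simp add: field_simps)
    have "T r \<le> 2 * t r" by (rule up[OF r])
    also have "\<dots> \<le> 2 * (C * t (1 - (1 - r) / 2))" using C(2)[OF r] unfolding e by simp
    also have "\<dots> \<le> 2 * (C * (C * T (1 - (1 - r) / 2)))"
      using r C(1) lo[of "1 - (1 - r) / 2"] by (intro mult_left_mono) (auto simp: field_simps)
    finally show ?thesis by (simp add: A_def mult_ac)
  qed
  have dbl_n: "T r \<le> A ^ n * T (1 - (1 - r) / 2 ^ n)" if r: "0 \<le> r" "r < 1" for r n
  proof (induction n)
    case (Suc n)
    define s where "s = 1 - (1 - r) / 2 ^ n"
    have s: "0 \<le> s" "s < 1" using shrink_radius[OF r, of "2 ^ n"] by (simp_all add: s_def)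
    have e: "1 - (1 - s) / 2 = 1 - (1 - r) / 2 ^ Suc n" by (simp add: s_def)
    have "T r \<le> A ^ n * T s" using Suc by (simp add: s_def)
    also have "\<dots> \<le> A ^ n * (A * T (1 - (1 - s) / 2))" using dbl[OF s] A by (intro mult_left_mono) auto
    finally show ?case unfolding e by (simp add: mult_ac)
  qed simp
  have dec_n: "C1 ^ n * t (1 - (1 - r) / K ^ n) \<le> t r" if r: "0 \<le> r" "r < 1" for r n
  proof (induction n)
    case (Suc n)
    define s where "s = 1 - (1 - r) / K ^ n"
    have "1 \<le> K ^ n" using K by (intro one_le_power) auto
    then have s: "0 \<le> s" "s < 1" using shrink_radius[OF r] by (simp_all add: s_def)
    have e: "1 - (1 - s) / K = 1 - (1 - r) / K ^ Suc n" using K by (simp add: s_def mult.commute)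
    have "C1 ^ n * (C1 * t (1 - (1 - s) / K)) \<le> C1 ^ n * t s" using K(3)[OF s] K by (intro mult_left_mono) auto
    also have "\<dots> \<le> t r" using Suc by (simp add: s_def)
    finally show ?case unfolding e by (simp add: mult_ac)
  qed simp
  obtain j where j: "4 * C < C1 ^ j" using real_arch_pow[OF K(2)] by blast
  have half: "T (1 - (1 - r) / K ^ j) \<le> T r / 2" if r: "0 \<le> r" "r < 1" for r
  proof -
    define s where "s = 1 - (1 - r) / K ^ j"
    have "1 \<le> K ^ j" using K by (intro one_le_power) auto
    then have s: "0 \<le> s" "s < 1" using shrink_radius[OF r] by (simp_all add: s_def)
    have "4 * C * t s \<le> C1 ^ j * t s" using j tpos[OF s] by (intro mult_right_mono) auto
    also have "\<dots> \<le> t r" using dec_n[OF r] by (simp add: s_def)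
    also have "\<dots> \<le> C * T r" by (rule lo[OF r])
    finally have "4 * t s \<le> T r" using C(1) by simp
    then show ?thesis using up[OF s] by (simp add: s_def)
  qed
  show ?thesis
  proof (rule exI[of _ "max 2 (K ^ j)"], intro allI impI)
    fix \<kappa> assume \<kappa>: "max 2 (K ^ j) \<le> \<kappa>"
    obtain m where m: "\<kappa> < 2 ^ m" using real_arch_pow[of 2 \<kappa>] by auto
    have "scale_measure \<kappa> (1 / A ^ m) M"
      unfolding scale_measure_def
    proof (intro conjI allI impI)
      show "rotation_invariant M" unfolding M_def by (rule rotation_invariant_weight_measure[OF wt rad])
      show "emeasure M {z. 1 \<le> cmod z} = 0" unfolding M_def by (rule weight_measure_outside[OF wt])
      fix r :: real assume r: "0 \<le> r" "r < 1"
      show "0 < tail_mass M r" using Tpos[OF r] by (simp add: T_def)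
      have "(1 - r) / 2 ^ m \<le> (1 - r) / \<kappa>" using r m \<kappa> by (intro divide_left_mono) auto
      then have "T r \<le> A ^ m * T (1 - (1 - r) / \<kappa>)"
        using dbl_n[OF r, of m] anti[of "1 - (1 - r) / \<kappa>" "1 - (1 - r) / 2 ^ m"] A
        by (smt (verit) mult_left_mono zero_le_power)
      then show "1 / A ^ m * tail_mass M r \<le> tail_mass M (1 - (1 - r) / \<kappa>)"
        using A by (simp add: T_def field_simps)
      have "(1 - r) / \<kappa> \<le> (1 - r) / K ^ j" using r \<kappa> K by (intro divide_left_mono) auto
      then have "T (1 - (1 - r) / \<kappa>) \<le> T (1 - (1 - r) / K ^ j)" by (intro anti) auto
      also have "\<dots> \<le> T r / 2" by (rule half[OF r])
      finally show "tail_mass M (1 - (1 - r) / \<kappa>) \<le> tail_mass M r / 2" by (simp add: T_def)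
    qed (use \<kappa> A in auto)
    then show "\<exists>c. scale_measure \<kappa> c (weight_measure \<omega>)" by (auto simp: M_def)
  qed
qed

lemma measurable_Arg [measurable]: "Arg \<in> borel_measurable borel"
proof -
  have "(\<lambda>z. if z \<in> - \<real>\<^sub>\<le>\<^sub>0 then Arg z else pi) \<in> borel_measurable borel"
    by (rule borel_measurable_continuous_on_if)
       (auto intro!: continuous_at_imp_continuous_on continuous_at_Arg)
  then have "(\<lambda>z. if z = 0 then 0 else if z \<in> - \<real>\<^sub>\<le>\<^sub>0 then Arg z else pi) \<in> borel_measurable borel"
    by measurable
  also have "(\<lambda>z. if z = 0 then 0 else if z \<in> - \<real>\<^sub>\<le>\<^sub>0 then Arg z else pi) = Arg"
  proof
    fix z :: complex
    have "Arg z = pi" if "z \<noteq> 0" "z \<in> \<real>\<^sub>\<le>\<^sub>0"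
    proof -
      have "Im z = 0" "Re z \<le> 0" using that by (auto simp: complex_nonpos_Reals_iff)
      moreover from this have "Re z \<noteq> 0" using that by (metis complex_eqI zero_complex.simps)
      ultimately show ?thesis by (simp add: Arg_eq_pi)
    qed
    then show "(if z = 0 then 0 else if z \<in> - \<real>\<^sub>\<le>\<^sub>0 then Arg z else pi) = Arg z" by (auto simp: Arg_zero)
  qed
  finally show ?thesis .
qed

lemma sets_carleson_square [measurable]: "carleson_square a \<in> sets borel"
proof (cases "a = 0")
  case False
  have "carleson_square a = {z. cmod z < 1 \<and> cmod a \<le> cmod z \<and>
        (\<exists>k::int. \<bar>Arg a - Arg z + 2 * pi * of_int k\<bar> < (1 - cmod a) / 2)}"
    using False by (auto simp: carleson_square_def)
  then show ?thesis by simp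
qed (simp add: carleson_square_def)

text \<open>The principal argument is additive only modulo \<open>2 * \<pi>\<close>, which is what the definition of a
  Carleson square allows for.\<close>

lemma Arg_rotate:
  assumes "z \<noteq> 0"
  shows "\<exists>m::int. Arg (z * ecirc t) = Arg z + 2 * pi * t + 2 * pi * of_int m"
proof -
  have "cis (Arg (z * ecirc t)) = sgn (z * ecirc t)" using assms by (intro cis_Arg) auto
  also have "\<dots> = cis (Arg z) * ecirc t" using cis_Arg[OF assms] by (simp add: sgn_mult)
  also have "\<dots> = cis (Arg z + 2 * pi * t)" by (simp add: cis_mult)
  finally have "sin (Arg (z * ecirc t)) = sin (Arg z + 2 * pi * t) \<and> cos (Arg (z * ecirc t)) = cos (Arg z + 2 * pi * t)"
    by (simp add: complex_eq_iff)
  then obtain m :: int where "Arg (z * ecirc t) = Arg z + 2 * pi * t + 2 * pi * of_int m"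
    using sin_cos_eq_iff by (metis mult.commute mult.left_commute)
  then show ?thesis by blast
qed

text \<open>The constants are generous: an arc of half-width \<open>\<delta>\<close> meets the period \<open>[0,
  1]\<close> in at least half of one of its translates and in at most three of them.\<close>

lemma emeasure_arc:
  assumes \<delta>: "0 < \<delta>" "\<delta> < 1/2"
  shows "ennreal \<delta> \<le> emeasure lborel {t \<in> {0..1}. \<exists>k::int. \<bar>t - t0 - of_int k\<bar> < \<delta>}"
    and "emeasure lborel {t \<in> {0..1}. \<exists>k::int. \<bar>t - t0 - of_int k\<bar> < \<delta>} \<le> ennreal (6 * \<delta>)"
proof -
  let ?A = "{t \<in> {0..1}. \<exists>k::int. \<bar>t - t0 - of_int k\<bar> < \<delta>}"
  have [measurable]: "?A \<in> sets borel" by measurable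
  define t1 where "t1 = frac t0"
  have t1: "0 \<le> t1" "t1 < 1" by (auto simp: t1_def frac_lt_1)
  have eq: "t - t0 - of_int k = t - t1 - of_int (k + \<lfloor>t0\<rfloor>)" for t k by (simp add: t1_def frac_def)
  show "ennreal \<delta> \<le> emeasure lborel ?A"
  proof (cases "t1 + \<delta> \<le> 1")
    case True
    have "{t1..<t1 + \<delta>} \<subseteq> ?A" using True t1 by (auto intro!: exI[of _ "- \<lfloor>t0\<rfloor>"] simp: eq)
    then have "emeasure lborel {t1..<t1 + \<delta>} \<le> emeasure lborel ?A" by (intro emeasure_mono) auto
    then show ?thesis using \<delta> by simp
  next
    case False
    have "{t1 - \<delta><..t1} \<subseteq> ?A" using False t1 \<delta> by (auto intro!: exI[of _ "- \<lfloor>t0\<rfloor>"] simp: eq)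
    then have "emeasure lborel {t1 - \<delta><..t1} \<le> emeasure lborel ?A" by (intro emeasure_mono) auto
    then show ?thesis using \<delta> by simp
  qed
  have "?A \<subseteq> (\<Union>j\<in>{-1,0,1::int}. {t1 + of_int j - \<delta><..<t1 + of_int j + \<delta>})"
  proof
    fix t assume "t \<in> ?A"
    then obtain k :: int where t: "0 \<le> t" "t \<le> 1" "\<bar>t - t0 - of_int k\<bar> < \<delta>" by auto
    define j where "j = k + \<lfloor>t0\<rfloor>"
    have *: "\<bar>t - t1 - of_int j\<bar> < \<delta>" using t(3) unfolding eq by (simp add: j_def)
    then have "real_of_int j < 2" "-2 < real_of_int j" using t t1 \<delta> by linarith+
    then have "j \<in> {-1,0,1}" by auto
    moreover have "t \<in> {t1 + of_int j - \<delta><..<t1 + of_int j + \<delta>}" using * by auto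
    ultimately show "t \<in> (\<Union>j\<in>{-1,0,1::int}. {t1 + of_int j - \<delta><..<t1 + of_int j + \<delta>})" by blast
  qed
  then have "emeasure lborel ?A \<le> emeasure lborel (\<Union>j\<in>{-1,0,1::int}. {t1 + of_int j - \<delta><..<t1 + of_int j + \<delta>})"
    by (intro emeasure_mono) auto
  also have "\<dots> \<le> (\<Sum>j\<in>{-1,0,1::int}. emeasure lborel {t1 + of_int j - \<delta><..<t1 + of_int j + \<delta>})"
    by (intro emeasure_subadditive_finite) auto
  also have "\<dots> = (\<Sum>j\<in>{-1,0,1::int}. ennreal (2 * \<delta>))"
    using \<delta> by (intro sum.cong) auto
  also have "\<dots> = ennreal 3 * ennreal (2 * \<delta>)" by simp
  also have "\<dots> = ennreal (6 * \<delta>)" using \<delta> by (subst ennreal_mult[symmetric]) auto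
  finally show "emeasure lborel ?A \<le> ennreal (6 * \<delta>)" .
qed

text \<open>The circle through \<open>z\<close> meets the Carleson square in an arc of normalised length comparable with
  \<open>1 - |a|\<close> if \<open>|a| \<le> |z| < 1\<close>, and not at all if \<open>|z| < |a|\<close>.\<close>

lemma circ_avg_carleson_square:
  assumes a: "a \<noteq> 0" "cmod a < 1"
  shows "ennreal ((1 - cmod a) / (4 * pi)) * indicator {w. cmod a \<le> cmod w \<and> cmod w < 1} z \<le> circ_avg (indicator (carleson_square a)) z"
    and "circ_avg (indicator (carleson_square a)) z \<le> ennreal (1 - cmod a) * indicator {w. cmod a \<le> cmod w} z"
proof -
  define \<delta> where "\<delta> = (1 - cmod a) / (4 * pi)"
  have pi2: "2 < pi" using pi_gt3 by simp
  have "1 - cmod a < 2 * pi" using pi2 norm_ge_zero[of a] by linarith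
  then have \<delta>: "0 < \<delta>" "\<delta> < 1/2" using a by (simp_all add: \<delta>_def divide_less_eq)
  have main: "ennreal ((1 - cmod a) / (4 * pi)) * indicator {w. cmod a \<le> cmod w \<and> cmod w < 1} z \<le> circ_avg (indicator (carleson_square a)) z \<and>
       circ_avg (indicator (carleson_square a)) z \<le> ennreal (1 - cmod a) * indicator {w. cmod a \<le> cmod w} z"
  proof (cases "cmod a \<le> cmod z \<and> cmod z < 1")
    case False
    have "circ_avg (indicator (carleson_square a)) z = circ_avg (\<lambda>w. 0) z"
      using False a by (intro circ_avg_cong) (auto simp: carleson_square_def indicator_def)
    then show ?thesis using False by (simp add: circ_avg_const)
  next
    case True
    then have z: "z \<noteq> 0" using a by auto
    define t0 where "t0 = (Arg a - Arg z) / (2 * pi)"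
    have iff: "z * ecirc t \<in> carleson_square a \<longleftrightarrow> (\<exists>k::int. \<bar>t - t0 - of_int k\<bar> < \<delta>)" for t
    proof -
      obtain m :: int where m: "Arg (z * ecirc t) = Arg z + 2 * pi * t + 2 * pi * of_int m" using Arg_rotate[OF z] by blast
      have e: "\<bar>Arg a - Arg (z * ecirc t) + 2 * pi * of_int k\<bar> < (1 - cmod a) / 2 \<longleftrightarrow> \<bar>t - t0 - of_int (k - m)\<bar> < \<delta>" for k :: int
      proof -
        have "Arg a - Arg (z * ecirc t) + 2 * pi * of_int k = - (2 * pi) * (t - t0 - of_int (k - m))"
          unfolding m t0_def by (simp add: field_simps)
        then have "\<bar>Arg a - Arg (z * ecirc t) + 2 * pi * of_int k\<bar> = 2 * pi * \<bar>t - t0 - of_int (k - m)\<bar>"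
          by (simp add: abs_mult)
        moreover have "(1 - cmod a) / 2 = 2 * pi * \<delta>" by (simp add: \<delta>_def)
        ultimately show ?thesis by simp
      qed
      have "z * ecirc t \<in> carleson_square a \<longleftrightarrow> (\<exists>k::int. \<bar>Arg a - Arg (z * ecirc t) + 2 * pi * of_int k\<bar> < (1 - cmod a) / 2)"
        using True a unfolding carleson_square_def by (simp add: norm_mult)
      also have "\<dots> \<longleftrightarrow> (\<exists>k::int. \<bar>t - t0 - of_int (k - m)\<bar> < \<delta>)" by (simp only: e)
      also have "\<dots> \<longleftrightarrow> (\<exists>k::int. \<bar>t - t0 - of_int k\<bar> < \<delta>)" by (metis add_diff_cancel_right')
      finally show ?thesis .
    qed
    have "circ_avg (indicator (carleson_square a)) z = (\<integral>\<^sup>+t. indicator {t \<in> {0..1}. \<exists>k::int. \<bar>t - t0 - of_int k\<bar> < \<delta>} t \<partial>lborel)"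
      unfolding circ_avg_def by (intro nn_integral_cong) (auto simp: indicator_def iff)
    also have "\<dots> = emeasure lborel {t \<in> {0..1}. \<exists>k::int. \<bar>t - t0 - of_int k\<bar> < \<delta>}"
      by (rule nn_integral_indicator) measurable
    finally have c: "circ_avg (indicator (carleson_square a)) z = emeasure lborel {t \<in> {0..1}. \<exists>k::int. \<bar>t - t0 - of_int k\<bar> < \<delta>}" .
    have "6 * \<delta> \<le> 1 - cmod a"
    proof -
      have "6 * (1 - cmod a) \<le> 4 * pi * (1 - cmod a)" using a pi2 by (intro mult_right_mono) auto
      then show ?thesis by (simp add: \<delta>_def field_simps)
    qed
    then have "ennreal (6 * \<delta>) \<le> ennreal (1 - cmod a)" by (rule ennreal_leI)
    with emeasure_arc(2)[OF \<delta>, of t0]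
    have "emeasure lborel {t \<in> {0..1}. \<exists>k::int. \<bar>t - t0 - of_int k\<bar> < \<delta>} \<le> ennreal (1 - cmod a)" by (rule order_trans)
    then show ?thesis using emeasure_arc(1)[OF \<delta>, of t0] True unfolding c \<delta>_def[symmetric] by simp
  qed
  from main show "ennreal ((1 - cmod a) / (4 * pi)) * indicator {w. cmod a \<le> cmod w \<and> cmod w < 1} z \<le> circ_avg (indicator (carleson_square a)) z" ..
  from main show "circ_avg (indicator (carleson_square a)) z \<le> ennreal (1 - cmod a) * indicator {w. cmod a \<le> cmod w} z" ..
qed

lemma measure_carleson_square:
  assumes M: "rotation_invariant M" and out: "emeasure M {z. 1 \<le> cmod z} = 0" and a: "cmod a < 1"
  shows "(1 - cmod a) / (4 * pi) * tail_mass M (cmod a) \<le> measure M (carleson_square a)"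
    and "measure M (carleson_square a) \<le> (1 - cmod a) * tail_mass M (cmod a)"
proof -
  have sM[measurable_cong]: "sets M = sets borel" using M by (simp add: rotation_invariant_def)
  have spM: "space M = UNIV" using sets_eq_imp_space_eq[OF sM] by simp
  interpret finite_measure M using M by (simp add: rotation_invariant_def)
  have tail_disc: "emeasure M {w. r \<le> cmod w \<and> cmod w < 1} = ennreal (tail_mass M r)" for r
  proof -
    have "emeasure M {w. r \<le> cmod w} = emeasure M ({w. r \<le> cmod w} - {w. 1 \<le> cmod w})"
      using out by (intro emeasure_Diff_null_set[symmetric]) (auto simp: null_sets_def sM)
    also have "{w. r \<le> cmod w} - {w. 1 \<le> cmod w} = {w. r \<le> cmod w \<and> cmod w < 1}" by auto
    finally show ?thesis by (simp add: tail_mass_def emeasure_eq_measure)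
  qed
  have "(1 - cmod a) / (4 * pi) * tail_mass M (cmod a) \<le> measure M (carleson_square a) \<and> measure M (carleson_square a) \<le> (1 - cmod a) * tail_mass M (cmod a)"
  proof (cases "a = 0")
    case True
    have "carleson_square a = {w. 0 \<le> cmod w \<and> cmod w < 1}" using True by (auto simp: carleson_square_def)
    then have "measure M (carleson_square a) = tail_mass M 0"
      using tail_disc[of 0] by (simp add: emeasure_eq_measure tail_mass_def)
    moreover have "tail_mass M 0 / (4 * pi) \<le> tail_mass M 0"
      using pi_gt3 by (simp add: divide_le_eq tail_mass_def mult_le_cancel_left1)
    ultimately show ?thesis using True by simp
  next
    case False
    have eq: "ennreal (measure M (carleson_square a)) = (\<integral>\<^sup>+z. circ_avg (indicator (carleson_square a)) z \<partial>M)"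
    proof -
      have "ennreal (measure M (carleson_square a)) = (\<integral>\<^sup>+z. indicator (carleson_square a) z \<partial>M)"
        by (subst nn_integral_indicator) (auto simp: sM emeasure_eq_measure)
      also have "\<dots> = (\<integral>\<^sup>+z. circ_avg (indicator (carleson_square a)) z \<partial>M)"
        by (rule nn_integral_circ_avg[OF M]) measurable
      finally show ?thesis .
    qed
    have "ennreal ((1 - cmod a) / (4 * pi) * tail_mass M (cmod a)) = ennreal ((1 - cmod a) / (4 * pi)) * emeasure M {w. cmod a \<le> cmod w \<and> cmod w < 1}"
      unfolding tail_disc using a by (intro ennreal_mult) (auto simp: tail_mass_def)
    also have "\<dots> = (\<integral>\<^sup>+z. ennreal ((1 - cmod a) / (4 * pi)) * indicator {w. cmod a \<le> cmod w \<and> cmod w < 1} z \<partial>M)"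
      by (rule nn_integral_cmult_indicator[symmetric]) (auto simp: sM)
    also have "\<dots> \<le> (\<integral>\<^sup>+z. circ_avg (indicator (carleson_square a)) z \<partial>M)"
      by (intro nn_integral_mono circ_avg_carleson_square False a)
    finally have 1: "ennreal ((1 - cmod a) / (4 * pi) * tail_mass M (cmod a)) \<le> ennreal (measure M (carleson_square a))" unfolding eq .
    have "ennreal (measure M (carleson_square a)) \<le> (\<integral>\<^sup>+z. ennreal (1 - cmod a) * indicator {w. cmod a \<le> cmod w} z \<partial>M)"
      unfolding eq by (intro nn_integral_mono circ_avg_carleson_square False a)
    also have "\<dots> = ennreal (1 - cmod a) * emeasure M {w. cmod a \<le> cmod w}"
      by (rule nn_integral_cmult_indicator) (auto simp: sM)
    also have "\<dots> = ennreal ((1 - cmod a) * tail_mass M (cmod a))"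
      unfolding emeasure_eq_measure tail_mass_def[symmetric] using a by (intro ennreal_mult[symmetric]) (auto simp: tail_mass_def)
    finally have 2: "ennreal (measure M (carleson_square a)) \<le> ennreal ((1 - cmod a) * tail_mass M (cmod a))" .
    show ?thesis using 1 2 a by (auto simp: tail_mass_def)
  qed
  then show "(1 - cmod a) / (4 * pi) * tail_mass M (cmod a) \<le> measure M (carleson_square a)"
    "measure M (carleson_square a) \<le> (1 - cmod a) * tail_mass M (cmod a)" by auto
qed

lemma weight_mass_eq_measure:
  assumes w: "weight \<omega>" and S[measurable]: "S \<in> sets borel"
  shows "weight_mass \<omega> S = measure (weight_measure \<omega>) S"
proof -
  have nn: "AE z in disc_area. 0 \<le> \<omega> z"
    using w by (intro AE_I2) (auto simp: weight_def disc_area_def space_restrict_space)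
  have [measurable]: "\<omega> \<in> borel_measurable disc_area" using w by (auto simp: weight_def)
  have [measurable]: "(indicator S :: complex \<Rightarrow> real) \<in> borel_measurable disc_area" by (rule measurable_disc_area) simp
  interpret finite_measure "weight_measure \<omega>" by (rule finite_weight_measure[OF w])
  have "weight_mass \<omega> S = enn2real (\<integral>\<^sup>+z. ennreal (indicator S z *\<^sub>R \<omega> z) \<partial>disc_area)"
    unfolding weight_mass_def set_lebesgue_integral_def
    by (rule integral_eq_nn_integral) (use nn in \<open>auto elim: eventually_mono\<close>)
  also have "(\<integral>\<^sup>+z. ennreal (indicator S z *\<^sub>R \<omega> z) \<partial>disc_area) = (\<integral>\<^sup>+z. ennreal (\<omega> z) * indicator S z \<partial>disc_area)"
    by (intro nn_integral_cong) (auto simp: indicator_def)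
  also have "\<dots> = emeasure (weight_measure \<omega>) S"
    by (subst nn_integral_weight_measure[OF w, symmetric]) auto
  finally show ?thesis by (simp add: measure_def)
qed

section \<open>Growth of analytic functions on geometric rings\<close>

text \<open>The radii of the scale; \<open>rad \<kappa> 0 = 0\<close>, so that the rings start at the origin.\<close>

definition rad :: "real \<Rightarrow> nat \<Rightarrow> real" where
  "rad \<kappa> k = 1 - 1 / \<kappa> ^ k"

definition annulus :: "real \<Rightarrow> nat \<Rightarrow> complex set" where
  "annulus \<kappa> k = {z. rad \<kappa> k \<le> cmod z \<and> cmod z < rad \<kappa> (Suc k)}"

definition tail :: "real \<Rightarrow> complex measure \<Rightarrow> nat \<Rightarrow> real" where
  "tail \<kappa> M k = tail_mass M (rad \<kappa> k)"

lemma rad_props: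
  assumes "2 \<le> \<kappa>"
  shows "0 \<le> rad \<kappa> k" "rad \<kappa> k < 1" "1 - (1 - rad \<kappa> k) / \<kappa> = rad \<kappa> (Suc k)"
    "rad \<kappa> (Suc k) - rad \<kappa> k \<le> 1 / \<kappa> ^ k" "rad \<kappa> 0 = 0"
proof -
  have "1 \<le> \<kappa> ^ k" using assms by (intro one_le_power) auto
  then show "0 \<le> rad \<kappa> k" "rad \<kappa> k < 1" using assms by (auto simp: rad_def)
  show "1 - (1 - rad \<kappa> k) / \<kappa> = rad \<kappa> (Suc k)" by (simp add: rad_def mult.commute)
  show "rad \<kappa> (Suc k) - rad \<kappa> k \<le> 1 / \<kappa> ^ k" using assms by (simp add: rad_def)
qed (simp add: rad_def)

lemma rad_mono: "2 \<le> \<kappa> \<Longrightarrow> i \<le> j \<Longrightarrow> rad \<kappa> i \<le> rad \<kappa> j"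
  unfolding rad_def by (intro diff_left_mono divide_left_mono power_increasing) auto

text \<open>The room between a ring and the next but one, for the Poisson kernel and for Cauchy's estimate.\<close>

lemma rad_gap:
  assumes "2 \<le> \<kappa>"
  shows "rad \<kappa> (k + 2) - rad \<kappa> (k + 1) \<ge> 1 / (2 * \<kappa>) * (1 / \<kappa> ^ k)"
proof -
  have "rad \<kappa> (k + 2) - rad \<kappa> (k + 1) = (1 / \<kappa> - 1 / \<kappa>\<^sup>2) * (1 / \<kappa> ^ k)"
    using assms by (simp add: rad_def power_add power2_eq_square field_simps)
  moreover have "1 / (2 * \<kappa>) \<le> 1 / \<kappa> - 1 / \<kappa>\<^sup>2" using assms by (simp add: field_simps power2_eq_square)
  then have "1 / (2 * \<kappa>) * (1 / \<kappa> ^ k) \<le> (1 / \<kappa> - 1 / \<kappa>\<^sup>2) * (1 / \<kappa> ^ k)"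
    using assms by (intro mult_right_mono) auto
  ultimately show ?thesis by simp
qed

lemma rad_ring_exists:
  assumes "2 \<le> \<kappa>" "0 \<le> r" "r < 1"
  shows "\<exists>k. rad \<kappa> k \<le> r \<and> r < rad \<kappa> (Suc k)"
proof -
  obtain n where "1 / (1 - r) < \<kappa> ^ n" using real_arch_pow[of \<kappa> "1 / (1 - r)"] assms by auto
  then have n: "r < rad \<kappa> n" using assms by (simp add: rad_def field_simps)
  define m where "m = (LEAST n. r < rad \<kappa> n)"
  have m: "r < rad \<kappa> m" "\<And>i. i < m \<Longrightarrow> \<not> r < rad \<kappa> i"
    unfolding m_def by (rule LeastI[of _ n], rule n) (rule not_less_Least)
  have "m \<noteq> 0" using m(1) assms rad_props(5)[OF assms(1)] by (metis not_less)
  then obtain k where "m = Suc k" using not0_implies_Suc by blast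
  then show ?thesis using m by (intro exI[of _ k]) (auto simp: not_less)
qed

lemma disjoint_annulus:
  assumes "2 \<le> \<kappa>" "i \<noteq> j" shows "annulus \<kappa> i \<inter> annulus \<kappa> j = {}"
proof -
  have "rad \<kappa> (Suc i) \<le> rad \<kappa> j \<or> rad \<kappa> (Suc j) \<le> rad \<kappa> i"
    using assms(2) rad_mono[OF assms(1), of "Suc i" j] rad_mono[OF assms(1), of "Suc j" i] by linarith
  then show ?thesis by (auto simp: annulus_def)
qed

lemma sets_annulus [measurable]: "annulus \<kappa> k \<in> sets borel"
  unfolding annulus_def by measurable

lemma scale_measureD:
  assumes "scale_measure \<kappa> c M"
  shows "rotation_invariant M" "sets M = sets borel" "finite_measure M" "2 \<le> \<kappa>" "0 < c" "emeasure M {z. 1 \<le> cmod z} = 0"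
    "0 < tail \<kappa> M k" "c * tail \<kappa> M k \<le> tail \<kappa> M (Suc k)" "tail \<kappa> M (Suc k) \<le> tail \<kappa> M k / 2"
proof -
  show *: "rotation_invariant M" "2 \<le> \<kappa>" "0 < c" "emeasure M {z. 1 \<le> cmod z} = 0"
    using assms by (auto simp: scale_measure_def)
  then show "sets M = sets borel" "finite_measure M" by (auto simp: rotation_invariant_def)
  show "0 < tail \<kappa> M k" "c * tail \<kappa> M k \<le> tail \<kappa> M (Suc k)" "tail \<kappa> M (Suc k) \<le> tail \<kappa> M k / 2"
    using assms rad_props(1-3)[OF *(2), of k] unfolding scale_measure_def tail_def by metis+
qed

lemma tail_decay:
  assumes "scale_measure \<kappa> c M" shows "tail \<kappa> M (k + j) \<le> tail \<kappa> M k / 2 ^ j"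
proof (induction j)
  case (Suc j)
  have "tail \<kappa> M (k + Suc j) \<le> tail \<kappa> M (k + j) / 2" using scale_measureD(9)[OF assms, of "k + j"] by simp
  also have "\<dots> \<le> tail \<kappa> M k / 2 ^ j / 2" using Suc by (intro divide_right_mono) auto
  finally show ?case by (simp add: mult.commute)
qed simp

lemma tail_decay_lower:
  assumes "scale_measure \<kappa> c M" shows "c ^ j * tail \<kappa> M k \<le> tail \<kappa> M (k + j)"
proof (induction j)
  case (Suc j)
  have "c * (c ^ j * tail \<kappa> M k) \<le> c * tail \<kappa> M (k + j)" using Suc scale_measureD(5)[OF assms] by (intro mult_left_mono) auto
  also have "\<dots> \<le> tail \<kappa> M (Suc (k + j))" by (rule scale_measureD(8)[OF assms])
  finally show ?case by (simp add: mult_ac)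
qed simp

text \<open>The lower bound holds because the next tail carries at most half of the mass.\<close>

lemma measure_annulus:
  assumes "scale_measure \<kappa> c M"
  shows "emeasure M (annulus \<kappa> k) \<le> ennreal (tail \<kappa> M k)" "ennreal (tail \<kappa> M k / 2) \<le> emeasure M (annulus \<kappa> k)"
proof -
  note D = scale_measureD[OF assms]
  interpret finite_measure M by (rule D(3))
  have [measurable_cong]: "sets M = sets borel" by (rule D(2))
  have eq: "annulus \<kappa> k = {z. rad \<kappa> k \<le> cmod z} - {z. rad \<kappa> (Suc k) \<le> cmod z}" by (auto simp: annulus_def)
  have "measure M (annulus \<kappa> k) = tail \<kappa> M k - tail \<kappa> M (Suc k)"
    unfolding eq tail_def tail_mass_def
    using rad_mono[OF D(4), of k "Suc k"] D(2) by (intro finite_measure_Diff) auto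
  then show "emeasure M (annulus \<kappa> k) \<le> ennreal (tail \<kappa> M k)" "ennreal (tail \<kappa> M k / 2) \<le> emeasure M (annulus \<kappa> k)"
    using D(7)[of "Suc k"] D(9)[of k] by (auto simp: emeasure_eq_measure intro!: ennreal_leI)
qed

text \<open>The representatives of analytic functions chosen for the Bergman spaces.\<close>

definition disc_fun :: "(complex \<Rightarrow> complex) \<Rightarrow> bool" where
  "disc_fun f \<longleftrightarrow> f holomorphic_on unit_disc \<and> (\<forall>z. z \<notin> unit_disc \<longrightarrow> f z = 0)"

lemma disc_fun_measurable:
  assumes "disc_fun f" shows "f \<in> borel_measurable borel"
proof -
  have "(\<lambda>z. if z \<in> unit_disc then f z else 0) = f" using assms unfolding disc_fun_def by fastforce
  then show ?thesis using measurable_indicator_holomorphic[of f] assms unfolding disc_fun_def by metis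
qed

text \<open>For \<open>F = orlicz p \<Psi>\<close> this is the \<open>p\<close>-th power of the quasinorm, as an extended
  number.\<close>

definition mass :: "(real \<Rightarrow> real) \<Rightarrow> complex measure \<Rightarrow> (complex \<Rightarrow> complex) \<Rightarrow> ennreal" where
  "mass F M f = (\<integral>\<^sup>+z. ennreal (F (cmod (f z))) \<partial>M)"

definition ann_mass :: "(real \<Rightarrow> real) \<Rightarrow> complex measure \<Rightarrow> real \<Rightarrow> (complex \<Rightarrow> complex) \<Rightarrow> nat \<Rightarrow> ennreal" where
  "ann_mass F M \<kappa> f k = (\<integral>\<^sup>+z. ennreal (F (cmod (f z))) * indicator (annulus \<kappa> k) z \<partial>M)"

lemma suminf_indicator_disjoint:
  fixes A :: "nat \<Rightarrow> 'a set"
  assumes "\<And>i j. i \<noteq> j \<Longrightarrow> A i \<inter> A j = {}"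
  shows "(\<Sum>k. indicator (A k) z :: ennreal) = indicator (\<Union>k. A k) z"
proof (cases "z \<in> (\<Union>k. A k)")
  case True
  then obtain i where i: "z \<in> A i" by auto
  have "(\<lambda>k. indicator (A k) z :: ennreal) = (\<lambda>k. if k = i then 1 else 0)"
    using i assms by (fastforce simp: fun_eq_iff indicator_def)
  then show ?thesis using True suminf_finite[of "{i}" "\<lambda>k. if k = i then (1::ennreal) else 0"] by simp
qed simp

lemma suminf_ann_mass:
  assumes M: "scale_measure \<kappa> c M" and F: "quasi_power F" and f: "disc_fun f"
  shows "(\<Sum>k. ann_mass F M \<kappa> f k) = mass F M f"
proof -
  note D = scale_measureD[OF M]
  have [measurable_cong]: "sets M = sets borel" by (rule D(2))
  have [measurable]: "F \<in> borel_measurable borel" "f \<in> borel_measurable borel"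
    using quasi_power_measurable[OF F] disc_fun_measurable[OF f] by auto
  have "(\<Sum>k. ann_mass F M \<kappa> f k) = (\<integral>\<^sup>+z. (\<Sum>k. ennreal (F (cmod (f z))) * indicator (annulus \<kappa> k) z) \<partial>M)"
    unfolding ann_mass_def by (rule nn_integral_suminf[symmetric]) measurable
  also have "\<dots> = (\<integral>\<^sup>+z. ennreal (F (cmod (f z))) \<partial>M)"
  proof (rule nn_integral_cong)
    fix z
    have "(\<Sum>k. ennreal (F (cmod (f z))) * indicator (annulus \<kappa> k) z) = ennreal (F (cmod (f z))) * (\<Sum>k. indicator (annulus \<kappa> k) z)"
      by (rule ennreal_suminf_cmult)
    also have "\<dots> = ennreal (F (cmod (f z))) * indicator (\<Union>k. annulus \<kappa> k) z"
      by (subst suminf_indicator_disjoint) (use disjoint_annulus[OF D(4)] in auto)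
    also have "\<dots> = ennreal (F (cmod (f z)))"
    proof (cases "cmod z < 1")
      case True
      then have "z \<in> (\<Union>k. annulus \<kappa> k)" using rad_ring_exists[OF D(4), of "cmod z"] by (auto simp: annulus_def)
      then show ?thesis by simp
    next
      case False
      then have "f z = 0" using f by (auto simp: disc_fun_def)
      then show ?thesis using quasi_power_zero[OF F] by simp
    qed
    finally show "(\<Sum>k. ennreal (F (cmod (f z))) * indicator (annulus \<kappa> k) z) = ennreal (F (cmod (f z)))" .
  qed
  finally show ?thesis by (simp add: mass_def)
qed

lemma ann_mass_le_mass: "ann_mass F M \<kappa> f k \<le> mass F M f"
  unfolding ann_mass_def mass_def by (intro nn_integral_mono) (auto simp: indicator_def)

lemma poisson_le: "cmod a < cmod w \<Longrightarrow> cmod w \<le> 1 \<Longrightarrow> poisson a w \<le> 2 / (cmod w - cmod a)"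
proof -
  assume *: "cmod a < cmod w" "cmod w \<le> 1"
  have "cmod w - cmod a \<le> cmod (w - a)" by (rule norm_triangle_ineq2)
  then have "(cmod w - cmod a)\<^sup>2 \<le> (cmod (w - a))\<^sup>2" using * by (intro power_mono) auto
  then have "poisson a w \<le> ((cmod w)\<^sup>2 - (cmod a)\<^sup>2) / (cmod w - cmod a)\<^sup>2"
    unfolding poisson_def using * by (intro divide_left_mono) (auto intro: power_mono mult_pos_pos)
  also have "(cmod w)\<^sup>2 - (cmod a)\<^sup>2 = (cmod w + cmod a) * (cmod w - cmod a)" by (simp add: power2_eq_square algebra_simps)
  also have "\<dots> / (cmod w - cmod a)\<^sup>2 = (cmod w + cmod a) / (cmod w - cmod a)" using * by (simp add: power2_eq_square)
  also have "\<dots> \<le> 2 / (cmod w - cmod a)" using * by (intro divide_right_mono) auto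
  finally show ?thesis .
qed

text \<open>Harnack's inequality on a radius, in the form that compares the whole radial segment from \<open>r1\<close> to
  \<open>r\<close> with its lower end.\<close>

lemma poisson_harnack:
  assumes u: "cmod u = 1" and r: "0 \<le> r1" "r1 \<le> r" "r < cmod w" and L: "r - r1 \<le> L * (cmod w - r)" "0 \<le> L"
  shows "poisson (of_real r * u) w \<le> (1 + L)\<^sup>2 * poisson (of_real r1 * u) w"
proof -
  define d where "d = cmod (w - of_real r * u)"
  define d1 where "d1 = cmod (w - of_real r1 * u)"
  have n: "cmod (of_real r * u) = r" "cmod (of_real r1 * u) = r1" using r u by (auto simp: norm_mult)
  have "cmod w - r \<le> d" using norm_triangle_ineq2[of w "of_real r * u"] by (simp add: n d_def)
  then have dpos: "0 < d" using r by linarith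
  have "cmod w - r1 \<le> d1" using norm_triangle_ineq2[of w "of_real r1 * u"] by (simp only: n d1_def)
  then have d1pos: "0 < d1" using r by linarith
  have "d1 \<le> d + cmod (of_real r * u - of_real r1 * u)"
    unfolding d_def d1_def by (metis diff_add_cancel diff_add_eq norm_triangle_ineq add.commute add_diff_eq)
  also have "cmod (of_real r * u - of_real r1 * u) = r - r1"
    using r u by (simp add: left_diff_distrib[symmetric] norm_mult flip: of_real_diff)
  also have "d + (r - r1) \<le> (1 + L) * d"
    using L mult_left_mono[OF \<open>cmod w - r \<le> d\<close> L(2)] by (simp add: algebra_simps)
  finally have "d1\<^sup>2 \<le> ((1 + L) * d)\<^sup>2" using d1pos by (intro power_mono) auto
  then have "d1\<^sup>2 \<le> (1 + L)\<^sup>2 * d\<^sup>2" by (simp only: power_mult_distrib)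
  then have dd: "1 / d\<^sup>2 \<le> (1 + L)\<^sup>2 / d1\<^sup>2" using dpos d1pos by (simp add: divide_simps mult.commute)
  have "poisson (of_real r * u) w = ((cmod w)\<^sup>2 - r\<^sup>2) * (1 / d\<^sup>2)" by (simp add: poisson_def n d_def)
  also have "\<dots> \<le> ((cmod w)\<^sup>2 - r1\<^sup>2) * ((1 + L)\<^sup>2 / d1\<^sup>2)"
    using r dd by (intro mult_mono) (auto intro: power_mono)
  also have "\<dots> = (1 + L)\<^sup>2 * poisson (of_real r1 * u) w" by (simp add: poisson_def n d1_def)
  finally show ?thesis .
qed

text \<open>The kernel depends only on the two moduli and on the angle between the two points.\<close>

lemma poisson_swap:
  assumes u: "cmod u = 1" and w: "w \<noteq> 0"
  shows "poisson (of_real r * u) w = poisson (of_real r * sgn w) (of_real (cmod w) * u)"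
proof -
  have u2: "(Re u)\<^sup>2 + (Im u)\<^sup>2 = 1" using u by (simp add: cmod_def)
  have w2: "(cmod w)\<^sup>2 = (Re w)\<^sup>2 + (Im w)\<^sup>2" by (simp add: cmod_power2)
  define s where "s = cmod w"
  have s: "s > 0" using w by (simp add: s_def)
  have ws: "w = of_real s * sgn w" by (simp add: s_def sgn_eq w)
  define v where "v = sgn w"
  have v: "cmod v = 1" using w by (simp add: v_def norm_sgn)
  then have v2: "(Re v)\<^sup>2 + (Im v)\<^sup>2 = 1" by (simp add: cmod_def)
  have "(cmod (of_real s * v - of_real r * u))\<^sup>2 = s\<^sup>2 * ((Re v)\<^sup>2 + (Im v)\<^sup>2) + r\<^sup>2 * ((Re u)\<^sup>2 + (Im u)\<^sup>2) - 2 * r * s * (Re u * Re v + Im u * Im v)"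
    unfolding cmod_power2 by (simp add: power2_eq_square algebra_simps)
  moreover have "(cmod (of_real s * u - of_real r * v))\<^sup>2 = s\<^sup>2 * ((Re u)\<^sup>2 + (Im u)\<^sup>2) + r\<^sup>2 * ((Re v)\<^sup>2 + (Im v)\<^sup>2) - 2 * r * s * (Re u * Re v + Im u * Im v)"
    unfolding cmod_power2 by (simp add: power2_eq_square algebra_simps)
  ultimately have "(cmod (of_real s * v - of_real r * u))\<^sup>2 = (cmod (of_real s * u - of_real r * v))\<^sup>2" by (simp add: u2 v2)
  then show ?thesis using u v ws
    unfolding poisson_def s_def[symmetric] v_def[symmetric] by (simp add: norm_mult)
qed

lemma nn_integral_annulus_circ_avg:
  assumes M: "rotation_invariant M" and H[measurable]: "H \<in> borel_measurable borel"
  shows "(\<integral>\<^sup>+z. circ_avg H z * indicator (annulus \<kappa> k) z \<partial>M) = (\<integral>\<^sup>+z. H z * indicator (annulus \<kappa> k) z \<partial>M)"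
proof -
  have "(\<integral>\<^sup>+z. H z * indicator (annulus \<kappa> k) z \<partial>M) = (\<integral>\<^sup>+z. circ_avg (\<lambda>w. H w * indicator (annulus \<kappa> k) w) z \<partial>M)"
    by (rule nn_integral_circ_avg[OF M]) measurable
  also have "\<dots> = (\<integral>\<^sup>+z. circ_avg H z * indicator (annulus \<kappa> k) z \<partial>M)"
  proof (rule nn_integral_cong)
    fix z
    have "circ_avg (\<lambda>w. H w * indicator (annulus \<kappa> k) w) z = circ_avg (\<lambda>w. indicator (annulus \<kappa> k) z * H w) z"
      by (rule circ_avg_cong) (auto simp: annulus_def indicator_def)
    also have "\<dots> = circ_avg H z * indicator (annulus \<kappa> k) z" by (subst circ_avg_cmult) (auto simp: mult.commute)
    finally show "circ_avg (\<lambda>w. H w * indicator (annulus \<kappa> k) w) z = circ_avg H z * indicator (annulus \<kappa> k) z" .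
  qed
  finally show ?thesis ..
qed

text \<open>Integrating the hypothesis over a ring, whose mass is comparable with that of the tail.\<close>

lemma annulus_average:
  assumes M: "scale_measure \<kappa> c M" and H[measurable]: "H \<in> borel_measurable borel"
    and le: "\<And>z. z \<in> annulus \<kappa> (k + 2) \<Longrightarrow> ennreal x \<le> circ_avg H z"
  shows "ennreal x \<le> ennreal (2 / (c\<^sup>2 * tail \<kappa> M k)) * (\<integral>\<^sup>+z. H z * indicator (annulus \<kappa> (k + 2)) z \<partial>M)"
proof -
  note D = scale_measureD[OF M]
  have [measurable_cong]: "sets M = sets borel" by (rule D(2))
  define b where "b = c\<^sup>2 * tail \<kappa> M k / 2"
  have b: "b > 0" using D(5,7) by (simp add: b_def)
  have "ennreal b \<le> ennreal (tail \<kappa> M (k + 2) / 2)"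
    using tail_decay_lower[OF M, of 2 k] by (intro ennreal_leI) (simp add: b_def)
  also have "\<dots> \<le> emeasure M (annulus \<kappa> (k + 2))" by (rule measure_annulus[OF M])
  finally have bM: "ennreal b \<le> emeasure M (annulus \<kappa> (k + 2))" .
  have "ennreal b * ennreal x \<le> emeasure M (annulus \<kappa> (k + 2)) * ennreal x" by (rule mult_right_mono[OF bM]) simp
  also have "\<dots> = (\<integral>\<^sup>+z. ennreal x * indicator (annulus \<kappa> (k + 2)) z \<partial>M)"
    by (subst nn_integral_cmult_indicator) (auto simp: mult.commute)
  also have "\<dots> \<le> (\<integral>\<^sup>+z. circ_avg H z * indicator (annulus \<kappa> (k + 2)) z \<partial>M)"
    by (intro nn_integral_mono) (auto simp: indicator_def le)
  also have "\<dots> = (\<integral>\<^sup>+z. H z * indicator (annulus \<kappa> (k + 2)) z \<partial>M)" by (rule nn_integral_annulus_circ_avg[OF D(1) H])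
  finally have "ennreal (1 / b) * (ennreal b * ennreal x) \<le> ennreal (1 / b) * (\<integral>\<^sup>+z. H z * indicator (annulus \<kappa> (k + 2)) z \<partial>M)"
    by (intro mult_left_mono) auto
  moreover have "ennreal (1 / b) * (ennreal b * ennreal x) = ennreal x"
    unfolding mult.assoc[symmetric] using b by (simp add: ennreal_mult'[symmetric])
  moreover have "1 / b = 2 / (c\<^sup>2 * tail \<kappa> M k)" by (simp add: b_def)
  ultimately show ?thesis by simp
qed

text \<open>Averaging the subharmonicity over a ring at distance about \<open>\<kappa>^(-k)\<close> from \<open>a\<close>,
  where the Poisson kernel is at most a multiple of \<open>\<kappa>^k\<close>.\<close>

lemma growth_estimate:
  assumes M: "scale_measure \<kappa> c M" and F: "quasi_power F"
  shows "\<exists>K>0. \<forall>f k a. disc_fun f \<longrightarrow> cmod a \<le> rad \<kappa> (k + 1) \<longrightarrow>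
    ennreal (F (cmod (f a))) \<le> ennreal (K * \<kappa> ^ k / tail \<kappa> M k) * ann_mass F M \<kappa> f (k + 2)"
proof -
  note D = scale_measureD[OF M]
  have [measurable]: "F \<in> borel_measurable borel" using quasi_power_measurable[OF F] .
  obtain K1 where K1: "K1 > 0" and sub: "\<And>f a z. f holomorphic_on ball 0 1 \<Longrightarrow> cmod a < cmod z \<Longrightarrow> cmod z < 1 \<Longrightarrow>
           ennreal (F (cmod (f a))) \<le> ennreal K1 * circ_avg (\<lambda>w. ennreal (poisson a w) * ennreal (F (cmod (f w)))) z"
    using quasi_power_subharmonic[OF F] by metis
  define K where "K = 2 / c\<^sup>2 * (K1 * (4 * \<kappa>))"
  have "ennreal (F (cmod (f a))) \<le> ennreal (K * \<kappa> ^ k / tail \<kappa> M k) * ann_mass F M \<kappa> f (k + 2)"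
    if f: "disc_fun f" and a: "cmod a \<le> rad \<kappa> (k + 1)" for f k a
  proof -
    have [measurable]: "f \<in> borel_measurable borel" by (rule disc_fun_measurable[OF f])
    define b where "b = K1 * (4 * \<kappa> * \<kappa> ^ k)"
    have b: "b > 0" using K1 D(4) by (simp add: b_def)
    have "ennreal (F (cmod (f a))) \<le> circ_avg (\<lambda>w. ennreal b * ennreal (F (cmod (f w)))) z" if z: "z \<in> annulus \<kappa> (k + 2)" for z
    proof -
      have g: "1 / (2 * \<kappa>) * (1 / \<kappa> ^ k) \<le> cmod z - cmod a"
        using rad_gap[OF D(4), of k] z a by (auto simp: annulus_def)
      moreover have "0 < 1 / (2 * \<kappa>) * (1 / \<kappa> ^ k)" using D(4) by simp
      ultimately have az: "cmod a < cmod z" by linarith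
      have z1: "cmod z < 1" using z rad_props(2)[OF D(4), of "Suc (k + 2)"] by (auto simp: annulus_def)
      have "ennreal (F (cmod (f a))) \<le> ennreal K1 * circ_avg (\<lambda>w. ennreal (poisson a w) * ennreal (F (cmod (f w)))) z"
        using f az z1 by (intro sub) (auto simp: disc_fun_def)
      also have "\<dots> = circ_avg (\<lambda>w. ennreal K1 * (ennreal (poisson a w) * ennreal (F (cmod (f w))))) z"
        by (rule circ_avg_cmult[symmetric]) measurable
      also have "\<dots> \<le> circ_avg (\<lambda>w. ennreal b * ennreal (F (cmod (f w)))) z"
      proof (rule circ_avg_mono)
        fix w assume w: "cmod w = cmod z"
        have "poisson a w \<le> 2 / (cmod w - cmod a)" using w az z1 by (intro poisson_le) auto
        also have "\<dots> \<le> 2 / (1 / (2 * \<kappa>) * (1 / \<kappa> ^ k))" using g w D(4) az by (intro divide_left_mono) auto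
        also have "\<dots> = 4 * \<kappa> * \<kappa> ^ k" by simp
        finally have "K1 * poisson a w \<le> b" unfolding b_def using K1 by (intro mult_left_mono) auto
        then have "ennreal K1 * ennreal (poisson a w) \<le> ennreal b"
          using K1 poisson_nonneg[of a w] w az by (simp add: ennreal_mult'[symmetric] ennreal_leI)
        then show "ennreal K1 * (ennreal (poisson a w) * ennreal (F (cmod (f w)))) \<le> ennreal b * ennreal (F (cmod (f w)))"
          unfolding mult.assoc[symmetric] by (rule mult_right_mono) simp
      qed
      finally show ?thesis .
    qed
    then have "ennreal (F (cmod (f a))) \<le> ennreal (2 / (c\<^sup>2 * tail \<kappa> M k)) * (\<integral>\<^sup>+z. ennreal b * ennreal (F (cmod (f z))) * indicator (annulus \<kappa> (k + 2)) z \<partial>M)"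
      by (intro annulus_average[OF M]) auto
    also have "(\<integral>\<^sup>+z. ennreal b * ennreal (F (cmod (f z))) * indicator (annulus \<kappa> (k + 2)) z \<partial>M) = ennreal b * ann_mass F M \<kappa> f (k + 2)"
      unfolding ann_mass_def mult.assoc by (rule nn_integral_cmult) (simp cong: measurable_cong_sets add: D(2))
    also have "ennreal (2 / (c\<^sup>2 * tail \<kappa> M k)) * (ennreal b * ann_mass F M \<kappa> f (k + 2)) = ennreal (2 / (c\<^sup>2 * tail \<kappa> M k) * b) * ann_mass F M \<kappa> f (k + 2)"
    proof -
      have "ennreal (2 / (c\<^sup>2 * tail \<kappa> M k)) * ennreal b = ennreal (2 / (c\<^sup>2 * tail \<kappa> M k) * b)"
        using D(5) D(7)[of k] b by (intro ennreal_mult[symmetric]) auto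
      then show ?thesis by (simp only: mult.assoc[symmetric])
    qed
    also have "2 / (c\<^sup>2 * tail \<kappa> M k) * b = K * \<kappa> ^ k / tail \<kappa> M k" by (simp add: K_def b_def)
    finally show ?thesis .
  qed
  moreover have "K > 0" using K1 D(4,5) by (simp add: K_def)
  ultimately show ?thesis by blast
qed

section \<open>Control of a function on a ring and of a primitive along radii\<close>

text \<open>By symmetry of the kernel this is the integral of a Poisson kernel over its boundary circle.\<close>

lemma circ_avg_poisson_rotating:
  assumes u: "cmod u = 1" and r: "0 \<le> r" "r < cmod w"
  shows "circ_avg (\<lambda>v. ennreal (poisson (of_real r * v) w)) u = 1"
proof -
  have w: "w \<noteq> 0" using r by auto
  have "circ_avg (\<lambda>v. ennreal (poisson (of_real r * v) w)) u = circ_avg (\<lambda>v. ennreal (poisson (of_real r * sgn w) v)) (of_real (cmod w) * u)"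
    unfolding circ_avg_def
    by (intro nn_integral_cong) (use u w in \<open>simp add: poisson_swap norm_mult mult.assoc\<close>)
  also have "\<dots> = 1" using u r w by (intro circ_avg_poisson) (simp add: norm_mult norm_sgn)
  finally show ?thesis .
qed

text \<open>Replaces the radial maximal function on one ring. The majorant is the Poisson integral of the mass on a
  further ring, evaluated at the lower end of the radial segment: Harnack's inequality transfers the bound to
  the other points of the segment, and integrating over the circle removes the kernel.\<close>

lemma annulus_majorant:
  assumes M: "scale_measure \<kappa> c M" and F: "quasi_power F"
  shows "\<exists>K>0. \<forall>f k. disc_fun f \<longrightarrow> (\<exists>B\<in>borel_measurable borel.
      (\<forall>u r. cmod u = 1 \<longrightarrow> rad \<kappa> k \<le> r \<longrightarrow> r \<le> rad \<kappa> (k + 1) \<longrightarrow> ennreal (F (cmod (f (of_real r * u)))) \<le> B u) \<and>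
      (\<forall>u. cmod u = 1 \<longrightarrow> ennreal (tail \<kappa> M k) * circ_avg B u \<le> ennreal K * ann_mass F M \<kappa> f (k + 2)))"
proof -
  note D = scale_measureD[OF M]
  have sM[measurable_cong]: "sets M = sets borel" by (rule D(2))
  interpret finite_measure M by (rule D(3))
  interpret P: pair_sigma_finite M lborel ..
  have [measurable]: "F \<in> borel_measurable borel" using quasi_power_measurable[OF F] .
  obtain K1 where K1: "K1 > 0" and sub: "\<And>f a z. f holomorphic_on ball 0 1 \<Longrightarrow> cmod a < cmod z \<Longrightarrow> cmod z < 1 \<Longrightarrow>
           ennreal (F (cmod (f a))) \<le> ennreal K1 * circ_avg (\<lambda>w. ennreal (poisson a w) * ennreal (F (cmod (f w)))) z"
    using quasi_power_subharmonic[OF F] by metis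
  define L where "L = 2 * \<kappa>"
  define b where "b = K1 * (1 + L)\<^sup>2"
  have b: "b > 0" using K1 D(4) by (simp add: b_def L_def add_pos_pos)
  define K where "K = 2 / c\<^sup>2 * b"
  have K: "K > 0" using b D(5) by (simp add: K_def)
  have "\<exists>B\<in>borel_measurable borel.
      (\<forall>u r. cmod u = 1 \<longrightarrow> rad \<kappa> k \<le> r \<longrightarrow> r \<le> rad \<kappa> (k + 1) \<longrightarrow> ennreal (F (cmod (f (of_real r * u)))) \<le> B u) \<and>
      (\<forall>u. cmod u = 1 \<longrightarrow> ennreal (tail \<kappa> M k) * circ_avg B u \<le> ennreal K * ann_mass F M \<kappa> f (k + 2))"
    if f: "disc_fun f" for f k
  proof -
    have [measurable]: "f \<in> borel_measurable borel" by (rule disc_fun_measurable[OF f])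
    define r1 where "r1 = rad \<kappa> k"
    have r1: "0 \<le> r1" using rad_props(1)[OF D(4)] by (simp add: r1_def)
    have mP[measurable]: "(\<lambda>(v, w). poisson (of_real r1 * v) w) \<in> borel_measurable (borel \<Otimes>\<^sub>M borel)"
      unfolding poisson_def by measurable
    have gap: "1 / (2 * \<kappa>) * (1 / \<kappa> ^ k) \<le> cmod w - r" if "w \<in> annulus \<kappa> (k + 2)" "r \<le> rad \<kappa> (k + 1)" for w r
      using rad_gap[OF D(4), of k] that by (auto simp: annulus_def)
    have gap0: "0 < 1 / (2 * \<kappa>) * (1 / \<kappa> ^ k)" using D(4) by simp
    have w1: "cmod w < 1" if "w \<in> annulus \<kappa> (k + 2)" for w
      using that rad_props(2)[OF D(4), of "Suc (k + 2)"] by (auto simp: annulus_def)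
    define q where "q = 2 / (c\<^sup>2 * tail \<kappa> M k) * b"
    have q: "q > 0" using b D(5) D(7)[of k] by (simp add: q_def)
    define h where "h w = ennreal (F (cmod (f w))) * indicator (annulus \<kappa> (k + 2)) w" for w
    have [measurable]: "h \<in> borel_measurable borel" unfolding h_def[abs_def] by measurable
    define B where "B v = ennreal q * (\<integral>\<^sup>+w. ennreal (poisson (of_real r1 * v) w) * h w \<partial>M)" for v
    have mB[measurable]: "B \<in> borel_measurable borel"
    proof -
      have "(\<lambda>v. (\<integral>\<^sup>+w. ennreal (poisson (of_real r1 * v) w) * h w \<partial>M)) \<in> borel_measurable borel"
        by (rule borel_measurable_nn_integral) measurable
      then show ?thesis unfolding B_def[abs_def] by measurable
    qed
    have "ennreal (F (cmod (f (of_real r * u)))) \<le> B u" if u: "cmod u = 1" and r: "rad \<kappa> k \<le> r" "r \<le> rad \<kappa> (k + 1)" for u r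
    proof -
      define H where "H w = ennreal b * (ennreal (poisson (of_real r1 * u) w) * ennreal (F (cmod (f w))))" for w
      have [measurable]: "H \<in> borel_measurable borel" unfolding H_def[abs_def] by measurable
      have "ennreal (F (cmod (f (of_real r * u)))) \<le> circ_avg H z" if z: "z \<in> annulus \<kappa> (k + 2)" for z
      proof -
        have rz: "r < cmod z" using gap[OF z r(2)] gap0 by linarith
        have r0: "0 \<le> r" using r1 r by (simp add: r1_def)
        have "ennreal (F (cmod (f (of_real r * u)))) \<le> ennreal K1 * circ_avg (\<lambda>w. ennreal (poisson (of_real r * u) w) * ennreal (F (cmod (f w)))) z"
          using f rz w1[OF z] r0 u by (intro sub) (auto simp: disc_fun_def norm_mult)
        also have "\<dots> = circ_avg (\<lambda>w. ennreal K1 * (ennreal (poisson (of_real r * u) w) * ennreal (F (cmod (f w))))) z"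
          by (rule circ_avg_cmult[symmetric]) measurable
        also have "\<dots> \<le> circ_avg H z"
        proof (rule circ_avg_mono)
          fix w assume w: "cmod w = cmod z"
          have "r - r1 \<le> 1 / \<kappa> ^ k" using r rad_props(4)[OF D(4), of k] by (simp add: r1_def)
          also have "1 / \<kappa> ^ k = L * (1 / (2 * \<kappa>) * (1 / \<kappa> ^ k))" using D(4) by (simp add: L_def)
          also have "\<dots> \<le> L * (cmod w - r)" using gap[OF z r(2)] w D(4) unfolding L_def by (intro mult_left_mono) auto
          finally have "poisson (of_real r * u) w \<le> (1 + L)\<^sup>2 * poisson (of_real r1 * u) w"
            using r r1 rz w D(4) by (intro poisson_harnack[OF u]) (auto simp: r1_def L_def)
          then have "K1 * poisson (of_real r * u) w \<le> b * poisson (of_real r1 * u) w" using K1 by (simp add: b_def)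
          then have "ennreal (K1 * poisson (of_real r * u) w) \<le> ennreal (b * poisson (of_real r1 * u) w)" by (rule ennreal_leI)
          then have "ennreal K1 * ennreal (poisson (of_real r * u) w) \<le> ennreal b * ennreal (poisson (of_real r1 * u) w)"
            using K1 b by (simp add: ennreal_mult')
          then show "ennreal K1 * (ennreal (poisson (of_real r * u) w) * ennreal (F (cmod (f w)))) \<le> H w"
            unfolding H_def mult.assoc[symmetric] by (rule mult_right_mono) simp
        qed
        finally show ?thesis .
      qed
      then have "ennreal (F (cmod (f (of_real r * u)))) \<le> ennreal (2 / (c\<^sup>2 * tail \<kappa> M k)) * (\<integral>\<^sup>+z. H z * indicator (annulus \<kappa> (k + 2)) z \<partial>M)"
        by (intro annulus_average[OF M]) auto
      also have "(\<integral>\<^sup>+z. H z * indicator (annulus \<kappa> (k + 2)) z \<partial>M) = ennreal b * (\<integral>\<^sup>+w. ennreal (poisson (of_real r1 * u) w) * h w \<partial>M)"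
        unfolding H_def h_def mult.assoc by (rule nn_integral_cmult) measurable
      also have "ennreal (2 / (c\<^sup>2 * tail \<kappa> M k)) * (ennreal b * (\<integral>\<^sup>+w. ennreal (poisson (of_real r1 * u) w) * h w \<partial>M)) = B u"
      proof -
        have "ennreal (2 / (c\<^sup>2 * tail \<kappa> M k)) * ennreal b = ennreal q"
          unfolding q_def using D(5) D(7)[of k] b by (intro ennreal_mult[symmetric]) auto
        then show ?thesis by (simp only: B_def mult.assoc[symmetric])
      qed
      finally show ?thesis .
    qed
    moreover have "ennreal (tail \<kappa> M k) * circ_avg B u \<le> ennreal K * ann_mass F M \<kappa> f (k + 2)" if u: "cmod u = 1" for u
    proof -
      have "circ_avg B u = ennreal q * circ_avg (\<lambda>v. \<integral>\<^sup>+w. ennreal (poisson (of_real r1 * v) w) * h w \<partial>M) u"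
        unfolding B_def[abs_def] by (intro circ_avg_cmult borel_measurable_nn_integral) measurable
      also have "circ_avg (\<lambda>v. \<integral>\<^sup>+w. ennreal (poisson (of_real r1 * v) w) * h w \<partial>M) u
         = (\<integral>\<^sup>+t. (\<integral>\<^sup>+w. ennreal (poisson (of_real r1 * (u * ecirc t)) w) * indicator {0..1} t * h w \<partial>M) \<partial>lborel)"
        unfolding circ_avg_def
        by (intro nn_integral_cong, subst nn_integral_multc[symmetric]) (auto intro!: nn_integral_cong simp: mult_ac)
      also have "\<dots> = (\<integral>\<^sup>+w. (\<integral>\<^sup>+t. ennreal (poisson (of_real r1 * (u * ecirc t)) w) * indicator {0..1} t * h w \<partial>lborel) \<partial>M)"
        by (rule P.Fubini') measurable
      also have "\<dots> = (\<integral>\<^sup>+w. h w \<partial>M)"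
      proof (rule nn_integral_cong)
        fix w
        have "(\<integral>\<^sup>+t. ennreal (poisson (of_real r1 * (u * ecirc t)) w) * indicator {0..1} t * h w \<partial>lborel)
           = circ_avg (\<lambda>v. ennreal (poisson (of_real r1 * v) w)) u * h w"
          unfolding circ_avg_def by (rule nn_integral_multc) measurable
        also have "\<dots> = h w"
        proof (cases "w \<in> annulus \<kappa> (k + 2)")
          case True
          have "r1 \<le> rad \<kappa> (k + 1)" unfolding r1_def by (rule rad_mono[OF D(4)]) simp
          then have "r1 < cmod w" using gap[OF True, of r1] gap0 by linarith
          then show ?thesis using circ_avg_poisson_rotating[OF u r1] by simp
        qed (simp add: h_def)
        finally show "(\<integral>\<^sup>+t. ennreal (poisson (of_real r1 * (u * ecirc t)) w) * indicator {0..1} t * h w \<partial>lborel) = h w" .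
      qed
      also have "(\<integral>\<^sup>+w. h w \<partial>M) = ann_mass F M \<kappa> f (k + 2)" by (simp add: h_def ann_mass_def)
      finally have "ennreal (tail \<kappa> M k) * circ_avg B u = ennreal (tail \<kappa> M k) * ennreal q * ann_mass F M \<kappa> f (k + 2)"
        by (simp add: mult.assoc)
      also have "ennreal (tail \<kappa> M k) * ennreal q = ennreal K"
      proof -
        have "ennreal (tail \<kappa> M k) * ennreal q = ennreal (tail \<kappa> M k * q)"
          using D(7)[of k] q by (intro ennreal_mult[symmetric]) auto
        also have "tail \<kappa> M k * q = K" using D(7)[of k] by (simp add: q_def K_def)
        finally show ?thesis .
      qed
      finally show ?thesis by simp
    qed
    ultimately show ?thesis using mB by blast
  qed
  then show ?thesis using K by blast
qed

text \<open>The \<open>k\<close>-th ring has width at most \<open>\<kappa>^(-k)\<close>, so it contributes at most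
  \<open>y k\<close>.\<close>

lemma radial_growth_by_derivative:
  assumes \<kappa>: "2 \<le> \<kappa>" and h: "h holomorphic_on unit_disc" and u: "cmod u = 1"
    and bd: "\<And>k r. rad \<kappa> k \<le> r \<Longrightarrow> r \<le> rad \<kappa> (k + 1) \<Longrightarrow> cmod (deriv h (of_real r * u)) \<le> \<kappa> ^ k * y k"
    and y: "\<And>k. 0 \<le> y k"
    and r: "rad \<kappa> j \<le> r" "r \<le> rad \<kappa> (j + 1)"
  shows "cmod (h (of_real r * u)) \<le> cmod (h 0) + (\<Sum>k\<le>j. y k)"
proof -
  have step: "cmod (h (of_real r * u) - h (of_real (rad \<kappa> k) * u)) \<le> y k"
    if r: "rad \<kappa> k \<le> r" "r \<le> rad \<kappa> (k + 1)" for r k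
  proof -
    let ?S = "closed_segment (of_real (rad \<kappa> k) * u) (of_real r * u)"
    have S: "\<exists>s. rad \<kappa> k \<le> s \<and> s \<le> r \<and> z = of_real s * u" if "z \<in> ?S" for z
    proof -
      obtain t where t: "0 \<le> t" "t \<le> 1" "z = (1 - t) *\<^sub>R (of_real (rad \<kappa> k) * u) + t *\<^sub>R (of_real r * u)"
        using \<open>z \<in> ?S\<close> by (auto simp: in_segment)
      define s where "s = (1 - t) * rad \<kappa> k + t * r"
      have "s = rad \<kappa> k + t * (r - rad \<kappa> k)" "s = r - (1 - t) * (r - rad \<kappa> k)" by (auto simp: s_def algebra_simps)
      moreover have "0 \<le> t * (r - rad \<kappa> k)" "0 \<le> (1 - t) * (r - rad \<kappa> k)" using t r by auto
      ultimately have "rad \<kappa> k \<le> s" "s \<le> r" by auto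
      moreover have "z = of_real s * u" using t(3) by (simp add: s_def scaleR_conv_of_real algebra_simps)
      ultimately show ?thesis by blast
    qed
    have "cmod (h (of_real r * u) - h (of_real (rad \<kappa> k) * u)) \<le> (\<kappa> ^ k * y k) * cmod (of_real r * u - of_real (rad \<kappa> k) * u)"
    proof (rule field_differentiable_bound[where S="?S" and f'="deriv h"])
      fix z assume "z \<in> ?S"
      then obtain s where s: "rad \<kappa> k \<le> s" "s \<le> r" "z = of_real s * u" using S by blast
      have "cmod z < 1"
        using s u r rad_props(1,2)[OF \<kappa>, of k] rad_props(2)[OF \<kappa>, of "k+1"] by (simp add: norm_mult)
      then show "(h has_field_derivative deriv h z) (at z within ?S)"
        using holomorphic_derivI[OF h, of z] by (auto intro: has_field_derivative_at_within)
      show "cmod (deriv h z) \<le> \<kappa> ^ k * y k" using s r bd[of k s] by simp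
    qed auto
    also have "cmod (of_real r * u - of_real (rad \<kappa> k) * u) = r - rad \<kappa> k"
      using r u by (simp add: left_diff_distrib[symmetric] norm_mult flip: of_real_diff)
    also have "\<kappa> ^ k * y k * (r - rad \<kappa> k) \<le> \<kappa> ^ k * y k * (1 / \<kappa> ^ k)"
      using r rad_props(4)[OF \<kappa>, of k] \<kappa> y[of k] by (intro mult_left_mono) auto
    also have "\<dots> = y k" using \<kappa> by simp
    finally show ?thesis .
  qed
  have base: "cmod (h (of_real (rad \<kappa> k) * u)) \<le> cmod (h 0) + (\<Sum>i<k. y i)" for k
  proof (induction k)
    case 0 then show ?case using rad_props(5)[OF \<kappa>] by simp
  next
    case (Suc k)
    have "cmod (h (of_real (rad \<kappa> (Suc k)) * u)) \<le> cmod (h (of_real (rad \<kappa> k) * u)) + y k"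
      using step[of k "rad \<kappa> (Suc k)"] rad_mono[OF \<kappa>, of k "Suc k"] norm_triangle_sub[of "h (of_real (rad \<kappa> (Suc k)) * u)" "h (of_real (rad \<kappa> k) * u)"]
      by simp
    then show ?case using Suc by simp
  qed
  have "cmod (h (of_real r * u)) \<le> cmod (h (of_real (rad \<kappa> j) * u)) + y j"
    using step[OF r] norm_triangle_sub[of "h (of_real r * u)" "h (of_real (rad \<kappa> j) * u)"] by simp
  also have "\<dots> \<le> cmod (h 0) + (\<Sum>i<j. y i) + y j" using base[of j] by simp
  finally show ?thesis by (simp add: lessThan_Suc_atMost[symmetric])
qed

lemma power_bounds_mono:
  assumes pb: "power_bounds F C \<alpha> \<beta>" and F: "quasi_power F" and xy: "0 \<le> x" "x \<le> y"
  shows "F x \<le> C * F y"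
proof (cases "y = 0")
  case True
  then have "x = 0" using xy by simp
  then show ?thesis using True quasi_power_zero[OF F] by simp
next
  case False
  then have y: "y > 0" using xy by simp
  have "F (x / y * y) \<le> C * (x / y) powr \<alpha> * F y" using xy y by (intro power_boundsD(4)[OF pb]) auto
  also have "\<dots> \<le> C * 1 * F y"
    using xy y power_boundsD(1,2)[OF pb] quasi_power_nonneg[OF F, of y]
    by (intro mult_right_mono mult_left_mono powr_le1) auto
  finally show ?thesis using y by simp
qed

text \<open>A sum is at most a constant times the largest of its terms after these are given geometric weights. The weight
  is chosen so that \<open>F\<close> turns its ratio into \<open>3 / 2\<close>, less than the factor
  \<open>2\<close> by which tails decrease.\<close>

lemma quasi_power_sum_le:
  assumes F: "quasi_power F"
  shows "\<exists>C>0. \<forall>j y. (\<forall>k. 0 \<le> y k) \<longrightarrow> F (\<Sum>k\<le>j. y k) \<le> C * (\<Sum>k\<le>j. (3/2) ^ (j - k) * F (y k))"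
proof -
  obtain C \<alpha> \<beta> where pb: "power_bounds F C \<alpha> \<beta>" using quasi_power_bounds[OF F] .
  note C = power_boundsD(1-3)[OF pb] and hi = power_boundsD(5)[OF pb]
  have \<beta>: "0 < \<beta>" using C by linarith
  define \<rho> where "\<rho> = (3/2) powr (1 / \<beta>)"
  have \<rho>: "1 < \<rho>" "\<rho> powr \<beta> = 3/2" using \<beta> by (auto simp: \<rho>_def powr_powr gr_one_powr)
  define S where "S = max 1 (1 / (1 - 1 / \<rho>))"
  define C' where "C' = C * (C * S powr \<beta>) * C"
  have "F (\<Sum>k\<le>j. y k) \<le> C' * (\<Sum>k\<le>j. (3/2) ^ (j - k) * F (y k))" if y: "\<forall>k. 0 \<le> y k" for j :: nat and y :: "nat \<Rightarrow> real"
  proof -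
    define m where "m = Max ((\<lambda>k. y k * \<rho> ^ (j - k)) ` {..j})"
    have fin: "finite ((\<lambda>k. y k * \<rho> ^ (j - k)) ` {..j})" "(\<lambda>k. y k * \<rho> ^ (j - k)) ` {..j} \<noteq> {}" by auto
    have "m \<in> (\<lambda>k. y k * \<rho> ^ (j - k)) ` {..j}" unfolding m_def by (rule Max_in[OF fin])
    then obtain k0 where k0: "k0 \<le> j" "m = y k0 * \<rho> ^ (j - k0)" by auto
    have m: "y k * \<rho> ^ (j - k) \<le> m" if "k \<le> j" for k unfolding m_def using that by (intro Max_ge) auto
    have m0: "0 \<le> m" using k0 y \<rho> by simp
    have "(\<Sum>k\<le>j. y k) \<le> (\<Sum>k\<le>j. m * (1 / \<rho>) ^ (j - k))"
      using m \<rho> by (intro sum_mono) (simp add: power_divide field_simps)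
    also have "\<dots> = m * (\<Sum>k\<le>j. (1 / \<rho>) ^ k)"
      unfolding sum_distrib_left[symmetric] by (subst sum.nat_diff_reindex[symmetric, of _ "Suc j", unfolded lessThan_Suc_atMost]) simp
    also have "\<dots> \<le> m * S"
    proof (rule mult_left_mono[OF _ m0])
      have "(\<Sum>k\<le>j. (1 / \<rho>) ^ k) \<le> (\<Sum>k. (1 / \<rho>) ^ k)" using \<rho> by (intro sum_le_suminf summable_geometric) auto
      also have "(\<Sum>k. (1 / \<rho>) ^ k) = 1 / (1 - 1 / \<rho>)" using \<rho> by (intro suminf_geometric) auto
      also have "\<dots> \<le> S" by (simp add: S_def)
      finally show "(\<Sum>k\<le>j. (1 / \<rho>) ^ k) \<le> S" .
    qed
    finally have "(\<Sum>k\<le>j. y k) \<le> S * m" by (simp add: mult.commute)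
    then have "F (\<Sum>k\<le>j. y k) \<le> C * F (S * m)" using y by (intro power_bounds_mono[OF pb F] sum_nonneg) auto
    also have "\<dots> \<le> C * (C * S powr \<beta> * F m)" using m0 C by (intro mult_left_mono hi) (auto simp: S_def)
    finally have 1: "F (\<Sum>k\<le>j. y k) \<le> C * (C * S powr \<beta>) * F m" by (simp add: mult.assoc)
    have "F (\<rho> ^ (j - k0) * y k0) \<le> C * (\<rho> ^ (j - k0)) powr \<beta> * F (y k0)"
      using \<rho> y by (intro hi) (auto intro: one_le_power)
    also have "(\<rho> ^ (j - k0)) powr \<beta> = (\<rho> powr \<beta>) ^ (j - k0)"
      using \<rho> by (simp add: powr_power mult.commute powr_realpow[symmetric] powr_powr)
    finally have 2: "F m \<le> C * ((3/2) ^ (j - k0) * F (y k0))" by (simp add: k0 \<rho> mult_ac)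
    have 3: "(3/2) ^ (j - k0) * F (y k0) \<le> (\<Sum>k\<le>j. (3/2) ^ (j - k) * F (y k))"
      using k0 y quasi_power_nonneg[OF F] by (intro member_le_sum) auto
    have "F m \<le> C * (\<Sum>k\<le>j. (3/2) ^ (j - k) * F (y k))"
      using 2 mult_left_mono[OF 3, of C] C by linarith
    then have "C * (C * S powr \<beta>) * F m \<le> C * (C * S powr \<beta>) * (C * (\<Sum>k\<le>j. (3/2) ^ (j - k) * F (y k)))"
      using C by (intro mult_left_mono) auto
    with 1 show ?thesis by (simp add: C'_def mult.assoc)
  qed
  moreover have "C' > 0" using C by (simp add: C'_def S_def)
  ultimately show ?thesis by blast
qed

lemma ennreal_suminf_swap: "(\<Sum>j. \<Sum>k. f j k) = (\<Sum>k. \<Sum>j. f j k :: ennreal)"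
proof -
  have "(\<Sum>j. \<Sum>k. f j k) = (\<integral>\<^sup>+j. (\<Sum>k. f j k) \<partial>count_space UNIV)" by (simp add: nn_integral_count_space_nat)
  also have "\<dots> = (\<Sum>k. \<integral>\<^sup>+j. f j k \<partial>count_space UNIV)" by (rule nn_integral_suminf) auto
  finally show ?thesis by (simp add: nn_integral_count_space_nat)
qed

text \<open>The ratio \<open>3 / 4\<close> is the product of the growth \<open>3 / 2\<close> in
  \<open>quasi_power_sum_le\<close> and the halving of the tails.\<close>

lemma ennreal_suminf_geometric_convolution:
  assumes C: "0 \<le> C" and le: "\<And>j. a j \<le> (\<Sum>k\<le>j. ennreal (C * (3/4) ^ (j - k)) * \<gamma> k)"
  shows "(\<Sum>j. a j) \<le> ennreal (4 * C) * (\<Sum>k. \<gamma> k)"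
proof -
  define f where "f k j = (if k \<le> j then C * (3/4) ^ (j - k) else 0)" for k j :: nat
  have f0: "0 \<le> f k j" for k j using C by (simp add: f_def)
  have fs: "f k sums (4 * C)" for k
  proof -
    have "(\<lambda>j. C * (3/4) ^ j) sums (C * (1 / (1 - 3/4)))" by (intro sums_mult geometric_sums) auto
    then have "(\<lambda>j. f k (j + k)) sums (4 * C)" by (simp add: f_def mult.commute)
    then show ?thesis using sums_iff_shift'[of "f k" k "4 * C"] by (simp add: f_def)
  qed
  have "(\<Sum>j. a j) \<le> (\<Sum>j. \<Sum>k. ennreal (f k j) * \<gamma> k)"
  proof (rule suminf_le)
    fix j
    have "a j \<le> (\<Sum>k\<le>j. ennreal (f k j) * \<gamma> k)" using le[of j] by (simp add: f_def)
    also have "\<dots> \<le> (\<Sum>k. ennreal (f k j) * \<gamma> k)" by (intro sum_le_suminf) auto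
    finally show "a j \<le> (\<Sum>k. ennreal (f k j) * \<gamma> k)" .
  qed auto
  also have "\<dots> = (\<Sum>k. \<Sum>j. ennreal (f k j) * \<gamma> k)" by (rule ennreal_suminf_swap)
  also have "\<dots> = (\<Sum>k. ennreal (4 * C) * \<gamma> k)"
    using suminf_ennreal_eq[OF f0 fs] by simp
  also have "\<dots> = ennreal (4 * C) * (\<Sum>k. \<gamma> k)" by simp
  finally show ?thesis .
qed

text \<open>A one-weight substitute for the estimate of an analytic function by its derivative. The bound \<open>y u
  k\<close> of the derivative on the \<open>k\<close>-th ring may depend on the direction \<open>u\<close>;
  only the circular means of \<open>F (y u k)\<close>, through the measurable majorants \<open>G k\<close>,
  enter the result. The contribution of the \<open>k\<close>-th ring to the \<open>j\<close>-th one decays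
  like \<open>(3 / 4) ^ (j - k)\<close>.\<close>

lemma area_estimate:
  assumes M: "scale_measure \<kappa> c M" and F: "quasi_power F"
  shows "\<exists>K>0. \<forall>h y G \<gamma>. disc_fun h \<longrightarrow> h 0 = 0 \<longrightarrow> (\<forall>u k. 0 \<le> y u k) \<longrightarrow>
     (\<forall>u k r. cmod u = 1 \<longrightarrow> rad \<kappa> k \<le> r \<longrightarrow> r \<le> rad \<kappa> (k + 1) \<longrightarrow> cmod (deriv h (of_real r * u)) \<le> \<kappa> ^ k * y u k) \<longrightarrow>
     (\<forall>k. G k \<in> borel_measurable borel) \<longrightarrow>
     (\<forall>u k. cmod u = 1 \<longrightarrow> ennreal (tail \<kappa> M k * F (y u k)) \<le> G k u) \<longrightarrow>
     (\<forall>u k. cmod u = 1 \<longrightarrow> circ_avg (G k) u \<le> \<gamma> k) \<longrightarrow>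
     mass F M h \<le> ennreal K * (\<Sum>k. \<gamma> k)"
proof -
  note D = scale_measureD[OF M]
  have sM[measurable_cong]: "sets M = sets borel" by (rule D(2))
  obtain C \<alpha> \<beta> where pb: "power_bounds F C \<alpha> \<beta>" using quasi_power_bounds[OF F] .
  have C1: "1 \<le> C" by (rule power_boundsD(1)[OF pb])
  obtain C2 where C2: "C2 > 0" and sum: "\<And>j y. (\<forall>k. 0 \<le> y k) \<Longrightarrow> F (\<Sum>k\<le>j. y k) \<le> C2 * (\<Sum>k\<le>j. (3/2) ^ (j - k) * F (y k))"
    using quasi_power_sum_le[OF F] by metis
  define A where "A = C * C2"
  have A: "A > 0" using C1 C2 by (simp add: A_def)
  have "mass F M h \<le> ennreal (4 * A) * (\<Sum>k. \<gamma> k)"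
    if h: "disc_fun h" "h 0 = 0" and y: "\<forall>u k. 0 \<le> y u k"
      and bd: "\<forall>u k r. cmod u = 1 \<longrightarrow> rad \<kappa> k \<le> r \<longrightarrow> r \<le> rad \<kappa> (k + 1) \<longrightarrow> cmod (deriv h (of_real r * u)) \<le> \<kappa> ^ k * y u k"
      and mG: "\<forall>k. G k \<in> borel_measurable borel"
      and G: "\<forall>u k. cmod u = 1 \<longrightarrow> ennreal (tail \<kappa> M k * F (y u k)) \<le> G k u"
      and \<gamma>: "\<forall>u k. cmod u = 1 \<longrightarrow> circ_avg (G k) u \<le> \<gamma> k" for h y G \<gamma>
  proof -
    have [measurable]: "G k \<in> borel_measurable borel" for k using mG by auto
    have msgn[measurable]: "(sgn :: complex \<Rightarrow> complex) \<in> borel_measurable borel"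
      unfolding sgn_div_norm[abs_def] by measurable
    define a where "a j k = A * (3/2) ^ (j - k) / tail \<kappa> M k" for j k :: nat
    have a0: "0 \<le> a j k" for j k using A D(7)[of k] by (simp add: a_def)
    define G' where "G' k z = (if z = 0 then 0 else G k (sgn z))" for k z
    have [measurable]: "G' k \<in> borel_measurable borel" for k unfolding G'_def[abs_def] by measurable
    have pt: "ennreal (F (cmod (h z))) \<le> (\<Sum>k\<le>j. ennreal (a j k) * G' k z)" if z: "z \<in> annulus \<kappa> j" for z j
    proof (cases "z = 0")
      case True then show ?thesis using h quasi_power_zero[OF F] by simp
    next
      case False
      define u where "u = sgn z"
      have u: "cmod u = 1" using False by (simp add: u_def norm_sgn)
      have zu: "z = of_real (cmod z) * u" using False by (simp add: u_def sgn_eq)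
      have "cmod (h (of_real (cmod z) * u)) \<le> cmod (h 0) + (\<Sum>k\<le>j. y u k)"
        using z u bd y h(1) by (intro radial_growth_by_derivative[OF D(4)]) (auto simp: annulus_def disc_fun_def)
      then have "cmod (h z) \<le> (\<Sum>k\<le>j. y u k)" using zu h(2) by simp
      then have "F (cmod (h z)) \<le> C * F (\<Sum>k\<le>j. y u k)" by (intro power_bounds_mono[OF pb F]) auto
      also have "\<dots> \<le> C * (C2 * (\<Sum>k\<le>j. (3/2) ^ (j - k) * F (y u k)))"
        using C1 y by (intro mult_left_mono sum) auto
      also have "\<dots> = (\<Sum>k\<le>j. a j k * (tail \<kappa> M k * F (y u k)))"
        unfolding sum_distrib_left
      proof (rule sum.cong)
        fix k show "C * (C2 * ((3/2) ^ (j - k) * F (y u k))) = a j k * (tail \<kappa> M k * F (y u k))"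
          using D(7)[of k] by (simp add: a_def A_def)
      qed simp
      finally have "ennreal (F (cmod (h z))) \<le> ennreal (\<Sum>k\<le>j. a j k * (tail \<kappa> M k * F (y u k)))" by (rule ennreal_leI)
      also have "\<dots> = (\<Sum>k\<le>j. ennreal (a j k * (tail \<kappa> M k * F (y u k))))"
        using a0 D(7) y quasi_power_nonneg[OF F] by (intro sum_ennreal[symmetric] mult_nonneg_nonneg) (auto intro: less_imp_le)
      also have "\<dots> \<le> (\<Sum>k\<le>j. ennreal (a j k) * G' k z)"
      proof (rule sum_mono)
        fix k
        have "ennreal (a j k * (tail \<kappa> M k * F (y u k))) = ennreal (a j k) * ennreal (tail \<kappa> M k * F (y u k))"
          using a0 by (rule ennreal_mult')
        also have "\<dots> \<le> ennreal (a j k) * G' k z" using G u False by (intro mult_left_mono) (auto simp: G'_def u_def)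
        finally show "ennreal (a j k * (tail \<kappa> M k * F (y u k))) \<le> ennreal (a j k) * G' k z" .
      qed
      finally show ?thesis .
    qed
    have "ann_mass F M \<kappa> h j \<le> (\<Sum>k\<le>j. ennreal (A * (3/4) ^ (j - k)) * \<gamma> k)" for j
    proof -
      have "ann_mass F M \<kappa> h j \<le> (\<integral>\<^sup>+z. (\<Sum>k\<le>j. ennreal (a j k) * (G' k z * indicator (annulus \<kappa> j) z)) \<partial>M)"
        unfolding ann_mass_def
      proof (rule nn_integral_mono)
        fix z
        show "ennreal (F (cmod (h z))) * indicator (annulus \<kappa> j) z \<le> (\<Sum>k\<le>j. ennreal (a j k) * (G' k z * indicator (annulus \<kappa> j) z))"
          using pt[of z j] by (cases "z \<in> annulus \<kappa> j") auto
      qed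
      also have "\<dots> = (\<Sum>k\<le>j. ennreal (a j k) * (\<integral>\<^sup>+z. G' k z * indicator (annulus \<kappa> j) z \<partial>M))"
        by (simp add: nn_integral_sum nn_integral_cmult)
      also have "\<dots> \<le> (\<Sum>k\<le>j. ennreal (A * (3/4) ^ (j - k)) * \<gamma> k)"
      proof (rule sum_mono)
        fix k assume k: "k \<in> {..j}"
        have "(\<integral>\<^sup>+z. G' k z * indicator (annulus \<kappa> j) z \<partial>M) = (\<integral>\<^sup>+z. circ_avg (G' k) z * indicator (annulus \<kappa> j) z \<partial>M)"
          by (rule nn_integral_annulus_circ_avg[OF D(1), symmetric]) measurable
        also have "\<dots> \<le> (\<integral>\<^sup>+z. \<gamma> k * indicator (annulus \<kappa> j) z \<partial>M)"
        proof (intro nn_integral_mono mult_right_mono)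
          fix z
          show "circ_avg (G' k) z \<le> \<gamma> k"
          proof (cases "z = 0")
            case True then show ?thesis by (simp add: circ_avg_def G'_def)
          next
            case False
            have "sgn (z * ecirc t) = sgn z * ecirc t" for t
            proof -
              have "cmod (ecirc t) = 1" by simp
              then show ?thesis by (simp add: sgn_mult sgn_eq[of "ecirc t"])
            qed
            then have "circ_avg (G' k) z = circ_avg (G k) (sgn z)"
              unfolding circ_avg_def G'_def using False by (intro nn_integral_cong) simp
            then show ?thesis using \<gamma> False by (simp add: norm_sgn)
          qed
        qed auto
        also have "\<dots> = \<gamma> k * emeasure M (annulus \<kappa> j)" by (rule nn_integral_cmult_indicator) (simp add: sM)
        also have "\<dots> \<le> \<gamma> k * ennreal (tail \<kappa> M j)" by (intro mult_left_mono measure_annulus[OF M]) auto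
        finally have "ennreal (a j k) * (\<integral>\<^sup>+z. G' k z * indicator (annulus \<kappa> j) z \<partial>M) \<le> ennreal (a j k) * (\<gamma> k * ennreal (tail \<kappa> M j))"
          by (rule mult_left_mono) simp
        also have "\<dots> = (ennreal (a j k) * ennreal (tail \<kappa> M j)) * \<gamma> k" by (simp add: mult_ac)
        also have "ennreal (a j k) * ennreal (tail \<kappa> M j) = ennreal (a j k * tail \<kappa> M j)"
          using a0 D(7)[of j] by (intro ennreal_mult[symmetric]) auto
        also have "a j k * tail \<kappa> M j \<le> A * (3/4) ^ (j - k)"
        proof -
          have "tail \<kappa> M j \<le> tail \<kappa> M k / 2 ^ (j - k)" using tail_decay[OF M, of k "j - k"] k by simp
          then have "a j k * tail \<kappa> M j \<le> a j k * (tail \<kappa> M k / 2 ^ (j - k))" by (rule mult_left_mono[OF _ a0])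
          also have "\<dots> = A * ((3/2) ^ (j - k) / 2 ^ (j - k))" using D(7)[of k] by (simp add: a_def)
          also have "(3/2) ^ (j - k) / 2 ^ (j - k) = (3/4 :: real) ^ (j - k)" by (simp add: power_divide[symmetric])
          finally show ?thesis .
        qed
        finally show "ennreal (a j k) * (\<integral>\<^sup>+z. G' k z * indicator (annulus \<kappa> j) z \<partial>M) \<le> ennreal (A * (3/4) ^ (j - k)) * \<gamma> k"
          by (simp add: ennreal_leI mult_right_mono)
      qed
      finally show ?thesis .
    qed
    then have "(\<Sum>j. ann_mass F M \<kappa> h j) \<le> ennreal (4 * A) * (\<Sum>k. \<gamma> k)"
      using A by (intro ennreal_suminf_geometric_convolution) auto
    then show ?thesis by (simp add: suminf_ann_mass[OF M F h(1)])
  qed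
  then show ?thesis using A by (intro exI[of _ "4 * A"]) auto
qed

text \<open>If \<open>X\<close> is a value with \<open>F X\<close> at least of the size \<open>1 / W\<close>, then a bound
  for \<open>F x * W\<close> is a bound for the quotient of \<open>x\<close> by \<open>X\<close>, and it tends
  to zero with \<open>\<eta>\<close>.\<close>

lemma quasi_power_inverse:
  assumes F: "quasi_power F"
  shows "\<exists>C>0. \<exists>\<alpha>>0. \<exists>\<beta>>0. \<forall>x X W K \<eta>. 0 \<le> x \<longrightarrow> 0 < X \<longrightarrow> 0 < K \<longrightarrow> 0 < W \<longrightarrow> 1 \<le> K * (F X * W) \<longrightarrow> F x * W \<le> \<eta> \<longrightarrow>
     x \<le> max ((C * K * \<eta>) powr \<alpha>) ((C * K * \<eta>) powr \<beta>) * X"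
proof -
  obtain C \<alpha> \<beta> where *: "C \<ge> 1" "\<alpha> > 0" "\<beta> > 0"
      "\<And>t x. 0 \<le> t \<Longrightarrow> 0 \<le> x \<Longrightarrow> F (t * x) \<le> C * max (t powr \<alpha>) (t powr \<beta>) * F x"
    using F unfolding quasi_power_def by auto
  have "x \<le> max ((C * K * \<eta>) powr (1/\<alpha>)) ((C * K * \<eta>) powr (1/\<beta>)) * X"
    if x: "0 \<le> x" and X: "0 < X" and K: "0 < K" and W: "0 < W" and 1: "1 \<le> K * (F X * W)" and 2: "F x * W \<le> \<eta>" for x X W K \<eta>
  proof (cases "x = 0")
    case True
    have "0 \<le> max ((C * K * \<eta>) powr (1/\<alpha>)) ((C * K * \<eta>) powr (1/\<beta>))" by (simp add: le_max_iff_disj)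
    then show ?thesis using X True by simp
  next
    case False
    then have x: "x > 0" using x by simp
    define s where "s = X / x"
    have s: "s > 0" using X x by (simp add: s_def)
    have "0 < F x * W" using quasi_power_pos[OF F x] W by simp
    then have \<eta>: "\<eta> > 0" using 2 by simp
    have "F (s * x) \<le> C * max (s powr \<alpha>) (s powr \<beta>) * F x" using s x by (intro *(4)) auto
    then have "F X \<le> C * max (s powr \<alpha>) (s powr \<beta>) * F x" using x by (simp add: s_def)
    then have "K * (F X * W) \<le> K * ((C * max (s powr \<alpha>) (s powr \<beta>) * F x) * W)"
      using K W by (intro mult_left_mono mult_right_mono) auto
    also have "\<dots> = K * C * max (s powr \<alpha>) (s powr \<beta>) * (F x * W)" by simp
    also have "\<dots> \<le> K * C * max (s powr \<alpha>) (s powr \<beta>) * \<eta>"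
      using 2 K * by (intro mult_left_mono) (auto simp: le_max_iff_disj)
    finally have "1 \<le> (C * K * \<eta>) * max (s powr \<alpha>) (s powr \<beta>)" using 1 by (simp add: mult_ac)
    then have "1 \<le> (C * K * \<eta>) * s powr \<alpha> \<or> 1 \<le> (C * K * \<eta>) * s powr \<beta>" by (auto simp: max_def split: if_splits)
    then have "\<exists>e\<in>{\<alpha>, \<beta>}. 1 \<le> (C * K * \<eta>) * s powr e" by auto
    then obtain e where e: "e = \<alpha> \<or> e = \<beta>" "1 \<le> (C * K * \<eta>) * s powr e" by auto
    have e0: "e > 0" using e * by auto
    have "1 powr (1/e) \<le> ((C * K * \<eta>) * s powr e) powr (1/e)" using e e0 by (intro powr_mono2) auto
    also have "\<dots> = (C * K * \<eta>) powr (1/e) * s" using * K \<eta> s e0 by (simp add: powr_mult powr_powr)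
    finally have "x \<le> (C * K * \<eta>) powr (1/e) * X" using x by (simp add: s_def field_simps)
    also have "\<dots> \<le> max ((C * K * \<eta>) powr (1/\<alpha>)) ((C * K * \<eta>) powr (1/\<beta>)) * X"
      using e(1) X by (intro mult_right_mono) auto
    finally show ?thesis .
  qed
  then show ?thesis using * by (intro exI[of _ C] conjI exI[of _ "1/\<alpha>"] exI[of _ "1/\<beta>"]) auto
qed

section \<open>The transfer from one Orlicz function to another\<close>

text \<open>\<open>D\<close> stands for the reciprocal of the distance to the circle and \<open>W\<close> for the mass of
  a Carleson square. The mass is smaller than the distance by a definite power \<open>a > 0\<close>.\<close>

definition power_size :: "real \<Rightarrow> real \<Rightarrow> real \<Rightarrow> real \<Rightarrow> real \<Rightarrow> bool" where
  "power_size A a L D W \<longleftrightarrow> 0 < W \<and> W \<le> A * D powr (-1 - a) \<and> D powr (- L) \<le> A * W"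

text \<open>Up to constants, the value at which the function with \<open>p\<close> and \<open>\<Psi>\<close> equals
  \<open>1 / W\<close>; see \<open>critical_compare\<close>.\<close>

definition critical :: "real \<Rightarrow> (real \<Rightarrow> real) \<Rightarrow> real \<Rightarrow> real \<Rightarrow> real" where
  "critical p \<Psi> D W = (W * \<Psi> D) powr (- (1 / p))"

lemma class_L_power_growth:
  assumes "\<Psi> \<in> class_L" "0 < \<sigma>"
  shows "\<exists>B\<ge>1. \<forall>D\<ge>1. \<Psi> D \<le> B * D powr \<sigma> \<and> 1 \<le> B * D powr \<sigma> * \<Psi> D"
proof -
  obtain B where B: "B > 0" "\<And>x y. 0 < x \<Longrightarrow> 0 < y \<Longrightarrow> \<Psi> x \<le> B * max (x/y) (y/x) powr \<sigma> * \<Psi> y"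
    using class_L_Potter[OF assms] by auto
  have p1: "\<Psi> 1 > 0" using class_L_pos[OF assms(1)] by simp
  define B' where "B' = max 1 (max (B * \<Psi> 1) (B / \<Psi> 1))"
  have "\<Psi> D \<le> B' * D powr \<sigma> \<and> 1 \<le> B' * D powr \<sigma> * \<Psi> D" if D: "D \<ge> 1" for D
  proof
    have "1 / D \<le> 1" using D by simp
    then have "1 / D \<le> D" using D by linarith
    then have m: "max D (1 / D) = D" by (rule max_absorb1)
    have pD: "\<Psi> D > 0" using class_L_pos[OF assms(1)] D by simp
    have "\<Psi> D \<le> (B * \<Psi> 1) * D powr \<sigma>" using B(2)[of D 1] D m by (simp add: mult_ac)
    also have "\<dots> \<le> B' * D powr \<sigma>" by (intro mult_right_mono) (auto simp: B'_def)
    finally show "\<Psi> D \<le> B' * D powr \<sigma>" .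
    have "\<Psi> 1 \<le> B * D powr \<sigma> * \<Psi> D" using B(2)[of 1 D] D m by (simp add: max.commute)
    then have "1 \<le> (B / \<Psi> 1) * (D powr \<sigma> * \<Psi> D)" using p1 by (simp add: field_simps)
    also have "\<dots> \<le> B' * (D powr \<sigma> * \<Psi> D)" using pD by (intro mult_right_mono) (auto simp: B'_def)
    finally show "1 \<le> B' * D powr \<sigma> * \<Psi> D" by (simp add: mult.assoc)
  qed
  then show ?thesis by (intro exI[of _ B']) (auto simp: B'_def)
qed

lemma critical_powr:
  assumes "\<Psi> \<in> class_L" "0 < p" "0 \<le> D" "0 < W"
  shows "0 < critical p \<Psi> D W" "critical p \<Psi> D W powr p * (W * \<Psi> D) = 1"
proof -
  have WD: "0 < W * \<Psi> D" using assms class_L_pos[OF assms(1,3)] by simp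
  then show "0 < critical p \<Psi> D W" unfolding critical_def by (metis powr_gt_zero less_irrefl)
  have "critical p \<Psi> D W powr p = (W * \<Psi> D) powr (- 1)" using assms(2) by (simp add: critical_def powr_powr)
  also have "\<dots> = 1 / (W * \<Psi> D)" using WD by (simp add: powr_minus_divide)
  finally show "critical p \<Psi> D W powr p * (W * \<Psi> D) = 1" using WD by (metis nonzero_divide_eq_eq less_irrefl)
qed

text \<open>Both bounds come from those for \<open>W\<close>. In the lower one the exponent \<open>1 + a\<close> is
  diminished by \<open>\<sigma>\<close>, which pays for \<open>\<Psi>\<close>.\<close>

lemma critical_size:
  assumes L: "\<Psi> \<in> class_L" and p: "0 < p" and A: "0 < A" and \<sigma>: "0 < \<sigma>" "\<sigma> \<le> a" and L0: "0 \<le> L"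
  shows "\<exists>A1\<ge>1. \<exists>L1\<ge>0. \<forall>D\<ge>1. \<forall>W. power_size A a L D W \<longrightarrow>
     critical p \<Psi> D W \<le> A1 * D powr L1 \<and> D powr (1 + a - \<sigma>) \<le> A1 * critical p \<Psi> D W powr p"
proof -
  obtain B where B: "B \<ge> 1" "\<And>D. D \<ge> 1 \<Longrightarrow> \<Psi> D \<le> B * D powr \<sigma>" "\<And>D. D \<ge> 1 \<Longrightarrow> 1 \<le> B * D powr \<sigma> * \<Psi> D"
    using class_L_power_growth[OF L \<sigma>(1)] by auto
  define A1 where "A1 = max 1 (max (A * B) ((A * B) powr (1 / p)))"
  have "critical p \<Psi> D W \<le> A1 * D powr ((L + \<sigma>) / p) \<and> D powr (1 + a - \<sigma>) \<le> A1 * critical p \<Psi> D W powr p"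
    if D: "D \<ge> 1" and W: "power_size A a L D W" for D W
  proof
    define X where "X = critical p \<Psi> D W"
    have W0: "W > 0" using W by (simp add: power_size_def)
    have pD: "\<Psi> D > 0" using class_L_pos[OF L] D by simp
    have X: "X > 0" "X powr p * (W * \<Psi> D) = 1" using critical_powr[OF L p _ W0, of D] D by (auto simp: X_def)
    have WD: "W * \<Psi> D > 0" using W0 pD by simp
    have Xp: "X powr p = 1 / (W * \<Psi> D)" using X(2) W0 pD by (simp add: field_simps)
    have "W * \<Psi> D \<le> (A * D powr (-1 - a)) * (B * D powr \<sigma>)"
      using W B(2)[OF D] W0 pD by (intro mult_mono) (auto simp: power_size_def)
    also have "\<dots> = A * B * D powr (- (1 + a - \<sigma>))" using D by (simp add: powr_add[symmetric] algebra_simps)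
    finally have "D powr (1 + a - \<sigma>) * (W * \<Psi> D) \<le> D powr (1 + a - \<sigma>) * (A * B * D powr (- (1 + a - \<sigma>)))"
      by (intro mult_left_mono) auto
    also have "\<dots> = A * B * (D powr (1 + a - \<sigma>) * D powr (- (1 + a - \<sigma>)))" by (simp only: mult_ac)
    also have "D powr (1 + a - \<sigma>) * D powr (- (1 + a - \<sigma>)) = 1" using D by (subst powr_add[symmetric]) simp
    finally have "D powr (1 + a - \<sigma>) \<le> A * B * X powr p" unfolding Xp using WD by (simp add: field_simps)
    also have "\<dots> \<le> A1 * X powr p" by (intro mult_right_mono) (auto simp: A1_def)
    finally show "D powr (1 + a - \<sigma>) \<le> A1 * critical p \<Psi> D W powr p" by (simp add: X_def)
    have "D powr (- L) * 1 \<le> (A * W) * (B * D powr \<sigma> * \<Psi> D)"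
      using W B(3)[OF D] A W0 by (intro mult_mono) (auto simp: power_size_def)
    then have "D powr (- L) * D powr (- \<sigma>) \<le> (A * W) * (B * D powr \<sigma> * \<Psi> D) * D powr (- \<sigma>)"
      by (intro mult_right_mono) auto
    also have "\<dots> = A * B * (W * \<Psi> D)" using D by (simp add: powr_minus field_simps)
    finally have "1 / (W * \<Psi> D) \<le> A * B * D powr (L + \<sigma>)"
      using WD D by (simp add: powr_add[symmetric] powr_minus field_simps powr_diff)
    then have "X powr p \<le> A * B * D powr (L + \<sigma>)" by (simp add: Xp)
    then have "(X powr p) powr (1 / p) \<le> (A * B * D powr (L + \<sigma>)) powr (1 / p)" using p by (intro powr_mono2) auto
    then have "X \<le> (A * B) powr (1 / p) * D powr ((L + \<sigma>) / p)" using p X A B(1) by (simp add: powr_powr powr_mult)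
    also have "\<dots> \<le> A1 * D powr ((L + \<sigma>) / p)" by (intro mult_right_mono) (auto simp: A1_def)
    finally show "critical p \<Psi> D W \<le> A1 * D powr ((L + \<sigma>) / p)" by (simp add: X_def)
  qed
  moreover have "A1 \<ge> 1" "(L + \<sigma>) / p \<ge> 0" using L0 \<sigma> p by (auto simp: A1_def)
  ultimately show ?thesis by blast
qed

text \<open>Since the critical value and \<open>D\<close> are bounded by powers of each other.\<close>

lemma critical_compare:
  assumes L: "\<Psi> \<in> class_L" and p: "0 < p" and A: "0 < A" and a: "0 < a" and L0: "0 \<le> L"
  shows "\<exists>K>0. \<forall>D\<ge>1. \<forall>W. power_size A a L D W \<longrightarrow>
     \<Psi> (critical p \<Psi> D W) \<le> K * \<Psi> D \<and> \<Psi> D \<le> K * \<Psi> (critical p \<Psi> D W)"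
proof -
  obtain A1 L1 where A1: "A1 \<ge> 1" and L1: "L1 \<ge> 0"
    and X: "\<And>D W. D \<ge> 1 \<Longrightarrow> power_size A a L D W \<Longrightarrow> critical p \<Psi> D W \<le> A1 * D powr L1"
      "\<And>D W. D \<ge> 1 \<Longrightarrow> power_size A a L D W \<Longrightarrow> D powr (1 + a - a) \<le> A1 * critical p \<Psi> D W powr p"
    using critical_size[OF L p A a order_refl L0] by metis
  define Lc where "Lc = max L1 p"
  obtain K where K: "K > 0" "\<And>x y. 0 \<le> x \<Longrightarrow> 0 \<le> y \<Longrightarrow> x \<le> A1 * max 1 y powr Lc \<Longrightarrow> y \<le> A1 * max 1 x powr Lc \<Longrightarrow> \<Psi> x \<le> K * \<Psi> y"
    using class_L_compare[OF L, of Lc A1] p unfolding Lc_def by (metis le_max_iff_disj less_imp_le)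
  have "\<Psi> (critical p \<Psi> D W) \<le> K * \<Psi> D \<and> \<Psi> D \<le> K * \<Psi> (critical p \<Psi> D W)" if D: "D \<ge> 1" and W: "power_size A a L D W" for D W
  proof -
    define x where "x = critical p \<Psi> D W"
    have x: "x > 0" using critical_powr[OF L p] D W by (auto simp: x_def power_size_def)
    have "x \<le> A1 * D powr L1" using X(1)[OF D W] by (simp add: x_def)
    also have "\<dots> \<le> A1 * D powr Lc" using A1 D by (intro mult_left_mono powr_mono) (auto simp: Lc_def)
    finally have 1: "x \<le> A1 * max 1 D powr Lc" using D by (simp add: max_def)
    have "D \<le> A1 * x powr p" using X(2)[OF D W] D by (simp add: x_def)
    also have "\<dots> \<le> A1 * max 1 x powr p" using A1 x p by (intro mult_left_mono powr_mono2) auto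
    also have "\<dots> \<le> A1 * max 1 x powr Lc" using A1 by (intro mult_left_mono powr_mono) (auto simp: Lc_def)
    finally have 2: "D \<le> A1 * max 1 x powr Lc" .
    show ?thesis using K(2)[of x D] K(2)[of D x] 1 2 x D by (simp add: x_def)
  qed
  then show ?thesis using K by blast
qed

text \<open>With \<open>t = x / X\<close> the left side is \<open>t powr q * \<Phi> (t * Y) / \<Phi> D\<close> and
  \<open>orlicz p \<Psi> x * W\<close> is \<open>t powr p * \<Psi> x / \<Psi> D\<close>. If both
  \<open>x\<close> and \<open>t * Y\<close> exceed a small power of \<open>D\<close>, the quotients of slowly
  varying functions are bounded, and \<open>t powr q \<le> R powr (q - p) * t powr p\<close> because \<open>p
  \<le> q\<close>. Otherwise the left side is \<open>O(D powr (-1 - \<tau>))\<close> on its own: if \<open>t *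
  Y\<close> is smaller, because \<open>V\<close> is at most a multiple of \<open>D powr (-1 - a)\<close>, and
  if \<open>x\<close> is smaller, because \<open>t\<close> is then at most a multiple of a negative power of
  \<open>D\<close>.\<close>

lemma pointwise_transfer:
  assumes p: "0 < p" "p \<le> q" and \<Psi>: "\<Psi> \<in> class_L" and \<Phi>: "\<Phi> \<in> class_L"
    and A: "0 < A" and a: "0 < a" and L0: "0 \<le> L" and R: "1 \<le> R"
  shows "\<exists>K>0. \<exists>\<tau>>0. \<forall>D\<ge>1. \<forall>W V x. power_size A a L D W \<longrightarrow> power_size A a L D V \<longrightarrow> 0 \<le> x \<longrightarrow> x \<le> R * critical p \<Psi> D W \<longrightarrow>
     orlicz q \<Phi> (critical q \<Phi> D V / critical p \<Psi> D W * x) * V \<le> K * (orlicz p \<Psi> x * W + D powr (-1 - \<tau>))"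
proof -
  have q: "0 < q" using p by simp
  define \<tau> where "\<tau> = a / 2"
  \<comment> \<open>\<open>\<sigma>\<close> is the exponent allowed for slow variation and \<open>\<epsilon>\<close> the small power of \<open>D\<close>; they are chosen such that all losses together stay below \<open>a - \<tau> = a / 2\<close>\<close>
  define \<sigma> where "\<sigma> = min (a / 8) (min (p / 2) (a * p / (8 * (1 + a))))"
  have \<sigma>: "0 < \<sigma>" "\<sigma> \<le> a / 8" "\<sigma> \<le> p / 2" "\<sigma> \<le> a * p / (8 * (1 + a))"
  proof -
    show "0 < \<sigma>" using a p by (simp add: \<sigma>_def)
    show "\<sigma> \<le> a / 8" unfolding \<sigma>_def by (rule min.cobounded1)
    show "\<sigma> \<le> p / 2" unfolding \<sigma>_def by (rule min.coboundedI2[OF min.cobounded1])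
    show "\<sigma> \<le> a * p / (8 * (1 + a))" unfolding \<sigma>_def by (rule min.coboundedI2[OF min.cobounded2])
  qed
  have F: "quasi_power (orlicz q \<Phi>)" by (rule quasi_power_orlicz[OF \<Phi> q])
  obtain C0 \<alpha> \<beta> where pb: "power_bounds (orlicz q \<Phi>) C0 \<alpha> \<beta>" using quasi_power_bounds[OF F] .
  note C0 = power_boundsD(1-3)[OF pb]
  have \<beta>: "\<beta> > 0" using C0 by linarith
  define \<epsilon> where "\<epsilon> = min (a / (8 * p)) (a / (2 * \<beta>))"
  have \<epsilon>: "0 < \<epsilon>" "\<epsilon> * p \<le> a / 8" "\<epsilon> * \<beta> \<le> a / 2"
  proof -
    show "0 < \<epsilon>" using a p \<beta> by (simp add: \<epsilon>_def)
    have "\<epsilon> * p \<le> a / (8 * p) * p" using p by (intro mult_right_mono) (auto simp: \<epsilon>_def)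
    then show "\<epsilon> * p \<le> a / 8" using p by simp
    have "\<epsilon> * \<beta> \<le> a / (2 * \<beta>) * \<beta>" using \<beta> by (intro mult_right_mono) (auto simp: \<epsilon>_def)
    then show "\<epsilon> * \<beta> \<le> a / 2" using \<beta> by simp
  qed
  define e where "e = (1 + a - \<sigma>) / p - \<epsilon>"
  have ep: "1 + \<tau> \<le> e * (p - \<sigma>)"
  proof -
    have "e * (p - \<sigma>) = (1 + a - \<sigma>) - (1 + a) * \<sigma> / p + \<sigma> * \<sigma> / p - \<epsilon> * p + \<epsilon> * \<sigma>"
      using p by (simp add: e_def field_simps)
    moreover have "(1 + a) * \<sigma> / p \<le> a / 8"
    proof -
      have "(1 + a) * \<sigma> \<le> (1 + a) * (a * p / (8 * (1 + a)))" using \<sigma> a by (intro mult_left_mono) auto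
      also have "\<dots> = a * p / 8"
      proof -
        have "b * (a * p / (8 * b)) = a * p / 8" if "b \<noteq> 0" for b :: real using that by simp
        then show ?thesis using a by (metis add_pos_pos less_irrefl zero_less_one)
      qed
      finally show ?thesis using p by (simp add: field_simps)
    qed
    moreover have "0 \<le> \<sigma> * \<sigma> / p" "0 \<le> \<epsilon> * \<sigma>" using \<sigma> \<epsilon> p by auto
    ultimately show ?thesis using \<sigma>(2) \<epsilon>(2) a unfolding \<tau>_def by linarith
  qed
  have e0: "e > 0"
  proof (rule ccontr)
    assume "\<not> e > 0"
    then have "e * (p - \<sigma>) \<le> 0" using \<sigma> p by (intro mult_nonpos_nonneg) auto
    then show False using ep a by (simp add: \<tau>_def)
  qed
  have eq: "1 + \<tau> \<le> e * (q - \<sigma>)"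
  proof -
    have "e * (p - \<sigma>) \<le> e * (q - \<sigma>)" using e0 p by (intro mult_left_mono) auto
    then show ?thesis using ep by linarith
  qed
  have \<sigma>a: "\<sigma> \<le> a" using \<sigma>(2) a by linarith
  obtain A1 L1 where A1: "A1 \<ge> 1" and L1: "L1 \<ge> 0"
    and X: "\<And>D W. D \<ge> 1 \<Longrightarrow> power_size A a L D W \<Longrightarrow> critical p \<Psi> D W \<le> A1 * D powr L1"
      "\<And>D W. D \<ge> 1 \<Longrightarrow> power_size A a L D W \<Longrightarrow> D powr (1 + a - \<sigma>) \<le> A1 * critical p \<Psi> D W powr p"
    using critical_size[OF \<Psi> p(1) A \<sigma>(1) \<sigma>a L0] by metis
  obtain A2 L2 where A2: "A2 \<ge> 1" and L2: "L2 \<ge> 0"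
    and Y: "\<And>D W. D \<ge> 1 \<Longrightarrow> power_size A a L D W \<Longrightarrow> critical q \<Phi> D W \<le> A2 * D powr L2"
    using critical_size[OF \<Phi> q A \<sigma>(1) \<sigma>a L0] by metis
  obtain K0 where K0: "K0 > 0" "\<And>D W. D \<ge> 1 \<Longrightarrow> power_size A a L D W \<Longrightarrow> \<Phi> (critical q \<Phi> D W) \<le> K0 * \<Phi> D"
    using critical_compare[OF \<Phi> q A a L0] by metis
  obtain B where B: "B > 0" "\<And>x y. 0 < x \<Longrightarrow> 0 < y \<Longrightarrow> \<Phi> x \<le> B * max (x/y) (y/x) powr \<sigma> * \<Phi> y"
    using class_L_Potter[OF \<Phi> \<sigma>(1)] by auto
  define Ac where "Ac = R * A1 * A2"
  define Lc where "Lc = max (1/\<epsilon>) (max L1 L2)"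
  have Lc: "Lc \<ge> 0" using L1 by (simp add: Lc_def)
  have RA: "1 \<le> R * A1" "1 \<le> R * A2" "1 \<le> A1 * A2" using mult_mono[of 1 R 1 A1] mult_mono[of 1 R 1 A2] mult_mono[of 1 A1 1 A2] R A1 A2 by auto
  have Ac: "Ac \<ge> 1" "R * A1 \<le> Ac" "R * A2 \<le> Ac"
  proof -
    show "R * A1 \<le> Ac" using mult_left_mono[OF A2, of "R * A1"] RA by (simp add: Ac_def)
    then show "Ac \<ge> 1" using RA by linarith
    show "R * A2 \<le> Ac" using mult_left_mono[OF A1, of "R * A2"] RA by (simp add: Ac_def mult_ac)
  qed
  obtain K1 where K1: "K1 > 0" "\<And>x y. 0 \<le> x \<Longrightarrow> 0 \<le> y \<Longrightarrow> x \<le> Ac * max 1 y powr Lc \<Longrightarrow> y \<le> Ac * max 1 x powr Lc \<Longrightarrow> \<Psi> x \<le> K1 * \<Psi> y"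
    using class_L_compare[OF \<Psi> Lc, of Ac] by auto
  obtain K2 where K2: "K2 > 0" "\<And>x y. 0 \<le> x \<Longrightarrow> 0 \<le> y \<Longrightarrow> x \<le> Ac * max 1 y powr Lc \<Longrightarrow> y \<le> Ac * max 1 x powr Lc \<Longrightarrow> \<Phi> x \<le> K2 * \<Phi> y"
    using class_L_compare[OF \<Phi> Lc, of Ac] by auto
  define k1 where "k1 = C0 * (C0 * orlicz q \<Phi> 1) * A"
  define k2 where "k2 = B * R powr (2 * \<sigma>) * K0 * (A1 powr (1/p)) powr (q - \<sigma>)"
  define k3 where "k3 = K2 * R powr (q - p) * K1"
  have o1: "orlicz q \<Phi> 1 > 0" using quasi_power_pos[OF F] by simp
  have k: "k1 > 0" "k2 > 0" "k3 > 0" using C0 o1 A B(1) R K0(1) A1 K1(1) K2(1) by (auto simp: k1_def k2_def k3_def)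
  define K where "K = k1 + k2 + k3"
  have "orlicz q \<Phi> (critical q \<Phi> D V / critical p \<Psi> D W * x) * V \<le> K * (orlicz p \<Psi> x * W + D powr (-1 - \<tau>))"
    if D: "D \<ge> 1" and W: "power_size A a L D W" and V: "power_size A a L D V" and x: "0 \<le> x" "x \<le> R * critical p \<Psi> D W" for D W V x
  proof -
    define X' where "X' = critical p \<Psi> D W"
    define Y' where "Y' = critical q \<Phi> D V"
    define t where "t = x / X'"
    define T where "T = D powr (-1 - \<tau>)"
    have W0: "W > 0" and V0: "V > 0" using W V by (auto simp: power_size_def)
    have pD: "\<Psi> D > 0" "\<Phi> D > 0" using class_L_pos[OF \<Psi>] class_L_pos[OF \<Phi>] D by auto
    have X': "X' > 0" "X' powr p * (W * \<Psi> D) = 1" using critical_powr[OF \<Psi> p(1) _ W0, of D] D by (auto simp: X'_def)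
    have Y': "Y' > 0" "Y' powr q * (V * \<Phi> D) = 1" using critical_powr[OF \<Phi> q _ V0, of D] D by (auto simp: Y'_def)
    have T: "T > 0" using D by (simp add: T_def)
    have t: "0 \<le> t" "t \<le> R" using x X' by (auto simp: t_def X'_def[symmetric] divide_le_eq mult.commute)
    have arg: "Y' / X' * x = t * Y'" by (simp add: t_def)
    have xt: "x = t * X'" using X' by (simp add: t_def)
    have oW: "0 \<le> orlicz p \<Psi> x * W" using class_L_pos[OF \<Psi>, of x] x W0 by (simp add: orlicz_def)
    have fin: "orlicz q \<Phi> (t * Y') * V \<le> K * (orlicz p \<Psi> x * W + T)"
      if "orlicz q \<Phi> (t * Y') * V \<le> k' * S" "0 \<le> k'" "k' \<le> K" "0 \<le> S" "S \<le> orlicz p \<Psi> x * W + T" for k' S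
    proof -
      have "k' * S \<le> K * (orlicz p \<Psi> x * W + T)" using that by (intro mult_mono) auto
      then show ?thesis using that(1) by linarith
    qed
    have "orlicz q \<Phi> (t * Y') * V \<le> K * (orlicz p \<Psi> x * W + T)"
    proof (cases "t * Y' \<le> D powr \<epsilon>")
      case True
      have "orlicz q \<Phi> (t * Y') \<le> C0 * orlicz q \<Phi> (D powr \<epsilon>)"
        using True t Y' by (intro power_bounds_mono[OF pb F]) auto
      also have "orlicz q \<Phi> (D powr \<epsilon>) \<le> C0 * (D powr \<epsilon>) powr \<beta> * orlicz q \<Phi> 1"
        using power_boundsD(5)[OF pb, of "D powr \<epsilon>" 1] D \<epsilon> by (simp add: ge_one_powr_ge_zero)
      finally have "orlicz q \<Phi> (t * Y') \<le> C0 * (C0 * (D powr \<epsilon>) powr \<beta> * orlicz q \<Phi> 1)" using C0 by simp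
      then have "orlicz q \<Phi> (t * Y') * V \<le> C0 * (C0 * (D powr \<epsilon>) powr \<beta> * orlicz q \<Phi> 1) * (A * D powr (-1 - a))"
        using V V0 C0 o1 by (intro mult_mono) (auto simp: power_size_def)
      also have "\<dots> = k1 * (D powr (\<epsilon> * \<beta>) * D powr (-1 - a))" by (simp add: k1_def powr_powr)
      also have "D powr (\<epsilon> * \<beta>) * D powr (-1 - a) = D powr (\<epsilon> * \<beta> + (-1 - a))" by (simp add: powr_add)
      also have "k1 * D powr (\<epsilon> * \<beta> + (-1 - a)) \<le> k1 * T"
        unfolding T_def using k D \<epsilon>(3) by (intro mult_left_mono powr_mono) (auto simp: \<tau>_def)
      finally show ?thesis using k T oW by (intro fin[of k1 T]) (auto simp: K_def)
    next
      case big: False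
      then have tY: "t * Y' > 0" using powr_ge_zero[of D \<epsilon>] by linarith
      then have t0: "t > 0" using Y' by (simp add: zero_less_mult_iff)
      have x0: "x > 0" using t0 X' by (simp add: xt)
      have FV: "orlicz q \<Phi> (t * Y') * V = t powr q * (\<Phi> (t * Y') / \<Phi> D)"
      proof -
        have "Y' powr q * V = 1 / \<Phi> D" using Y'(2) pD by (simp add: field_simps)
        then have "t powr q * \<Phi> (t * Y') * (Y' powr q * V) = t powr q * (\<Phi> (t * Y') / \<Phi> D)" by simp
        then show ?thesis using tY t0 Y' by (simp add: orlicz_def powr_mult mult_ac)
      qed
      show ?thesis
      proof (cases "x \<le> D powr \<epsilon>")
        case True
        \<comment> \<open>\<open>t\<close> may exceed \<open>1\<close>, but not \<open>R\<close>\<close>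
        have mx: "max t (1 / t) powr \<sigma> \<le> R powr (2 * \<sigma>) * t powr (- \<sigma>)"
        proof (cases "1 \<le> t")
          case True
          have "1 / t \<le> 1" using True by simp
          then have "1 / t \<le> t" using True by linarith
          then have "max t (1 / t) = t" by (rule max_absorb1)
          then have "max t (1 / t) powr \<sigma> = t powr (2 * \<sigma>) * t powr (- \<sigma>)" by (simp add: powr_add[symmetric])
          also have "\<dots> \<le> R powr (2 * \<sigma>) * t powr (- \<sigma>)" using t \<sigma> by (intro mult_right_mono powr_mono2) auto
          finally show ?thesis .
        next
          case False
          then have "1 < 1 / t" using t0 by simp
          then have "max t (1 / t) = 1 / t" using False by simp
          then have "max t (1 / t) powr \<sigma> = 1 * t powr (- \<sigma>)" using t0 by (simp add: powr_divide powr_minus_divide)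
          also have "\<dots> \<le> R powr (2 * \<sigma>) * t powr (- \<sigma>)" using R \<sigma> by (intro mult_right_mono ge_one_powr_ge_zero) auto
          finally show ?thesis .
        qed
        have "\<Phi> (t * Y') \<le> B * max t (1 / t) powr \<sigma> * \<Phi> Y'" using B(2)[OF tY Y'(1)] Y'(1) t0 by simp
        also have "\<dots> \<le> B * (R powr (2 * \<sigma>) * t powr (- \<sigma>)) * (K0 * \<Phi> D)"
          using mx B(1) K0(2)[OF D V] class_L_pos[OF \<Phi>, of Y'] Y'(1)
          by (intro mult_mono) (auto simp: Y'_def[symmetric])
        finally have "\<Phi> (t * Y') / \<Phi> D \<le> B * R powr (2 * \<sigma>) * K0 * t powr (- \<sigma>)"
          using pD by (simp add: field_simps)
        then have "orlicz q \<Phi> (t * Y') * V \<le> t powr q * (B * R powr (2 * \<sigma>) * K0 * t powr (- \<sigma>))"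
          unfolding FV by (intro mult_left_mono) auto
        also have "\<dots> = B * R powr (2 * \<sigma>) * K0 * t powr (q - \<sigma>)" using t0 by (simp add: powr_diff powr_minus_divide)
        also have "t powr (q - \<sigma>) \<le> (A1 powr (1/p)) powr (q - \<sigma>) * T"
        proof -
          have "D powr (1 + a - \<sigma>) \<le> A1 * X' powr p" using X(2)[OF D W] by (simp add: X'_def)
          then have "(D powr (1 + a - \<sigma>)) powr (1/p) \<le> (A1 * X' powr p) powr (1/p)" using p by (intro powr_mono2) auto
          then have *: "D powr ((1 + a - \<sigma>) / p) \<le> A1 powr (1/p) * X'" using p A1 X'(1) by (simp add: powr_powr powr_mult)
          have "t * X' \<le> D powr \<epsilon>" using True by (simp add: xt)
          then have "t * X' * D powr ((1 + a - \<sigma>) / p) \<le> D powr \<epsilon> * (A1 powr (1/p) * X')" using * t0 X'(1) by (intro mult_mono) auto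
          then have "t * D powr ((1 + a - \<sigma>) / p) \<le> D powr \<epsilon> * A1 powr (1/p)" using X'(1) by (simp add: field_simps)
          then have "t \<le> A1 powr (1/p) * (D powr \<epsilon> / D powr ((1 + a - \<sigma>) / p))" using D by (simp add: field_simps)
          also have "D powr \<epsilon> / D powr ((1 + a - \<sigma>) / p) = D powr (- e)" by (simp add: e_def powr_diff[symmetric])
          finally have "t powr (q - \<sigma>) \<le> (A1 powr (1/p) * D powr (- e)) powr (q - \<sigma>)" using t \<sigma> p by (intro powr_mono2) auto
          also have "\<dots> = (A1 powr (1/p)) powr (q - \<sigma>) * D powr (- (e * (q - \<sigma>)))" using A1 D by (simp add: powr_mult powr_powr)
          also have "\<dots> \<le> (A1 powr (1/p)) powr (q - \<sigma>) * T"
            unfolding T_def using eq D by (intro mult_left_mono powr_mono) auto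
          finally show ?thesis .
        qed
        finally have "orlicz q \<Phi> (t * Y') * V \<le> B * R powr (2 * \<sigma>) * K0 * ((A1 powr (1/p)) powr (q - \<sigma>) * T)"
          using B(1) K0(1) by (simp add: mult_left_mono)
        then have "orlicz q \<Phi> (t * Y') * V \<le> k2 * T" by (simp add: k2_def mult_ac)
        then show ?thesis using k T oW by (intro fin[of k2 T]) (auto simp: K_def)
      next
        case False
        \<comment> \<open>both \<open>x\<close> and \<open>t * Y'\<close> lie between two powers of \<open>D\<close>\<close>
        have lowx: "D \<le> Ac * max 1 z powr Lc" if "D powr \<epsilon> \<le> z" for z
        proof -
          have "D = (D powr \<epsilon>) powr (1/\<epsilon>)" using D \<epsilon> by (simp add: powr_powr)
          also have "\<dots> \<le> max 1 z powr (1/\<epsilon>)" using that \<epsilon> by (intro powr_mono2) auto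
          also have "\<dots> \<le> max 1 z powr Lc" by (intro powr_mono) (auto simp: Lc_def)
          also have "\<dots> \<le> Ac * max 1 z powr Lc" using mult_right_mono[OF Ac(1), of "max 1 z powr Lc"] by simp
          finally show ?thesis .
        qed
        have upx: "z \<le> Ac * max 1 D powr Lc" if "z \<le> c * D powr l" "c \<le> Ac" "l \<le> Lc" for z c l
        proof -
          have "c * D powr l \<le> Ac * D powr Lc" using that D Ac by (intro mult_mono powr_mono) auto
          then show ?thesis using that(1) D by (simp add: max_def)
        qed
        have "x \<le> R * (A1 * D powr L1)" using x(2) mult_left_mono[OF X(1)[OF D W], of R] R by linarith
        then have "x \<le> (R * A1) * D powr L1" by simp
        then have x_up: "x \<le> Ac * max 1 D powr Lc" by (rule upx) (use Ac in \<open>auto simp: Lc_def\<close>)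
        have "t * Y' \<le> R * (A2 * D powr L2)" using t Y[OF D V] Y' R by (intro mult_mono) (auto simp: Y'_def)
        then have "t * Y' \<le> (R * A2) * D powr L2" by simp
        then have y_up: "t * Y' \<le> Ac * max 1 D powr Lc" by (rule upx) (use Ac in \<open>auto simp: Lc_def\<close>)
        have "\<Psi> D \<le> K1 * \<Psi> x" using K1(2)[of D x] lowx[of x] x_up False x D by simp
        then have 1: "1 \<le> K1 * (\<Psi> x / \<Psi> D)" using pD by (simp add: field_simps)
        have "\<Phi> (t * Y') \<le> K2 * \<Phi> D" using K2(2)[of "t * Y'" D] lowx[of "t * Y'"] y_up big tY D by simp
        then have "\<Phi> (t * Y') / \<Phi> D \<le> K2" using pD by (simp add: field_simps)
        then have "orlicz q \<Phi> (t * Y') * V \<le> t powr q * K2" unfolding FV by (intro mult_left_mono) auto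
        also have "t powr q = t powr (q - p) * t powr p" by (simp add: powr_add[symmetric])
        also have "t powr (q - p) * t powr p * K2 \<le> R powr (q - p) * t powr p * K2"
          using t p K2(1) by (intro mult_right_mono powr_mono2) auto
        also have "\<dots> \<le> R powr (q - p) * t powr p * K2 * (K1 * (\<Psi> x / \<Psi> D))"
          using mult_left_mono[OF 1, of "R powr (q - p) * t powr p * K2"] K2(1) by simp
        also have "\<dots> = k3 * (t powr p * (\<Psi> x / \<Psi> D))" by (simp add: k3_def)
        also have "t powr p * (\<Psi> x / \<Psi> D) = orlicz p \<Psi> x * W"
        proof -
          have "X' powr p * W = 1 / \<Psi> D" using X'(2) pD by (simp add: field_simps)
          then have "t powr p * \<Psi> x * (X' powr p * W) = t powr p * (\<Psi> x / \<Psi> D)" by simp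
          moreover have "x powr p = t powr p * X' powr p" unfolding xt using t0 X' by (simp add: powr_mult)
          ultimately show ?thesis using x0 by (simp add: orlicz_def mult_ac)
        qed
        finally show ?thesis using k T oW by (intro fin[of k3 "orlicz p \<Psi> x * W"]) (auto simp: K_def)
      qed
    qed
    then show ?thesis unfolding T_def by (simp only: arg[unfolded X'_def Y'_def] Y'_def)
  qed
  moreover have "K > 0" "\<tau> > 0" using k a by (auto simp: K_def \<tau>_def)
  ultimately show ?thesis by blast
qed

section \<open>Two weights on a common scale\<close>

lemma power_size_mono:
  assumes "power_size A a L D W" "1 \<le> D" "A \<le> A'" "a' \<le> a" "L \<le> L'" "0 < A"
  shows "power_size A' a' L' D W"
proof -
  have W: "0 < W" "W \<le> A * D powr (-1 - a)" "D powr (- L) \<le> A * W" using assms(1) by (auto simp: power_size_def)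
  have "A * D powr (-1 - a) \<le> A' * D powr (-1 - a')" using assms by (intro mult_mono powr_mono) auto
  moreover have "D powr (- L') \<le> D powr (- L)" using assms by (intro powr_mono) auto
  moreover have "A * W \<le> A' * W" using assms W by (intro mult_right_mono) auto
  ultimately show ?thesis using W unfolding power_size_def by linarith
qed

text \<open>The halving of the tails gives the upper bound with \<open>a = log \<kappa> 2\<close>, and their bounded
  decrease gives the lower one.\<close>

lemma power_size_tail:
  assumes M: "scale_measure \<kappa> c M"
  shows "\<exists>A>0. \<exists>a>0. \<exists>L\<ge>0. \<forall>k. power_size A a L (\<kappa> ^ k) (tail \<kappa> M k / \<kappa> ^ k)"
proof -
  note D = scale_measureD[OF M]
  have \<kappa>: "1 < \<kappa>" "0 < \<kappa>" using D(4) by auto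
  define a where "a = log \<kappa> 2"
  define L where "L = max 0 (- log \<kappa> c) + 1"
  define A where "A = max (tail \<kappa> M 0) (1 / tail \<kappa> M 0)"
  have t0: "tail \<kappa> M 0 > 0" by (rule D(7))
  have A0: "A > 0" using t0 by (simp add: A_def less_max_iff_disj)
  have Dp: "(\<kappa> ^ k) powr e = (\<kappa> powr e) ^ k" for k e using \<kappa> by (simp add: powr_realpow[symmetric] powr_powr mult.commute powr_power)
  have "power_size A a L (\<kappa> ^ k) (tail \<kappa> M k / \<kappa> ^ k)" for k
    unfolding power_size_def
  proof (intro conjI)
    show "0 < tail \<kappa> M k / \<kappa> ^ k" using D(7)[of k] \<kappa> by simp
    have "tail \<kappa> M k \<le> tail \<kappa> M 0 / 2 ^ k" using tail_decay[OF M, of 0 k] by simp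
    then have "tail \<kappa> M k / \<kappa> ^ k \<le> tail \<kappa> M 0 / 2 ^ k / \<kappa> ^ k" using \<kappa> by (intro divide_right_mono) auto
    also have "\<dots> = tail \<kappa> M 0 * (\<kappa> ^ k) powr (-1 - a)"
    proof -
      have "\<kappa> powr (-1 - a) = 1 / (\<kappa> * 2)" using \<kappa> by (simp add: a_def powr_diff powr_minus_divide)
      then show ?thesis by (simp add: Dp power_divide power_mult_distrib mult.commute)
    qed
    also have "\<dots> \<le> A * (\<kappa> ^ k) powr (-1 - a)" by (intro mult_right_mono) (auto simp: A_def)
    finally show "tail \<kappa> M k / \<kappa> ^ k \<le> A * (\<kappa> ^ k) powr (-1 - a)" .
    have "\<kappa> powr (- L) \<le> \<kappa> powr (log \<kappa> c - 1)" using \<kappa> by (intro powr_mono) (auto simp: L_def)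
    also have "\<dots> = c / \<kappa>" using \<kappa> D(5) by (simp add: powr_diff)
    finally have "(\<kappa> powr (- L)) ^ k \<le> (c / \<kappa>) ^ k" by (intro power_mono) auto
    also have "\<dots> = (1 / tail \<kappa> M 0) * (c ^ k * tail \<kappa> M 0) / \<kappa> ^ k" using t0 by (simp add: power_divide)
    also have "\<dots> \<le> (1 / tail \<kappa> M 0) * tail \<kappa> M k / \<kappa> ^ k"
      using tail_decay_lower[OF M, of k 0] t0 \<kappa> by (intro divide_right_mono mult_left_mono) auto
    also have "\<dots> \<le> A * tail \<kappa> M k / \<kappa> ^ k"
      using D(7)[of k] \<kappa> by (intro divide_right_mono mult_right_mono) (auto simp: A_def)
    finally show "(\<kappa> ^ k) powr (- L) \<le> A * (tail \<kappa> M k / \<kappa> ^ k)" by (simp add: Dp)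
  qed
  moreover have "a > 0" "L \<ge> 0" using \<kappa> by (auto simp: a_def L_def)
  ultimately show ?thesis using A0 by blast
qed

lemma critical_orlicz:
  assumes "\<Psi> \<in> class_L" "0 < p" "0 \<le> D" "0 < W"
  shows "orlicz p \<Psi> (critical p \<Psi> D W) * W * \<Psi> D = \<Psi> (critical p \<Psi> D W)"
proof -
  note X = critical_powr[OF assms]
  have "orlicz p \<Psi> (critical p \<Psi> D W) * W * \<Psi> D = (critical p \<Psi> D W powr p * (W * \<Psi> D)) * \<Psi> (critical p \<Psi> D W)"
    using X(1) by (simp add: orlicz_def)
  then show ?thesis unfolding X(2) by simp
qed

text \<open>The critical values \<open>x = X_k\<close> satisfy \<open>F x * W_k \<asymp> 1\<close>, and quasi-powers can
  be inverted.\<close>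

lemma critical_inverse:
  assumes M: "scale_measure \<kappa> c M" and \<Psi>: "\<Psi> \<in> class_L" and p: "0 < p"
  shows "\<exists>C>0. \<exists>\<alpha>>0. \<exists>\<beta>>0. \<forall>k x \<eta>. 0 \<le> x \<longrightarrow> orlicz p \<Psi> x * (tail \<kappa> M k / \<kappa> ^ k) \<le> \<eta> \<longrightarrow>
     x \<le> max ((C * \<eta>) powr \<alpha>) ((C * \<eta>) powr \<beta>) * critical p \<Psi> (\<kappa> ^ k) (tail \<kappa> M k / \<kappa> ^ k)"
    and "\<exists>K>0. \<forall>k. orlicz p \<Psi> (critical p \<Psi> (\<kappa> ^ k) (tail \<kappa> M k / \<kappa> ^ k)) * (tail \<kappa> M k / \<kappa> ^ k) \<le> K"
proof -
  note D = scale_measureD[OF M]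
  obtain A a L where A: "A > 0" "a > 0" "L \<ge> 0" and ps: "\<And>k. power_size A a L (\<kappa> ^ k) (tail \<kappa> M k / \<kappa> ^ k)"
    using power_size_tail[OF M] by auto
  obtain K where K: "K > 0" and cmp: "\<And>D W. D \<ge> 1 \<Longrightarrow> power_size A a L D W \<Longrightarrow>
     \<Psi> (critical p \<Psi> D W) \<le> K * \<Psi> D \<and> \<Psi> D \<le> K * \<Psi> (critical p \<Psi> D W)"
    using critical_compare[OF \<Psi> p A] by metis
  define W where "W k = tail \<kappa> M k / \<kappa> ^ k" for k
  define X where "X k = critical p \<Psi> (\<kappa> ^ k) (W k)" for k
  have D1: "\<kappa> ^ k \<ge> 1" for k using D(4) by (intro one_le_power) auto
  have W0: "W k > 0" for k using ps[of k] by (simp add: power_size_def W_def)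
  have pD: "\<Psi> (\<kappa> ^ k) > 0" for k using class_L_pos[OF \<Psi>] D1[of k] by simp
  have X0: "X k > 0" for k using critical_powr(1)[OF \<Psi> p _ W0] D1[of k] by (simp add: X_def)
  have e: "orlicz p \<Psi> (X k) * W k * \<Psi> (\<kappa> ^ k) = \<Psi> (X k)" for k
    unfolding X_def using D1[of k] by (intro critical_orlicz[OF \<Psi> p _ W0]) auto
  have cmp': "\<Psi> (X k) \<le> K * \<Psi> (\<kappa> ^ k)" "\<Psi> (\<kappa> ^ k) \<le> K * \<Psi> (X k)" for k
    using cmp[OF D1[of k] ps[of k]] unfolding X_def W_def by auto
  have lo: "1 \<le> K * (orlicz p \<Psi> (X k) * W k)" for k
  proof -
    have "1 * \<Psi> (\<kappa> ^ k) \<le> K * (orlicz p \<Psi> (X k) * W k * \<Psi> (\<kappa> ^ k))"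
      using cmp'(2)[of k] unfolding e by simp
    then show ?thesis using pD[of k] by (simp only: mult.assoc[symmetric] mult_le_cancel_right_pos)
  qed
  have hi: "orlicz p \<Psi> (X k) * W k \<le> K" for k
  proof -
    have "orlicz p \<Psi> (X k) * W k * \<Psi> (\<kappa> ^ k) \<le> K * \<Psi> (\<kappa> ^ k)"
      using cmp'(1)[of k] unfolding e by simp
    then show ?thesis using pD[of k] by (simp only: mult_le_cancel_right_pos)
  qed
  then show "\<exists>K>0. \<forall>k. orlicz p \<Psi> (critical p \<Psi> (\<kappa> ^ k) (tail \<kappa> M k / \<kappa> ^ k)) * (tail \<kappa> M k / \<kappa> ^ k) \<le> K"
    using K unfolding X_def W_def by blast
  obtain C \<alpha> \<beta> where C: "C > 0" "\<alpha> > 0" "\<beta> > 0" and inv: "\<And>x X W K \<eta>. 0 \<le> x \<Longrightarrow> 0 < X \<Longrightarrow> 0 < K \<Longrightarrow> 0 < W \<Longrightarrow> 1 \<le> K * (orlicz p \<Psi> X * W) \<Longrightarrow> orlicz p \<Psi> x * W \<le> \<eta> \<Longrightarrow>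
     x \<le> max ((C * K * \<eta>) powr \<alpha>) ((C * K * \<eta>) powr \<beta>) * X"
    using quasi_power_inverse[OF quasi_power_orlicz[OF \<Psi> p]] by metis
  show "\<exists>C>0. \<exists>\<alpha>>0. \<exists>\<beta>>0. \<forall>k x \<eta>. 0 \<le> x \<longrightarrow> orlicz p \<Psi> x * (tail \<kappa> M k / \<kappa> ^ k) \<le> \<eta> \<longrightarrow>
     x \<le> max ((C * \<eta>) powr \<alpha>) ((C * \<eta>) powr \<beta>) * critical p \<Psi> (\<kappa> ^ k) (tail \<kappa> M k / \<kappa> ^ k)"
    using inv[OF _ X0 K W0 lo] C K unfolding X_def W_def
    by (intro exI[of _ "C * K"] exI[of _ \<alpha>] exI[of _ \<beta>] conjI) auto
qed

lemma growth_relative: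
  assumes M: "scale_measure \<kappa> c M" and F: "quasi_power F"
  shows "\<exists>K>0. \<forall>f k a \<eta>. disc_fun f \<longrightarrow> cmod a \<le> rad \<kappa> (k + 1) \<longrightarrow> 0 \<le> \<eta> \<longrightarrow> ann_mass F M \<kappa> f (k + 2) \<le> ennreal \<eta> \<longrightarrow>
    F (cmod (f a)) * (tail \<kappa> M k / \<kappa> ^ k) \<le> K * \<eta>"
proof -
  note D = scale_measureD[OF M]
  obtain K where K: "K > 0" and gr: "\<And>f k a. disc_fun f \<Longrightarrow> cmod a \<le> rad \<kappa> (k + 1) \<Longrightarrow>
    ennreal (F (cmod (f a))) \<le> ennreal (K * \<kappa> ^ k / tail \<kappa> M k) * ann_mass F M \<kappa> f (k + 2)"
    using growth_estimate[OF M F] by metis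
  have "F (cmod (f a)) * (tail \<kappa> M k / \<kappa> ^ k) \<le> K * \<eta>"
    if f: "disc_fun f" and a: "cmod a \<le> rad \<kappa> (k + 1)" and \<eta>: "0 \<le> \<eta>" "ann_mass F M \<kappa> f (k + 2) \<le> ennreal \<eta>" for f k a \<eta>
  proof -
    have pos: "0 < K * \<kappa> ^ k / tail \<kappa> M k" using K D(4) D(7)[of k] by simp
    have "ennreal (F (cmod (f a))) \<le> ennreal (K * \<kappa> ^ k / tail \<kappa> M k) * ennreal \<eta>"
      using gr[OF f a] mult_left_mono[OF \<eta>(2), of "ennreal (K * \<kappa> ^ k / tail \<kappa> M k)"] by (metis order_trans zero_le)
    also have "\<dots> = ennreal (K * \<kappa> ^ k / tail \<kappa> M k * \<eta>)" using pos \<eta> by (intro ennreal_mult[symmetric]) auto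
    finally have "F (cmod (f a)) \<le> K * \<kappa> ^ k / tail \<kappa> M k * \<eta>"
      by (subst (asm) ennreal_le_iff) (rule mult_nonneg_nonneg, use pos \<eta> in auto)
    then have "F (cmod (f a)) * (tail \<kappa> M k / \<kappa> ^ k) \<le> K * \<kappa> ^ k / tail \<kappa> M k * \<eta> * (tail \<kappa> M k / \<kappa> ^ k)"
      using D(4) D(7)[of k] by (intro mult_right_mono) auto
    also have "\<dots> = K * \<eta>" using D(4) D(7)[of k] by simp
    finally show ?thesis .
  qed
  then show ?thesis using K by blast
qed

text \<open>\<open>W k\<close> and \<open>V k\<close> are the masses of Carleson squares at distance
  \<open>\<kappa>^(-k)\<close> from the circle, and \<open>X k\<close> and \<open>Y k\<close> the
  corresponding critical values. The analysis needs only the two measures; the weights enter in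
  \<open>weighted_pair\<close>.\<close>

locale two_weights =
  fixes p q :: real and M N :: "complex measure" and \<Psi> \<Phi> :: "real \<Rightarrow> real" and \<kappa> c1 c2 :: real
  assumes p: "0 < p" "p \<le> q" and \<Psi>: "\<Psi> \<in> class_L" and \<Phi>: "\<Phi> \<in> class_L"
    and M: "scale_measure \<kappa> c1 M" and N: "scale_measure \<kappa> c2 N"
begin

definition W :: "nat \<Rightarrow> real" where "W k = tail \<kappa> M k / \<kappa> ^ k"
definition V :: "nat \<Rightarrow> real" where "V k = tail \<kappa> N k / \<kappa> ^ k"
definition X :: "nat \<Rightarrow> real" where "X k = critical p \<Psi> (\<kappa> ^ k) (W k)"
definition Y :: "nat \<Rightarrow> real" where "Y k = critical q \<Phi> (\<kappa> ^ k) (V k)"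

lemma q: "0 < q" using p by simp

lemma \<kappa>: "2 \<le> \<kappa>" by (rule scale_measureD(4)[OF M])

lemma \<kappa>_power: "1 \<le> \<kappa> ^ k" using \<kappa> by (intro one_le_power) auto

lemma W_pos: "0 < W k" and V_pos: "0 < V k"
  using scale_measureD(7)[OF M, of k] scale_measureD(7)[OF N, of k] \<kappa> by (auto simp: W_def V_def)

lemma X_pos: "0 < X k" and Y_pos: "0 < Y k"
  using critical_powr(1)[OF \<Psi> p(1) _ W_pos] critical_powr(1)[OF \<Phi> q _ V_pos] \<kappa>_power[of k] by (auto simp: X_def Y_def)

lemma quasi_power_\<Psi>: "quasi_power (orlicz p \<Psi>)" and quasi_power_\<Phi>: "quasi_power (orlicz q \<Phi>)"
  by (rule quasi_power_orlicz[OF \<Psi> p(1)], rule quasi_power_orlicz[OF \<Phi> q])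

text \<open>The numbers \<open>X k\<close> measure the growth of the functions of bounded mass.\<close>

lemma norm_growth:
  "\<exists>R\<ge>1. \<forall>f k a. disc_fun f \<longrightarrow> mass (orlicz p \<Psi>) M f \<le> ennreal S \<longrightarrow> cmod a \<le> rad \<kappa> (k + 1) \<longrightarrow> cmod (f a) \<le> R * X k"
proof -
  obtain K where K: "K > 0" and gr: "\<And>f k a \<eta>. disc_fun f \<Longrightarrow> cmod a \<le> rad \<kappa> (k + 1) \<Longrightarrow> 0 \<le> \<eta> \<Longrightarrow>
     ann_mass (orlicz p \<Psi>) M \<kappa> f (k + 2) \<le> ennreal \<eta> \<Longrightarrow> orlicz p \<Psi> (cmod (f a)) * W k \<le> K * \<eta>"
    using growth_relative[OF M quasi_power_\<Psi>] unfolding W_def by metis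
  obtain C \<alpha> \<beta> where C: "C > 0" "\<alpha> > 0" "\<beta> > 0" and inv: "\<And>k x \<eta>. 0 \<le> x \<Longrightarrow> orlicz p \<Psi> x * W k \<le> \<eta> \<Longrightarrow>
     x \<le> max ((C * \<eta>) powr \<alpha>) ((C * \<eta>) powr \<beta>) * X k"
    using critical_inverse(1)[OF M \<Psi> p(1)] unfolding W_def X_def by metis
  define S' where "S' = max 0 S"
  define m where "m = max ((C * (K * S')) powr \<alpha>) ((C * (K * S')) powr \<beta>)"
  have "cmod (f a) \<le> max 1 m * X k" if f: "disc_fun f" "mass (orlicz p \<Psi>) M f \<le> ennreal S" "cmod a \<le> rad \<kappa> (k + 1)" for f k a
  proof -
    have "ann_mass (orlicz p \<Psi>) M \<kappa> f (k + 2) \<le> ennreal S'"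
      using order_trans[OF ann_mass_le_mass f(2)] unfolding S'_def by (metis ennreal_leI max.cobounded2 order_trans)
    then have "orlicz p \<Psi> (cmod (f a)) * W k \<le> K * S'" using f by (intro gr) (auto simp: S'_def)
    then have "cmod (f a) \<le> m * X k" unfolding m_def by (intro inv) auto
    also have "\<dots> \<le> max 1 m * X k" using X_pos[of k] by (intro mult_right_mono) auto
    finally show ?thesis .
  qed
  then show ?thesis by (intro exI[of _ "max 1 m"]) auto
qed

text \<open>The majorant of \<open>f\<close> on a ring becomes one for the target space by the pointwise transfer. The
  errors form a convergent geometric series in \<open>k\<close>; this is why \<open>D powr (-1 -
  \<tau>)\<close> is needed there with an exponent beyond \<open>-1\<close>.\<close>

lemma carleson_majorant:
  "\<exists>K>0. \<exists>\<tau>>0. \<forall>f k. disc_fun f \<longrightarrow> mass (orlicz p \<Psi>) M f \<le> ennreal S \<longrightarrow> (\<exists>G\<in>borel_measurable borel.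
      (\<forall>u r. cmod u = 1 \<longrightarrow> rad \<kappa> k \<le> r \<longrightarrow> r \<le> rad \<kappa> (k + 1) \<longrightarrow>
         ennreal (tail \<kappa> N k * orlicz q \<Phi> (Y k / X k * cmod (f (of_real r * u)))) \<le> G u) \<and>
      (\<forall>u. cmod u = 1 \<longrightarrow> circ_avg G u \<le> ennreal K * (ann_mass (orlicz p \<Psi>) M \<kappa> f (k + 2) + ennreal ((\<kappa> powr (- \<tau>)) ^ k))))"
proof -
  obtain A1 a1 L1 where A1: "A1 > 0" "a1 > 0" "L1 \<ge> 0" "\<And>k. power_size A1 a1 L1 (\<kappa> ^ k) (W k)"
    using power_size_tail[OF M] unfolding W_def by auto
  obtain A2 a2 L2 where A2: "A2 > 0" "a2 > 0" "L2 \<ge> 0" "\<And>k. power_size A2 a2 L2 (\<kappa> ^ k) (V k)"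
    using power_size_tail[OF N] unfolding V_def by auto
  define A where "A = max A1 A2"
  define a where "a = min a1 a2"
  define L where "L = max L1 L2"
  have A: "0 < A" "0 < a" "0 \<le> L" using A1 A2 by (auto simp: A_def a_def L_def)
  have ps: "power_size A a L (\<kappa> ^ k) (W k)" "power_size A a L (\<kappa> ^ k) (V k)" for k
    by (rule power_size_mono[OF A1(4) \<kappa>_power], use A1 in \<open>auto simp: A_def a_def L_def\<close>)
       (rule power_size_mono[OF A2(4) \<kappa>_power], use A2 in \<open>auto simp: A_def a_def L_def\<close>)
  obtain R where R: "R \<ge> 1" and gr: "\<And>f k a. disc_fun f \<Longrightarrow> mass (orlicz p \<Psi>) M f \<le> ennreal S \<Longrightarrow> cmod a \<le> rad \<kappa> (k + 1) \<Longrightarrow> cmod (f a) \<le> R * X k"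
    using norm_growth[of S] by metis
  obtain K \<tau> where K: "K > 0" "\<tau> > 0" and tr: "\<And>D W V x. D \<ge> 1 \<Longrightarrow> power_size A a L D W \<Longrightarrow> power_size A a L D V \<Longrightarrow> 0 \<le> x \<Longrightarrow> x \<le> R * critical p \<Psi> D W \<Longrightarrow>
     orlicz q \<Phi> (critical q \<Phi> D V / critical p \<Psi> D W * x) * V \<le> K * (orlicz p \<Psi> x * W + D powr (-1 - \<tau>))"
    using pointwise_transfer[OF p \<Psi> \<Phi> A R] by metis
  obtain K2 where K2: "K2 > 0" and mj: "\<And>f k. disc_fun f \<Longrightarrow> (\<exists>B\<in>borel_measurable borel.
      (\<forall>u r. cmod u = 1 \<longrightarrow> rad \<kappa> k \<le> r \<longrightarrow> r \<le> rad \<kappa> (k + 1) \<longrightarrow> ennreal (orlicz p \<Psi> (cmod (f (of_real r * u)))) \<le> B u) \<and>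
      (\<forall>u. cmod u = 1 \<longrightarrow> ennreal (tail \<kappa> M k) * circ_avg B u \<le> ennreal K2 * ann_mass (orlicz p \<Psi>) M \<kappa> f (k + 2)))"
    using annulus_majorant[OF M quasi_power_\<Psi>] by metis
  have "\<exists>G\<in>borel_measurable borel.
      (\<forall>u r. cmod u = 1 \<longrightarrow> rad \<kappa> k \<le> r \<longrightarrow> r \<le> rad \<kappa> (k + 1) \<longrightarrow>
         ennreal (tail \<kappa> N k * orlicz q \<Phi> (Y k / X k * cmod (f (of_real r * u)))) \<le> G u) \<and>
      (\<forall>u. cmod u = 1 \<longrightarrow> circ_avg G u \<le> ennreal (K * max 1 K2) * (ann_mass (orlicz p \<Psi>) M \<kappa> f (k + 2) + ennreal ((\<kappa> powr (- \<tau>)) ^ k)))"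
    if f: "disc_fun f" "mass (orlicz p \<Psi>) M f \<le> ennreal S" for f k
  proof -
    obtain B where mB[measurable]: "B \<in> borel_measurable borel"
      and B: "\<And>u r. cmod u = 1 \<Longrightarrow> rad \<kappa> k \<le> r \<Longrightarrow> r \<le> rad \<kappa> (k + 1) \<Longrightarrow> ennreal (orlicz p \<Psi> (cmod (f (of_real r * u)))) \<le> B u"
        "\<And>u. cmod u = 1 \<Longrightarrow> ennreal (tail \<kappa> M k) * circ_avg B u \<le> ennreal K2 * ann_mass (orlicz p \<Psi>) M \<kappa> f (k + 2)"
      using mj[OF f(1), of k] by metis
    define e where "e = (\<kappa> powr (- \<tau>)) ^ k"
    have e: "e = (\<kappa> ^ k) powr (- \<tau>)" using \<kappa> by (simp add: e_def powr_realpow[symmetric] powr_powr mult.commute powr_power)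
    define G where "G u = ennreal K * (ennreal (tail \<kappa> M k) * B u + ennreal e)" for u
    have [measurable]: "G \<in> borel_measurable borel" unfolding G_def[abs_def] by measurable
    have tM: "tail \<kappa> M k > 0" and tN: "tail \<kappa> N k > 0" using scale_measureD(7)[OF M] scale_measureD(7)[OF N] by auto
    have Dk: "\<kappa> ^ k \<ge> 1" by (rule \<kappa>_power)
    have "ennreal (tail \<kappa> N k * orlicz q \<Phi> (Y k / X k * cmod (f (of_real r * u)))) \<le> G u"
      if u: "cmod u = 1" and r: "rad \<kappa> k \<le> r" "r \<le> rad \<kappa> (k + 1)" for u r
    proof -
      define x where "x = cmod (f (of_real r * u))"
      have "0 \<le> r" using r rad_props(1)[OF \<kappa>, of k] by simp
      then have "cmod (of_real r * u) \<le> rad \<kappa> (k + 1)" using r u by (simp add: norm_mult)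
      then have x: "0 \<le> x" "x \<le> R * X k" using gr[OF f] by (auto simp: x_def)
      have "orlicz q \<Phi> (Y k / X k * x) * V k \<le> K * (orlicz p \<Psi> x * W k + (\<kappa> ^ k) powr (-1 - \<tau>))"
        using tr[OF Dk ps[of k] x(1)] x(2) by (simp add: X_def Y_def)
      then have "\<kappa> ^ k * (orlicz q \<Phi> (Y k / X k * x) * V k) \<le> \<kappa> ^ k * (K * (orlicz p \<Psi> x * W k + (\<kappa> ^ k) powr (-1 - \<tau>)))"
        using Dk by (intro mult_left_mono) auto
      also have "\<dots> = K * (tail \<kappa> M k * orlicz p \<Psi> x + e)"
      proof -
        have "\<kappa> ^ k * (\<kappa> ^ k) powr (-1 - \<tau>) = (\<kappa> ^ k) powr 1 * (\<kappa> ^ k) powr (-1 - \<tau>)" using Dk by simp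
        also have "\<dots> = e" unfolding e powr_add[symmetric] by simp
        finally show ?thesis using \<kappa> by (simp add: W_def algebra_simps)
      qed
      also have "\<kappa> ^ k * (orlicz q \<Phi> (Y k / X k * x) * V k) = tail \<kappa> N k * orlicz q \<Phi> (Y k / X k * x)"
        using \<kappa> by (simp add: V_def)
      finally have "ennreal (tail \<kappa> N k * orlicz q \<Phi> (Y k / X k * x)) \<le> ennreal (K * (tail \<kappa> M k * orlicz p \<Psi> x + e))" by (rule ennreal_leI)
      also have "\<dots> = ennreal K * (ennreal (tail \<kappa> M k) * ennreal (orlicz p \<Psi> x) + ennreal e)"
        using K(1) tM quasi_power_nonneg[OF quasi_power_\<Psi> x(1)] by (simp add: ennreal_mult e_def)
      also have "\<dots> \<le> G u" unfolding G_def using B(1)[OF u r] by (intro mult_left_mono add_right_mono) (auto simp: x_def)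
      finally show ?thesis by (simp add: x_def)
    qed
    moreover have "circ_avg G u \<le> ennreal (K * max 1 K2) * (ann_mass (orlicz p \<Psi>) M \<kappa> f (k + 2) + ennreal e)" if u: "cmod u = 1" for u
    proof -
      have "circ_avg G u = ennreal K * (ennreal (tail \<kappa> M k) * circ_avg B u + ennreal e)"
        unfolding G_def[abs_def] by (simp add: circ_avg_cmult circ_avg_add circ_avg_const)
      also have "\<dots> \<le> ennreal K * (ennreal (max 1 K2) * ann_mass (orlicz p \<Psi>) M \<kappa> f (k + 2) + ennreal (max 1 K2) * ennreal e)"
      proof (intro mult_left_mono add_mono)
        have "ennreal K2 * ann_mass (orlicz p \<Psi>) M \<kappa> f (k + 2) \<le> ennreal (max 1 K2) * ann_mass (orlicz p \<Psi>) M \<kappa> f (k + 2)"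
          by (intro mult_right_mono ennreal_leI) auto
        then show "ennreal (tail \<kappa> M k) * circ_avg B u \<le> ennreal (max 1 K2) * ann_mass (orlicz p \<Psi>) M \<kappa> f (k + 2)"
          using B(2)[OF u] by (rule order_trans[rotated])
        have "1 * ennreal e \<le> ennreal (max 1 K2) * ennreal e" by (intro mult_right_mono) (auto simp: ennreal_1[symmetric] simp del: ennreal_1 intro: ennreal_leI)
        then show "ennreal e \<le> ennreal (max 1 K2) * ennreal e" by simp
      qed auto
      also have "\<dots> = (ennreal K * ennreal (max 1 K2)) * (ann_mass (orlicz p \<Psi>) M \<kappa> f (k + 2) + ennreal e)"
        by (simp add: distrib_left mult.assoc)
      also have "ennreal K * ennreal (max 1 K2) = ennreal (K * max 1 K2)" using K by (intro ennreal_mult[symmetric]) auto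
      finally show ?thesis .
    qed
    ultimately show ?thesis unfolding e_def[symmetric] by (intro bexI[of _ G]) auto
  qed
  moreover have "K * max 1 K2 > 0" using K(1) by simp
  ultimately show ?thesis using K(2) by blast
qed

end

section \<open>The integral operator and test functions\<close>

text \<open>The path integral is a primitive of \<open>f * g'\<close>, because the disc is convex.\<close>

lemma integral_op_facts:
  assumes f: "disc_fun f" and g: "g holomorphic_on unit_disc"
  shows "disc_fun (integral_op g f)" "integral_op g f 0 = 0"
    "cmod z < 1 \<Longrightarrow> deriv (integral_op g f) z = f z * deriv g z"
proof -
  have "(\<lambda>z. f z * deriv g z) holomorphic_on unit_disc"
    using f g by (intro holomorphic_intros holomorphic_deriv) (auto simp: disc_fun_def)
  then obtain h where h: "\<And>z. z \<in> unit_disc \<Longrightarrow> (h has_field_derivative f z * deriv g z) (at z within unit_disc)"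
    using holomorphic_convex_primitive'[of unit_disc] by auto
  have eq: "integral_op g f z = h z - h 0" if z: "z \<in> unit_disc" for z
  proof -
    have "path_image (linepath 0 z) \<subseteq> unit_disc"
      using z convex_ball[of "0::complex" 1] by (simp add: closed_segment_subset)
    then have "((\<lambda>z. f z * deriv g z) has_contour_integral (h (pathfinish (linepath 0 z)) - h (pathstart (linepath 0 z)))) (linepath 0 z)"
      by (intro contour_integral_primitive[OF h]) auto
    then show ?thesis using z by (simp add: integral_op_def contour_integral_unique)
  qed
  have d: "(integral_op g f has_field_derivative f z * deriv g z) (at z)" if z: "z \<in> unit_disc" for z
  proof -
    have "(h has_field_derivative f z * deriv g z) (at z)"
      using h[OF z] z at_within_open[OF z] by (metis open_ball)
    then have "((\<lambda>z. h z - h 0) has_field_derivative f z * deriv g z) (at z)"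
      by (auto intro!: derivative_eq_intros)
    then show ?thesis
      by (rule has_field_derivative_transform_within_open[OF _ open_ball z]) (simp add: eq)
  qed
  show "disc_fun (integral_op g f)"
  proof -
    have "\<forall>z\<in>unit_disc. \<exists>f'. (integral_op g f has_field_derivative f') (at z)" using d by blast
    then show ?thesis unfolding disc_fun_def by (simp add: holomorphic_on_open integral_op_def)
  qed
  show "integral_op g f 0 = 0" by (simp add: eq)
  show "deriv (integral_op g f) z = f z * deriv g z" if "cmod z < 1" using d[of z] that by (auto intro: DERIV_imp_deriv)
qed

text \<open>For choosing, in each direction, a point of the ring where \<open>|f|\<close> is largest.\<close>

lemma radial_max_attained:
  assumes f: "disc_fun f" and \<kappa>: "2 \<le> \<kappa>" and u: "cmod u = 1"
  shows "\<exists>r0. rad \<kappa> k \<le> r0 \<and> r0 \<le> rad \<kappa> (k + 1) \<and>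
    (\<forall>r. rad \<kappa> k \<le> r \<longrightarrow> r \<le> rad \<kappa> (k + 1) \<longrightarrow> cmod (f (of_real r * u)) \<le> cmod (f (of_real r0 * u)))"
proof -
  have "continuous_on {rad \<kappa> k..rad \<kappa> (k + 1)} (f \<circ> (\<lambda>r. of_real r * u))"
  proof (rule continuous_on_compose)
    have "(\<lambda>r. of_real r * u) ` {rad \<kappa> k..rad \<kappa> (k + 1)} \<subseteq> unit_disc"
      using u rad_props(1,2)[OF \<kappa>] by (auto simp: norm_mult intro: order_le_less_trans) (metis abs_of_nonneg order_le_less_trans order_trans)
    then show "continuous_on ((\<lambda>r. of_real r * u) ` {rad \<kappa> k..rad \<kappa> (k + 1)}) f"
      using f by (auto simp: disc_fun_def intro: continuous_on_subset holomorphic_on_imp_continuous_on)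
  qed (intro continuous_intros)
  then have "continuous_on {rad \<kappa> k..rad \<kappa> (k + 1)} (\<lambda>r. cmod (f (of_real r * u)))"
    by (auto simp: o_def intro: continuous_intros)
  moreover have "{rad \<kappa> k..rad \<kappa> (k + 1)} \<noteq> {}" using rad_mono[OF \<kappa>, of k "k + 1"] by simp
  ultimately have "\<exists>r0\<in>{rad \<kappa> k..rad \<kappa> (k + 1)}. \<forall>r\<in>{rad \<kappa> k..rad \<kappa> (k + 1)}. cmod (f (of_real r * u)) \<le> cmod (f (of_real r0 * u))"
    by (intro continuous_attains_sup) auto
  then show ?thesis by auto
qed

lemma ennreal_suminf_shift_le: "(\<Sum>k. f (k + n)) \<le> (\<Sum>k. f k :: ennreal)"
proof (rule suminf_le_const)
  fix m
  have "(\<Sum>k<m. f (k + n)) = sum f {n..<n + m}"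
    by (rule sum.reindex_bij_witness[of _ "\<lambda>k. k - n" "\<lambda>k. k + n"]) auto
  also have "\<dots> \<le> (\<Sum>k. f k)" by (intro sum_le_suminf) auto
  finally show "(\<Sum>k<m. f (k + n)) \<le> (\<Sum>k. f k)" .
qed auto

text \<open>On the circle through \<open>z\<close> the integrand is a multiple of the Poisson kernel with pole \<open>a *
  cnj z\<close>, whose mean is \<open>1\<close>.\<close>

lemma circ_avg_inverse_square:
  assumes a: "cmod a < 1" and z: "cmod z \<le> 1"
  shows "circ_avg (\<lambda>w. ennreal (1 / (cmod (1 - cnj a * w))\<^sup>2)) z = ennreal (1 / (1 - (cmod (a * z))\<^sup>2))"
proof -
  define b where "b = a * cnj z"
  have "cmod b \<le> cmod a * 1" using mult_left_mono[OF z norm_ge_zero[of a]] by (simp add: b_def norm_mult)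
  then have b: "cmod b < 1" using a by simp
  have b2: "1 - (cmod b)\<^sup>2 > 0" using b by (simp add: abs_square_less_1)
  have cb: "cmod b = cmod (a * z)" by (simp add: b_def norm_mult)
  have "circ_avg (\<lambda>w. ennreal (1 / (cmod (1 - cnj a * w))\<^sup>2)) z = circ_avg (\<lambda>w. ennreal (1 / (1 - (cmod b)\<^sup>2)) * ennreal (poisson b w)) 1"
    unfolding circ_avg_def
  proof (rule nn_integral_cong)
    fix t
    have "cmod (1 - cnj a * (z * ecirc t)) = cmod (1 - cnj b * ecirc t)" by (simp add: b_def mult_ac)
    also have "\<dots> = cmod (ecirc t - b)" by (rule cmod_one_minus_cnj_unit) simp
    finally have "1 / (cmod (1 - cnj a * (z * ecirc t)))\<^sup>2 = 1 / (1 - (cmod b)\<^sup>2) * poisson b (ecirc t)"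
      using b2 by (simp add: poisson_def)
    then have "ennreal (1 / (cmod (1 - cnj a * (z * ecirc t)))\<^sup>2) = ennreal (1 / (1 - (cmod b)\<^sup>2) * poisson b (ecirc t))" by (simp only:)
    also have "\<dots> = ennreal (1 / (1 - (cmod b)\<^sup>2)) * ennreal (poisson b (ecirc t))"
      by (rule ennreal_mult') (use b2 in simp)
    finally have "ennreal (1 / (cmod (1 - cnj a * (z * ecirc t)))\<^sup>2) = ennreal (1 / (1 - (cmod b)\<^sup>2)) * ennreal (poisson b (ecirc t))" .
    then show "ennreal (1 / (cmod (1 - cnj a * (z * ecirc t)))\<^sup>2) * indicator {0..1} t
      = ennreal (1 / (1 - (cmod b)\<^sup>2)) * ennreal (poisson b (1 * ecirc t)) * indicator {0..1} t" by simp
  qed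
  also have "\<dots> = ennreal (1 / (1 - (cmod b)\<^sup>2)) * circ_avg (\<lambda>w. ennreal (poisson b w)) 1"
    by (rule circ_avg_cmult) measurable
  also have "circ_avg (\<lambda>w. ennreal (poisson b w)) 1 = 1" using b by (intro circ_avg_poisson) simp
  finally show ?thesis by (simp add: cb)
qed

lemma two_sided_geometric:
  "(\<Sum>j. ennreal ((1/2) ^ (k - j + (j - k)))) \<le> ennreal 4"
proof -
  define h where "h j = ennreal ((1/2) ^ (k - j + (j - k)))" for j
  have "(\<lambda>j. (1/2::real) ^ j) sums (1 / (1 - 1/2))" by (intro geometric_sums) simp
  then have "(\<Sum>j. ennreal ((1/2) ^ j)) = ennreal (1 / (1 - 1/2))" by (rule suminf_ennreal_eq[rotated]) simp
  moreover have "1 / (1 - 1/2) = (2::real)" by simp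
  moreover have "h (j + k) = ennreal ((1/2) ^ j)" for j by (simp add: h_def)
  ultimately have 1: "(\<Sum>j. h (j + k)) = ennreal 2" by (simp only:)
  have "(\<Sum>j<k. (1/2::real) ^ (k - j + (j - k))) = (\<Sum>j<k. (1/2) ^ Suc j)"
    by (rule sum.reindex_bij_witness[of _ "\<lambda>j. k - Suc j" "\<lambda>j. k - Suc j"])
       (auto simp: Suc_diff_Suc simp del: power_Suc)
  also have "\<dots> \<le> (\<Sum>j<k. (1/2) ^ j)" by (intro sum_mono) simp
  also have "\<dots> \<le> (\<Sum>j. (1/2::real) ^ j)" by (intro sum_le_suminf summable_geometric) auto
  also have "\<dots> = 1 / (1 - 1/2)" by (rule suminf_geometric) simp
  finally have "(\<Sum>j<k. (1/2::real) ^ (k - j + (j - k))) \<le> 2" by simp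
  moreover have "(\<Sum>j<k. h j) = ennreal (\<Sum>j<k. (1/2) ^ (k - j + (j - k)))" unfolding h_def by (rule sum_ennreal) simp
  ultimately have 2: "(\<Sum>j<k. h j) \<le> ennreal 2" using ennreal_leI by metis
  have "(\<Sum>j. h j) = (\<Sum>j. h (j + k)) + (\<Sum>j<k. h j)" by (rule suminf_offset[OF summableI])
  also have "\<dots> \<le> ennreal 2 + ennreal 2" unfolding 1 by (rule add_left_mono[OF 2])
  also have "\<dots> = ennreal 4" by (subst ennreal_plus[symmetric]) simp_all
  finally show ?thesis by (simp only: h_def)
qed

context two_weights
begin

text \<open>The rings from \<open>k0\<close> on are handled by \<open>carleson_majorant\<close> and contribute in terms of
  \<open>\<epsilon>\<close>; on the finitely many others \<open>f\<close> is bounded by \<open>s\<close>. The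
  sufficiency of the boundedness condition is the case \<open>k0 = 0\<close>, and compactness uses large
  \<open>k0\<close> with small \<open>\<epsilon>\<close> and \<open>s\<close>.\<close>

lemma operator_estimate:
  "\<exists>C>0. \<exists>\<alpha>>0. \<exists>\<beta>>0. \<forall>f h d \<epsilon> k0 s m. disc_fun f \<longrightarrow> mass (orlicz p \<Psi>) M f \<le> ennreal S \<longrightarrow> disc_fun h \<longrightarrow> h 0 = 0 \<longrightarrow>
     (\<forall>z. cmod z < 1 \<longrightarrow> deriv h z = f z * d z) \<longrightarrow> 0 \<le> \<epsilon> \<longrightarrow>
     (\<forall>k z. k0 \<le> k \<longrightarrow> rad \<kappa> k \<le> cmod z \<longrightarrow> cmod z \<le> rad \<kappa> (k + 1) \<longrightarrow> cmod (d z) \<le> \<kappa> ^ k * (\<epsilon> * (Y k / X k))) \<longrightarrow>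
     (\<forall>k z. k < k0 \<longrightarrow> rad \<kappa> k \<le> cmod z \<longrightarrow> cmod z \<le> rad \<kappa> (k + 1) \<longrightarrow> cmod (d z) \<le> \<kappa> ^ k * m k \<and> cmod (f z) \<le> s) \<longrightarrow>
     (\<forall>k. 0 \<le> m k) \<longrightarrow> 0 \<le> s \<longrightarrow>
     mass (orlicz q \<Phi>) N h \<le> ennreal C * ((\<Sum>k<k0. ennreal (tail \<kappa> N k * orlicz q \<Phi> (m k * s))) + ennreal (max (\<epsilon> powr \<alpha>) (\<epsilon> powr \<beta>)))"
proof -
  define F where "F = orlicz q \<Phi>"
  have F: "quasi_power F" unfolding F_def by (rule quasi_power_\<Phi>)
  obtain Cf \<alpha> \<beta> where Cf: "Cf \<ge> 1" "\<alpha> > 0" "\<beta> > 0"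
      and sc: "\<And>t x. 0 \<le> t \<Longrightarrow> 0 \<le> x \<Longrightarrow> F (t * x) \<le> Cf * max (t powr \<alpha>) (t powr \<beta>) * F x"
    using F unfolding quasi_power_def by auto
  obtain K1 where K1: "K1 > 0" and area: "\<And>h y G \<gamma>. disc_fun h \<Longrightarrow> h 0 = 0 \<Longrightarrow> (\<forall>u k. 0 \<le> y u k) \<Longrightarrow>
     (\<forall>u k r. cmod u = 1 \<longrightarrow> rad \<kappa> k \<le> r \<longrightarrow> r \<le> rad \<kappa> (k + 1) \<longrightarrow> cmod (deriv h (of_real r * u)) \<le> \<kappa> ^ k * y u k) \<Longrightarrow>
     (\<forall>k. G k \<in> borel_measurable borel) \<Longrightarrow>
     (\<forall>u k. cmod u = 1 \<longrightarrow> ennreal (tail \<kappa> N k * F (y u k)) \<le> G k u) \<Longrightarrow>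
     (\<forall>u k. cmod u = 1 \<longrightarrow> circ_avg (G k) u \<le> \<gamma> k) \<Longrightarrow>
     mass F N h \<le> ennreal K1 * (\<Sum>k. \<gamma> k)"
    using area_estimate[OF N F] by metis
  obtain Kc \<tau> where Kc: "Kc > 0" "\<tau> > 0" and maj: "\<And>f k. disc_fun f \<Longrightarrow> mass (orlicz p \<Psi>) M f \<le> ennreal S \<Longrightarrow> (\<exists>G\<in>borel_measurable borel.
      (\<forall>u r. cmod u = 1 \<longrightarrow> rad \<kappa> k \<le> r \<longrightarrow> r \<le> rad \<kappa> (k + 1) \<longrightarrow>
         ennreal (tail \<kappa> N k * F (Y k / X k * cmod (f (of_real r * u)))) \<le> G u) \<and>
      (\<forall>u. cmod u = 1 \<longrightarrow> circ_avg G u \<le> ennreal Kc * (ann_mass (orlicz p \<Psi>) M \<kappa> f (k + 2) + ennreal ((\<kappa> powr (- \<tau>)) ^ k))))"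
    using carleson_majorant[of S] unfolding F_def by metis
  define \<rho> where "\<rho> = \<kappa> powr (- \<tau>)"
  have \<rho>: "0 \<le> \<rho>" "\<rho> < 1" using \<kappa> Kc by (auto simp: \<rho>_def powr_less_one)
  define S' where "S' = max 0 S + 1 / (1 - \<rho>)"
  have S': "S' > 0" using \<rho> by (auto simp: S'_def intro: add_nonneg_pos)
  define C where "C = K1 * max 1 (Cf * Kc * S')"
  have main: "mass F N h \<le> ennreal C * ((\<Sum>k<k0. ennreal (tail \<kappa> N k * F (m k * s))) + ennreal (max (\<epsilon> powr \<alpha>) (\<epsilon> powr \<beta>)))"
    if f: "disc_fun f" "mass (orlicz p \<Psi>) M f \<le> ennreal S" and h: "disc_fun h" "h 0 = 0"
      and dh: "\<forall>z. cmod z < 1 \<longrightarrow> deriv h z = f z * d z" and \<epsilon>: "0 \<le> \<epsilon>"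
      and large: "\<forall>k z. k0 \<le> k \<longrightarrow> rad \<kappa> k \<le> cmod z \<longrightarrow> cmod z \<le> rad \<kappa> (k + 1) \<longrightarrow> cmod (d z) \<le> \<kappa> ^ k * (\<epsilon> * (Y k / X k))"
      and small: "\<forall>k z. k < k0 \<longrightarrow> rad \<kappa> k \<le> cmod z \<longrightarrow> cmod z \<le> rad \<kappa> (k + 1) \<longrightarrow> cmod (d z) \<le> \<kappa> ^ k * m k \<and> cmod (f z) \<le> s"
      and m: "\<forall>k. 0 \<le> m k" and s: "0 \<le> s" for f h d \<epsilon> k0 s m
  proof -
    define e where "e = max (\<epsilon> powr \<alpha>) (\<epsilon> powr \<beta>)"
    have e0: "0 \<le> e" by (simp add: e_def le_max_iff_disj)
    define Q where "Q k G \<longleftrightarrow> G \<in> borel_measurable borel \<and>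
      (\<forall>u r. cmod u = 1 \<longrightarrow> rad \<kappa> k \<le> r \<longrightarrow> r \<le> rad \<kappa> (k + 1) \<longrightarrow>
         ennreal (tail \<kappa> N k * F (Y k / X k * cmod (f (of_real r * u)))) \<le> G u) \<and>
      (\<forall>u. cmod u = 1 \<longrightarrow> circ_avg G u \<le> ennreal Kc * (ann_mass (orlicz p \<Psi>) M \<kappa> f (k + 2) + ennreal (\<rho> ^ k)))" for k G
    have "\<exists>G. Q k G" for k
      using maj[OF f, of k] unfolding Q_def \<rho>_def Bex_def .
    then obtain G where "\<And>k. Q k (G k)" using choice[of Q] by blast
    then have mG: "\<And>k. G k \<in> borel_measurable borel"
      and G: "\<And>k u r. cmod u = 1 \<Longrightarrow> rad \<kappa> k \<le> r \<Longrightarrow> r \<le> rad \<kappa> (k + 1) \<Longrightarrow>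
         ennreal (tail \<kappa> N k * F (Y k / X k * cmod (f (of_real r * u)))) \<le> G k u"
      and Gavg: "\<And>k u. cmod u = 1 \<Longrightarrow> circ_avg (G k) u \<le> ennreal Kc * (ann_mass (orlicz p \<Psi>) M \<kappa> f (k + 2) + ennreal (\<rho> ^ k))"
      unfolding Q_def by auto
    note mG[measurable]
    define r0 where "r0 u k = (SOME r0. rad \<kappa> k \<le> r0 \<and> r0 \<le> rad \<kappa> (k + 1) \<and>
       (\<forall>r. rad \<kappa> k \<le> r \<longrightarrow> r \<le> rad \<kappa> (k + 1) \<longrightarrow> cmod (f (of_real r * u)) \<le> cmod (f (of_real r0 * u))))" for u k
    have r0: "\<And>u k. cmod u = 1 \<Longrightarrow> rad \<kappa> k \<le> r0 u k" "\<And>u k. cmod u = 1 \<Longrightarrow> r0 u k \<le> rad \<kappa> (k + 1)"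
      "\<And>u k r. cmod u = 1 \<Longrightarrow> rad \<kappa> k \<le> r \<Longrightarrow> r \<le> rad \<kappa> (k + 1) \<Longrightarrow> cmod (f (of_real r * u)) \<le> cmod (f (of_real (r0 u k) * u))"
      using someI_ex[OF radial_max_attained[OF f(1) \<kappa>], folded r0_def] by auto
    define y where "y u k = (if k < k0 then m k * s else \<epsilon> * (Y k / X k * cmod (f (of_real (r0 u k) * u))))" for u k
    define G' where "G' k u = (if k < k0 then ennreal (tail \<kappa> N k * F (m k * s)) else ennreal (Cf * e) * G k u)" for k u
    define \<gamma> where "\<gamma> k = (if k < k0 then ennreal (tail \<kappa> N k * F (m k * s)) else ennreal (Cf * e) * (ennreal Kc * (ann_mass (orlicz p \<Psi>) M \<kappa> f (k + 2) + ennreal (\<rho> ^ k))))" for k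
    have b0: "0 \<le> Y k / X k" for k using X_pos[of k] Y_pos[of k] by simp
    have "mass F N h \<le> ennreal K1 * (\<Sum>k. \<gamma> k)"
    proof (rule area[of h y G'])
      show "\<forall>u k. 0 \<le> y u k"
      proof (intro allI)
        fix u k
        have "0 \<le> \<epsilon> * (Y k / X k * cmod (f (of_real (r0 u k) * u)))"
          by (intro mult_nonneg_nonneg \<epsilon> b0 norm_ge_zero)
        then show "0 \<le> y u k" using m s by (simp add: y_def)
      qed
      show "\<forall>u k r. cmod u = 1 \<longrightarrow> rad \<kappa> k \<le> r \<longrightarrow> r \<le> rad \<kappa> (k + 1) \<longrightarrow> cmod (deriv h (of_real r * u)) \<le> \<kappa> ^ k * y u k"
      proof (intro allI impI)
        fix u k r assume u: "cmod u = 1" and r: "rad \<kappa> k \<le> r" "r \<le> rad \<kappa> (k + 1)"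
        define z where "z = of_real r * u"
        have "0 \<le> r" using r rad_props(1)[OF \<kappa>, of k] by simp
        then have cz: "cmod z = r" using u by (simp add: z_def norm_mult)
        have "cmod z < 1" using cz r rad_props(2)[OF \<kappa>, of "k + 1"] by simp
        then have dz: "cmod (deriv h z) = cmod (f z) * cmod (d z)" using dh by (simp add: norm_mult)
        show "cmod (deriv h (of_real r * u)) \<le> \<kappa> ^ k * y u k"
        proof (cases "k < k0")
          case True
          then have *: "cmod (d z) \<le> \<kappa> ^ k * m k" "cmod (f z) \<le> s" using small r cz by auto
          then have "cmod (f z) * cmod (d z) \<le> s * (\<kappa> ^ k * m k)" using s by (intro mult_mono) auto
          then show ?thesis using True unfolding z_def[symmetric] dz by (simp add: y_def mult_ac)
        next
          case False
          then have "cmod (d z) \<le> \<kappa> ^ k * (\<epsilon> * (Y k / X k))" using large r cz by auto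
          moreover have "cmod (f z) \<le> cmod (f (of_real (r0 u k) * u))" using r0(3)[OF u r] by (simp add: z_def)
          ultimately have "cmod (f z) * cmod (d z) \<le> cmod (f (of_real (r0 u k) * u)) * (\<kappa> ^ k * (\<epsilon> * (Y k / X k)))"
            by (intro mult_mono) auto
          then show ?thesis using False unfolding z_def[symmetric] dz by (simp add: y_def mult_ac)
        qed
      qed
      show "\<forall>k. G' k \<in> borel_measurable borel" unfolding G'_def by measurable
      show "\<forall>u k. cmod u = 1 \<longrightarrow> ennreal (tail \<kappa> N k * F (y u k)) \<le> G' k u"
      proof (intro allI impI)
        fix u k assume u: "cmod u = (1::real)"
        show "ennreal (tail \<kappa> N k * F (y u k)) \<le> G' k u"
        proof (cases "k < k0")
          case False
          define x where "x = Y k / X k * cmod (f (of_real (r0 u k) * u))"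
          have x: "0 \<le> x" unfolding x_def by (intro mult_nonneg_nonneg b0 norm_ge_zero)
          have "tail \<kappa> N k * F (\<epsilon> * x) \<le> tail \<kappa> N k * (Cf * e * F x)"
            using sc[OF \<epsilon> x] scale_measureD(7)[OF N, of k] unfolding e_def by (intro mult_left_mono) auto
          then have "ennreal (tail \<kappa> N k * F (\<epsilon> * x)) \<le> ennreal (Cf * e * (tail \<kappa> N k * F x))" by (intro ennreal_leI) (simp add: mult_ac)
          also have "\<dots> = ennreal (Cf * e) * ennreal (tail \<kappa> N k * F x)" using Cf e0 by (intro ennreal_mult') auto
          also have "\<dots> \<le> ennreal (Cf * e) * G k u" using G[OF u r0(1,2)[OF u]] unfolding x_def by (intro mult_left_mono) auto
          finally show ?thesis using False by (simp add: y_def G'_def x_def)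
        qed (simp add: y_def G'_def)
      qed
      show "\<forall>u k. cmod u = 1 \<longrightarrow> circ_avg (G' k) u \<le> \<gamma> k"
      proof (intro allI impI)
        fix u k assume u: "cmod u = (1::real)"
        show "circ_avg (G' k) u \<le> \<gamma> k"
        proof (cases "k < k0")
          case True then show ?thesis by (simp add: G'_def[abs_def] \<gamma>_def circ_avg_const)
        next
          case False
          have "circ_avg (G' k) u = ennreal (Cf * e) * circ_avg (G k) u"
            using False unfolding G'_def[abs_def] by (simp add: circ_avg_cmult)
          then show ?thesis using False Gavg[OF u, of k] by (simp add: \<gamma>_def mult_left_mono)
        qed
      qed
    qed (rule h)+
    also have "(\<Sum>k. \<gamma> k) \<le> (\<Sum>k<k0. ennreal (tail \<kappa> N k * F (m k * s))) + ennreal (Cf * Kc * S' * e)"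
    proof -
      define \<gamma>1 where "\<gamma>1 k = (if k < k0 then ennreal (tail \<kappa> N k * F (m k * s)) else 0)" for k
      define \<gamma>2 where "\<gamma>2 k = ennreal (Cf * e * Kc) * (ann_mass (orlicz p \<Psi>) M \<kappa> f (k + 2) + ennreal (\<rho> ^ k))" for k
      have "(\<Sum>k. \<gamma> k) \<le> (\<Sum>k. \<gamma>1 k + \<gamma>2 k)"
      proof (rule suminf_le)
        fix k
        have "ennreal (Cf * e) * ennreal Kc = ennreal (Cf * e * Kc)" using Cf e0 Kc by (intro ennreal_mult[symmetric]) auto
        then show "\<gamma> k \<le> \<gamma>1 k + \<gamma>2 k" by (simp add: \<gamma>_def \<gamma>1_def \<gamma>2_def mult.assoc[symmetric])
      qed auto
      also have "\<dots> = (\<Sum>k. \<gamma>1 k) + (\<Sum>k. \<gamma>2 k)" by (intro suminf_add[symmetric]) auto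
      also have "(\<Sum>k. \<gamma>1 k) = (\<Sum>k<k0. \<gamma>1 k)" by (rule suminf_finite) (auto simp: \<gamma>1_def)
      also have "\<dots> = (\<Sum>k<k0. ennreal (tail \<kappa> N k * F (m k * s)))" by (simp add: \<gamma>1_def)
      also have "(\<Sum>k. \<gamma>2 k) \<le> ennreal (Cf * Kc * S' * e)"
      proof -
        have "(\<Sum>k. \<gamma>2 k) = ennreal (Cf * e * Kc) * ((\<Sum>k. ann_mass (orlicz p \<Psi>) M \<kappa> f (k + 2)) + (\<Sum>k. ennreal (\<rho> ^ k)))"
          unfolding \<gamma>2_def by (simp add: suminf_add[symmetric])
        also have "\<dots> \<le> ennreal (Cf * e * Kc) * (ennreal (max 0 S) + ennreal (1 / (1 - \<rho>)))"
        proof (intro mult_left_mono add_mono)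
          have "(\<Sum>k. ann_mass (orlicz p \<Psi>) M \<kappa> f (k + 2)) \<le> mass (orlicz p \<Psi>) M f"
            using ennreal_suminf_shift_le[of "ann_mass (orlicz p \<Psi>) M \<kappa> f" 2] suminf_ann_mass[OF M quasi_power_\<Psi> f(1)] by simp
          also have "\<dots> \<le> ennreal (max 0 S)" using f(2) by (metis ennreal_leI max.cobounded2 order_trans)
          finally show "(\<Sum>k. ann_mass (orlicz p \<Psi>) M \<kappa> f (k + 2)) \<le> ennreal (max 0 S)" .
          have "(\<lambda>k. \<rho> ^ k) sums (1 / (1 - \<rho>))" using \<rho> by (intro geometric_sums) auto
          then have "(\<Sum>k. ennreal (\<rho> ^ k)) = ennreal (1 / (1 - \<rho>))"
            by (rule suminf_ennreal_eq[rotated]) (use \<rho> in simp)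
          then show "(\<Sum>k. ennreal (\<rho> ^ k)) \<le> ennreal (1 / (1 - \<rho>))" by simp
        qed auto
        also have "ennreal (max 0 S) + ennreal (1 / (1 - \<rho>)) = ennreal S'" unfolding S'_def using \<rho> by (intro ennreal_plus[symmetric]) auto
        also have "ennreal (Cf * e * Kc) * ennreal S' = ennreal (Cf * Kc * S' * e)"
          using Cf e0 Kc S' by (subst ennreal_mult[symmetric]) (auto simp: mult_ac)
        finally show ?thesis .
      qed
      finally show ?thesis by (simp add: add_left_mono)
    qed
    also have "ennreal K1 * ((\<Sum>k<k0. ennreal (tail \<kappa> N k * F (m k * s))) + ennreal (Cf * Kc * S' * e))
      \<le> ennreal K1 * (ennreal (max 1 (Cf * Kc * S')) * (\<Sum>k<k0. ennreal (tail \<kappa> N k * F (m k * s))) + ennreal (max 1 (Cf * Kc * S')) * ennreal e)"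
    proof (intro mult_left_mono add_mono)
      have "1 \<le> ennreal (max 1 (Cf * Kc * S'))" by (metis ennreal_1 ennreal_leI max.cobounded1)
      then have "1 * (\<Sum>k<k0. ennreal (tail \<kappa> N k * F (m k * s))) \<le> ennreal (max 1 (Cf * Kc * S')) * (\<Sum>k<k0. ennreal (tail \<kappa> N k * F (m k * s)))"
        by (rule mult_right_mono) simp
      then show "(\<Sum>k<k0. ennreal (tail \<kappa> N k * F (m k * s))) \<le> ennreal (max 1 (Cf * Kc * S')) * (\<Sum>k<k0. ennreal (tail \<kappa> N k * F (m k * s)))" by simp
      have "ennreal (Cf * Kc * S' * e) = ennreal (Cf * Kc * S') * ennreal e" using e0 Cf Kc S' by (intro ennreal_mult) auto
      also have "\<dots> \<le> ennreal (max 1 (Cf * Kc * S')) * ennreal e" by (intro mult_right_mono ennreal_leI) auto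
      finally show "ennreal (Cf * Kc * S' * e) \<le> ennreal (max 1 (Cf * Kc * S')) * ennreal e" .
    qed auto
    also have "\<dots> = ennreal C * ((\<Sum>k<k0. ennreal (tail \<kappa> N k * F (m k * s))) + ennreal e)"
    proof -
      have "ennreal C = ennreal K1 * ennreal (max 1 (Cf * Kc * S'))" unfolding C_def using K1 by (intro ennreal_mult) auto
      then show ?thesis by (simp add: distrib_left mult.assoc)
    qed
    finally show ?thesis by (simp add: e_def mult_left_mono)
  qed
  have "C > 0" using K1 by (simp add: C_def)
  show ?thesis
    unfolding F_def[symmetric]
    by (rule exI[of _ C], rule conjI[OF \<open>C > 0\<close>], rule exI[of _ \<alpha>], rule conjI[OF Cf(2)], rule exI[of _ \<beta>], rule conjI[OF Cf(3)],
        intro allI impI, rule main; assumption)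
qed

text \<open>The functions \<open>X_k * ((1 - |a|) / (1 - cnj a * z)) ^ n\<close> with large \<open>n\<close>: their mass
  concentrates on the rings near \<open>a\<close>: towards the circle the tails halve, and towards the origin
  the powers of \<open>(1 - |a|) / |1 - cnj a * z|\<close> beat the growth of the tails.\<close>

lemma test_function:
  "\<exists>K>0. \<exists>\<delta>>0. \<forall>k a. rad \<kappa> k \<le> cmod a \<longrightarrow> cmod a \<le> rad \<kappa> (k + 1) \<longrightarrow>
     (\<exists>f. disc_fun f \<and> mass (orlicz p \<Psi>) M f \<le> ennreal K \<and> \<delta> * X k \<le> cmod (f a))"
proof -
  note DM = scale_measureD[OF M]
  have sM[measurable_cong]: "sets M = sets borel" by (rule DM(2))
  define F where "F = orlicz p \<Psi>"
  have F: "quasi_power F" unfolding F_def by (rule quasi_power_\<Psi>)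
  have [measurable]: "F \<in> borel_measurable borel" using quasi_power_measurable[OF F] .
  obtain C \<alpha> \<beta> where pb: "power_bounds F C \<alpha> \<beta>" using quasi_power_bounds[OF F] .
  note C = power_boundsD(1-3)[OF pb]
  obtain K0 where K0: "K0 > 0" "\<And>k. F (X k) * W k \<le> K0"
    using critical_inverse(2)[OF M \<Psi> p(1)] unfolding F_def X_def W_def by auto
  have c1: "0 < c1" "c1 \<le> 1/2"
  proof -
    show "0 < c1" by (rule DM(5))
    have "c1 * tail \<kappa> M 0 \<le> tail \<kappa> M 0 / 2" using DM(8,9)[of 0] by linarith
    then have "c1 * tail \<kappa> M 0 \<le> (1/2) * tail \<kappa> M 0" by simp
    then show "c1 \<le> 1/2" using DM(7)[of 0] by (simp only: mult_le_cancel_right_pos)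
  qed
  \<comment> \<open>the tails grow towards the origin by at most \<open>1 / c1\<close> per ring, and \<open>\<kappa> powr lam = 2 / c1\<close> leaves a factor \<open>1 / 2\<close> to spare\<close>
  define lam where "lam = log \<kappa> (2 / c1)"
  have lam: "\<kappa> powr lam = 2 / c1" "0 < lam"
  proof -
    show "\<kappa> powr lam = 2 / c1" using \<kappa> c1 by (simp add: lam_def)
    have "1 < 2 / c1" using c1 by (simp add: less_divide_eq)
    moreover have "1 < \<kappa>" using \<kappa> by simp
    ultimately show "0 < lam" unfolding lam_def using c1 by (subst zero_less_log_cancel_iff) auto
  qed
  obtain n :: nat where n: "(2 + lam) / \<alpha> \<le> real n" using real_arch_simple by blast
  then have n\<alpha>: "2 + lam \<le> real n * \<alpha>" using C by (simp add: divide_le_eq)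
  define K where "K = C * K0 * (2 / c1) * 4"
  have K: "K > 0" using C K0 c1 by (simp add: K_def)
  have "\<exists>f. disc_fun f \<and> mass F M f \<le> ennreal K \<and> (1 / 2 ^ n) * X k \<le> cmod (f a)"
    if a: "rad \<kappa> k \<le> cmod a" "cmod a \<le> rad \<kappa> (k + 1)" for k a
  proof -
    have a1: "cmod a < 1" using a rad_props(2)[OF \<kappa>, of "k + 1"] by simp
    have nz: "1 - cnj a * z \<noteq> 0" if "cmod z < 1" for z using one_minus_cnj_mult_nonzero[OF a1, of z] that by simp
    define f where "f z = (if z \<in> unit_disc then of_real (X k) * (of_real (1 - cmod a) / (1 - cnj a * z)) ^ n else 0)" for z
    have "(\<lambda>z. of_real (X k) * (of_real (1 - cmod a) / (1 - cnj a * z)) ^ n) holomorphic_on unit_disc"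
      using nz by (intro holomorphic_intros) auto
    then have "f holomorphic_on unit_disc" by (rule holomorphic_transform) (simp add: f_def)
    then have df: "disc_fun f" unfolding disc_fun_def by (simp add: f_def)
    then have [measurable]: "f \<in> borel_measurable borel" by (rule disc_fun_measurable)
    have ea: "1 - cmod a \<le> 1 / \<kappa> ^ k" using a by (simp add: rad_def)
    define \<tau> where "\<tau> z = (1 - cmod a) / cmod (1 - cnj a * z)" for z
    have den: "1 - cmod a * cmod z \<le> cmod (1 - cnj a * z)" for z
      using norm_triangle_ineq2[of 1 "cnj a * z"] by (simp add: norm_mult)
    have den1: "1 - cmod a \<le> cmod (1 - cnj a * z)" "1 - cmod z \<le> cmod (1 - cnj a * z)" if "cmod z < 1" for z
    proof -
      have "cmod a * cmod z \<le> cmod a * 1" using that by (intro mult_left_mono) auto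
      then show "1 - cmod a \<le> cmod (1 - cnj a * z)" using den[of z] by linarith
      have "cmod a * cmod z \<le> 1 * cmod z" using a1 by (intro mult_right_mono) auto
      then show "1 - cmod z \<le> cmod (1 - cnj a * z)" using den[of z] by linarith
    qed
    have \<tau>: "0 < \<tau> z" "\<tau> z \<le> 1" if "cmod z < 1" for z
      using den1(1)[OF that] a1 nz[OF that] by (auto simp: \<tau>_def divide_le_eq)
    have fz: "cmod (f z) = \<tau> z ^ n * X k" if "cmod z < 1" for z
      using that a1 X_pos[of k] by (simp add: f_def \<tau>_def norm_mult norm_power norm_divide del: of_real_diff)
    have ann: "ann_mass F M \<kappa> f j \<le> ennreal (C * F (X k) * W k * (2 / c1) * (1/2) ^ (k - j + (j - k)))" for j
    proof -
      define E where "E = C * F (X k) * (2 / c1) * (c1 / 2) ^ (k - j)"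
      have E0: "0 \<le> E" using C quasi_power_pos[OF F X_pos[of k]] c1 by (simp add: E_def)
      have pt: "ennreal (F (cmod (f z))) * indicator (annulus \<kappa> j) z \<le> ennreal (E * (1 - cmod a)\<^sup>2) * ennreal (1 / (cmod (1 - cnj a * z))\<^sup>2) * indicator (annulus \<kappa> j) z" for z
      proof (cases "z \<in> annulus \<kappa> j")
        case True
        then have zr: "cmod z < rad \<kappa> (Suc j)" by (simp add: annulus_def)
        then have z1: "cmod z < 1" using rad_props(2)[OF \<kappa>, of "Suc j"] by simp
        have T: "0 < \<tau> z" "\<tau> z \<le> 1" using \<tau>[OF z1] by auto
        have "F (cmod (f z)) \<le> C * (\<tau> z ^ n) powr \<alpha> * F (X k)"
          unfolding fz[OF z1] using T X_pos[of k] by (intro power_boundsD(4)[OF pb]) (auto intro: power_le_one)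
        also have "(\<tau> z ^ n) powr \<alpha> = \<tau> z powr (real n * \<alpha>)" using T by (simp add: powr_realpow[symmetric] powr_powr)
        also have "C * \<tau> z powr (real n * \<alpha>) * F (X k) \<le> C * ((2 / c1) * (c1 / 2) ^ (k - j) * (\<tau> z)\<^sup>2) * F (X k)"
        proof -
          have "\<tau> z powr (real n * \<alpha>) \<le> \<tau> z powr (2 + lam)" using T n\<alpha> by (intro powr_mono') auto
          also have "\<dots> = (\<tau> z)\<^sup>2 * \<tau> z powr lam" using T by (simp add: powr_add)
          also have "\<dots> \<le> (\<tau> z)\<^sup>2 * ((2 / c1) * (c1 / 2) ^ (k - j))"
          proof (rule mult_left_mono)
            show "\<tau> z powr lam \<le> (2 / c1) * (c1 / 2) ^ (k - j)"
            proof (cases "j \<le> k")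
              case False
              have "\<tau> z powr lam \<le> 1" using T lam by (intro powr_le1) auto
              also have "1 \<le> 2 / c1" using c1 by (simp add: le_divide_eq)
              finally show ?thesis using False by simp
            next
              case True
              have low: "1 / \<kappa> ^ Suc j \<le> cmod (1 - cnj a * z)" using den1(2)[OF z1] zr by (simp add: rad_def)
              have "\<tau> z \<le> (1 / \<kappa> ^ k) / (1 / \<kappa> ^ Suc j)"
                unfolding \<tau>_def using ea low a1 \<kappa> by (intro frac_le) auto
              also have "\<dots> = \<kappa> / \<kappa> ^ (k - j)" using \<kappa> True by (simp add: power_diff field_simps)
              finally have "\<tau> z powr lam \<le> (\<kappa> / \<kappa> ^ (k - j)) powr lam" using T lam by (intro powr_mono2) auto
              also have "\<dots> = \<kappa> powr lam / (\<kappa> powr lam) ^ (k - j)"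
                using \<kappa> by (simp add: powr_divide powr_realpow[symmetric] powr_powr mult.commute powr_power)
              also have "\<dots> = (2 / c1) * (c1 / 2) ^ (k - j)" unfolding lam by (simp add: power_divide)
              finally show ?thesis .
            qed
          qed simp
          finally show ?thesis using C quasi_power_nonneg[OF F, of "X k"] X_pos[of k]
            by (intro mult_right_mono mult_left_mono) (auto simp: mult_ac)
        qed
        also have "\<dots> = E * (1 - cmod a)\<^sup>2 * (1 / (cmod (1 - cnj a * z))\<^sup>2)"
          by (simp add: E_def \<tau>_def power_divide mult_ac)
        finally have "ennreal (F (cmod (f z))) \<le> ennreal (E * (1 - cmod a)\<^sup>2 * (1 / (cmod (1 - cnj a * z))\<^sup>2))" by (rule ennreal_leI)
        also have "\<dots> = ennreal (E * (1 - cmod a)\<^sup>2) * ennreal (1 / (cmod (1 - cnj a * z))\<^sup>2)" using E0 by (intro ennreal_mult) auto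
        finally show ?thesis using True by simp
      qed simp
      define H where "H z = ennreal (E * (1 - cmod a)\<^sup>2) * ennreal (1 / (cmod (1 - cnj a * z))\<^sup>2)" for z
      have [measurable]: "H \<in> borel_measurable borel" unfolding H_def[abs_def] by measurable
      have "ann_mass F M \<kappa> f j \<le> (\<integral>\<^sup>+z. H z * indicator (annulus \<kappa> j) z \<partial>M)"
        unfolding ann_mass_def H_def by (rule nn_integral_mono) (rule pt)
      also have "\<dots> = (\<integral>\<^sup>+z. circ_avg H z * indicator (annulus \<kappa> j) z \<partial>M)"
        by (rule nn_integral_annulus_circ_avg[OF DM(1), symmetric]) measurable
      also have "\<dots> \<le> (\<integral>\<^sup>+z. ennreal (E * (1 / \<kappa> ^ k)) * indicator (annulus \<kappa> j) z \<partial>M)"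
      proof (rule nn_integral_mono)
        fix z
        show "circ_avg H z * indicator (annulus \<kappa> j) z \<le> ennreal (E * (1 / \<kappa> ^ k)) * indicator (annulus \<kappa> j) z"
        proof (cases "z \<in> annulus \<kappa> j")
          case True
          then have z1: "cmod z < 1" using rad_props(2)[OF \<kappa>, of "Suc j"] by (simp add: annulus_def)
          have "circ_avg H z = ennreal (E * (1 - cmod a)\<^sup>2) * ennreal (1 / (1 - (cmod (a * z))\<^sup>2))"
            unfolding H_def[abs_def] using z1 by (subst circ_avg_cmult) (auto simp: circ_avg_inverse_square[OF a1])
          also have "\<dots> = ennreal (E * (1 - cmod a)\<^sup>2 * (1 / (1 - (cmod (a * z))\<^sup>2)))"
            using E0 by (intro ennreal_mult'[symmetric]) auto
          also have "\<dots> \<le> ennreal (E * (1 / \<kappa> ^ k))"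
          proof (rule ennreal_leI)
            have "cmod (a * z) \<le> cmod a" using z1 mult_left_mono[of "cmod z" 1 "cmod a"] by (simp add: norm_mult)
            then have "(cmod (a * z))\<^sup>2 \<le> (cmod a)\<^sup>2" by (intro power_mono) auto
            also have "(cmod a)\<^sup>2 \<le> cmod a" using a1 by (simp add: power2_eq_square mult_left_le)
            finally have "(1 - cmod a)\<^sup>2 * (1 / (1 - (cmod (a * z))\<^sup>2)) \<le> (1 - cmod a)\<^sup>2 * (1 / (1 - cmod a))"
              using a1 by (intro mult_left_mono frac_le) auto
            also have "\<dots> = 1 - cmod a" using a1 by (simp add: power2_eq_square)
            also have "\<dots> \<le> 1 / \<kappa> ^ k" by (rule ea)
            finally have "E * ((1 - cmod a)\<^sup>2 * (1 / (1 - (cmod (a * z))\<^sup>2))) \<le> E * (1 / \<kappa> ^ k)" using E0 by (intro mult_left_mono)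
            then show "E * (1 - cmod a)\<^sup>2 * (1 / (1 - (cmod (a * z))\<^sup>2)) \<le> E * (1 / \<kappa> ^ k)" by (simp only: mult.assoc)
          qed
          finally show ?thesis using True by simp
        qed simp
      qed
      also have "\<dots> = ennreal (E * (1 / \<kappa> ^ k)) * emeasure M (annulus \<kappa> j)" by (rule nn_integral_cmult_indicator) (simp add: sM)
      also have "\<dots> \<le> ennreal (E * (1 / \<kappa> ^ k)) * ennreal (tail \<kappa> M j)" by (intro mult_left_mono measure_annulus[OF M]) auto
      also have "\<dots> = ennreal (E * (1 / \<kappa> ^ k) * tail \<kappa> M j)" using E0 \<kappa> DM(7)[of j] by (intro ennreal_mult[symmetric]) auto
      also have "\<dots> \<le> ennreal (C * F (X k) * W k * (2 / c1) * (1/2) ^ (k - j + (j - k)))"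
      proof (rule ennreal_leI)
        have tj: "(c1 / 2) ^ (k - j) * tail \<kappa> M j \<le> (1/2) ^ (k - j + (j - k)) * tail \<kappa> M k"
        proof (cases "j \<le> k")
          case True
          have "c1 ^ (k - j) * tail \<kappa> M j \<le> tail \<kappa> M k" using tail_decay_lower[OF M, of "k - j" j] True by simp
          then have "(1/2) ^ (k - j) * (c1 ^ (k - j) * tail \<kappa> M j) \<le> (1/2) ^ (k - j) * tail \<kappa> M k" by (intro mult_left_mono) auto
          moreover have "(c1 / 2) ^ (k - j) = (1/2) ^ (k - j) * c1 ^ (k - j)" by (simp add: power_divide)
          ultimately show ?thesis using True by (simp add: mult.assoc)
        next
          case False
          then show ?thesis using tail_decay[OF M, of k "j - k"] by (simp add: power_divide)
        qed
        have "E * (1 / \<kappa> ^ k) * tail \<kappa> M j = (C * F (X k) * (2 / c1) * (1 / \<kappa> ^ k)) * ((c1 / 2) ^ (k - j) * tail \<kappa> M j)"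
          by (simp add: E_def)
        also have "\<dots> \<le> (C * F (X k) * (2 / c1) * (1 / \<kappa> ^ k)) * ((1/2) ^ (k - j + (j - k)) * tail \<kappa> M k)"
          using tj C quasi_power_pos[OF F X_pos[of k]] c1 \<kappa> by (intro mult_left_mono) auto
        also have "\<dots> = C * F (X k) * W k * (2 / c1) * (1/2) ^ (k - j + (j - k))" by (simp add: W_def mult_ac)
        finally show "E * (1 / \<kappa> ^ k) * tail \<kappa> M j \<le> C * F (X k) * W k * (2 / c1) * (1/2) ^ (k - j + (j - k))" .
      qed
      finally show ?thesis .
    qed
    define B where "B = C * F (X k) * W k * (2 / c1)"
    have B: "0 \<le> B" using C quasi_power_pos[OF F X_pos[of k]] c1 W_pos[of k] by (simp add: B_def)
    have "mass F M f = (\<Sum>j. ann_mass F M \<kappa> f j)" by (rule suminf_ann_mass[OF M F df, symmetric])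
    also have "\<dots> \<le> (\<Sum>j. ennreal B * ennreal ((1/2) ^ (k - j + (j - k))))"
    proof (rule suminf_le)
      show "ann_mass F M \<kappa> f j \<le> ennreal B * ennreal ((1/2) ^ (k - j + (j - k)))" for j
        using ann[of j] unfolding B_def[symmetric] ennreal_mult'[OF B] .
    qed auto
    also have "\<dots> = ennreal B * (\<Sum>j. ennreal ((1/2) ^ (k - j + (j - k))))" by (rule ennreal_suminf_cmult)
    also have "\<dots> \<le> ennreal B * ennreal 4" by (intro mult_left_mono two_sided_geometric) auto
    also have "\<dots> = ennreal (B * 4)" using B by (intro ennreal_mult[symmetric]) auto
    also have "\<dots> \<le> ennreal K"
    proof (rule ennreal_leI)
      have "C * (F (X k) * W k) * (2 / c1) * 4 \<le> C * K0 * (2 / c1) * 4"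
        using K0(2)[of k] C c1 by (intro mult_right_mono mult_left_mono) auto
      then show "B * 4 \<le> K" by (simp add: B_def K_def mult.assoc)
    qed
    finally have mf: "mass F M f \<le> ennreal K" .
    have "(1 / 2) ^ n * X k \<le> \<tau> a ^ n * X k"
    proof (intro mult_right_mono power_mono)
      have "cnj a * a = of_real ((cmod a)\<^sup>2)" by (simp only: complex_norm_square mult.commute)
      then have "cmod (1 - cnj a * a) = \<bar>1 - (cmod a)\<^sup>2\<bar>" by (metis norm_of_real of_real_1 of_real_diff)
      also have "\<dots> = 1 - (cmod a)\<^sup>2" using a1 by (simp add: abs_square_le_1)
      also have "\<dots> = (1 - cmod a) * (1 + cmod a)" by (simp add: power2_eq_square algebra_simps)
      finally have "\<tau> a = 1 / (1 + cmod a)" using a1 by (simp add: \<tau>_def)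
      moreover have "0 < 1 + cmod a" using norm_ge_zero[of a] by linarith
      ultimately show "1 / 2 \<le> \<tau> a" using a1 by (simp add: le_divide_eq)
    qed (use X_pos[of k] in auto)
    also have "\<dots> = cmod (f a)" using fz[OF a1] by simp
    finally have "(1 / 2 ^ n) * X k \<le> cmod (f a)" by (simp add: power_divide)
    then show ?thesis using df mf by blast
  qed
  moreover have "0 < 1 / (2::real) ^ n" by simp
  ultimately show ?thesis using K unfolding F_def by blast
qed

end

section \<open>The quasinorm topology\<close>

text \<open>The link between the Bergman spaces, defined by integrability for the area, and masses for the Borel measure
  of the weight.\<close>

lemma nn_integral_bergman:
  assumes w: "weight \<omega>" and F: "quasi_power (orlicz p \<Psi>)" and f: "disc_fun f"
  shows "(\<integral>\<^sup>+z. ennreal (cmod (f z) powr p * \<Psi> (cmod (f z)) * \<omega> z) \<partial>disc_area) = mass (orlicz p \<Psi>) (weight_measure \<omega>) f"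
    and "(\<lambda>z. cmod (f z) powr p * \<Psi> (cmod (f z)) * \<omega> z) \<in> borel_measurable disc_area"
    and "AE z in disc_area. 0 \<le> cmod (f z) powr p * \<Psi> (cmod (f z)) * \<omega> z"
proof -
  have [measurable]: "orlicz p \<Psi> \<in> borel_measurable borel" "f \<in> borel_measurable borel"
    using quasi_power_measurable[OF F] disc_fun_measurable[OF f] by auto
  have [measurable]: "\<omega> \<in> borel_measurable disc_area" using w by (auto simp: weight_def)
  have [measurable]: "(\<lambda>z. orlicz p \<Psi> (cmod (f z))) \<in> borel_measurable disc_area" by (rule measurable_disc_area) measurable
  have eq: "cmod (f z) powr p * \<Psi> (cmod (f z)) * \<omega> z = orlicz p \<Psi> (cmod (f z)) * \<omega> z" for z by (simp add: orlicz_def)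
  show "(\<lambda>z. cmod (f z) powr p * \<Psi> (cmod (f z)) * \<omega> z) \<in> borel_measurable disc_area" unfolding eq by measurable
  have wn: "0 \<le> \<omega> z" if "z \<in> space disc_area" for z using w that by (auto simp: weight_def disc_area_def space_restrict_space)
  have on: "0 \<le> orlicz p \<Psi> (cmod (f z))" for z by (rule quasi_power_nonneg[OF F]) simp
  show "AE z in disc_area. 0 \<le> cmod (f z) powr p * \<Psi> (cmod (f z)) * \<omega> z"
    unfolding eq using wn on by (intro AE_I2) simp
  have "mass (orlicz p \<Psi>) (weight_measure \<omega>) f = (\<integral>\<^sup>+z. ennreal (\<omega> z) * ennreal (orlicz p \<Psi> (cmod (f z))) \<partial>disc_area)"
    unfolding mass_def by (rule nn_integral_weight_measure[OF w]) measurable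
  also have "\<dots> = (\<integral>\<^sup>+z. ennreal (cmod (f z) powr p * \<Psi> (cmod (f z)) * \<omega> z) \<partial>disc_area)"
    unfolding eq using wn on by (intro nn_integral_cong) (simp add: ennreal_mult mult.commute)
  finally show "(\<integral>\<^sup>+z. ennreal (cmod (f z) powr p * \<Psi> (cmod (f z)) * \<omega> z) \<partial>disc_area) = mass (orlicz p \<Psi>) (weight_measure \<omega>) f" ..
qed

lemma bergman_space_iff:
  assumes w: "weight \<omega>" and F: "quasi_power (orlicz p \<Psi>)"
  shows "f \<in> bergman_space p \<omega> \<Psi> \<longleftrightarrow> disc_fun f \<and> mass (orlicz p \<Psi>) (weight_measure \<omega>) f < \<infinity>"
proof (cases "disc_fun f")
  case True
  note * = nn_integral_bergman[OF w F True]
  have "integrable disc_area (\<lambda>z. cmod (f z) powr p * \<Psi> (cmod (f z)) * \<omega> z) \<longleftrightarrow> mass (orlicz p \<Psi>) (weight_measure \<omega>) f < \<infinity>"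
  proof -
    have "(\<integral>\<^sup>+z. ennreal (norm (cmod (f z) powr p * \<Psi> (cmod (f z)) * \<omega> z)) \<partial>disc_area) = (\<integral>\<^sup>+z. ennreal (cmod (f z) powr p * \<Psi> (cmod (f z)) * \<omega> z) \<partial>disc_area)"
      using *(3) by (intro nn_integral_cong_AE) (auto elim: eventually_mono)
    then show ?thesis using *(1,2) by (simp add: integrable_iff_bounded)
  qed
  then show ?thesis using True by (auto simp: bergman_space_def disc_fun_def)
qed (auto simp: bergman_space_def disc_fun_def)

lemma bergman_norm_eq:
  assumes w: "weight \<omega>" and F: "quasi_power (orlicz p \<Psi>)" and f: "disc_fun f"
  shows "bergman_norm p \<omega> \<Psi> f = enn2real (mass (orlicz p \<Psi>) (weight_measure \<omega>) f) powr (1 / p)"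
  unfolding bergman_norm_def using nn_integral_bergman[OF w F f] by (simp add: integral_eq_nn_integral)

lemma disc_fun_add: "disc_fun f \<Longrightarrow> disc_fun g \<Longrightarrow> disc_fun (\<lambda>z. f z + g z)"
  and disc_fun_diff: "disc_fun f \<Longrightarrow> disc_fun g \<Longrightarrow> disc_fun (\<lambda>z. f z - g z)"
  and disc_fun_cmult: "disc_fun f \<Longrightarrow> disc_fun (\<lambda>z. c * f z)"
  and disc_fun_zero: "disc_fun (\<lambda>z. 0)"
  by (auto simp: disc_fun_def intro: holomorphic_intros)

lemma mass_zero: "quasi_power F \<Longrightarrow> mass F M (\<lambda>z. 0) = 0"
  by (simp add: mass_def quasi_power_zero)

lemma mass_minus_commute: "mass F M (\<lambda>z. f z - g z) = mass F M (\<lambda>z. g z - f z)"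
  by (simp add: mass_def norm_minus_commute)

text \<open>\<open>|x + y|\<close> is at most twice the larger of \<open>|x|\<close> and \<open>|y|\<close>.\<close>

lemma quasi_power_triangle:
  assumes F: "quasi_power F"
  shows "\<exists>C\<ge>1. \<forall>x y. F (cmod (x + y)) \<le> C * (F (cmod x) + F (cmod y))"
proof -
  obtain C \<alpha> \<beta> where pb: "power_bounds F C \<alpha> \<beta>" using quasi_power_bounds[OF F] .
  note C = power_boundsD(1-3)[OF pb]
  define K where "K = C * (C * 2 powr \<beta>)"
  have "1 \<le> 2 powr \<beta>" using C by (intro ge_one_powr_ge_zero) auto
  then have "1 * 1 \<le> C * 2 powr \<beta>" using C by (intro mult_mono) auto
  then have "1 * 1 \<le> K" unfolding K_def using C by (intro mult_mono) auto
  moreover have "F (cmod (x + y)) \<le> K * (F (cmod x) + F (cmod y))" for x y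
  proof -
    define m where "m = max (cmod x) (cmod y)"
    have "cmod (x + y) \<le> 2 * m" using norm_triangle_ineq[of x y] unfolding m_def by linarith
    then have "F (cmod (x + y)) \<le> C * F (2 * m)" by (intro power_bounds_mono[OF pb F]) auto
    also have "\<dots> \<le> C * (C * 2 powr \<beta> * F m)" using C by (intro mult_left_mono power_boundsD(5)[OF pb]) (auto simp: m_def le_max_iff_disj)
    also have "\<dots> = K * F m" by (simp add: K_def)
    also have "F m \<le> F (cmod x) + F (cmod y)"
      using quasi_power_nonneg[OF F, of "cmod x"] quasi_power_nonneg[OF F, of "cmod y"] by (auto simp: m_def max_def)
    then have "K * F m \<le> K * (F (cmod x) + F (cmod y))" using C by (intro mult_left_mono) (auto simp: K_def)
    finally show ?thesis .
  qed
  ultimately show ?thesis by auto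
qed

lemma mass_triangle:
  assumes F: "quasi_power F" and sM: "sets M = sets borel"
  shows "\<exists>C\<ge>1. \<forall>f g. disc_fun f \<longrightarrow> disc_fun g \<longrightarrow>
     mass F M (\<lambda>z. f z + g z) \<le> ennreal C * (mass F M f + mass F M g) \<and>
     (\<forall>\<kappa> k. ann_mass F M \<kappa> (\<lambda>z. f z + g z) k \<le> ennreal C * (ann_mass F M \<kappa> f k + ann_mass F M \<kappa> g k))"
proof -
  note sM[measurable_cong]
  have [measurable]: "F \<in> borel_measurable borel" using quasi_power_measurable[OF F] .
  obtain C where C: "C \<ge> 1" "\<And>x y. F (cmod (x + y)) \<le> C * (F (cmod x) + F (cmod y))"
    using quasi_power_triangle[OF F] by auto
  have "mass F M (\<lambda>z. f z + g z) \<le> ennreal C * (mass F M f + mass F M g) \<and>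
     (\<forall>\<kappa> k. ann_mass F M \<kappa> (\<lambda>z. f z + g z) k \<le> ennreal C * (ann_mass F M \<kappa> f k + ann_mass F M \<kappa> g k))"
    if f: "disc_fun f" and g: "disc_fun g" for f g
  proof -
    have [measurable]: "f \<in> borel_measurable borel" "g \<in> borel_measurable borel" using f g disc_fun_measurable by auto
    have pt: "ennreal (F (cmod (f z + g z))) \<le> ennreal C * (ennreal (F (cmod (f z))) + ennreal (F (cmod (g z))))" for z
    proof -
      have "ennreal (F (cmod (f z + g z))) \<le> ennreal (C * (F (cmod (f z)) + F (cmod (g z))))" by (rule ennreal_leI[OF C(2)])
      also have "\<dots> = ennreal C * (ennreal (F (cmod (f z))) + ennreal (F (cmod (g z))))"
        using C(1) quasi_power_nonneg[OF F] by (simp add: ennreal_mult)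
      finally show ?thesis .
    qed
    have "mass F M (\<lambda>z. f z + g z) \<le> (\<integral>\<^sup>+z. ennreal C * (ennreal (F (cmod (f z))) + ennreal (F (cmod (g z)))) \<partial>M)"
      unfolding mass_def by (rule nn_integral_mono) (rule pt)
    also have "\<dots> = ennreal C * (mass F M f + mass F M g)" unfolding mass_def by (simp add: nn_integral_cmult nn_integral_add)
    finally have 1: "mass F M (\<lambda>z. f z + g z) \<le> ennreal C * (mass F M f + mass F M g)" .
    have 2: "ann_mass F M \<kappa> (\<lambda>z. f z + g z) k \<le> ennreal C * (ann_mass F M \<kappa> f k + ann_mass F M \<kappa> g k)" for \<kappa> k
    proof -
      have "ann_mass F M \<kappa> (\<lambda>z. f z + g z) k \<le> (\<integral>\<^sup>+z. ennreal C * (ennreal (F (cmod (f z))) * indicator (annulus \<kappa> k) z + ennreal (F (cmod (g z))) * indicator (annulus \<kappa> k) z) \<partial>M)"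
        unfolding ann_mass_def by (rule nn_integral_mono) (use pt in \<open>auto simp: indicator_def\<close>)
      also have "\<dots> = ennreal C * (ann_mass F M \<kappa> f k + ann_mass F M \<kappa> g k)" unfolding ann_mass_def by (simp add: nn_integral_cmult nn_integral_add)
      finally show ?thesis .
    qed
    show ?thesis using 1 2 by blast
  qed
  then show ?thesis using C by blast
qed

lemma mass_scale:
  assumes F: "quasi_power F" and sM: "sets M = sets borel"
  shows "\<exists>C>0. \<exists>\<alpha>>0. \<forall>f t. disc_fun f \<longrightarrow> 0 \<le> t \<longrightarrow> t \<le> 1 \<longrightarrow> mass F M (\<lambda>z. of_real t * f z) \<le> ennreal (C * t powr \<alpha>) * mass F M f"
proof -
  note sM[measurable_cong]
  have [measurable]: "F \<in> borel_measurable borel" using quasi_power_measurable[OF F] .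
  obtain C \<alpha> \<beta> where pb: "power_bounds F C \<alpha> \<beta>" using quasi_power_bounds[OF F] .
  note C = power_boundsD(1-3)[OF pb]
  have "mass F M (\<lambda>z. of_real t * f z) \<le> ennreal (C * t powr \<alpha>) * mass F M f" if f: "disc_fun f" and t: "0 \<le> t" "t \<le> 1" for f t
  proof -
    have [measurable]: "f \<in> borel_measurable borel" by (rule disc_fun_measurable[OF f])
    have "mass F M (\<lambda>z. of_real t * f z) \<le> (\<integral>\<^sup>+z. ennreal (C * t powr \<alpha>) * ennreal (F (cmod (f z))) \<partial>M)"
      unfolding mass_def
    proof (rule nn_integral_mono)
      fix z
      have "F (t * cmod (f z)) \<le> C * t powr \<alpha> * F (cmod (f z))" using t by (intro power_boundsD(4)[OF pb]) auto
      then have "ennreal (F (t * cmod (f z))) \<le> ennreal (C * t powr \<alpha> * F (cmod (f z)))" by (rule ennreal_leI)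
      also have "\<dots> = ennreal (C * t powr \<alpha>) * ennreal (F (cmod (f z)))" using C by (intro ennreal_mult') auto
      finally show "ennreal (F (cmod (of_real t * f z))) \<le> ennreal (C * t powr \<alpha>) * ennreal (F (cmod (f z)))" using t by (simp add: norm_mult)
    qed
    also have "\<dots> = ennreal (C * t powr \<alpha>) * mass F M f" unfolding mass_def by (rule nn_integral_cmult) measurable
    finally show ?thesis .
  qed
  moreover have "C > 0" using C by simp
  ultimately show ?thesis using C(2) by blast
qed

locale bergman =
  fixes q :: real and \<nu> :: "complex \<Rightarrow> real" and \<Phi> :: "real \<Rightarrow> real"
  assumes q: "0 < q" and w: "weight \<nu>" and F: "quasi_power (orlicz q \<Phi>)"
begin

abbreviation A where "A \<equiv> bergman_space q \<nu> \<Phi>"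
abbreviation T where "T \<equiv> bergman_topology q \<nu> \<Phi>"
text \<open>The topology is handled through this extended-valued function, to avoid the exponent \<open>1 / q\<close> and
  because it has a value outside the space as well.\<close>

definition ms :: "(complex \<Rightarrow> complex) \<Rightarrow> ennreal" where "ms = mass (orlicz q \<Phi>) (weight_measure \<nu>)"

lemma A_iff: "f \<in> A \<longleftrightarrow> disc_fun f \<and> ms f < \<infinity>"
  unfolding ms_def by (rule bergman_space_iff[OF w F])

lemma norm_less_iff: "f \<in> A \<Longrightarrow> 0 < \<epsilon> \<Longrightarrow> bergman_norm q \<nu> \<Phi> f < \<epsilon> \<longleftrightarrow> ms f < ennreal (\<epsilon> powr q)"
proof -
  assume f: "f \<in> A" and \<epsilon>: "0 < \<epsilon>"
  obtain m where m: "ms f = ennreal m" "0 \<le> m" using f by (cases "ms f") (auto simp: A_iff)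
  have n: "bergman_norm q \<nu> \<Phi> f = m powr (1/q)"
    using bergman_norm_eq[OF w F] f m by (simp add: A_iff ms_def[symmetric])
  have "m powr (1/q) < \<epsilon> \<longleftrightarrow> m < \<epsilon> powr q"
  proof
    assume "m powr (1/q) < \<epsilon>"
    then have "(m powr (1/q)) powr q < \<epsilon> powr q" using q by (intro powr_less_mono2) auto
    then show "m < \<epsilon> powr q" using q m by (simp add: powr_powr)
  next
    assume "m < \<epsilon> powr q"
    then have "m powr (1/q) < (\<epsilon> powr q) powr (1/q)" using q m by (intro powr_less_mono2) auto
    then show "m powr (1/q) < \<epsilon>" using q \<epsilon> by (simp add: powr_powr)
  qed
  then show ?thesis using m n by (simp add: ennreal_less_iff)
qed

lemma norm_le_iff: "f \<in> A \<Longrightarrow> 0 \<le> b \<Longrightarrow> bergman_norm q \<nu> \<Phi> f \<le> b \<longleftrightarrow> ms f \<le> ennreal (b powr q)"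
proof -
  assume f: "f \<in> A" and b: "0 \<le> b"
  obtain m where m: "ms f = ennreal m" "0 \<le> m" using f by (cases "ms f") (auto simp: A_iff)
  have n: "bergman_norm q \<nu> \<Phi> f = m powr (1/q)"
    using bergman_norm_eq[OF w F] f m by (simp add: A_iff ms_def[symmetric])
  have "m powr (1/q) \<le> b \<longleftrightarrow> m \<le> b powr q"
  proof
    assume "m powr (1/q) \<le> b"
    then have "(m powr (1/q)) powr q \<le> b powr q" using q by (intro powr_mono2) auto
    then show "m \<le> b powr q" using q m by (simp add: powr_powr)
  next
    assume "m \<le> b powr q"
    then have "m powr (1/q) \<le> (b powr q) powr (1/q)" using q m by (intro powr_mono2) auto
    then show "m powr (1/q) \<le> b" using q b by (simp add: powr_powr)
  qed
  then show ?thesis using m n by (simp add: ennreal_le_iff)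
qed

lemma triangle: "\<exists>C\<ge>1. \<forall>f g. disc_fun f \<longrightarrow> disc_fun g \<longrightarrow> ms (\<lambda>z. f z + g z) \<le> ennreal C * (ms f + ms g)"
  using mass_triangle[OF F sets_weight_measure[of \<nu>]] unfolding ms_def by blast

lemma triangle_less:
  assumes "0 < \<epsilon>"
  shows "\<exists>\<delta>>0. \<forall>f g. disc_fun f \<longrightarrow> disc_fun g \<longrightarrow> ms f < ennreal \<delta> \<longrightarrow> ms g < ennreal \<delta> \<longrightarrow> ms (\<lambda>z. f z + g z) < ennreal \<epsilon>"
proof -
  obtain C where C: "C \<ge> 1" "\<And>f g. disc_fun f \<Longrightarrow> disc_fun g \<Longrightarrow> ms (\<lambda>z. f z + g z) \<le> ennreal C * (ms f + ms g)"
    using triangle by auto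
  have "ms (\<lambda>z. f z + g z) < ennreal \<epsilon>" if "disc_fun f" "disc_fun g" "ms f < ennreal (\<epsilon> / (4 * C))" "ms g < ennreal (\<epsilon> / (4 * C))" for f g
  proof -
    have "ms (\<lambda>z. f z + g z) \<le> ennreal C * (ms f + ms g)" by (rule C(2)[OF that(1,2)])
    also have "\<dots> \<le> ennreal C * (ennreal (\<epsilon> / (4 * C)) + ennreal (\<epsilon> / (4 * C)))"
      using that by (intro mult_left_mono add_mono) auto
    also have "ennreal (\<epsilon> / (4 * C)) + ennreal (\<epsilon> / (4 * C)) = ennreal (\<epsilon> / (4 * C) + \<epsilon> / (4 * C))"
      using C(1) assms by (intro ennreal_plus[symmetric]) auto
    also have "ennreal C * ennreal (\<epsilon> / (4 * C) + \<epsilon> / (4 * C)) = ennreal (C * (\<epsilon> / (4 * C) + \<epsilon> / (4 * C)))"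
      using C(1) assms by (intro ennreal_mult[symmetric]) auto
    also have "C * (\<epsilon> / (4 * C) + \<epsilon> / (4 * C)) = \<epsilon> / 2" using C(1) by (simp add: field_simps)
    also have "ennreal (\<epsilon> / 2) < ennreal \<epsilon>" using assms by (simp add: ennreal_less_iff)
    finally show ?thesis .
  qed
  moreover have "0 < \<epsilon> / (4 * C)" using assms C(1) by simp
  ultimately show ?thesis by blast
qed

lemma A_add: "f \<in> A \<Longrightarrow> g \<in> A \<Longrightarrow> (\<lambda>z. f z + g z) \<in> A"
proof -
  assume f: "f \<in> A" and g: "g \<in> A"
  obtain C where C: "C \<ge> 1" "ms (\<lambda>z. f z + g z) \<le> ennreal C * (ms f + ms g)"
    using triangle f g unfolding A_iff by blast
  have "ennreal C * (ms f + ms g) < \<infinity>" using f g by (simp add: A_iff ennreal_mult_less_top)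
  then show ?thesis using C f g by (auto simp: A_iff intro: disc_fun_add)
qed

lemma ms_uminus: "ms (\<lambda>z. - f z) = ms f" by (simp add: ms_def mass_def)

lemma A_uminus: "f \<in> A \<Longrightarrow> (\<lambda>z. - f z) \<in> A"
  using disc_fun_cmult[of f "-1"] by (auto simp: A_iff ms_uminus)

lemma A_diff: "f \<in> A \<Longrightarrow> g \<in> A \<Longrightarrow> (\<lambda>z. f z - g z) \<in> A"
  using A_add[OF _ A_uminus, of f g] by simp

lemma A_zero: "(\<lambda>z. 0) \<in> A"
  by (simp add: A_iff disc_fun_zero ms_def mass_zero[OF F])

lemma openin_iff:
  "openin T V \<longleftrightarrow> V \<subseteq> A \<and> (\<forall>f\<in>V. \<exists>\<epsilon>>0. \<forall>h\<in>A. ms h < ennreal \<epsilon> \<longrightarrow> (\<lambda>z. f z + h z) \<in> V)"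
proof -
  have "(\<exists>\<epsilon>>0. \<forall>h\<in>A. bergman_norm q \<nu> \<Phi> h < \<epsilon> \<longrightarrow> P h) \<longleftrightarrow> (\<exists>\<epsilon>>0. \<forall>h\<in>A. ms h < ennreal \<epsilon> \<longrightarrow> P h)" for P
  proof
    assume "\<exists>\<epsilon>>0. \<forall>h\<in>A. bergman_norm q \<nu> \<Phi> h < \<epsilon> \<longrightarrow> P h"
    then obtain \<epsilon> where \<epsilon>: "\<epsilon> > 0" "\<forall>h\<in>A. bergman_norm q \<nu> \<Phi> h < \<epsilon> \<longrightarrow> P h" by blast
    then have "\<forall>h\<in>A. ms h < ennreal (\<epsilon> powr q) \<longrightarrow> P h" using norm_less_iff by blast
    moreover have "\<epsilon> powr q > 0" using \<epsilon> by simp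
    ultimately show "\<exists>\<epsilon>>0. \<forall>h\<in>A. ms h < ennreal \<epsilon> \<longrightarrow> P h" by blast
  next
    assume "\<exists>\<epsilon>>0. \<forall>h\<in>A. ms h < ennreal \<epsilon> \<longrightarrow> P h"
    then obtain \<epsilon> where \<epsilon>: "\<epsilon> > 0" "\<forall>h\<in>A. ms h < ennreal \<epsilon> \<longrightarrow> P h" by blast
    have "(\<epsilon> powr (1/q)) powr q = \<epsilon>" using q \<epsilon> by (simp add: powr_powr)
    moreover have pos: "\<epsilon> powr (1/q) > 0" using \<epsilon> by simp
    ultimately have "\<forall>h\<in>A. bergman_norm q \<nu> \<Phi> h < \<epsilon> powr (1/q) \<longrightarrow> P h" using norm_less_iff[OF _ pos] \<epsilon>(2) by simp
    then show "\<exists>\<epsilon>>0. \<forall>h\<in>A. bergman_norm q \<nu> \<Phi> h < \<epsilon> \<longrightarrow> P h" using pos by blast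
  qed
  then show ?thesis unfolding openin_bergman_topology by simp
qed

lemma topspace_T: "topspace T = A"
proof
  show "topspace T \<subseteq> A" unfolding topspace_def using openin_iff by auto
  have "openin T A" unfolding openin_iff using A_add by (auto intro!: exI[of _ 1])
  then show "A \<subseteq> topspace T" by (rule openin_subset)
qed

text \<open>Quasinorm balls need not be open, but they contain the set of those points around which a whole ball still
  satisfies the inequality with room \<open>\<delta>\<close>; the quasi-triangle inequality shows that this
  set is open.\<close>

lemma nbhd:
  assumes f: "f \<in> A" and \<epsilon>: "0 < \<epsilon>"
  shows "\<exists>U. openin T U \<and> f \<in> U \<and> (\<forall>h\<in>U. ms (\<lambda>z. h z - f z) < ennreal \<epsilon>)"
proof -
  define U where "U = {h \<in> A. \<exists>\<delta>>0. \<forall>e\<in>A. ms e < ennreal \<delta> \<longrightarrow> ms (\<lambda>z. h z + e z - f z) < ennreal \<epsilon>}"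
  have "openin T U"
    unfolding openin_iff
  proof (intro conjI ballI)
    show "U \<subseteq> A" by (auto simp: U_def)
    fix h assume h: "h \<in> U"
    then obtain \<delta> where \<delta>: "\<delta> > 0" "\<And>e. e \<in> A \<Longrightarrow> ms e < ennreal \<delta> \<Longrightarrow> ms (\<lambda>z. h z + e z - f z) < ennreal \<epsilon>"
      by (auto simp: U_def)
    obtain \<eta> where \<eta>: "\<eta> > 0" "\<And>f g. disc_fun f \<Longrightarrow> disc_fun g \<Longrightarrow> ms f < ennreal \<eta> \<Longrightarrow> ms g < ennreal \<eta> \<Longrightarrow> ms (\<lambda>z. f z + g z) < ennreal \<delta>"
      using triangle_less[OF \<delta>(1)] by blast
    have "(\<lambda>z. h z + e z) \<in> U" if e: "e \<in> A" "ms e < ennreal \<eta>" for e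
    proof -
      have "ms (\<lambda>z. (h z + e z) + e' z - f z) < ennreal \<epsilon>" if e': "e' \<in> A" "ms e' < ennreal \<eta>" for e'
      proof -
        have "ms (\<lambda>z. e z + e' z) < ennreal \<delta>" using e e' by (intro \<eta>(2)) (auto simp: A_iff)
        then have "ms (\<lambda>z. h z + (e z + e' z) - f z) < ennreal \<epsilon>" using A_add[OF e(1) e'(1)] by (intro \<delta>(2))
        then show ?thesis by (simp add: add.assoc)
      qed
      moreover have "(\<lambda>z. h z + e z) \<in> A" using h e A_add by (auto simp: U_def)
      ultimately show ?thesis using \<eta>(1) by (auto simp: U_def)
    qed
    then show "\<exists>\<epsilon>>0. \<forall>e\<in>A. ms e < ennreal \<epsilon> \<longrightarrow> (\<lambda>z. h z + e z) \<in> U" using \<eta>(1) by blast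
  qed
  moreover have "f \<in> U" using f \<epsilon> by (auto simp: U_def)
  moreover have "ms (\<lambda>z. h z - f z) < ennreal \<epsilon>" if h: "h \<in> U" for h
  proof -
    obtain \<delta> where \<delta>: "\<delta> > 0" "\<And>e. e \<in> A \<Longrightarrow> ms e < ennreal \<delta> \<Longrightarrow> ms (\<lambda>z. h z + e z - f z) < ennreal \<epsilon>"
      using h by (auto simp: U_def)
    have "ms (\<lambda>z. 0) < ennreal \<delta>" using \<delta>(1) by (simp add: ms_def mass_zero[OF F])
    then show ?thesis using \<delta>(2)[OF A_zero] by simp
  qed
  ultimately show ?thesis by blast
qed

lemma tendsto_zero_add:
  assumes "\<And>n. disc_fun (f n)" "\<And>n. disc_fun (g n)" "(\<lambda>n. ms (f n)) \<longlonglongrightarrow> 0" "(\<lambda>n. ms (g n)) \<longlonglongrightarrow> 0"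
  shows "(\<lambda>n. ms (\<lambda>z. f n z + g n z)) \<longlonglongrightarrow> 0"
proof -
  obtain C where C: "C \<ge> 1" "\<And>f g. disc_fun f \<Longrightarrow> disc_fun g \<Longrightarrow> ms (\<lambda>z. f z + g z) \<le> ennreal C * (ms f + ms g)"
    using triangle by auto
  have "(\<lambda>n. ennreal C * (ms (f n) + ms (g n))) \<longlonglongrightarrow> ennreal C * (0 + 0)"
    by (intro ennreal_tendsto_cmult tendsto_add assms) simp
  then have lim: "(\<lambda>n. ennreal C * (ms (f n) + ms (g n))) \<longlonglongrightarrow> 0" by simp
  show ?thesis
  proof (rule tendsto_sandwich[OF _ _ tendsto_const lim])
    show "\<forall>\<^sub>F n in sequentially. ms (\<lambda>z. f n z + g n z) \<le> ennreal C * (ms (f n) + ms (g n))"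
      by (intro always_eventually allI C assms)
  qed simp
qed

lemma openin_sequentially:
  assumes U: "openin T U" and l: "l \<in> U" and s: "\<And>n. s n \<in> A" and lim: "(\<lambda>n. ms (\<lambda>z. s n z - l z)) \<longlonglongrightarrow> 0"
  shows "eventually (\<lambda>n. s n \<in> U) sequentially"
proof -
  obtain \<epsilon> where \<epsilon>: "\<epsilon> > 0" "\<And>h. h \<in> A \<Longrightarrow> ms h < ennreal \<epsilon> \<Longrightarrow> (\<lambda>z. l z + h z) \<in> U"
    using U l unfolding openin_iff by blast
  have lA: "l \<in> A" using U l unfolding openin_iff by blast
  have "eventually (\<lambda>n. ms (\<lambda>z. s n z - l z) < ennreal \<epsilon>) sequentially"
    using lim \<epsilon>(1) by (intro order_tendstoD(2)) auto
  then show ?thesis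
  proof eventually_elim
    case (elim n)
    have "(\<lambda>z. l z + (s n z - l z)) \<in> U" using elim by (intro \<epsilon>(2) A_diff s lA)
    then show ?case by simp
  qed
qed

text \<open>The classical proof that sequential compactness implies compactness, with the quasinorm in place of a metric:
  limits of sequences in the closure are in the closure, every open cover has a Lebesgue number, and the
  closure is totally bounded.\<close>

lemma compactin_closure_of:
  assumes S: "S \<subseteq> A"
    and seq: "\<And>s. (\<And>n::nat. s n \<in> S) \<Longrightarrow> \<exists>r l. strict_mono r \<and> l \<in> A \<and> (\<lambda>n. ms (\<lambda>z. s (r n) z - l z)) \<longlonglongrightarrow> 0"
  shows "compactin T (T closure_of S)"
proof -
  define K where "K = T closure_of S"
  have KA: "K \<subseteq> A" unfolding K_def using closure_of_subset_topspace topspace_T by metis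
  have dA: "disc_fun f" if "f \<in> A" for f using that by (simp add: A_iff)
  have inv: "(\<lambda>n. inverse (real (Suc n))) \<longlonglongrightarrow> 0" by (rule LIMSEQ_inverse_real_of_nat)
  have einv: "(\<lambda>n. ennreal (inverse (real (Suc n)))) \<longlonglongrightarrow> 0" using tendsto_ennrealI[OF inv] by simp
  have seqK: "\<exists>r l. strict_mono r \<and> l \<in> K \<and> (\<lambda>n. ms (\<lambda>z. k (r n) z - l z)) \<longlonglongrightarrow> 0" if k: "\<And>n::nat. k n \<in> K" for k
  proof -
    have "\<exists>s. s \<in> S \<and> ms (\<lambda>z. s z - k n z) < ennreal (inverse (real (Suc n)))" for n
    proof -
      obtain U where U: "openin T U" "k n \<in> U" "\<And>h. h \<in> U \<Longrightarrow> ms (\<lambda>z. h z - k n z) < ennreal (inverse (real (Suc n)))"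
        using nbhd[of "k n" "inverse (real (Suc n))"] k[of n] KA by auto
      then show ?thesis using k[of n] unfolding K_def in_closure_of by blast
    qed
    then obtain s where s: "\<And>n. s n \<in> S" "\<And>n. ms (\<lambda>z. s n z - k n z) < ennreal (inverse (real (Suc n)))" by metis
    obtain r l where r: "strict_mono r" and l: "l \<in> A" and lim: "(\<lambda>n. ms (\<lambda>z. s (r n) z - l z)) \<longlonglongrightarrow> 0"
      using seq[of s] s(1) by blast
    have sA: "s n \<in> A" "k n \<in> A" for n using s(1) S k KA by auto
    have "(\<lambda>n. ms (\<lambda>z. k n z - s n z)) \<longlonglongrightarrow> 0"
      by (rule tendsto_sandwich[OF _ _ tendsto_const einv])
         (use s(2) in \<open>auto simp: ms_def mass_minus_commute[where f="k _"] intro!: always_eventually less_imp_le\<close>)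
    then have "(\<lambda>n. ms (\<lambda>z. k (r n) z - s (r n) z)) \<longlonglongrightarrow> 0" using LIMSEQ_subseq_LIMSEQ[OF _ r] by (simp add: o_def)
    then have "(\<lambda>n. ms (\<lambda>z. (k (r n) z - s (r n) z) + (s (r n) z - l z))) \<longlonglongrightarrow> 0"
      using sA l by (intro tendsto_zero_add lim disc_fun_diff dA) auto
    then have kl: "(\<lambda>n. ms (\<lambda>z. k (r n) z - l z)) \<longlonglongrightarrow> 0" by simp
    have "l \<in> K"
      unfolding K_def in_closure_of topspace_T
    proof (intro conjI allI impI l)
      fix U assume "l \<in> U \<and> openin T U"
      then have "eventually (\<lambda>n. s (r n) \<in> U) sequentially" using openin_sequentially[OF _ _ _ lim] sA by blast
      then obtain n where "s (r n) \<in> U" by (auto simp: eventually_sequentially)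
      then show "\<exists>y. y \<in> S \<and> y \<in> U" using s(1) by blast
    qed
    then show ?thesis using r kl by blast
  qed
  have "compactin T K"
    unfolding compactin_def
  proof (intro conjI allI impI)
    show "K \<subseteq> topspace T" using KA topspace_T by simp
    fix \<U> assume "(\<forall>U\<in>\<U>. openin T U) \<and> K \<subseteq> \<Union>\<U>"
    then have op: "\<And>U. U \<in> \<U> \<Longrightarrow> openin T U" and cov: "K \<subseteq> \<Union>\<U>" by auto
    \<comment> \<open>a Lebesgue number of the cover\<close>
    have "\<exists>\<epsilon>>0. \<forall>k\<in>K. \<exists>U\<in>\<U>. \<forall>h\<in>A. ms h < ennreal \<epsilon> \<longrightarrow> (\<lambda>z. k z + h z) \<in> U"
    proof (rule ccontr)
      assume neg: "\<not> ?thesis"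
      have ex: "\<forall>n. \<exists>k. k \<in> K \<and> (\<forall>U\<in>\<U>. \<exists>h. h \<in> A \<and> ms h < ennreal (inverse (real (Suc n))) \<and> (\<lambda>z. k z + h z) \<notin> U)"
      proof (rule allI, rule ccontr)
        fix n
        assume "\<nexists>k. k \<in> K \<and> (\<forall>U\<in>\<U>. \<exists>h. h \<in> A \<and> ms h < ennreal (inverse (real (Suc n))) \<and> (\<lambda>z. k z + h z) \<notin> U)"
        then have "\<forall>k\<in>K. \<exists>U\<in>\<U>. \<forall>h\<in>A. ms h < ennreal (inverse (real (Suc n))) \<longrightarrow> (\<lambda>z. k z + h z) \<in> U" by blast
        moreover have "inverse (real (Suc n)) > 0" by simp
        ultimately have "\<exists>\<epsilon>>0. \<forall>k\<in>K. \<exists>U\<in>\<U>. \<forall>h\<in>A. ms h < ennreal \<epsilon> \<longrightarrow> (\<lambda>z. k z + h z) \<in> U"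
          by (rule_tac exI[of _ "inverse (real (Suc n))"]) (rule conjI)
        with neg show False by (rule notE)
      qed
      from choice[OF ex] obtain k where k': "\<forall>n. k n \<in> K \<and> (\<forall>U\<in>\<U>. \<exists>h. h \<in> A \<and> ms h < ennreal (inverse (real (Suc n))) \<and> (\<lambda>z. k n z + h z) \<notin> U)" ..
      then have k: "\<And>n. k n \<in> K" "\<And>n U. U \<in> \<U> \<Longrightarrow> \<exists>h. h \<in> A \<and> ms h < ennreal (inverse (real (Suc n))) \<and> (\<lambda>z. k n z + h z) \<notin> U" by simp_all
      obtain r l where r: "strict_mono r" and l: "l \<in> K" and lim: "(\<lambda>n. ms (\<lambda>z. k (r n) z - l z)) \<longlonglongrightarrow> 0"
        using seqK[of k] k(1) by blast
      obtain U where U: "U \<in> \<U>" "l \<in> U" using cov l by blast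
      have "\<forall>n. \<exists>h. h \<in> A \<and> ms h < ennreal (inverse (real (Suc n))) \<and> (\<lambda>z. k n z + h z) \<notin> U" using k(2)[OF U(1)] by blast
      from choice[OF this] obtain h where "\<forall>n. h n \<in> A \<and> ms (h n) < ennreal (inverse (real (Suc n))) \<and> (\<lambda>z. k n z + h n z) \<notin> U" ..
      then have h: "\<And>n. h n \<in> A" "\<And>n. ms (h n) < ennreal (inverse (real (Suc n)))" "\<And>n. (\<lambda>z. k n z + h n z) \<notin> U" by simp_all
      have "(\<lambda>n. ms (h n)) \<longlonglongrightarrow> 0"
        by (rule tendsto_sandwich[OF _ _ tendsto_const einv]) (use h(2) in \<open>auto intro!: always_eventually less_imp_le\<close>)
      then have "(\<lambda>n. ms (h (r n))) \<longlonglongrightarrow> 0" using LIMSEQ_subseq_LIMSEQ[OF _ r] by (simp add: o_def)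
      then have "(\<lambda>n. ms (\<lambda>z. (k (r n) z - l z) + h (r n) z)) \<longlonglongrightarrow> 0"
        using k(1) l h(1) KA by (intro tendsto_zero_add lim disc_fun_diff dA) auto
      then have lim2: "(\<lambda>n. ms (\<lambda>z. (k (r n) z + h (r n) z) - l z)) \<longlonglongrightarrow> 0" by (simp add: algebra_simps)
      have "eventually (\<lambda>n. (\<lambda>z. k (r n) z + h (r n) z) \<in> U) sequentially"
        using openin_sequentially[OF op[OF U(1)] U(2) _ lim2] A_add k(1) h(1) KA by blast
      then show False using h(3) by (auto simp: eventually_sequentially)
    qed
    then obtain \<epsilon> where \<epsilon>': "\<epsilon> > 0 \<and> (\<forall>k\<in>K. \<exists>U\<in>\<U>. \<forall>h\<in>A. ms h < ennreal \<epsilon> \<longrightarrow> (\<lambda>z. k z + h z) \<in> U)" ..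
    have \<epsilon>: "\<epsilon> > 0" "\<And>k. k \<in> K \<Longrightarrow> \<exists>U\<in>\<U>. \<forall>h\<in>A. ms h < ennreal \<epsilon> \<longrightarrow> (\<lambda>z. k z + h z) \<in> U"
      using \<epsilon>' by simp_all
    \<comment> \<open>total boundedness: otherwise there is a sequence whose terms are pairwise apart\<close>
    have "\<exists>P. finite P \<and> P \<subseteq> K \<and> (\<forall>k\<in>K. \<exists>x\<in>P. ms (\<lambda>z. k z - x z) < ennreal \<epsilon>)"
    proof (rule ccontr)
      assume neg: "\<not> ?thesis"
      have "\<exists>s. \<forall>n::nat. s n \<in> K \<and> (\<forall>m<n. \<not> ms (\<lambda>z. s n z - s m z) < ennreal \<epsilon>)"
      proof (rule dependent_wellorder_choice)
        fix n :: nat and s :: "nat \<Rightarrow> complex \<Rightarrow> complex"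
        assume "\<And>y. y < n \<Longrightarrow> s y \<in> K \<and> (\<forall>m<y. \<not> ms (\<lambda>z. s y z - s m z) < ennreal \<epsilon>)"
        then have fin: "finite (s ` {..<n}) \<and> s ` {..<n} \<subseteq> K" by auto
        show "\<exists>k. k \<in> K \<and> (\<forall>m<n. \<not> ms (\<lambda>z. k z - s m z) < ennreal \<epsilon>)"
        proof (rule ccontr)
          assume "\<not> ?thesis"
          then have "\<forall>k\<in>K. \<exists>x\<in>s ` {..<n}. ms (\<lambda>z. k z - x z) < ennreal \<epsilon>" by auto
          with fin have "\<exists>P. finite P \<and> P \<subseteq> K \<and> (\<forall>k\<in>K. \<exists>x\<in>P. ms (\<lambda>z. k z - x z) < ennreal \<epsilon>)"
            by (rule_tac exI[of _ "s ` {..<n}"]) (simp only: simp_thms)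
          with neg show False by (rule notE)
        qed
      qed auto
      then obtain s where "\<forall>n::nat. s n \<in> K \<and> (\<forall>m<n. \<not> ms (\<lambda>z. s n z - s m z) < ennreal \<epsilon>)" ..
      then have s: "\<And>n::nat. s n \<in> K" "\<And>m n. m < n \<Longrightarrow> \<not> ms (\<lambda>z. s n z - s m z) < ennreal \<epsilon>" by simp_all
      obtain r l where r: "strict_mono r" and l: "l \<in> K" and lim: "(\<lambda>n. ms (\<lambda>z. s (r n) z - l z)) \<longlonglongrightarrow> 0"
        using seqK[of s] s(1) by blast
      have lim2: "(\<lambda>n. ms (\<lambda>z. l z - s (r n) z)) \<longlonglongrightarrow> 0"
        using lim by (simp add: ms_def mass_minus_commute[where f=l])
      have "(\<lambda>n. ms (\<lambda>z. (s (r (Suc n)) z - l z) + (l z - s (r n) z))) \<longlonglongrightarrow> 0"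
        using s(1) l KA by (intro tendsto_zero_add lim2 LIMSEQ_Suc[OF lim] disc_fun_diff dA) auto
      then have "eventually (\<lambda>n. ms (\<lambda>z. (s (r (Suc n)) z - l z) + (l z - s (r n) z)) < ennreal \<epsilon>) sequentially"
        using \<epsilon>(1) by (intro order_tendstoD(2)) auto
      then obtain n where "ms (\<lambda>z. s (r (Suc n)) z - s (r n) z) < ennreal \<epsilon>" by (auto simp: eventually_sequentially)
      moreover have "r n < r (Suc n)" using r by (simp add: strict_mono_def)
      ultimately show False using s(2) by blast
    qed
    then obtain P where "finite P \<and> P \<subseteq> K \<and> (\<forall>k\<in>K. \<exists>x\<in>P. ms (\<lambda>z. k z - x z) < ennreal \<epsilon>)" ..
    then have P: "finite P" "P \<subseteq> K" "\<And>k. k \<in> K \<Longrightarrow> \<exists>x\<in>P. ms (\<lambda>z. k z - x z) < ennreal \<epsilon>" by simp_all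
    have "\<forall>x\<in>P. \<exists>U. U \<in> \<U> \<and> (\<forall>h\<in>A. ms h < ennreal \<epsilon> \<longrightarrow> (\<lambda>z. x z + h z) \<in> U)" using \<epsilon>(2) P(2) by blast
    from bchoice[OF this] obtain u where "\<forall>x\<in>P. u x \<in> \<U> \<and> (\<forall>h\<in>A. ms h < ennreal \<epsilon> \<longrightarrow> (\<lambda>z. x z + h z) \<in> u x)" ..
    then have u: "\<And>x. x \<in> P \<Longrightarrow> u x \<in> \<U>" "\<And>x h. x \<in> P \<Longrightarrow> h \<in> A \<Longrightarrow> ms h < ennreal \<epsilon> \<Longrightarrow> (\<lambda>z. x z + h z) \<in> u x" by simp_all
    have "K \<subseteq> \<Union>(u ` P)"
    proof
      fix k assume k: "k \<in> K"
      then obtain x where x: "x \<in> P" "ms (\<lambda>z. k z - x z) < ennreal \<epsilon>" using P(3) by blast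
      have "(\<lambda>z. x z + (k z - x z)) \<in> u x" using x k P KA by (intro u(2) A_diff) auto
      then show "k \<in> \<Union>(u ` P)" using x by auto
    qed
    then show "\<exists>\<F>. finite \<F> \<and> \<F> \<subseteq> \<U> \<and> K \<subseteq> \<Union>\<F>" using P(1) u(1) by (intro exI[of _ "u ` P"]) auto
  qed
  then show ?thesis by (simp add: K_def)
qed

end

section \<open>Carleson squares and the critical values\<close>

text \<open>\<open>1 - |a|\<close> is comparable with \<open>\<kappa>^(-k)\<close>, and the tail at \<open>|a|\<close>
  with the tail at \<open>rad \<kappa> k\<close>.\<close>

lemma measure_carleson_square_tail:
  assumes M: "scale_measure \<kappa> c M"
  shows "\<exists>b>0. \<forall>k a. rad \<kappa> k \<le> cmod a \<longrightarrow> cmod a \<le> rad \<kappa> (k + 1) \<longrightarrow>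
     b * (tail \<kappa> M k / \<kappa> ^ k) \<le> measure M (carleson_square a) \<and> measure M (carleson_square a) \<le> tail \<kappa> M k / \<kappa> ^ k"
proof -
  note D = scale_measureD[OF M]
  have \<kappa>: "\<kappa> > 0" using D(4) by simp
  have "c / (4 * pi * \<kappa>) * (tail \<kappa> M k / \<kappa> ^ k) \<le> measure M (carleson_square a) \<and> measure M (carleson_square a) \<le> tail \<kappa> M k / \<kappa> ^ k"
    if a: "rad \<kappa> k \<le> cmod a" "cmod a \<le> rad \<kappa> (k + 1)" for k a
  proof
    have a1: "cmod a < 1" using a rad_props(2)[OF D(4), of "k + 1"] by linarith
    note S = measure_carleson_square[OF D(1,6) a1]
    have gap: "1 - cmod a \<le> 1 / \<kappa> ^ k" "1 / \<kappa> ^ (k + 1) \<le> 1 - cmod a" using a by (auto simp: rad_def)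
    have t: "tail_mass M (cmod a) \<le> tail \<kappa> M k" "tail \<kappa> M (Suc k) \<le> tail_mass M (cmod a)"
      using tail_mass_antimono[OF D(3,2)] a by (auto simp: tail_def)
    have tp: "0 < tail \<kappa> M k" "0 < tail \<kappa> M (Suc k)" using D(7) by auto
    have "(1 - cmod a) * tail_mass M (cmod a) \<le> 1 / \<kappa> ^ k * tail \<kappa> M k"
      using gap t tp \<kappa> by (intro mult_mono) auto
    then show "measure M (carleson_square a) \<le> tail \<kappa> M k / \<kappa> ^ k" using S(2) by simp
    have "c / (4 * pi * \<kappa>) * (tail \<kappa> M k / \<kappa> ^ k) = (1 / \<kappa> ^ (k + 1)) / (4 * pi) * (c * tail \<kappa> M k)" by simp
    also have "\<dots> \<le> (1 - cmod a) / (4 * pi) * tail_mass M (cmod a)"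
    proof (intro mult_mono divide_right_mono)
      show "c * tail \<kappa> M k \<le> tail_mass M (cmod a)" using D(8)[of k] t by linarith
    qed (use gap D(5) tp a1 in auto)
    finally show "c / (4 * pi * \<kappa>) * (tail \<kappa> M k / \<kappa> ^ k) \<le> measure M (carleson_square a)" using S(1) by linarith
  qed
  moreover have "c / (4 * pi * \<kappa>) > 0" using D(5) \<kappa> by simp
  ultimately show ?thesis by blast
qed

text \<open>The mass of a Carleson square and its size are bounded by powers of each other.\<close>

lemma class_L_carleson_square:
  assumes M: "scale_measure \<kappa> c M" and \<Theta>: "\<Theta> \<in> class_L"
  shows "\<exists>K>0. \<forall>k a. rad \<kappa> k \<le> cmod a \<longrightarrow> cmod a \<le> rad \<kappa> (k + 1) \<longrightarrow>
     \<Theta> (1 / measure M (carleson_square a)) \<le> K * \<Theta> (\<kappa> ^ k) \<and> \<Theta> (\<kappa> ^ k) \<le> K * \<Theta> (1 / measure M (carleson_square a))"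
proof -
  note D = scale_measureD[OF M]
  obtain b where b: "b > 0" and sq: "\<And>k a. rad \<kappa> k \<le> cmod a \<Longrightarrow> cmod a \<le> rad \<kappa> (k + 1) \<Longrightarrow>
     b * (tail \<kappa> M k / \<kappa> ^ k) \<le> measure M (carleson_square a) \<and> measure M (carleson_square a) \<le> tail \<kappa> M k / \<kappa> ^ k"
    using measure_carleson_square_tail[OF M] by auto
  obtain A a0 L where A: "A > 0" "a0 > 0" "L \<ge> 0" and ps: "\<And>k. power_size A a0 L (\<kappa> ^ k) (tail \<kappa> M k / \<kappa> ^ k)"
    using power_size_tail[OF M] by auto
  define L' where "L' = max L 1"
  define A' where "A' = max A (A / b)"
  have "0 \<le> L'" by (simp add: L'_def)
  then obtain K where K: "K > 0" and cmp: "\<And>x y. 0 \<le> x \<Longrightarrow> 0 \<le> y \<Longrightarrow> x \<le> A' * max 1 y powr L' \<Longrightarrow> y \<le> A' * max 1 x powr L' \<Longrightarrow> \<Theta> x \<le> K * \<Theta> y"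
    using class_L_compare[OF \<Theta>, of L' A'] by auto
  have "\<Theta> (1 / w) \<le> K * \<Theta> (\<kappa> ^ k) \<and> \<Theta> (\<kappa> ^ k) \<le> K * \<Theta> (1 / w)"
    if a: "rad \<kappa> k \<le> cmod a" "cmod a \<le> rad \<kappa> (k + 1)" and w: "w = measure M (carleson_square a)" for k a w
  proof -
    define W where "W = tail \<kappa> M k / \<kappa> ^ k"
    define E where "E = \<kappa> ^ k"
    have E: "E \<ge> 1" unfolding E_def using D(4) by (intro one_le_power) auto
    have W: "0 < W" "W \<le> A * E powr (-1 - a0)" "E powr (- L) \<le> A * W" using ps[of k] by (auto simp: power_size_def W_def E_def)
    have w': "b * W \<le> w" "w \<le> W" using sq[OF a] by (auto simp: w W_def)
    have w0: "w > 0" using w'(1) W(1) b mult_pos_pos[of b W] by linarith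
    have 1: "1 / w \<le> A' * max 1 E powr L'"
    proof -
      have "1 / w \<le> 1 / (b * W)" using w' W b w0 by (intro divide_left_mono) auto
      also have "1 / (b * W) \<le> (A / b) * E powr L"
      proof -
        have "1 / W \<le> A * E powr L" using W E by (simp add: powr_minus field_simps)
        then show ?thesis using b W by (simp add: field_simps)
      qed
      also have "\<dots> \<le> A' * E powr L'" using E A by (intro mult_mono powr_mono) (auto simp: A'_def L'_def)
      finally show ?thesis using E by (simp add: max_absorb2)
    qed
    have 2: "E \<le> A' * max 1 (1 / w) powr L'"
    proof -
      have "E powr (-1 - a0) \<le> E powr (-1)" using E A by (intro powr_mono) auto
      then have "W \<le> A * E powr (-1)" using W(2) A by (meson mult_left_mono order_trans less_imp_le)
      then have "w \<le> A / E" using w'(2) E by (simp add: powr_minus_divide)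
      then have "E \<le> A * (1 / w)" using w0 E by (simp add: field_simps)
      also have "\<dots> \<le> A' * max 1 (1 / w) powr L'"
      proof (intro mult_mono)
        have "max 1 (1 / w) powr 1 \<le> max 1 (1 / w) powr L'" by (intro powr_mono) (auto simp: L'_def)
        then show "1 / w \<le> max 1 (1 / w) powr L'" using w0 by simp
      qed (use A w0 in \<open>auto simp: A'_def\<close>)
      finally show ?thesis .
    qed
    show ?thesis using cmp[of "1 / w" E] cmp[of E "1 / w"] 1 2 w0 E by (simp add: E_def)
  qed
  then show ?thesis using K by blast
qed

lemma carleson_critical:
  assumes M: "scale_measure \<kappa> c1 M" and N: "scale_measure \<kappa> c2 N" and \<Theta>: "\<Theta> \<in> class_L" and q: "0 < q"
  shows "\<exists>K>0. \<forall>k a. rad \<kappa> k \<le> cmod a \<longrightarrow> cmod a \<le> rad \<kappa> (k + 1) \<longrightarrow>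
     (\<Theta> (1 / measure M (carleson_square a)) * measure N (carleson_square a)) powr (1 / q) * critical q \<Theta> (\<kappa> ^ k) (tail \<kappa> N k / \<kappa> ^ k) \<le> K \<and>
     1 \<le> K * ((\<Theta> (1 / measure M (carleson_square a)) * measure N (carleson_square a)) powr (1 / q) * critical q \<Theta> (\<kappa> ^ k) (tail \<kappa> N k / \<kappa> ^ k))"
proof -
  obtain b where b: "b > 0" and sq: "\<And>k a. rad \<kappa> k \<le> cmod a \<Longrightarrow> cmod a \<le> rad \<kappa> (k + 1) \<Longrightarrow>
     b * (tail \<kappa> N k / \<kappa> ^ k) \<le> measure N (carleson_square a) \<and> measure N (carleson_square a) \<le> tail \<kappa> N k / \<kappa> ^ k"
    using measure_carleson_square_tail[OF N] by auto
  obtain K0 where K0: "K0 > 0" and cmp: "\<And>k a. rad \<kappa> k \<le> cmod a \<Longrightarrow> cmod a \<le> rad \<kappa> (k + 1) \<Longrightarrow>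
     \<Theta> (1 / measure M (carleson_square a)) \<le> K0 * \<Theta> (\<kappa> ^ k) \<and> \<Theta> (\<kappa> ^ k) \<le> K0 * \<Theta> (1 / measure M (carleson_square a))"
    using class_L_carleson_square[OF M \<Theta>] by auto
  define K where "K = max (K0 powr (1 / q)) ((K0 / b) powr (1 / q))"
  have K: "K > 0" using K0 by (simp add: K_def less_max_iff_disj)
  have "Q powr (1 / q) * critical q \<Theta> (\<kappa> ^ k) V \<le> K \<and> 1 \<le> K * (Q powr (1 / q) * critical q \<Theta> (\<kappa> ^ k) V)"
    if a: "rad \<kappa> k \<le> cmod a" "cmod a \<le> rad \<kappa> (k + 1)" and Q: "Q = \<Theta> (1 / measure M (carleson_square a)) * measure N (carleson_square a)"
      and V: "V = tail \<kappa> N k / \<kappa> ^ k" for k a Q V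
  proof -
    define \<theta> where "\<theta> = \<Theta> (1 / measure M (carleson_square a))"
    define v where "v = measure N (carleson_square a)"
    define P where "P = V * \<Theta> (\<kappa> ^ k)"
    have V0: "V > 0" using scale_measureD(4,7)[OF N] by (simp add: V)
    have D0: "\<Theta> (\<kappa> ^ k) > 0" using scale_measureD(4)[OF N] by (intro class_L_pos[OF \<Theta>]) auto
    have \<theta>0: "\<theta> > 0" unfolding \<theta>_def by (intro class_L_pos[OF \<Theta>]) auto
    have v: "b * V \<le> v" "v \<le> V" using sq[OF a] by (auto simp: v_def V)
    have P0: "P > 0" using V0 D0 by (simp add: P_def)
    have Q': "Q = \<theta> * v" by (simp add: Q \<theta>_def v_def)
    have "\<theta> * v \<le> (K0 * \<Theta> (\<kappa> ^ k)) * V" using cmp[OF a] v V0 b \<theta>0 K0 D0 by (intro mult_mono) (auto simp: \<theta>_def v_def)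
    then have hi: "Q \<le> K0 * P" by (simp add: Q' P_def mult_ac)
    have "\<Theta> (\<kappa> ^ k) * (b * V) \<le> (K0 * \<theta>) * v" using cmp[OF a] v V0 b \<theta>0 K0 D0 by (intro mult_mono) (auto simp: \<theta>_def)
    then have lo: "P \<le> (K0 / b) * Q" using b by (simp add: Q' P_def field_simps)
    have "0 < v" using v(1) mult_pos_pos[OF b V0] by linarith
    then have Q0: "Q > 0" unfolding Q' using \<theta>0 by simp
    have cr: "critical q \<Theta> (\<kappa> ^ k) V = 1 / P powr (1 / q)" by (simp add: critical_def P_def powr_minus_divide)
    have Pq: "P powr (1 / q) > 0" using P0 by simp
    have "Q powr (1 / q) \<le> (K0 * P) powr (1 / q)" using hi Q0 q by (intro powr_mono2) auto
    also have "\<dots> = K0 powr (1 / q) * P powr (1 / q)" using K0 P0 by (simp add: powr_mult)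
    also have "\<dots> \<le> K * P powr (1 / q)" by (intro mult_right_mono) (auto simp: K_def)
    finally have 1: "Q powr (1 / q) \<le> K * P powr (1 / q)" .
    have "P powr (1 / q) \<le> ((K0 / b) * Q) powr (1 / q)" using lo P0 q by (intro powr_mono2) auto
    also have "\<dots> = (K0 / b) powr (1 / q) * Q powr (1 / q)" by (rule powr_mult)
    also have "\<dots> \<le> K * Q powr (1 / q)" by (intro mult_right_mono) (auto simp: K_def)
    finally have 2: "P powr (1 / q) \<le> K * Q powr (1 / q)" .
    show ?thesis using 1 2 Pq unfolding cr by (simp add: field_simps)
  qed
  then show ?thesis using K by blast
qed

context two_weights
begin

text \<open>The quotient in the theorem, for two measures and an arbitrary function \<open>d\<close> in the place of
  \<open>g'\<close>.\<close>

definition ratio :: "(complex \<Rightarrow> complex) \<Rightarrow> complex \<Rightarrow> real" where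
  "ratio d a = cmod (d a) * (1 - cmod a) * (\<Phi> (1 / measure M (carleson_square a)) * measure N (carleson_square a)) powr (1 / q)
     / (\<Psi> (1 / measure M (carleson_square a)) * measure M (carleson_square a)) powr (1 / p)"

text \<open>The product of three comparisons, of \<open>1 - |a|\<close> with \<open>\<kappa>^(-k)\<close> and of the two
  powers with \<open>1 / Y k\<close> and \<open>1 / X k\<close>.\<close>

lemma ratio_compare:
  "\<exists>K>0. \<forall>d k a. rad \<kappa> k \<le> cmod a \<longrightarrow> cmod a \<le> rad \<kappa> (k + 1) \<longrightarrow>
     0 \<le> ratio d a \<and> cmod (d a) \<le> \<kappa> ^ k * (K * ratio d a * (Y k / X k)) \<and> \<kappa> ^ k * (ratio d a * Y k) \<le> K * (cmod (d a) * X k)"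
proof -
  obtain K1 where K1: "K1 > 0" and c1: "\<And>k a. rad \<kappa> k \<le> cmod a \<Longrightarrow> cmod a \<le> rad \<kappa> (k + 1) \<Longrightarrow>
     (\<Psi> (1 / measure M (carleson_square a)) * measure M (carleson_square a)) powr (1 / p) * X k \<le> K1 \<and>
     1 \<le> K1 * ((\<Psi> (1 / measure M (carleson_square a)) * measure M (carleson_square a)) powr (1 / p) * X k)"
    using carleson_critical[OF M M \<Psi> p(1)] unfolding X_def W_def by auto
  obtain K2 where K2: "K2 > 0" and c2: "\<And>k a. rad \<kappa> k \<le> cmod a \<Longrightarrow> cmod a \<le> rad \<kappa> (k + 1) \<Longrightarrow>
     (\<Phi> (1 / measure M (carleson_square a)) * measure N (carleson_square a)) powr (1 / q) * Y k \<le> K2 \<and>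
     1 \<le> K2 * ((\<Phi> (1 / measure M (carleson_square a)) * measure N (carleson_square a)) powr (1 / q) * Y k)"
    using carleson_critical[OF M N \<Phi> q] unfolding Y_def V_def by auto
  define K where "K = K1 * K2 * \<kappa>"
  have K: "K > 0" using K1 K2 \<kappa> by (simp add: K_def)
  have "0 \<le> ratio d a \<and> cmod (d a) \<le> \<kappa> ^ k * (K * ratio d a * (Y k / X k)) \<and> \<kappa> ^ k * (ratio d a * Y k) \<le> K * (cmod (d a) * X k)"
    if a: "rad \<kappa> k \<le> cmod a" "cmod a \<le> rad \<kappa> (k + 1)" for d k a
  proof -
    define P where "P = (\<Psi> (1 / measure M (carleson_square a)) * measure M (carleson_square a)) powr (1 / p)"
    define Q where "Q = (\<Phi> (1 / measure M (carleson_square a)) * measure N (carleson_square a)) powr (1 / q)"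
    define g where "g = cmod (d a)"
    define D where "D = \<kappa> ^ k"
    have D: "D \<ge> 1" using \<kappa>_power by (simp add: D_def)
    have P: "P * X k \<le> K1" "1 \<le> K1 * (P * X k)" using c1[OF a] by (auto simp: P_def)
    have Q: "Q * Y k \<le> K2" "1 \<le> K2 * (Q * Y k)" using c2[OF a] by (auto simp: Q_def)
    have P0: "P \<noteq> 0" using P(2) by auto
    have nn: "0 \<le> P" "0 \<le> Q" "0 \<le> g" by (auto simp: P_def Q_def g_def)
    then have P1: "P > 0" using P0 by simp
    have R: "ratio d a = g * (1 - cmod a) * Q / P" by (simp add: ratio_def P_def Q_def g_def)
    have gap: "1 - cmod a \<le> 1 / D" "1 / (D * \<kappa>) \<le> 1 - cmod a" using a by (auto simp: rad_def D_def mult.commute)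
    have a1: "0 \<le> 1 - cmod a" using gap(2) D \<kappa> by (smt (verit) divide_nonneg_nonneg mult_nonneg_nonneg)
    have pos: "X k > 0" "Y k > 0" using X_pos Y_pos by auto
    have r0: "0 \<le> ratio d a" unfolding R using nn a1 by simp
    \<comment> \<open>both bounds follow from the two-sided bounds for \<open>D * (1 - cmod a)\<close>, \<open>P * X k\<close> and \<open>Q * Y k\<close>\<close>
    have "g * X k * P * 1 * 1 \<le> g * X k * P * (D * \<kappa> * (1 - cmod a)) * (K2 * (Q * Y k))"
    proof (intro mult_mono)
      show "1 \<le> D * \<kappa> * (1 - cmod a)" using gap(2) D \<kappa> by (simp add: field_simps)
    qed (use Q nn pos a1 D \<kappa> in auto)
    also have "\<dots> = D * (K2 * \<kappa>) * (ratio d a * P * P * X k * Y k)" using P1 by (simp add: R)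
    also have "\<dots> = (D * (K2 * \<kappa>) * ratio d a * P * Y k) * (P * X k)" by (simp add: mult_ac)
    also have "\<dots> \<le> (D * (K2 * \<kappa>) * ratio d a * P * Y k) * K1"
      using P(1) D K2 \<kappa> r0 nn pos by (intro mult_left_mono) auto
    finally have "(g * X k) * P \<le> (D * (K * ratio d a * Y k)) * P" by (simp add: K_def mult_ac)
    then have "g * X k \<le> D * (K * ratio d a * Y k)" using P1 by (rule mult_right_le_imp_le)
    then have up: "g \<le> D * (K * ratio d a * (Y k / X k))" using pos by (simp add: field_simps)
    have "D * (ratio d a * Y k) = (g / P) * (D * (1 - cmod a)) * (Q * Y k)" by (simp add: R)
    also have "\<dots> \<le> (g / P) * 1 * K2"
    proof (intro mult_mono)
      show "D * (1 - cmod a) \<le> 1" using gap(1) D by (simp add: field_simps)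
    qed (use Q nn pos a1 D K2 P1 in auto)
    also have "\<dots> \<le> (g / P) * \<kappa> * K2" using \<kappa> K2 nn P1 by (intro mult_right_mono mult_left_mono) auto
    also have "\<dots> \<le> (g / P) * \<kappa> * K2 * (K1 * (P * X k))" using P(2) mult_left_mono[OF P(2), of "(g / P) * \<kappa> * K2"] nn \<kappa> K2 by simp
    also have "\<dots> = K * (g * X k)" using P1 by (simp add: K_def)
    finally show ?thesis using up r0 by (simp add: g_def D_def)
  qed
  then show ?thesis using K by blast
qed


section \<open>Necessity and sufficiency in terms of masses\<close>

text \<open>The growth estimate bounds \<open>h\<close> on the disc around \<open>a\<close> of radius \<open>rad \<kappa>
  (k + 2) - rad \<kappa> (k + 1)\<close>, and Cauchy's estimate bounds the derivative. That \<open>G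
  \<eta>\<close> becomes arbitrarily small serves the compact case.\<close>

lemma derivative_growth:
  "\<exists>G. (\<forall>\<epsilon>>0. \<exists>\<eta>>0. G \<eta> \<le> \<epsilon>) \<and> (\<forall>h k a \<eta>. disc_fun h \<longrightarrow> rad \<kappa> k \<le> cmod a \<longrightarrow> cmod a \<le> rad \<kappa> (k + 1) \<longrightarrow> 0 \<le> \<eta> \<longrightarrow>
     ann_mass (orlicz q \<Phi>) N \<kappa> h (k + 3) \<le> ennreal \<eta> \<longrightarrow> cmod (deriv h a) \<le> \<kappa> ^ k * (G \<eta> * Y k))"
proof -
  note D = scale_measureD[OF N]
  obtain K1 where K1: "K1 > 0" and gr: "\<And>f k a \<eta>. disc_fun f \<Longrightarrow> cmod a \<le> rad \<kappa> (k + 1) \<Longrightarrow> 0 \<le> \<eta> \<Longrightarrow>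
     ann_mass (orlicz q \<Phi>) N \<kappa> f (k + 2) \<le> ennreal \<eta> \<Longrightarrow> orlicz q \<Phi> (cmod (f a)) * V k \<le> K1 * \<eta>"
    using growth_relative[OF N quasi_power_\<Phi>] unfolding V_def by auto
  obtain C \<alpha> \<beta> where C: "C > 0" "\<alpha> > 0" "\<beta> > 0" and inv: "\<And>k x \<eta>. 0 \<le> x \<Longrightarrow> orlicz q \<Phi> x * V k \<le> \<eta> \<Longrightarrow>
     x \<le> max ((C * \<eta>) powr \<alpha>) ((C * \<eta>) powr \<beta>) * Y k"
    using critical_inverse(1)[OF N \<Phi> q] unfolding V_def Y_def by metis
  define K where "K = C * (\<kappa> / c2 * K1)"
  define H where "H \<eta> = max ((K * \<eta>) powr \<alpha>) ((K * \<eta>) powr \<beta>)" for \<eta>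
  have K: "K > 0" using C K1 D(4,5) by (simp add: K_def)
  have "\<exists>\<eta>>0. 2 * \<kappa> * H \<eta> \<le> \<epsilon>" if "\<epsilon> > 0" for \<epsilon>
  proof -
    define t where "t = \<epsilon> / (2 * \<kappa>)"
    define m where "m = min (t powr (1 / \<alpha>)) (t powr (1 / \<beta>))"
    have t: "t > 0" using that \<kappa> by (simp add: t_def)
    have m: "m > 0" "m \<le> t powr (1 / \<alpha>)" "m \<le> t powr (1 / \<beta>)" using t by (auto simp: m_def)
    have "m powr \<alpha> \<le> (t powr (1 / \<alpha>)) powr \<alpha>" "m powr \<beta> \<le> (t powr (1 / \<beta>)) powr \<beta>"
      using m C by (auto intro!: powr_mono2)
    then have "m powr \<alpha> \<le> t" "m powr \<beta> \<le> t" using C t by (simp_all add: powr_powr)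
    then have "H (m / K) \<le> t" using K by (simp add: H_def)
    then have "2 * \<kappa> * H (m / K) \<le> \<epsilon>" using \<kappa> by (simp add: t_def field_simps)
    moreover have "m / K > 0" using m K by simp
    ultimately show ?thesis by blast
  qed
  moreover have "cmod (deriv h a) \<le> \<kappa> ^ k * (2 * \<kappa> * H \<eta> * Y k)"
    if h: "disc_fun h" and a: "rad \<kappa> k \<le> cmod a" "cmod a \<le> rad \<kappa> (k + 1)" and \<eta>: "0 \<le> \<eta>" "ann_mass (orlicz q \<Phi>) N \<kappa> h (k + 3) \<le> ennreal \<eta>" for h k a \<eta>
  proof -
    have VV: "V k \<le> \<kappa> / c2 * V (k + 1)" using D(8)[of k] D(4,5) by (simp add: V_def field_simps)
    have bd: "cmod (h w) \<le> H \<eta> * Y k" if w: "cmod w \<le> rad \<kappa> (k + 2)" for w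
    proof -
      have "orlicz q \<Phi> (cmod (h w)) * V (k + 1) \<le> K1 * \<eta>" using w \<eta> by (intro gr h) (auto simp: numeral_eq_Suc)
      moreover have "orlicz q \<Phi> (cmod (h w)) * V k \<le> orlicz q \<Phi> (cmod (h w)) * (\<kappa> / c2 * V (k + 1))"
        using quasi_power_nonneg[OF quasi_power_\<Phi>] VV by (intro mult_left_mono) auto
      moreover have "\<kappa> / c2 * (orlicz q \<Phi> (cmod (h w)) * V (k + 1)) \<le> \<kappa> / c2 * (K1 * \<eta>)"
        using calculation(1) D(4,5) by (intro mult_left_mono) auto
      ultimately have "orlicz q \<Phi> (cmod (h w)) * V k \<le> \<kappa> / c2 * (K1 * \<eta>)" by (simp add: mult_ac)
      then have "cmod (h w) \<le> max ((C * (\<kappa> / c2 * (K1 * \<eta>))) powr \<alpha>) ((C * (\<kappa> / c2 * (K1 * \<eta>))) powr \<beta>) * Y k" by (intro inv) auto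
      moreover have "C * (\<kappa> / c2 * (K1 * \<eta>)) = K * \<eta>" by (simp add: K_def)
      ultimately show ?thesis by (simp add: H_def)
    qed
    define \<rho> where "\<rho> = rad \<kappa> (k + 2) - rad \<kappa> (k + 1)"
    have \<rho>: "\<rho> \<ge> 1 / (2 * \<kappa>) * (1 / \<kappa> ^ k)" unfolding \<rho>_def by (rule rad_gap[OF \<kappa>])
    have "1 / (2 * \<kappa>) * (1 / \<kappa> ^ k) > 0" using \<kappa> by simp
    then have \<rho>0: "\<rho> > 0" using \<rho> by linarith
    have inside: "cmod w \<le> rad \<kappa> (k + 2)" if "cmod (a - w) \<le> \<rho>" for w
      using that a norm_triangle_ineq2[of w a] by (simp add: \<rho>_def norm_minus_commute)
    have sub: "cball a \<rho> \<subseteq> unit_disc"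
      using inside rad_props(2)[OF \<kappa>, of "k + 2"] by (force simp: dist_norm)
    have hol: "h holomorphic_on cball a \<rho>" using h sub by (auto simp: disc_fun_def intro: holomorphic_on_subset)
    have "cmod ((deriv ^^ 1) h a) \<le> fact 1 * (H \<eta> * Y k) / \<rho> ^ 1"
    proof (rule Cauchy_inequality)
      show "h holomorphic_on ball a \<rho>" using hol by (rule holomorphic_on_subset) auto
      show "continuous_on (cball a \<rho>) h" using hol by (rule holomorphic_on_imp_continuous_on)
    qed (use \<rho>0 bd inside in auto)
    then have "cmod (deriv h a) \<le> H \<eta> * Y k / \<rho>" by simp
    also have "\<dots> \<le> H \<eta> * Y k / (1 / (2 * \<kappa>) * (1 / \<kappa> ^ k))"
    proof (rule divide_left_mono[OF \<rho>])
      show "0 \<le> H \<eta> * Y k" using Y_pos[of k] by (simp add: H_def le_max_iff_disj)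
      show "0 < \<rho> * (1 / (2 * \<kappa>) * (1 / \<kappa> ^ k))" using \<rho>0 \<kappa> by simp
    qed
    also have "\<dots> = \<kappa> ^ k * (2 * \<kappa> * H \<eta> * Y k)" by simp
    finally show ?thesis .
  qed
  ultimately show ?thesis by (intro exI[of _ "\<lambda>\<eta>. 2 * \<kappa> * H \<eta>"]) auto
qed

lemma ring_cover: "cmod a < 1 \<Longrightarrow> \<exists>k. rad \<kappa> k \<le> cmod a \<and> cmod a \<le> rad \<kappa> (k + 1)"
  using rad_ring_exists[OF \<kappa>, of "cmod a"] by (auto intro: less_imp_le)

lemma bounded_necessary:
  assumes g: "g holomorphic_on unit_disc"
    and bdd: "\<And>S. \<exists>B. \<forall>f. disc_fun f \<longrightarrow> mass (orlicz p \<Psi>) M f \<le> ennreal S \<longrightarrow> mass (orlicz q \<Phi>) N (integral_op g f) \<le> ennreal B"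
  shows "\<exists>R. \<forall>a. cmod a < 1 \<longrightarrow> ratio (deriv g) a \<le> R"
proof -
  obtain G where G: "\<And>h k a \<eta>. disc_fun h \<Longrightarrow> rad \<kappa> k \<le> cmod a \<Longrightarrow> cmod a \<le> rad \<kappa> (k + 1) \<Longrightarrow> 0 \<le> \<eta> \<Longrightarrow>
     ann_mass (orlicz q \<Phi>) N \<kappa> h (k + 3) \<le> ennreal \<eta> \<Longrightarrow> cmod (deriv h a) \<le> \<kappa> ^ k * (G \<eta> * Y k)"
    using derivative_growth by metis
  obtain K where K: "K > 0" and cmp: "\<And>d k a. rad \<kappa> k \<le> cmod a \<Longrightarrow> cmod a \<le> rad \<kappa> (k + 1) \<Longrightarrow>
     \<kappa> ^ k * (ratio d a * Y k) \<le> K * (cmod (d a) * X k)"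
    using ratio_compare by metis
  obtain S \<delta> where \<delta>: "\<delta> > 0" and test: "\<And>k a. rad \<kappa> k \<le> cmod a \<Longrightarrow> cmod a \<le> rad \<kappa> (k + 1) \<Longrightarrow>
     \<exists>f. disc_fun f \<and> mass (orlicz p \<Psi>) M f \<le> ennreal S \<and> \<delta> * X k \<le> cmod (f a)"
    using test_function by metis
  obtain B0 where B0: "\<And>f. disc_fun f \<Longrightarrow> mass (orlicz p \<Psi>) M f \<le> ennreal S \<Longrightarrow> mass (orlicz q \<Phi>) N (integral_op g f) \<le> ennreal B0"
    using bdd[of S] by auto
  define B where "B = max 0 B0"
  have "ratio (deriv g) a \<le> K * G B / \<delta>" if a1: "cmod a < 1" for a
  proof -
    obtain k where a: "rad \<kappa> k \<le> cmod a" "cmod a \<le> rad \<kappa> (k + 1)" using ring_cover[OF a1] by auto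
    obtain f where f: "disc_fun f" "mass (orlicz p \<Psi>) M f \<le> ennreal S" "\<delta> * X k \<le> cmod (f a)" using test[OF a] by auto
    note T = integral_op_facts[OF f(1) g]
    have "ann_mass (orlicz q \<Phi>) N \<kappa> (integral_op g f) (k + 3) \<le> ennreal B"
      using order_trans[OF ann_mass_le_mass B0[OF f(1,2)]] unfolding B_def by (metis ennreal_leI max.cobounded2 order_trans)
    then have "cmod (deriv (integral_op g f) a) \<le> \<kappa> ^ k * (G B * Y k)" using a T(1) by (intro G) (auto simp: B_def)
    then have "cmod (f a) * cmod (deriv g a) \<le> \<kappa> ^ k * (G B * Y k)" using T(3)[OF a1] by (simp add: norm_mult)
    moreover have "\<delta> * X k * cmod (deriv g a) \<le> cmod (f a) * cmod (deriv g a)" using f(3) by (intro mult_right_mono) auto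
    ultimately have "\<delta> * (cmod (deriv g a) * X k) \<le> \<kappa> ^ k * (G B * Y k)" by (simp add: mult_ac)
    then have "cmod (deriv g a) * X k \<le> \<kappa> ^ k * (G B * Y k) / \<delta>" using \<delta> by (simp add: pos_le_divide_eq mult.commute)
    then have "K * (cmod (deriv g a) * X k) \<le> K * (\<kappa> ^ k * (G B * Y k) / \<delta>)" using K by (intro mult_left_mono) auto
    with cmp[OF a, of "deriv g"] have "\<kappa> ^ k * (ratio (deriv g) a * Y k) \<le> K * (\<kappa> ^ k * (G B * Y k) / \<delta>)" by linarith
    then have "ratio (deriv g) a * (\<kappa> ^ k * Y k) \<le> K * G B / \<delta> * (\<kappa> ^ k * Y k)" by (simp add: mult_ac)
    moreover have "\<kappa> ^ k * Y k > 0" using Y_pos \<kappa> by simp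
    ultimately show ?thesis by (metis mult_right_le_imp_le)
  qed
  then show ?thesis by blast
qed

text \<open>\<open>operator_estimate\<close> with the hypotheses on \<open>d\<close> expressed by the quotient of the
  theorem. The function \<open>h\<close> is kept general because compactness needs the estimate for a
  difference of two images.\<close>

lemma integral_op_estimate:
  "\<exists>C K \<alpha> \<beta>. 0 < C \<and> 0 < K \<and> 0 < \<alpha> \<and> 0 < \<beta> \<and> (\<forall>f h d \<epsilon> k0 s b. disc_fun f \<longrightarrow> mass (orlicz p \<Psi>) M f \<le> ennreal S \<longrightarrow> disc_fun h \<longrightarrow> h 0 = 0 \<longrightarrow>
     (\<forall>z. cmod z < 1 \<longrightarrow> deriv h z = f z * d z) \<longrightarrow> 0 \<le> \<epsilon> \<longrightarrow>
     (\<forall>z. rad \<kappa> k0 \<le> cmod z \<longrightarrow> cmod z < 1 \<longrightarrow> ratio d z \<le> \<epsilon>) \<longrightarrow>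
     (\<forall>z. cmod z \<le> rad \<kappa> k0 \<longrightarrow> cmod (d z) \<le> b \<and> cmod (f z) \<le> s) \<longrightarrow>
     mass (orlicz q \<Phi>) N h \<le> ennreal C * ((\<Sum>k<k0. ennreal (tail \<kappa> N k * orlicz q \<Phi> (b * s))) + ennreal (max ((K * \<epsilon>) powr \<alpha>) ((K * \<epsilon>) powr \<beta>))))"
proof -
  obtain K where K: "K > 0" and cmp: "\<And>d k a. rad \<kappa> k \<le> cmod a \<Longrightarrow> cmod a \<le> rad \<kappa> (k + 1) \<Longrightarrow>
     cmod (d a) \<le> \<kappa> ^ k * (K * ratio d a * (Y k / X k))"
    using ratio_compare by metis
  from operator_estimate[of S] show ?thesis
  proof (elim exE conjE)
    fix C \<alpha> \<beta> :: real
    assume C: "0 < C" "0 < \<alpha>" "0 < \<beta>" and est: "\<forall>f h d \<epsilon> k0 s m. disc_fun f \<longrightarrow> mass (orlicz p \<Psi>) M f \<le> ennreal S \<longrightarrow> disc_fun h \<longrightarrow> h 0 = 0 \<longrightarrow>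
       (\<forall>z. cmod z < 1 \<longrightarrow> deriv h z = f z * d z) \<longrightarrow> 0 \<le> \<epsilon> \<longrightarrow>
       (\<forall>k z. k0 \<le> k \<longrightarrow> rad \<kappa> k \<le> cmod z \<longrightarrow> cmod z \<le> rad \<kappa> (k + 1) \<longrightarrow> cmod (d z) \<le> \<kappa> ^ k * (\<epsilon> * (Y k / X k))) \<longrightarrow>
       (\<forall>k z. k < k0 \<longrightarrow> rad \<kappa> k \<le> cmod z \<longrightarrow> cmod z \<le> rad \<kappa> (k + 1) \<longrightarrow> cmod (d z) \<le> \<kappa> ^ k * m k \<and> cmod (f z) \<le> s) \<longrightarrow>
       (\<forall>k. 0 \<le> m k) \<longrightarrow> 0 \<le> s \<longrightarrow>
       mass (orlicz q \<Phi>) N h \<le> ennreal C * ((\<Sum>k<k0. ennreal (tail \<kappa> N k * orlicz q \<Phi> (m k * s))) + ennreal (max (\<epsilon> powr \<alpha>) (\<epsilon> powr \<beta>)))"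
    have main: "mass (orlicz q \<Phi>) N h \<le> ennreal C * ((\<Sum>k<k0. ennreal (tail \<kappa> N k * orlicz q \<Phi> (b * s))) + ennreal (max ((K * \<epsilon>) powr \<alpha>) ((K * \<epsilon>) powr \<beta>)))"
      if f: "disc_fun f" "mass (orlicz p \<Psi>) M f \<le> ennreal S" and h: "disc_fun h" "h 0 = 0" "\<forall>z. cmod z < 1 \<longrightarrow> deriv h z = f z * d z"
        and \<epsilon>: "0 \<le> \<epsilon>" "\<forall>z. rad \<kappa> k0 \<le> cmod z \<longrightarrow> cmod z < 1 \<longrightarrow> ratio d z \<le> \<epsilon>"
        and inner: "\<forall>z. cmod z \<le> rad \<kappa> k0 \<longrightarrow> cmod (d z) \<le> b \<and> cmod (f z) \<le> s" for f h d \<epsilon> k0 s b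
    proof -
      have bs: "0 \<le> b" "0 \<le> s"
        using inner[rule_format, of 0] rad_props(1)[OF \<kappa>, of k0] norm_ge_zero[of "d 0"] norm_ge_zero[of "f 0"] by (auto simp del: norm_ge_zero)
      have outer: "\<forall>k z. k0 \<le> k \<longrightarrow> rad \<kappa> k \<le> cmod z \<longrightarrow> cmod z \<le> rad \<kappa> (k + 1) \<longrightarrow> cmod (d z) \<le> \<kappa> ^ k * (K * \<epsilon> * (Y k / X k))"
      proof (intro allI impI)
        fix k z assume k: "k0 \<le> k" and z: "rad \<kappa> k \<le> cmod z" "cmod z \<le> rad \<kappa> (k + 1)"
        have "cmod z < 1" using z rad_props(2)[OF \<kappa>, of "k + 1"] by linarith
        moreover have "rad \<kappa> k0 \<le> cmod z" using rad_mono[OF \<kappa> k] z by linarith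
        ultimately have "K * ratio d z \<le> K * \<epsilon>" using \<epsilon>(2) K by (intro mult_left_mono) auto
        then have "K * ratio d z * (Y k / X k) \<le> K * \<epsilon> * (Y k / X k)" using X_pos[of k] Y_pos[of k] by (intro mult_right_mono) auto
        then have "\<kappa> ^ k * (K * ratio d z * (Y k / X k)) \<le> \<kappa> ^ k * (K * \<epsilon> * (Y k / X k))" using \<kappa> by (intro mult_left_mono) auto
        then show "cmod (d z) \<le> \<kappa> ^ k * (K * \<epsilon> * (Y k / X k))" using cmp[OF z, of d] by linarith
      qed
      have inner': "\<forall>k z. k < k0 \<longrightarrow> rad \<kappa> k \<le> cmod z \<longrightarrow> cmod z \<le> rad \<kappa> (k + 1) \<longrightarrow> cmod (d z) \<le> \<kappa> ^ k * b \<and> cmod (f z) \<le> s"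
      proof (intro allI impI)
        fix k z assume k: "k < k0" and z: "rad \<kappa> k \<le> cmod z" "cmod z \<le> rad \<kappa> (k + 1)"
        have "cmod z \<le> rad \<kappa> k0" using rad_mono[OF \<kappa>, of "k + 1" k0] k z by simp
        moreover have "b \<le> \<kappa> ^ k * b" using mult_right_mono[OF \<kappa>_power[of k] bs(1)] by simp
        ultimately show "cmod (d z) \<le> \<kappa> ^ k * b \<and> cmod (f z) \<le> s" using inner by (meson order_trans)
      qed
      have "0 \<le> K * \<epsilon>" using K \<epsilon> by simp
      moreover have "\<forall>k::nat. 0 \<le> b" using bs by simp
      ultimately show ?thesis
        using est[THEN spec, of f, THEN spec, of h, THEN spec, of d, THEN spec, of "K * \<epsilon>", THEN spec, of k0, THEN spec, of s, THEN spec, of "\<lambda>_. b"]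
          f h outer inner' bs(2) by (simp only: simp_thms)
    qed
    show ?thesis
      by (rule exI[of _ C], rule exI[of _ K], rule exI[of _ \<alpha>], rule exI[of _ \<beta>], intro conjI allI impI C K) (rule main; assumption)
  qed
qed

lemma bounded_sufficient:
  assumes g: "g holomorphic_on unit_disc" and R: "\<And>a. cmod a < 1 \<Longrightarrow> ratio (deriv g) a \<le> R"
  shows "\<exists>B. \<forall>f. disc_fun f \<longrightarrow> mass (orlicz p \<Psi>) M f \<le> ennreal S \<longrightarrow> mass (orlicz q \<Phi>) N (integral_op g f) \<le> ennreal B"
proof -
  from integral_op_estimate[of S] show ?thesis
  proof (elim exE conjE)
    fix C K \<alpha> \<beta> :: real
    assume C: "0 < C" "0 < K" and est: "\<forall>f h d \<epsilon> k0 s b. disc_fun f \<longrightarrow> mass (orlicz p \<Psi>) M f \<le> ennreal S \<longrightarrow> disc_fun h \<longrightarrow> h 0 = 0 \<longrightarrow>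
     (\<forall>z. cmod z < 1 \<longrightarrow> deriv h z = f z * d z) \<longrightarrow> 0 \<le> \<epsilon> \<longrightarrow>
     (\<forall>z. rad \<kappa> k0 \<le> cmod z \<longrightarrow> cmod z < 1 \<longrightarrow> ratio d z \<le> \<epsilon>) \<longrightarrow>
     (\<forall>z. cmod z \<le> rad \<kappa> k0 \<longrightarrow> cmod (d z) \<le> b \<and> cmod (f z) \<le> s) \<longrightarrow>
     mass (orlicz q \<Phi>) N h \<le> ennreal C * ((\<Sum>k<k0. ennreal (tail \<kappa> N k * orlicz q \<Phi> (b * s))) + ennreal (max ((K * \<epsilon>) powr \<alpha>) ((K * \<epsilon>) powr \<beta>)))"
    define \<epsilon> where "\<epsilon> = max 0 R"
    have \<epsilon>: "0 \<le> \<epsilon>" "\<forall>z. rad \<kappa> 0 \<le> cmod z \<longrightarrow> cmod z < 1 \<longrightarrow> ratio (deriv g) z \<le> \<epsilon>"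
      using R by (auto simp: \<epsilon>_def le_max_iff_disj)
    have "mass (orlicz q \<Phi>) N (integral_op g f) \<le> ennreal (C * max ((K * \<epsilon>) powr \<alpha>) ((K * \<epsilon>) powr \<beta>))"
      if f: "disc_fun f" "mass (orlicz p \<Psi>) M f \<le> ennreal S" for f
    proof -
      note T = integral_op_facts[OF f(1) g]
      have inner: "\<forall>z. cmod z \<le> rad \<kappa> 0 \<longrightarrow> cmod (deriv g z) \<le> cmod (deriv g 0) \<and> cmod (f z) \<le> cmod (f 0)"
        using rad_props(5)[OF \<kappa>] by auto
      have der: "\<forall>z. cmod z < 1 \<longrightarrow> deriv (integral_op g f) z = f z * deriv g z" using T(3) by simp
      have "mass (orlicz q \<Phi>) N (integral_op g f) \<le> ennreal C * ((\<Sum>k<0. ennreal (tail \<kappa> N k * orlicz q \<Phi> (cmod (deriv g 0) * cmod (f 0)))) + ennreal (max ((K * \<epsilon>) powr \<alpha>) ((K * \<epsilon>) powr \<beta>)))"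
        using est[THEN spec, of f, THEN spec, of "integral_op g f", THEN spec, of "deriv g", THEN spec, of \<epsilon>, THEN spec, of 0,
            THEN spec, of "cmod (f 0)", THEN spec, of "cmod (deriv g 0)"] f T(1,2) \<epsilon> inner der by (simp only: simp_thms)
      then show ?thesis using C by (simp add: ennreal_mult')
    qed
    then show ?thesis by blast
  qed
qed


text \<open>Scaled test functions belong to the set on which the finite net \<open>H\<close> approximates the images. Near
  the circle the members of \<open>H\<close> have little mass on each ring, hence so do the images, and this
  makes their derivatives small compared with \<open>\<kappa>^k * Y k\<close>.\<close>

lemma compact_necessary:
  assumes g: "g holomorphic_on unit_disc" and S: "0 < S"
    and net: "\<And>\<eta>. 0 < \<eta> \<Longrightarrow> \<exists>H. finite H \<and> (\<forall>h\<in>H. disc_fun h \<and> mass (orlicz q \<Phi>) N h < \<infinity>) \<and>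
       (\<forall>f. disc_fun f \<longrightarrow> mass (orlicz p \<Psi>) M f \<le> ennreal S \<longrightarrow> (\<exists>h\<in>H. mass (orlicz q \<Phi>) N (\<lambda>z. integral_op g f z - h z) \<le> ennreal \<eta>))"
    and \<epsilon>: "0 < \<epsilon>"
  shows "\<exists>k0. \<forall>a. rad \<kappa> k0 \<le> cmod a \<longrightarrow> cmod a < 1 \<longrightarrow> ratio (deriv g) a \<le> \<epsilon>"
proof -
  define F where "F = orlicz q \<Phi>"
  have F: "quasi_power F" unfolding F_def by (rule quasi_power_\<Phi>)
  obtain G where Gsmall: "\<And>\<epsilon>. 0 < \<epsilon> \<Longrightarrow> \<exists>\<eta>>0. G \<eta> \<le> \<epsilon>" and G: "\<And>h k a \<eta>. disc_fun h \<Longrightarrow> rad \<kappa> k \<le> cmod a \<Longrightarrow> cmod a \<le> rad \<kappa> (k + 1) \<Longrightarrow> 0 \<le> \<eta> \<Longrightarrow>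
     ann_mass F N \<kappa> h (k + 3) \<le> ennreal \<eta> \<Longrightarrow> cmod (deriv h a) \<le> \<kappa> ^ k * (G \<eta> * Y k)"
    using derivative_growth unfolding F_def[symmetric] by metis
  obtain K where K: "K > 0" and cmp: "\<And>d k a. rad \<kappa> k \<le> cmod a \<Longrightarrow> cmod a \<le> rad \<kappa> (k + 1) \<Longrightarrow>
     \<kappa> ^ k * (ratio d a * Y k) \<le> K * (cmod (d a) * X k)"
    using ratio_compare by metis
  obtain S1 \<delta> where S1: "S1 > 0" and \<delta>: "\<delta> > 0" and test: "\<And>k a. rad \<kappa> k \<le> cmod a \<Longrightarrow> cmod a \<le> rad \<kappa> (k + 1) \<Longrightarrow>
     \<exists>f. disc_fun f \<and> mass (orlicz p \<Psi>) M f \<le> ennreal S1 \<and> \<delta> * X k \<le> cmod (f a)"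
    using test_function by metis
  obtain Cs \<alpha> where Cs: "Cs > 0" "\<alpha> > 0" and scale: "\<And>f t. disc_fun f \<Longrightarrow> 0 \<le> t \<Longrightarrow> t \<le> 1 \<Longrightarrow>
     mass (orlicz p \<Psi>) M (\<lambda>z. of_real t * f z) \<le> ennreal (Cs * t powr \<alpha>) * mass (orlicz p \<Psi>) M f"
    using mass_scale[OF quasi_power_\<Psi> scale_measureD(2)[OF M]] by metis
  obtain Ct where Ct: "Ct \<ge> 1" and tri: "\<And>f g k. disc_fun f \<Longrightarrow> disc_fun g \<Longrightarrow>
     ann_mass F N \<kappa> (\<lambda>z. f z + g z) k \<le> ennreal Ct * (ann_mass F N \<kappa> f k + ann_mass F N \<kappa> g k)"
    using mass_triangle[OF F scale_measureD(2)[OF N]] by metis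
  \<comment> \<open>the factor that brings the test functions into the set \<open>mass \<le> S\<close>\<close>
  define t where "t = min 1 ((S / (Cs * S1)) powr (1 / \<alpha>))"
  have t: "0 < t" "t \<le> 1" using S S1 Cs by (auto simp: t_def)
  have "t powr \<alpha> \<le> ((S / (Cs * S1)) powr (1 / \<alpha>)) powr \<alpha>" using t Cs by (intro powr_mono2) (auto simp: t_def)
  then have "t powr \<alpha> \<le> S / (Cs * S1)" using Cs S S1 by (simp add: powr_powr)
  then have tS: "Cs * t powr \<alpha> * S1 \<le> S" using Cs S1 by (simp add: field_simps)
  have "0 < \<epsilon> * (t * \<delta>) / K" using \<epsilon> t \<delta> K by simp
  then obtain \<eta>1 where \<eta>1: "\<eta>1 > 0" "G \<eta>1 \<le> \<epsilon> * (t * \<delta>) / K" using Gsmall by blast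
  define \<eta> where "\<eta> = \<eta>1 / (2 * Ct)"
  have \<eta>: "\<eta> > 0" "Ct * (\<eta> + \<eta>) = \<eta>1" using \<eta>1 Ct by (auto simp: \<eta>_def)
  obtain H where H: "finite H" "\<And>h. h \<in> H \<Longrightarrow> disc_fun h \<and> mass F N h < \<infinity>"
     "\<And>f. disc_fun f \<Longrightarrow> mass (orlicz p \<Psi>) M f \<le> ennreal S \<Longrightarrow> \<exists>h\<in>H. mass F N (\<lambda>z. integral_op g f z - h z) \<le> ennreal \<eta>"
    using net[OF \<eta>(1)] unfolding F_def[symmetric] by metis
  \<comment> \<open>a single function of finite mass has little mass on the far annuli\<close>
  have "eventually (\<lambda>k. ann_mass F N \<kappa> h k \<le> ennreal \<eta>) sequentially" if h: "h \<in> H" for h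
  proof -
    have fin: "(\<Sum>k. ann_mass F N \<kappa> h k) \<noteq> top" using suminf_ann_mass[OF N F] H(2)[OF h] by (auto simp: less_top)
    have af: "ann_mass F N \<kappa> h k \<noteq> top" for k using order_le_less_trans[OF ann_mass_le_mass[of F N \<kappa> h k]] H(2)[OF h] by force
    define m where "m k = enn2real (ann_mass F N \<kappa> h k)" for k
    have m: "ann_mass F N \<kappa> h k = ennreal (m k)" "0 \<le> m k" for k using af[of k] by (auto simp: m_def less_top)
    have "summable m" using fin m(2) unfolding m(1) by (intro summable_suminf_not_top)
    then have "m \<longlonglongrightarrow> 0" by (rule summable_LIMSEQ_zero)
    then have "eventually (\<lambda>k. m k < \<eta>) sequentially" using \<eta>(1) by (rule order_tendstoD)
    then show ?thesis by eventually_elim (simp add: m ennreal_leI)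
  qed
  then have "eventually (\<lambda>k. \<forall>h\<in>H. ann_mass F N \<kappa> h k \<le> ennreal \<eta>) sequentially" using H(1) by (simp add: eventually_ball_finite)
  then obtain k0 where k0: "\<And>k h. k0 \<le> k \<Longrightarrow> h \<in> H \<Longrightarrow> ann_mass F N \<kappa> h k \<le> ennreal \<eta>" by (auto simp: eventually_sequentially)
  have "ratio (deriv g) a \<le> \<epsilon>" if a0: "rad \<kappa> (k0 + 1) \<le> cmod a" and a1: "cmod a < 1" for a
  proof -
    obtain k where a: "rad \<kappa> k \<le> cmod a" "cmod a < rad \<kappa> (k + 1)"
      using rad_ring_exists[OF \<kappa>, of "cmod a"] a1 by auto
    have "k0 \<le> k + 3"
    proof (rule ccontr)
      assume "\<not> k0 \<le> k + 3"
      then have "rad \<kappa> (k + 1) \<le> rad \<kappa> (k0 + 1)" by (intro rad_mono \<kappa>) auto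
      then show False using a a0 by linarith
    qed
    note ring = a(1) less_imp_le[OF a(2)]
    obtain f0 where f0: "disc_fun f0" "mass (orlicz p \<Psi>) M f0 \<le> ennreal S1" "\<delta> * X k \<le> cmod (f0 a)" using test[OF ring] by auto
    define f where "f = (\<lambda>z. of_real t * f0 z)"
    have f: "disc_fun f" unfolding f_def using f0(1) by (rule disc_fun_cmult)
    have "mass (orlicz p \<Psi>) M f \<le> ennreal (Cs * t powr \<alpha>) * mass (orlicz p \<Psi>) M f0" unfolding f_def using t by (intro scale f0) auto
    also have "\<dots> \<le> ennreal (Cs * t powr \<alpha>) * ennreal S1" by (intro mult_left_mono f0) simp
    also have "\<dots> = ennreal (Cs * t powr \<alpha> * S1)" using Cs S1 by (intro ennreal_mult[symmetric]) auto
    also have "\<dots> \<le> ennreal S" by (rule ennreal_leI[OF tS])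
    finally have fS: "mass (orlicz p \<Psi>) M f \<le> ennreal S" .
    note T = integral_op_facts[OF f g]
    obtain h where h: "h \<in> H" "mass F N (\<lambda>z. integral_op g f z - h z) \<le> ennreal \<eta>" using H(3)[OF f fS] by auto
    have dh: "disc_fun h" using H(2)[OF h(1)] by simp
    have "ann_mass F N \<kappa> (\<lambda>z. (integral_op g f z - h z) + h z) (k + 3) \<le>
        ennreal Ct * (ann_mass F N \<kappa> (\<lambda>z. integral_op g f z - h z) (k + 3) + ann_mass F N \<kappa> h (k + 3))"
      by (intro tri disc_fun_diff T dh)
    also have "\<dots> \<le> ennreal Ct * (ennreal \<eta> + ennreal \<eta>)"
      using order_trans[OF ann_mass_le_mass h(2)] k0[OF \<open>k0 \<le> k + 3\<close> h(1)] by (intro mult_left_mono add_mono) auto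
    also have "\<dots> = ennreal \<eta>1" using Ct \<eta> by (simp add: ennreal_mult'[symmetric] flip: ennreal_plus)
    finally have "ann_mass F N \<kappa> (integral_op g f) (k + 3) \<le> ennreal \<eta>1" by simp
    then have "cmod (deriv (integral_op g f) a) \<le> \<kappa> ^ k * (G \<eta>1 * Y k)" using \<eta>1 ring T(1) by (intro G) auto
    also have "\<dots> \<le> \<kappa> ^ k * (\<epsilon> * (t * \<delta>) / K * Y k)"
      using \<eta>1(2) Y_pos[of k] \<kappa> by (intro mult_left_mono mult_right_mono) auto
    finally have "t * cmod (f0 a) * cmod (deriv g a) \<le> \<kappa> ^ k * (\<epsilon> * (t * \<delta>) / K * Y k)"
      using T(3)[OF a1] t by (simp add: norm_mult f_def)
    moreover have "t * (\<delta> * X k) * cmod (deriv g a) \<le> t * cmod (f0 a) * cmod (deriv g a)"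
      using f0(3) t by (intro mult_right_mono mult_left_mono) auto
    ultimately have "t * (\<delta> * X k) * cmod (deriv g a) \<le> \<kappa> ^ k * (\<epsilon> * (t * \<delta>) / K * Y k)" by linarith
    then have "(t * \<delta>) * (K * (cmod (deriv g a) * X k)) \<le> (t * \<delta>) * (\<kappa> ^ k * (\<epsilon> * Y k))" using K by (simp add: field_simps)
    moreover have "t * \<delta> > 0" using t \<delta> by simp
    ultimately have "K * (cmod (deriv g a) * X k) \<le> \<kappa> ^ k * (\<epsilon> * Y k)" by (rule mult_left_le_imp_le)
    then have "\<kappa> ^ k * (ratio (deriv g) a * Y k) \<le> \<kappa> ^ k * (\<epsilon> * Y k)" using cmp[OF ring, of "deriv g"] by linarith
    then have "ratio (deriv g) a * (\<kappa> ^ k * Y k) \<le> \<epsilon> * (\<kappa> ^ k * Y k)" by (simp add: mult_ac)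
    moreover have "\<kappa> ^ k * Y k > 0" using Y_pos \<kappa> by simp
    ultimately show ?thesis by (rule mult_right_le_imp_le)
  qed
  then show ?thesis by blast
qed

end

text \<open>Fatou's lemma. As \<open>F\<close> need not be continuous, the limit of \<open>F (cmod (s n z))\<close> is
  replaced by the comparison \<open>F x \<le> C0 * F y\<close> for \<open>x \<le> 2 * y\<close>, which costs
  the constant.\<close>

lemma mass_pointwise_limit:
  assumes F: "quasi_power F" and sM: "sets M = sets borel"
  shows "\<exists>C>0. \<forall>f s S. (\<forall>n::nat. disc_fun (s n)) \<longrightarrow> (\<forall>z. (\<lambda>n. s n z) \<longlonglongrightarrow> f z) \<longrightarrow> (\<forall>n. mass F M (s n) \<le> S) \<longrightarrow> mass F M f \<le> ennreal C * S"
proof -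
  note sM[measurable_cong]
  have [measurable]: "F \<in> borel_measurable borel" using quasi_power_measurable[OF F] .
  obtain C \<alpha> \<beta> where pb: "power_bounds F C \<alpha> \<beta>" using quasi_power_bounds[OF F] .
  note C = power_boundsD(1-3)[OF pb]
  define C0 where "C0 = C * 2 powr \<beta> * C"
  have C0: "C0 > 0" using C by (simp add: C0_def)
  have half: "F x \<le> C0 * F y" if "0 \<le> x" "x \<le> 2 * y" for x y
  proof -
    have "F (2 * (x / 2)) \<le> C * 2 powr \<beta> * F (x / 2)" using that by (intro power_boundsD(5)[OF pb]) auto
    also have "\<dots> \<le> C * 2 powr \<beta> * (C * F y)" using that C by (intro mult_left_mono power_bounds_mono[OF pb F]) auto
    finally show ?thesis by (simp add: C0_def)
  qed
  have "mass F M f \<le> ennreal C0 * S" if s: "\<forall>n::nat. disc_fun (s n)" and lim: "\<forall>z. (\<lambda>n. s n z) \<longlonglongrightarrow> f z" and S: "\<forall>n. mass F M (s n) \<le> S" for f s S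
  proof -
    have [measurable]: "s n \<in> borel_measurable borel" for n using s disc_fun_measurable by auto
    have pt: "ennreal (F (cmod (f z))) \<le> liminf (\<lambda>n. ennreal C0 * ennreal (F (cmod (s n z))))" for z
    proof -
      have "eventually (\<lambda>n. cmod (f z) \<le> 2 * cmod (s n z)) sequentially"
      proof (cases "f z = 0")
        case False
        have "(\<lambda>n. cmod (s n z)) \<longlonglongrightarrow> cmod (f z)" using lim by (intro tendsto_norm) auto
        then have "eventually (\<lambda>n. cmod (f z) / 2 < cmod (s n z)) sequentially" using False by (intro order_tendstoD(1)) auto
        then show ?thesis by eventually_elim simp
      qed simp
      then have "eventually (\<lambda>n. ennreal (F (cmod (f z))) \<le> ennreal C0 * ennreal (F (cmod (s n z)))) sequentially"
      proof eventually_elim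
        case (elim n)
        then have "F (cmod (f z)) \<le> C0 * F (cmod (s n z))" by (intro half) auto
        then have "ennreal (F (cmod (f z))) \<le> ennreal (C0 * F (cmod (s n z)))" by (rule ennreal_leI)
        then show ?case using C0 by (simp add: ennreal_mult')
      qed
      then show ?thesis by (rule Liminf_bounded)
    qed
    have "mass F M f \<le> (\<integral>\<^sup>+z. liminf (\<lambda>n. ennreal C0 * ennreal (F (cmod (s n z)))) \<partial>M)"
      unfolding mass_def by (rule nn_integral_mono) (rule pt)
    also have "\<dots> \<le> liminf (\<lambda>n. \<integral>\<^sup>+z. ennreal C0 * ennreal (F (cmod (s n z))) \<partial>M)"
      by (rule nn_integral_liminf) measurable
    also have "\<dots> = liminf (\<lambda>n. ennreal C0 * mass F M (s n))"
      unfolding mass_def by (subst nn_integral_cmult) auto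
    also have "\<dots> \<le> ennreal C0 * S"
      using S by (intro order_trans[OF Liminf_le_Limsup Limsup_bounded]) (auto intro!: always_eventually mult_left_mono)
    finally show ?thesis .
  qed
  then show ?thesis using C0 by blast
qed

context two_weights
begin

text \<open>Montel's theorem applies because the functions are bounded on each ring by \<open>norm_growth\<close>. The
  limit belongs to the source space by Fatou's lemma, so the differences have bounded mass, and they are
  uniformly small away from the circle.\<close>

lemma compact_sufficient:
  assumes g: "g holomorphic_on unit_disc"
    and small: "\<And>\<epsilon>. 0 < \<epsilon> \<Longrightarrow> \<exists>k0. \<forall>a. rad \<kappa> k0 \<le> cmod a \<longrightarrow> cmod a < 1 \<longrightarrow> ratio (deriv g) a \<le> \<epsilon>"
    and f: "\<And>n::nat. disc_fun (f n)" "\<And>n. mass (orlicz p \<Psi>) M (f n) \<le> ennreal S" and S: "0 \<le> S"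
  shows "\<exists>r l S'. strict_mono r \<and> disc_fun l \<and> mass (orlicz p \<Psi>) M l \<le> ennreal S' \<and>
     (\<lambda>n. mass (orlicz q \<Phi>) N (\<lambda>z. integral_op g (f (r n)) z - integral_op g l z)) \<longlonglongrightarrow> 0"
proof -
  define F where "F = orlicz q \<Phi>"
  have F: "quasi_power F" unfolding F_def by (rule quasi_power_\<Phi>)
  have inner_cover: "\<exists>k. \<forall>z\<in>K. cmod z \<le> rad \<kappa> (k + 1)" if K: "compact K" "K \<subseteq> unit_disc" for K
  proof (cases "K = {}")
    case False
    have "continuous_on K cmod" by (intro continuous_intros)
    then obtain x where x: "x \<in> K" "\<And>z. z \<in> K \<Longrightarrow> cmod z \<le> cmod x"
      using continuous_attains_sup[OF K(1) False, of cmod] by auto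
    have "cmod x < 1" using x K by auto
    then obtain k where "cmod x < rad \<kappa> (k + 1)" using rad_ring_exists[OF \<kappa>, of "cmod x"] by auto
    then have "\<forall>z\<in>K. cmod z \<le> rad \<kappa> (k + 1)" using x(2) by (meson less_imp_le order_trans)
    then show ?thesis by blast
  qed simp
  obtain R where R: "R \<ge> 1" and gr: "\<And>f k a. disc_fun f \<Longrightarrow> mass (orlicz p \<Psi>) M f \<le> ennreal S \<Longrightarrow> cmod a \<le> rad \<kappa> (k + 1) \<Longrightarrow> cmod (f a) \<le> R * X k"
    using norm_growth by metis
  obtain l0 r where l0: "l0 holomorphic_on unit_disc" and r: "strict_mono (r :: nat \<Rightarrow> nat)"
    and lim0: "\<And>z. z \<in> unit_disc \<Longrightarrow> (\<lambda>n. f (r n) z) \<longlonglongrightarrow> l0 z"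
    and unif: "\<And>K. compact K \<Longrightarrow> K \<subseteq> unit_disc \<Longrightarrow> uniform_limit K (f \<circ> r) l0 sequentially"
  proof (rule Montel[of unit_disc "{f. disc_fun f \<and> mass (orlicz p \<Psi>) M f \<le> ennreal S}" f])
    fix K :: "complex set" assume "compact K" "K \<subseteq> unit_disc"
    then obtain k where k: "\<forall>z\<in>K. cmod z \<le> rad \<kappa> (k + 1)" using inner_cover by blast
    have "\<forall>h\<in>{f. disc_fun f \<and> mass (orlicz p \<Psi>) M f \<le> ennreal S}. \<forall>z\<in>K. cmod (h z) \<le> R * X k" using gr k by blast
    then show "\<exists>B. \<forall>h\<in>{f. disc_fun f \<and> mass (orlicz p \<Psi>) M f \<le> ennreal S}. \<forall>z\<in>K. cmod (h z) \<le> B" by blast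
  qed (use f in \<open>auto simp: disc_fun_def\<close>)
  define l where "l z = (if z \<in> unit_disc then l0 z else 0)" for z
  have l: "disc_fun l"
  proof -
    have "l holomorphic_on unit_disc \<longleftrightarrow> l0 holomorphic_on unit_disc" by (intro holomorphic_cong) (auto simp: l_def)
    then show ?thesis using l0 by (auto simp: disc_fun_def l_def)
  qed
  have lim: "(\<lambda>n. f (r n) z) \<longlonglongrightarrow> l z" for z
  proof (cases "z \<in> unit_disc")
    case True then show ?thesis using lim0 by (simp add: l_def)
  next
    case False
    then have "f (r n) z = 0" for n using f(1)[of "r n"] unfolding disc_fun_def by blast
    then show ?thesis using False by (simp add: l_def)
  qed
  obtain C1 where C1: "C1 > 0" and fatou: "\<And>f s S. (\<forall>n::nat. disc_fun (s n)) \<Longrightarrow> (\<forall>z. (\<lambda>n. s n z) \<longlonglongrightarrow> f z) \<Longrightarrow>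
      (\<forall>n. mass (orlicz p \<Psi>) M (s n) \<le> S) \<Longrightarrow> mass (orlicz p \<Psi>) M f \<le> ennreal C1 * S"
    using mass_pointwise_limit[OF quasi_power_\<Psi> scale_measureD(2)[OF M]] by metis
  have "mass (orlicz p \<Psi>) M l \<le> ennreal C1 * ennreal S" by (rule fatou[of "\<lambda>n. f (r n)"]) (use f lim in auto)
  then have lS: "mass (orlicz p \<Psi>) M l \<le> ennreal (C1 * S)" using C1 by (simp add: ennreal_mult')
  obtain Ct where Ct: "Ct \<ge> 1" and tri: "\<And>f g. disc_fun f \<Longrightarrow> disc_fun g \<Longrightarrow>
     mass (orlicz p \<Psi>) M (\<lambda>z. f z + g z) \<le> ennreal Ct * (mass (orlicz p \<Psi>) M f + mass (orlicz p \<Psi>) M g)"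
    using mass_triangle[OF quasi_power_\<Psi> scale_measureD(2)[OF M]] by metis
  define S2 where "S2 = Ct * (S + C1 * S)"
  define e where "e n = (\<lambda>z. f (r n) z - l z)" for n
  have e: "disc_fun (e n)" for n unfolding e_def by (intro disc_fun_diff f l)
  have eS: "mass (orlicz p \<Psi>) M (e n) \<le> ennreal S2" for n
  proof -
    have "mass (orlicz p \<Psi>) M (\<lambda>z. - l z) = mass (orlicz p \<Psi>) M l" by (simp add: mass_def)
    then have "mass (orlicz p \<Psi>) M (\<lambda>z. f (r n) z + - l z) \<le> ennreal Ct * (mass (orlicz p \<Psi>) M (f (r n)) + mass (orlicz p \<Psi>) M l)"
      using tri[OF f(1)[of "r n"], of "\<lambda>z. - l z"] disc_fun_cmult[OF l, of "-1"] by simp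
    also have "\<dots> \<le> ennreal Ct * (ennreal S + ennreal (C1 * S))" using f(2) lS by (intro mult_left_mono add_mono) auto
    also have "\<dots> = ennreal S2" unfolding S2_def using Ct S C1 by (simp add: ennreal_mult' ennreal_plus)
    finally show ?thesis by (simp add: e_def)
  qed
  define h where "h n = (\<lambda>z. integral_op g (f (r n)) z - integral_op g l z)" for n
  have h: "disc_fun (h n)" "h n 0 = 0" "\<forall>z. cmod z < 1 \<longrightarrow> deriv (h n) z = e n z * deriv g z" for n
  proof -
    note T1 = integral_op_facts[OF f(1)[of "r n"] g] and T2 = integral_op_facts[OF l g]
    show "disc_fun (h n)" unfolding h_def by (intro disc_fun_diff T1 T2)
    show "h n 0 = 0" unfolding h_def using T1(2) T2(2) by simp
    show "\<forall>z. cmod z < 1 \<longrightarrow> deriv (h n) z = e n z * deriv g z"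
    proof (intro allI impI)
      fix z :: complex assume z: "cmod z < 1"
      have "integral_op g (f (r n)) field_differentiable at z" "integral_op g l field_differentiable at z"
        using T1(1) T2(1) z by (auto simp: disc_fun_def intro!: holomorphic_on_imp_differentiable_at[where s=unit_disc])
      then have "deriv (h n) z = deriv (integral_op g (f (r n))) z - deriv (integral_op g l) z" unfolding h_def by (rule deriv_diff)
      then show "deriv (h n) z = e n z * deriv g z" using T1(3)[OF z] T2(3)[OF z] by (simp add: e_def algebra_simps)
    qed
  qed
  have "(\<lambda>n. mass F N (h n)) \<longlonglongrightarrow> 0"
    using integral_op_estimate[of S2]
  proof (elim exE conjE)
    fix C K \<alpha> \<beta> :: real
    assume C: "0 < C" "0 < K" "0 < \<alpha>" "0 < \<beta>" and est: "\<forall>f h d \<epsilon> k0 s b. disc_fun f \<longrightarrow> mass (orlicz p \<Psi>) M f \<le> ennreal S2 \<longrightarrow> disc_fun h \<longrightarrow> h 0 = 0 \<longrightarrow>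
     (\<forall>z. cmod z < 1 \<longrightarrow> deriv h z = f z * d z) \<longrightarrow> 0 \<le> \<epsilon> \<longrightarrow>
     (\<forall>z. rad \<kappa> k0 \<le> cmod z \<longrightarrow> cmod z < 1 \<longrightarrow> ratio d z \<le> \<epsilon>) \<longrightarrow>
     (\<forall>z. cmod z \<le> rad \<kappa> k0 \<longrightarrow> cmod (d z) \<le> b \<and> cmod (f z) \<le> s) \<longrightarrow>
     mass (orlicz q \<Phi>) N h \<le> ennreal C * ((\<Sum>k<k0. ennreal (tail \<kappa> N k * orlicz q \<Phi> (b * s))) + ennreal (max ((K * \<epsilon>) powr \<alpha>) ((K * \<epsilon>) powr \<beta>)))"
    have ev: "eventually (\<lambda>n. mass F N (h n) \<le> ennreal \<theta>) sequentially" if \<theta>: "0 < \<theta>" for \<theta>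
    proof -
      define t where "t = \<theta> / (2 * C)"
      define \<epsilon> where "\<epsilon> = min (t powr (1 / \<alpha>)) (t powr (1 / \<beta>)) / K"
      have t: "t > 0" using \<theta> C by (simp add: t_def)
      have \<epsilon>: "\<epsilon> > 0" using t C by (simp add: \<epsilon>_def)
      have "(K * \<epsilon>) powr \<alpha> \<le> (t powr (1 / \<alpha>)) powr \<alpha>" "(K * \<epsilon>) powr \<beta> \<le> (t powr (1 / \<beta>)) powr \<beta>"
        using C by (auto simp: \<epsilon>_def intro!: powr_mono2)
      then have far: "max ((K * \<epsilon>) powr \<alpha>) ((K * \<epsilon>) powr \<beta>) \<le> t" using C t by (simp add: powr_powr)
      obtain k0 where k0: "\<forall>z. rad \<kappa> k0 \<le> cmod z \<longrightarrow> cmod z < 1 \<longrightarrow> ratio (deriv g) z \<le> \<epsilon>" using small[OF \<epsilon>] by blast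
      define D where "D = cball (0::complex) (rad \<kappa> k0)"
      have D: "compact D" "D \<subseteq> unit_disc" using rad_props(2)[OF \<kappa>, of k0] by (auto simp: D_def)
      obtain b where b: "b > 0" "\<And>z. z \<in> D \<Longrightarrow> cmod (deriv g z) \<le> b"
      proof -
        have "continuous_on D (deriv g)"
          using g D by (meson holomorphic_deriv holomorphic_on_imp_continuous_on holomorphic_on_subset open_ball)
        then have "bounded (deriv g ` D)" using D by (intro compact_imp_bounded compact_continuous_image)
        then show ?thesis using that by (auto simp: bounded_pos)
      qed
      obtain Cf \<alpha>' \<beta>' where pb: "power_bounds F Cf \<alpha>' \<beta>'" using quasi_power_bounds[OF F] .
      note Cf = power_boundsD(1-3)[OF pb]
      define s where "s n = 1 / real (Suc n)" for n
      have s: "s n > 0" "s n \<le> 1" for n by (auto simp: s_def)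
      have slim: "s \<longlonglongrightarrow> 0" unfolding s_def using LIMSEQ_inverse_real_of_nat by (simp add: inverse_eq_divide)
      have "(\<lambda>n. s n powr \<alpha>') \<longlonglongrightarrow> 0 powr \<alpha>'" using s Cf by (intro tendsto_powr' slim tendsto_const) (auto intro!: always_eventually less_imp_le)
      then have spow: "(\<lambda>n. (\<Sum>k<k0. tail \<kappa> N k * (Cf * s n powr \<alpha>' * F b))) \<longlonglongrightarrow> (\<Sum>k<k0. tail \<kappa> N k * (Cf * 0 * F b))"
        by (intro tendsto_intros) simp
      then have "eventually (\<lambda>n. (\<Sum>k<k0. tail \<kappa> N k * (Cf * s n powr \<alpha>' * F b)) < t) sequentially"
        using t by (intro order_tendstoD(2)) auto
      then obtain m where m: "(\<Sum>k<k0. tail \<kappa> N k * (Cf * s m powr \<alpha>' * F b)) < t" by (auto simp: eventually_sequentially)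
      have near: "(\<Sum>k<k0. ennreal (tail \<kappa> N k * F (b * s m))) \<le> ennreal t"
      proof -
        have tn: "0 \<le> tail \<kappa> N k" for k using scale_measureD(7)[OF N, of k] by simp
        have "(\<Sum>k<k0. ennreal (tail \<kappa> N k * F (b * s m))) = ennreal (\<Sum>k<k0. tail \<kappa> N k * F (b * s m))"
          using tn quasi_power_nonneg[OF F] b s by (intro sum_ennreal) (simp add: less_imp_le)
        also have "\<dots> \<le> ennreal t"
        proof (rule ennreal_leI)
          have "F (b * s m) \<le> Cf * s m powr \<alpha>' * F b" using power_boundsD(4)[OF pb, of "s m" b] s[of m] b by (simp add: mult.commute)
          then have "(\<Sum>k<k0. tail \<kappa> N k * F (b * s m)) \<le> (\<Sum>k<k0. tail \<kappa> N k * (Cf * s m powr \<alpha>' * F b))"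
            using tn by (intro sum_mono mult_left_mono) auto
          then show "(\<Sum>k<k0. tail \<kappa> N k * F (b * s m)) \<le> t" using m by linarith
        qed
        finally show ?thesis .
      qed
      have "eventually (\<lambda>n. \<forall>z\<in>D. dist ((f \<circ> r) n z) (l0 z) < s m) sequentially"
        by (rule uniform_limitD[OF unif[OF D] s(1)])
      then show ?thesis
      proof eventually_elim
        case (elim n)
        have inner: "\<forall>z. cmod z \<le> rad \<kappa> k0 \<longrightarrow> cmod (deriv g z) \<le> b \<and> cmod (e n z) \<le> s m"
        proof (intro allI impI conjI)
          fix z :: complex assume "cmod z \<le> rad \<kappa> k0"
          then have z: "z \<in> D" by (simp add: D_def)
          then show "cmod (deriv g z) \<le> b" by (rule b)
          have "cmod (f (r n) z - l0 z) < s m" using elim z by (simp add: dist_norm)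
          moreover have "l z = l0 z" using z D by (auto simp: l_def)
          ultimately show "cmod (e n z) \<le> s m" by (simp add: e_def)
        qed
        have "0 \<le> \<epsilon>" using \<epsilon> by simp
        then have "mass F N (h n) \<le> ennreal C * ((\<Sum>k<k0. ennreal (tail \<kappa> N k * F (b * s m))) + ennreal (max ((K * \<epsilon>) powr \<alpha>) ((K * \<epsilon>) powr \<beta>)))"
          unfolding F_def using est[THEN spec, of "e n", THEN spec, of "h n", THEN spec, of "deriv g", THEN spec, of \<epsilon>, THEN spec, of k0,
            THEN spec, of "s m", THEN spec, of b] e[of n] eS[of n] h[of n] k0 inner by (simp only: simp_thms)
        also have "\<dots> \<le> ennreal C * (ennreal t + ennreal t)"
          using near ennreal_leI[OF far] by (intro mult_left_mono add_mono) auto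
        also have "\<dots> = ennreal (C * (t + t))" using C t by (simp add: ennreal_mult'[symmetric] flip: ennreal_plus)
        also have "C * (t + t) = \<theta>" using C by (simp add: t_def)
        finally show ?case .
      qed
    qed
    show ?thesis
    proof (rule order_tendstoI)
      fix a :: ennreal assume "0 < a"
      then obtain y where y: "0 < y" "y < a" using dense by blast
      then obtain \<theta> where \<theta>: "y = ennreal \<theta>" "0 \<le> \<theta>" by (cases y) auto
      then have \<theta>': "0 < \<theta>" "ennreal \<theta> < a" using y by auto
      show "eventually (\<lambda>n. mass F N (h n) < a) sequentially"
        using ev[OF \<theta>'(1)] by eventually_elim (rule order_le_less_trans[OF _ \<theta>'(2)])
    qed simp
  qed
  then show ?thesis using r l lS unfolding h_def F_def by blast
qed

end

section \<open>Boundedness and compactness of the operator\<close>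

lemma (in bergman) A_intro: "disc_fun f \<Longrightarrow> ms f \<le> ennreal b \<Longrightarrow> f \<in> A"
  unfolding A_iff using order_le_less_trans[of "ms f" "ennreal b" top] by simp

lemma (in bergman) bounded_iff:
  "bergman_bounded q \<nu> \<Phi> B \<longleftrightarrow> B \<subseteq> A \<and> (\<exists>b. \<forall>f\<in>B. ms f \<le> ennreal b)"
proof
  assume "bergman_bounded q \<nu> \<Phi> B"
  then have BA: "B \<subseteq> A" and "bdd_above (bergman_norm q \<nu> \<Phi> ` B)" by (auto simp: bergman_bounded_def)
  then obtain b where b: "\<And>f. f \<in> B \<Longrightarrow> bergman_norm q \<nu> \<Phi> f \<le> b" by (auto simp: bdd_above_def)
  have "ms f \<le> ennreal (max 0 b powr q)" if "f \<in> B" for f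
  proof (rule norm_le_iff[THEN iffD1])
    show "f \<in> A" using BA that by (rule subsetD)
    show "bergman_norm q \<nu> \<Phi> f \<le> max 0 b" using b[OF that] by (rule max.coboundedI2)
  qed simp
  then show "B \<subseteq> A \<and> (\<exists>b. \<forall>f\<in>B. ms f \<le> ennreal b)" using BA by blast
next
  assume *: "B \<subseteq> A \<and> (\<exists>b. \<forall>f\<in>B. ms f \<le> ennreal b)"
  then obtain b where b: "\<And>f. f \<in> B \<Longrightarrow> ms f \<le> ennreal b" by blast
  have "bergman_norm q \<nu> \<Phi> f \<le> max 0 b powr (1 / q)" if "f \<in> B" for f
  proof (rule norm_le_iff[THEN iffD2])
    show "f \<in> A" using * that by blast
    have "(max 0 b powr (1 / q)) powr q = max 0 b" using q by (simp add: powr_powr)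
    moreover have "ms f \<le> ennreal (max 0 b)" using b[OF that] by (metis ennreal_leI max.cobounded2 order_trans)
    ultimately show "ms f \<le> ennreal ((max 0 b powr (1 / q)) powr q)" by simp
  qed simp
  then show "bergman_bounded q \<nu> \<Phi> B" using * by (auto simp: bergman_bounded_def bdd_above_def)
qed

locale weighted_pair = two_weights p q "weight_measure \<omega>" "weight_measure \<nu>" \<Psi> \<Phi> \<kappa> c1 c2
  for p q :: real and \<omega> \<nu> :: "complex \<Rightarrow> real" and \<Psi> \<Phi> :: "real \<Rightarrow> real" and \<kappa> c1 c2 :: real +
  assumes weight_\<omega>: "weight \<omega>" and weight_\<nu>: "weight \<nu>"
begin

sublocale source: bergman p \<omega> \<Psi>
  by unfold_locales (use p weight_\<omega> quasi_power_\<Psi> in auto)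

sublocale target: bergman q \<nu> \<Phi>
  by unfold_locales (use q weight_\<nu> quasi_power_\<Phi> in auto)

lemma carleson_ratio_eq: "carleson_ratio p \<omega> \<Psi> q \<nu> \<Phi> g a = ratio (deriv g) a"
  unfolding carleson_ratio_def ratio_def Let_def
  by (simp add: weight_mass_eq_measure[OF weight_\<omega> sets_carleson_square] weight_mass_eq_measure[OF weight_\<nu> sets_carleson_square])

text \<open>Boundedness of an operator concerns bounded sets; it suffices to consider the sets where the mass is at most a
  given number.\<close>

lemma bounded_operator_iff:
  assumes g: "g holomorphic_on unit_disc"
  shows "bounded_operator p \<omega> \<Psi> q \<nu> \<Phi> (integral_op g) \<longleftrightarrow>
     (\<forall>S. \<exists>B. \<forall>f. disc_fun f \<longrightarrow> source.ms f \<le> ennreal S \<longrightarrow> target.ms (integral_op g f) \<le> ennreal B)"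
proof
  assume bdd: "bounded_operator p \<omega> \<Psi> q \<nu> \<Phi> (integral_op g)"
  show "\<forall>S. \<exists>B. \<forall>f. disc_fun f \<longrightarrow> source.ms f \<le> ennreal S \<longrightarrow> target.ms (integral_op g f) \<le> ennreal B"
  proof
    fix S :: real
    have "bergman_bounded p \<omega> \<Psi> {f. disc_fun f \<and> source.ms f \<le> ennreal S}"
      unfolding source.bounded_iff using source.A_intro by blast
    then have "bergman_bounded q \<nu> \<Phi> (integral_op g ` {f. disc_fun f \<and> source.ms f \<le> ennreal S})"
      using bdd unfolding bounded_operator_def by blast
    then obtain B where "\<forall>h\<in>integral_op g ` {f. disc_fun f \<and> source.ms f \<le> ennreal S}. target.ms h \<le> ennreal B"
      unfolding target.bounded_iff by blast
    then show "\<exists>B. \<forall>f. disc_fun f \<longrightarrow> source.ms f \<le> ennreal S \<longrightarrow> target.ms (integral_op g f) \<le> ennreal B" by blast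
  qed
next
  assume *: "\<forall>S. \<exists>B. \<forall>f. disc_fun f \<longrightarrow> source.ms f \<le> ennreal S \<longrightarrow> target.ms (integral_op g f) \<le> ennreal B"
  have into: "integral_op g f \<in> target.A" if f: "f \<in> source.A" for f
  proof -
    obtain m where "source.ms f = ennreal m" using f by (cases "source.ms f") (auto simp: source.A_iff)
    then obtain B where "target.ms (integral_op g f) \<le> ennreal B" using * f by (metis order_refl source.A_iff)
    then show ?thesis using f integral_op_facts(1)[OF _ g] by (auto simp: source.A_iff intro: target.A_intro)
  qed
  show "bounded_operator p \<omega> \<Psi> q \<nu> \<Phi> (integral_op g)"
    unfolding bounded_operator_def
  proof (intro conjI allI impI)
    show "integral_op g ` source.A \<subseteq> target.A" using into by blast
    fix B assume "bergman_bounded p \<omega> \<Psi> B"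
    then obtain S where BA: "B \<subseteq> source.A" and S: "\<forall>f\<in>B. source.ms f \<le> ennreal S" unfolding source.bounded_iff by blast
    obtain b where b: "\<forall>f. disc_fun f \<longrightarrow> source.ms f \<le> ennreal S \<longrightarrow> target.ms (integral_op g f) \<le> ennreal b" using * by blast
    have "target.ms (integral_op g f) \<le> ennreal b" if f: "f \<in> B" for f
    proof -
      have "f \<in> source.A" using BA f by (rule subsetD)
      then have "disc_fun f" by (simp only: source.A_iff)
      then show ?thesis using b S f by blast
    qed
    then show "bergman_bounded q \<nu> \<Phi> (integral_op g ` B)" unfolding target.bounded_iff using BA into by blast
  qed
qed

lemma bounded_integral_op_iff:
  assumes g: "g holomorphic_on unit_disc"
  shows "bounded_operator p \<omega> \<Psi> q \<nu> \<Phi> (integral_op g) \<longleftrightarrow> (\<exists>R. \<forall>a. cmod a < 1 \<longrightarrow> ratio (deriv g) a \<le> R)"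
proof -
  have 1: "\<exists>R. \<forall>a. cmod a < 1 \<longrightarrow> ratio (deriv g) a \<le> R"
    if "\<forall>S. \<exists>B. \<forall>f. disc_fun f \<longrightarrow> source.ms f \<le> ennreal S \<longrightarrow> target.ms (integral_op g f) \<le> ennreal B"
    by (rule bounded_necessary[OF g]) (use that in \<open>simp only: source.ms_def target.ms_def\<close>)
  have 2: "\<forall>S. \<exists>B. \<forall>f. disc_fun f \<longrightarrow> source.ms f \<le> ennreal S \<longrightarrow> target.ms (integral_op g f) \<le> ennreal B"
    if "\<exists>R. \<forall>a. cmod a < 1 \<longrightarrow> ratio (deriv g) a \<le> R"
  proof -
    from that obtain R where "\<And>a. cmod a < 1 \<Longrightarrow> ratio (deriv g) a \<le> R" by blast
    from bounded_sufficient[OF g this] show ?thesis unfolding source.ms_def target.ms_def by blast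
  qed
  show ?thesis unfolding bounded_operator_iff[OF g] by (rule iffI, erule 1, erule 2)
qed

text \<open>The radii \<open>rad \<kappa> k\<close> increase to \<open>1\<close>.\<close>

lemma ratio_tendsto_zero_iff:
  "(ratio d \<longlongrightarrow> 0) (filtercomap cmod (at_left 1)) \<longleftrightarrow>
     (\<forall>\<epsilon>>0. \<exists>k0. \<forall>a. rad \<kappa> k0 \<le> cmod a \<longrightarrow> cmod a < 1 \<longrightarrow> ratio d a \<le> \<epsilon>)"
proof -
  have cmp: "\<And>d k a. rad \<kappa> k \<le> cmod a \<Longrightarrow> cmod a \<le> rad \<kappa> (k + 1) \<Longrightarrow> 0 \<le> ratio d a"
    using ratio_compare by blast
  have nn: "0 \<le> ratio d a" if "cmod a < 1" for a using ring_cover[OF that] cmp by blast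
  show ?thesis
  proof
    assume lim: "(ratio d \<longlongrightarrow> 0) (filtercomap cmod (at_left 1))"
    show "\<forall>\<epsilon>>0. \<exists>k0. \<forall>a. rad \<kappa> k0 \<le> cmod a \<longrightarrow> cmod a < 1 \<longrightarrow> ratio d a \<le> \<epsilon>"
    proof (intro allI impI)
      fix \<epsilon> :: real assume "0 < \<epsilon>"
      then have "eventually (\<lambda>a. ratio d a < \<epsilon>) (filtercomap cmod (at_left 1))" using lim by (intro order_tendstoD(2))
      then obtain Q where Q: "eventually Q (at_left 1)" "\<And>a. Q (cmod a) \<Longrightarrow> ratio d a < \<epsilon>" unfolding eventually_filtercomap by blast
      obtain b where b: "b < 1" "\<And>y. b < y \<Longrightarrow> y < 1 \<Longrightarrow> Q y" using Q(1) unfolding eventually_at_left[OF zero_less_one] by blast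
      obtain k where k: "max 0 b < rad \<kappa> (Suc k)" using rad_ring_exists[OF \<kappa>, of "max 0 b"] b(1) by auto
      have "ratio d a \<le> \<epsilon>" if "rad \<kappa> (Suc k) \<le> cmod a" "cmod a < 1" for a
        using Q(2)[OF b(2)] that k by (auto intro: less_imp_le)
      then show "\<exists>k0. \<forall>a. rad \<kappa> k0 \<le> cmod a \<longrightarrow> cmod a < 1 \<longrightarrow> ratio d a \<le> \<epsilon>" by blast
    qed
  next
    assume small: "\<forall>\<epsilon>>0. \<exists>k0. \<forall>a. rad \<kappa> k0 \<le> cmod a \<longrightarrow> cmod a < 1 \<longrightarrow> ratio d a \<le> \<epsilon>"
    show "(ratio d \<longlongrightarrow> 0) (filtercomap cmod (at_left 1))"
      unfolding tendsto_iff
    proof (intro allI impI)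
      fix \<epsilon> :: real assume \<epsilon>: "0 < \<epsilon>"
      then obtain k0 where k0: "\<forall>a. rad \<kappa> k0 \<le> cmod a \<longrightarrow> cmod a < 1 \<longrightarrow> ratio d a \<le> \<epsilon> / 2" using small half_gt_zero by blast
      have "eventually (\<lambda>y. rad \<kappa> k0 < y \<and> y < 1) (at_left 1)"
        unfolding eventually_at_left[OF zero_less_one] using rad_props(2)[OF \<kappa>, of k0] by blast
      moreover have "dist (ratio d a) 0 < \<epsilon>" if "rad \<kappa> k0 < cmod a \<and> cmod a < 1" for a
        using nn[of a] k0[rule_format, of a] that \<epsilon> by simp
      ultimately show "eventually (\<lambda>a. dist (ratio d a) 0 < \<epsilon>) (filtercomap cmod (at_left 1))"
        unfolding eventually_filtercomap by blast
    qed
  qed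
qed

text \<open>A neighbourhood of zero contains all functions of small mass, and the compact closure of its image is covered
  by finitely many of the open sets from \<open>nbhd\<close>; their centres form the net.\<close>

lemma compact_operator_imp_small:
  assumes g: "g holomorphic_on unit_disc" and cpt: "compact_operator p \<omega> \<Psi> q \<nu> \<Phi> (integral_op g)" and \<epsilon>: "0 < \<epsilon>"
  shows "\<exists>k0. \<forall>a. rad \<kappa> k0 \<le> cmod a \<longrightarrow> cmod a < 1 \<longrightarrow> ratio (deriv g) a \<le> \<epsilon>"
proof -
  obtain B U where into: "integral_op g ` source.A \<subseteq> target.A" and BA: "B \<subseteq> source.A"
    and U: "openin source.T U" "(\<lambda>_. 0) \<in> U" "U \<subseteq> B"
    and K: "compactin target.T (target.T closure_of (integral_op g ` B))"
    using cpt unfolding compact_operator_def by blast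
  define K where "K = target.T closure_of (integral_op g ` B)"
  obtain S where S: "S > 0" "\<And>f. f \<in> source.A \<Longrightarrow> source.ms f < ennreal S \<Longrightarrow> f \<in> U"
  proof -
    from U(1,2) obtain S where "S > 0 \<and> (\<forall>h\<in>source.A. source.ms h < ennreal S \<longrightarrow> (\<lambda>z. 0 + h z) \<in> U)"
      unfolding source.openin_iff by blast
    then show ?thesis by (intro that[of S]) auto
  qed
  have KA: "K \<subseteq> target.A" unfolding K_def using closure_of_subset_topspace target.topspace_T by metis
  have TK: "integral_op g ` B \<subseteq> K"
    unfolding K_def by (rule closure_of_subset) (use into BA target.topspace_T in auto)
  have net: "\<exists>H. finite H \<and> (\<forall>h\<in>H. disc_fun h \<and> target.ms h < \<infinity>) \<and>
       (\<forall>f. disc_fun f \<longrightarrow> source.ms f \<le> ennreal (S / 2) \<longrightarrow> (\<exists>h\<in>H. target.ms (\<lambda>z. integral_op g f z - h z) \<le> ennreal \<eta>))"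
    if \<eta>: "0 < \<eta>" for \<eta>
  proof -
    have "\<forall>h\<in>K. \<exists>V. openin target.T V \<and> h \<in> V \<and> (\<forall>x\<in>V. target.ms (\<lambda>z. x z - h z) < ennreal \<eta>)"
      using target.nbhd[OF _ \<eta>] KA by blast
    from bchoice[OF this] obtain V where V: "\<forall>h\<in>K. openin target.T (V h) \<and> h \<in> V h \<and> (\<forall>x\<in>V h. target.ms (\<lambda>z. x z - h z) < ennreal \<eta>)" ..
    have "K \<subseteq> \<Union>(V ` K)" "\<And>U. U \<in> V ` K \<Longrightarrow> openin target.T U" using V by auto
    then obtain \<F> where \<F>: "finite \<F>" "\<F> \<subseteq> V ` K" "K \<subseteq> \<Union>\<F>" using compactinD[OF K[folded K_def]] by metis
    obtain H where H: "H \<subseteq> K" "finite H" "\<F> = V ` H" using finite_subset_image[OF \<F>(1,2)] by auto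
    have "\<exists>h\<in>H. target.ms (\<lambda>z. integral_op g f z - h z) \<le> ennreal \<eta>" if f: "disc_fun f" "source.ms f \<le> ennreal (S / 2)" for f
    proof -
      have "ennreal (S / 2) < ennreal S" using S(1) by (simp add: ennreal_less_iff)
      then have "source.ms f < ennreal S" using f(2) by (rule order_le_less_trans[rotated])
      moreover from this have "f \<in> source.A" using f(1) by (simp add: source.A_iff) (metis ennreal_less_top order_less_trans)
      ultimately have "f \<in> U" by (intro S(2))
      then have "integral_op g f \<in> K" using U(3) TK by blast
      then obtain h where h: "h \<in> H" "integral_op g f \<in> V h" using \<F>(3) H(3) by blast
      then have "target.ms (\<lambda>z. integral_op g f z - h z) < ennreal \<eta>" using V H(1) by blast
      then show ?thesis using h(1) by (intro bexI[of _ h] less_imp_le)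
    qed
    moreover have "\<forall>h\<in>H. disc_fun h \<and> target.ms h < \<infinity>" using H(1) KA target.A_iff by blast
    ultimately show ?thesis using H(2) by (intro exI[of _ H]) simp
  qed
  show ?thesis
  proof (rule compact_necessary[OF g _ _ \<epsilon>])
    show "0 < S / 2" using S(1) by simp
  qed (rule net[unfolded source.ms_def target.ms_def])
qed

text \<open>A quotient that tends to zero at the circle is bounded, so the operator maps into the target space. The
  neighbourhood of zero is the set where the mass is at most \<open>1\<close>.\<close>

lemma small_imp_compact_operator:
  assumes g: "g holomorphic_on unit_disc"
    and small: "\<And>\<epsilon>. 0 < \<epsilon> \<Longrightarrow> \<exists>k0. \<forall>a. rad \<kappa> k0 \<le> cmod a \<longrightarrow> cmod a < 1 \<longrightarrow> ratio (deriv g) a \<le> \<epsilon>"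
  shows "compact_operator p \<omega> \<Psi> q \<nu> \<Phi> (integral_op g)"
proof -
  have "bounded_operator p \<omega> \<Psi> q \<nu> \<Phi> (integral_op g)"
  proof -
    obtain K where K: "K > 0" and cmp: "\<And>d k a. rad \<kappa> k \<le> cmod a \<Longrightarrow> cmod a \<le> rad \<kappa> (k + 1) \<Longrightarrow>
       \<kappa> ^ k * (ratio d a * Y k) \<le> K * (cmod (d a) * X k)"
      using ratio_compare by metis
    obtain k0 where k0: "\<And>a. rad \<kappa> k0 \<le> cmod a \<Longrightarrow> cmod a < 1 \<Longrightarrow> ratio (deriv g) a \<le> 1" using small[of 1] by auto
    obtain b where b: "b > 0" "\<And>z. cmod z \<le> rad \<kappa> k0 \<Longrightarrow> cmod (deriv g z) \<le> b"
    proof -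
      have "cball 0 (rad \<kappa> k0) \<subseteq> unit_disc" using rad_props(2)[OF \<kappa>, of k0] by auto
      then have "continuous_on (cball 0 (rad \<kappa> k0)) (deriv g)"
        using g by (meson holomorphic_deriv holomorphic_on_imp_continuous_on holomorphic_on_subset open_ball)
      then have "bounded (deriv g ` cball 0 (rad \<kappa> k0))" by (intro compact_imp_bounded compact_continuous_image) auto
      then show ?thesis using that by (auto simp: bounded_pos)
    qed
    define c where "c k = K * (b * X k) / (\<kappa> ^ k * Y k)" for k
    define R where "R = max 1 (Max (c ` {..k0}))"
    have "ratio (deriv g) a \<le> R" if a1: "cmod a < 1" for a
    proof (cases "rad \<kappa> k0 \<le> cmod a")
      case True then show ?thesis using k0[OF True a1] by (simp add: R_def)
    next
      case False
      obtain k where a: "rad \<kappa> k \<le> cmod a" "cmod a \<le> rad \<kappa> (k + 1)" using ring_cover[OF a1] by auto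
      have kk: "k \<le> k0"
      proof (rule ccontr)
        assume "\<not> k \<le> k0"
        then have "rad \<kappa> k0 \<le> rad \<kappa> k" by (intro rad_mono \<kappa>) auto
        then show False using a False by linarith
      qed
      have "cmod (deriv g a) \<le> b" using b(2) False by simp
      then have "K * (cmod (deriv g a) * X k) \<le> K * (b * X k)" using K X_pos[of k] by (intro mult_left_mono mult_right_mono) auto
      then have "\<kappa> ^ k * (ratio (deriv g) a * Y k) \<le> K * (b * X k)" using cmp[OF a, of "deriv g"] by linarith
      moreover have "0 < \<kappa> ^ k * Y k" using Y_pos[of k] \<kappa> by simp
      ultimately have "ratio (deriv g) a \<le> c k" unfolding c_def by (subst pos_le_divide_eq) (simp_all add: mult_ac)
      also have "c k \<le> Max (c ` {..k0})" using kk by (intro Max_ge) auto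
      finally show ?thesis by (simp add: R_def)
    qed
    then show ?thesis unfolding bounded_integral_op_iff[OF g] by blast
  qed
  then have into: "integral_op g ` source.A \<subseteq> target.A" by (simp add: bounded_operator_def)
  define B where "B = {f. disc_fun f \<and> source.ms f \<le> ennreal 1}"
  have B1: "f \<in> source.A" if "f \<in> B" for f
    using that source.A_intro[of f 1] unfolding B_def by blast
  obtain U where U: "openin source.T U" "(\<lambda>z. 0) \<in> U" "\<forall>h\<in>U. source.ms (\<lambda>z. h z - 0) < ennreal 1"
    using source.nbhd[OF source.A_zero, of 1] by auto
  have UB: "U \<subseteq> B"
  proof
    fix f assume f: "f \<in> U"
    then have "disc_fun f" using U(1) by (auto simp: source.openin_iff source.A_iff)
    moreover have "source.ms f \<le> ennreal 1" using U(3) f by (auto intro: less_imp_le)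
    ultimately show "f \<in> B" by (simp add: B_def)
  qed
  have "compactin target.T (target.T closure_of (integral_op g ` B))"
  proof (rule target.compactin_closure_of)
    show "integral_op g ` B \<subseteq> target.A" using into B1 by blast
    fix s assume s: "\<And>n::nat. s n \<in> integral_op g ` B"
    then have "\<forall>n. \<exists>f. f \<in> B \<and> s n = integral_op g f" by blast
    from choice[OF this] obtain f where f: "\<forall>n. f n \<in> B \<and> s n = integral_op g (f n)" ..
    have fd: "disc_fun (f n)" "mass (orlicz p \<Psi>) (weight_measure \<omega>) (f n) \<le> ennreal 1" for n
      using f by (auto simp: B_def source.ms_def)
    have "\<exists>r l S'. strict_mono r \<and> disc_fun l \<and> mass (orlicz p \<Psi>) (weight_measure \<omega>) l \<le> ennreal S' \<and>
       (\<lambda>n. mass (orlicz q \<Phi>) (weight_measure \<nu>) (\<lambda>z. integral_op g (f (r n)) z - integral_op g l z)) \<longlonglongrightarrow> 0"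
      by (rule compact_sufficient[OF g small]) (assumption, rule fd, rule fd, simp)
    then obtain r l S' where r: "strict_mono r" "disc_fun l" "mass (orlicz p \<Psi>) (weight_measure \<omega>) l \<le> ennreal S'"
      and lim: "(\<lambda>n. mass (orlicz q \<Phi>) (weight_measure \<nu>) (\<lambda>z. integral_op g (f (r n)) z - integral_op g l z)) \<longlonglongrightarrow> 0"
      by (elim exE conjE) (rule that)
    have "l \<in> source.A" using r(2,3) by (intro source.A_intro[of l S']) (simp_all add: source.ms_def)
    then have "integral_op g l \<in> target.A" using into by blast
    moreover have "(\<lambda>n. target.ms (\<lambda>z. s (r n) z - integral_op g l z)) \<longlonglongrightarrow> 0" using lim f by (simp add: target.ms_def)
    ultimately show "\<exists>r l. strict_mono r \<and> l \<in> target.A \<and> (\<lambda>n. target.ms (\<lambda>z. s (r n) z - l z)) \<longlonglongrightarrow> 0"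
      using r(1) by blast
  qed
  then show ?thesis unfolding compact_operator_def using into B1 U UB by blast
qed

end

theorem theorem2:
  fixes p q :: real and \<omega> \<nu> :: "complex \<Rightarrow> real" and \<Psi> \<Phi> :: "real \<Rightarrow> real"
    and g :: "complex \<Rightarrow> complex"
  assumes "0 < p" and "p \<le> q"
    and "\<omega> \<in> class_D" and "\<nu> \<in> class_D"
    and "\<Psi> \<in> class_L" and "\<Phi> \<in> class_L"
    and "g holomorphic_on unit_disc"
  shows "(bounded_operator p \<omega> \<Psi> q \<nu> \<Phi> (integral_op g) \<longleftrightarrow>
            bdd_above (carleson_ratio p \<omega> \<Psi> q \<nu> \<Phi> g ` unit_disc)) \<and>
         (compact_operator p \<omega> \<Psi> q \<nu> \<Phi> (integral_op g) \<longleftrightarrow>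
            (carleson_ratio p \<omega> \<Psi> q \<nu> \<Phi> g \<longlongrightarrow> 0) (filtercomap cmod (at_left 1)))"
proof -
  obtain \<kappa>1 where \<kappa>1: "\<forall>\<kappa>\<ge>\<kappa>1. \<exists>c. scale_measure \<kappa> c (weight_measure \<omega>)" using class_D_scale_measure[OF assms(3)] ..
  obtain \<kappa>2 where \<kappa>2: "\<forall>\<kappa>\<ge>\<kappa>2. \<exists>c. scale_measure \<kappa> c (weight_measure \<nu>)" using class_D_scale_measure[OF assms(4)] ..
  define \<kappa> where "\<kappa> = max \<kappa>1 \<kappa>2"
  obtain c1 where c1: "scale_measure \<kappa> c1 (weight_measure \<omega>)" using \<kappa>1 unfolding \<kappa>_def by (meson max.cobounded1)
  obtain c2 where c2: "scale_measure \<kappa> c2 (weight_measure \<nu>)" using \<kappa>2 unfolding \<kappa>_def by (meson max.cobounded2)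
  have "weight \<omega>" "weight \<nu>" using assms(3,4) by (auto simp: class_D_def class_D_hat_def radial_weight_def)
  then interpret weighted_pair p q \<omega> \<nu> \<Psi> \<Phi> \<kappa> c1 c2
    using assms(1,2,5,6) c1 c2 by unfold_locales
  have eq: "carleson_ratio p \<omega> \<Psi> q \<nu> \<Phi> g = ratio (deriv g)" by (rule ext) (rule carleson_ratio_eq)
  have "bdd_above (ratio (deriv g) ` unit_disc) \<longleftrightarrow> (\<exists>R. \<forall>a. cmod a < 1 \<longrightarrow> ratio (deriv g) a \<le> R)"
    by (simp only: bdd_above_def ball_simps) (simp add: Ball_def)
  then have "bounded_operator p \<omega> \<Psi> q \<nu> \<Phi> (integral_op g) \<longleftrightarrow> bdd_above (carleson_ratio p \<omega> \<Psi> q \<nu> \<Phi> g ` unit_disc)"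
    unfolding eq bounded_integral_op_iff[OF assms(7)] by simp
  moreover have "compact_operator p \<omega> \<Psi> q \<nu> \<Phi> (integral_op g) \<longleftrightarrow>
      (carleson_ratio p \<omega> \<Psi> q \<nu> \<Phi> g \<longlongrightarrow> 0) (filtercomap cmod (at_left 1))"
    unfolding eq ratio_tendsto_zero_iff
    using compact_operator_imp_small[OF assms(7)] small_imp_compact_operator[OF assms(7)] by blast
  ultimately show ?thesis ..
qed

end
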